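(* Let $k$ be an algebraically closed field, and let $A_n^2=kA_n/\operatorname{rad}^2$ ($n\ge1$) and $D_n^2=kD_n/\operatorname{rad}^2$ ($n\ge4$) be the radical-square-zero algebras of linearly oriented Dynkin type. Then: (1) $|\mathrm{tilt}\,A_n^2|=2$ for $n\ge 2$; (2) $|\tau\text{-tilt}\,A_n^2|=\dfrac{(1+\sqrt5)^{n+1}-(1-\sqrt5)^{n+1}}{\sqrt5\cdot 2^{n+1}}$ for $n\ge1$; (3) $|\mathrm{s}\tau\text{-tilt}\,A_n^2|=\dfrac{(1+\sqrt2)^{n+1}-(1-\sqrt2)^{n+1}}{2\sqrt2}$ for $n\ge1$; (4) $|\mathrm{tilt}\,D_n^2|=5$ for $n\ge4$; (5) $|\tau\text{-tilt}\,D_n^2|=\dfrac{(2\sqrt5-1)(1+\sqrt5)^{n-1}+(2\sqrt5+1)(1-\sqrt5)^{n-1}}{\sqrt5\cdot 2^{n-1}}$ for $n\ge4$; (6) $|\mathrm{s}\tau\text{-tilt}\,D_n^2|=\dfrac{(3\sqrt2-1)(1+\sqrt2)^{n-1}+(3\sqrt2+1)(1-\sqrt2)^{n-1}}{\sqrt2}$ for $n\ge4$.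
   Context: $A_n$ is the quiver $n\to n-1\to\cdots\to 2\to 1$. $D_n$ is the quiver with points $1,\dots,n$ and arrows $n\to n-1\to\cdots\to 4\to 3$, $3\to 1$ and $3\to 2$. For such a quiver $Q$, $kQ/\operatorname{rad}^2$ is the path algebra modulo the square of its radical (all paths of length $2$ are zero). Modules are finitely generated left modules, with conventions such that an arrow $x\to y$ corresponds to $\operatorname{Ext}^1(S_x,S_y)\ne0$. For a finite-dimensional $k$-algebra $\Lambda$, $\tau$ is the Auslander–Reiten translation and, for a module $M$, $|M|$ is the number of pairwise nonisomorphic indecomposable direct summands of $M$. A $\Lambda$-module $M$ is $\tau$-rigid if $\operatorname{Hom}_\Lambda(M,\tau M)=0$; it is $\tau$-tilting if it is $\tau$-rigid and $|M|=|\Lambda|$; it is support $\tau$-tilting if it is a $\tau$-tilting $\Lambda/\Lambda e\Lambda$-module for some idempotent $e$ of $\Lambda$ (the zero module is included, with $e=1$); it is (classical) tilting if its projective dimension is at most one, $\operatorname{Ext}^1_\Lambda(M,M)=0$ and $|M|=|\Lambda|$. $\mathrm{tilt}\,\Lambda$, $\tau\text{-tilt}\,\Lambda$ and $\mathrm{s}\tau\text{-tilt}\,\Lambda$ denote the sets of isomorphism classes of basic tilting, basic $\tau$-tilting and basic support $\tau$-tilting $\Lambda$-modules, and $|\cdot|$ of a set is its cardinality. *)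

theory Defs
  imports
    "HOL-Computational_Algebra.Polynomial"
    "Graph_Theory.Arc_Walk"
    "HOL-Algebra.Module"
    "HOL-Algebra.QuotRing"
    "HOL-Algebra.Ideal_Product"
begin

section \<open>Left modules over a ring that need not be commutative\<close>

text \<open>
  The record type \<open>('a, 'm) module\<close> of HOL-Algebra is used in two ways.  A left module over a
  ring with elements of type \<open>'a\<close> is such a record whose fields \<open>mult\<close> and \<open>one\<close> are ignored.
  A \<open>k\<close>-algebra is a record \<open>('k, 'a) module\<close>, where \<open>'k\<close> is a type of class \<open>field\<close>;
  the field \<open>smult\<close> is the action of the scalars.  The locale \<open>module\<close> of the library
  requires a commutative ring of scalars.
\<close>

locale left_module = R?: ring R + M?: abelian_group M
  for R :: "('a, 'r) ring_scheme" (structure) and M :: "('a, 'm, 's) module_scheme" (structure) +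
  assumes smult_closed: "\<lbrakk>a \<in> carrier R; x \<in> carrier M\<rbrakk> \<Longrightarrow> a \<odot>\<^bsub>M\<^esub> x \<in> carrier M"
    and smult_l_distr: "\<lbrakk>a \<in> carrier R; b \<in> carrier R; x \<in> carrier M\<rbrakk> \<Longrightarrow>
      (a \<oplus>\<^bsub>R\<^esub> b) \<odot>\<^bsub>M\<^esub> x = a \<odot>\<^bsub>M\<^esub> x \<oplus>\<^bsub>M\<^esub> b \<odot>\<^bsub>M\<^esub> x"
    and smult_r_distr: "\<lbrakk>a \<in> carrier R; x \<in> carrier M; y \<in> carrier M\<rbrakk> \<Longrightarrow>
      a \<odot>\<^bsub>M\<^esub> (x \<oplus>\<^bsub>M\<^esub> y) = a \<odot>\<^bsub>M\<^esub> x \<oplus>\<^bsub>M\<^esub> a \<odot>\<^bsub>M\<^esub> y"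
    and smult_assoc: "\<lbrakk>a \<in> carrier R; b \<in> carrier R; x \<in> carrier M\<rbrakk> \<Longrightarrow>
      (a \<otimes>\<^bsub>R\<^esub> b) \<odot>\<^bsub>M\<^esub> x = a \<odot>\<^bsub>M\<^esub> (b \<odot>\<^bsub>M\<^esub> x)"
    and smult_one: "x \<in> carrier M \<Longrightarrow> \<one>\<^bsub>R\<^esub> \<odot>\<^bsub>M\<^esub> x = x"

text \<open>The library's \<open>submodule\<close> does not need commutativity.\<close>

definition fg_module :: "('a, 'r) ring_scheme \<Rightarrow> ('a, 'm) module \<Rightarrow> bool" where
  "fg_module R M \<longleftrightarrow> left_module R M \<and>
     (\<exists>S. finite S \<and> S \<subseteq> carrier M \<and> (\<forall>N. submodule N R M \<and> S \<subseteq> N \<longrightarrow> N = carrier M))"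

text \<open>
  Homomorphisms are extensional functions, so that equality of elements of \<open>mod_hom R M N\<close> is
  equality of homomorphisms.
\<close>

definition mod_hom ::
    "('a, 'r) ring_scheme \<Rightarrow> ('a, 'm) module \<Rightarrow> ('a, 'n) module \<Rightarrow> ('m \<Rightarrow> 'n) set" where
  "mod_hom R M N = {f \<in> carrier M \<rightarrow>\<^sub>E carrier N.
     (\<forall>x\<in>carrier M. \<forall>y\<in>carrier M. f (x \<oplus>\<^bsub>M\<^esub> y) = f x \<oplus>\<^bsub>N\<^esub> f y) \<and>
     (\<forall>a\<in>carrier R. \<forall>x\<in>carrier M. f (a \<odot>\<^bsub>M\<^esub> x) = a \<odot>\<^bsub>N\<^esub> f x)}"

definition mod_iso :: "('a, 'r) ring_scheme \<Rightarrow> ('a, 'm) module \<Rightarrow> ('a, 'n) module \<Rightarrow> bool" where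
  "mod_iso R M N \<longleftrightarrow> (\<exists>f\<in>mod_hom R M N. bij_betw f (carrier M) (carrier N))"

definition hom_kernel :: "('a, 'm) module \<Rightarrow> ('a, 'n) module \<Rightarrow> ('m \<Rightarrow> 'n) \<Rightarrow> 'm set" where
  "hom_kernel M N f = {x \<in> carrier M. f x = \<zero>\<^bsub>N\<^esub>}"

definition iso_classes ::
    "('a, 'r) ring_scheme \<Rightarrow> ('a, 'm) module set \<Rightarrow> ('a, 'm) module set set" where
  "iso_classes R C = C // {(M, N). M \<in> C \<and> N \<in> C \<and> mod_iso R M N}"

definition regular_module :: "('a, 'r) ring_scheme \<Rightarrow> ('a, 'a) module" where
  "regular_module R = \<lparr>carrier = carrier R, mult = mult R, one = \<one>\<^bsub>R\<^esub>, zero = \<zero>\<^bsub>R\<^esub>, add = add R,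
     smult = mult R\<rparr>"

text \<open>
  Applied to a module and a submodule this is the quotient module; applied to an algebra and a
  two-sided ideal it is the quotient algebra.
\<close>

definition quot :: "('a, 'm) module \<Rightarrow> 'm set \<Rightarrow> ('a, 'm set) module" where
  "quot M N = \<lparr>carrier = carrier (M Quot N), mult = mult (M Quot N), one = one (M Quot N),
     zero = zero (M Quot N), add = add (M Quot N),
     smult = (\<lambda>a X. \<Union>x\<in>X. N +>\<^bsub>M\<^esub> (a \<odot>\<^bsub>M\<^esub> x))\<rparr>"


section \<open>Direct summands and the number of indecomposable summands\<close>

definition complementary ::
    "('a, 'r) ring_scheme \<Rightarrow> ('a, 'm) module \<Rightarrow> 'm set \<Rightarrow> 'm set \<Rightarrow> bool" where
  "complementary R M N N' \<longleftrightarrow> submodule N R M \<and> submodule N' R M \<and>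
     N \<inter> N' = {\<zero>\<^bsub>M\<^esub>} \<and> N <+>\<^bsub>M\<^esub> N' = carrier M"

definition indecomposable :: "('a, 'r) ring_scheme \<Rightarrow> ('a, 'm) module \<Rightarrow> bool" where
  "indecomposable R M \<longleftrightarrow> carrier M \<noteq> {\<zero>\<^bsub>M\<^esub>} \<and>
     (\<forall>N N'. complementary R M N N' \<longrightarrow> N = {\<zero>\<^bsub>M\<^esub>} \<or> N' = {\<zero>\<^bsub>M\<^esub>})"

definition indec_summands :: "('a, 'r) ring_scheme \<Rightarrow> ('a, 'm) module \<Rightarrow> ('a, 'm) module set" where
  "indec_summands R M =
     {M\<lparr>carrier := N\<rparr> |N. (\<exists>N'. complementary R M N N') \<and> indecomposable R (M\<lparr>carrier := N\<rparr>)}"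

definition num_summands :: "('a, 'r) ring_scheme \<Rightarrow> ('a, 'm) module \<Rightarrow> nat" where
  "num_summands R M = card (iso_classes R (indec_summands R M))"

definition internal_direct_sum ::
    "('a, 'r) ring_scheme \<Rightarrow> ('a, 'm) module \<Rightarrow> 'm set set \<Rightarrow> bool" where
  "internal_direct_sum R M F \<longleftrightarrow> finite F \<and> (\<forall>N\<in>F. submodule N R M) \<and>
     (\<forall>x\<in>carrier M. \<exists>!c. c \<in> (\<Pi>\<^sub>E N\<in>F. N) \<and> x = finsum M c F)"

definition basic :: "('a, 'r) ring_scheme \<Rightarrow> ('a, 'm) module \<Rightarrow> bool" where
  "basic R M \<longleftrightarrow> (\<exists>F. internal_direct_sum R M F \<and>
     (\<forall>N\<in>F. indecomposable R (M\<lparr>carrier := N\<rparr>)) \<and>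
     (\<forall>N\<in>F. \<forall>N'\<in>F. N \<noteq> N' \<longrightarrow> \<not> mod_iso R (M\<lparr>carrier := N\<rparr>) (M\<lparr>carrier := N'\<rparr>)))"


section \<open>Finitely generated modules over a finite-dimensional algebra\<close>

text \<open>
  A finitely generated module over a finite-dimensional \<open>k\<close>-algebra is finite-dimensional over
  \<open>k\<close>, hence isomorphic to a module whose carrier is a subset of the type \<open>nat \<Rightarrow> 'k\<close> (with
  arbitrary operations).  So the modules with elements in this type represent all isomorphism
  classes, and quantification over all finitely generated modules is quantification over
  \<open>('k, 'a) fmod\<close>.
\<close>

type_synonym ('k, 'a) fmod = "('a, nat \<Rightarrow> 'k) module"

definition projective :: "('k::field, 'a) module \<Rightarrow> ('k, 'a) fmod \<Rightarrow> bool" where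
  "projective \<Lambda> P \<longleftrightarrow> fg_module \<Lambda> P \<and>
     (\<forall>(X :: ('k, 'a) fmod) (Y :: ('k, 'a) fmod). \<forall>g\<in>mod_hom \<Lambda> X Y. \<forall>h\<in>mod_hom \<Lambda> P Y.
        fg_module \<Lambda> X \<and> fg_module \<Lambda> Y \<and> g ` carrier X = carrier Y \<longrightarrow>
        (\<exists>h'\<in>mod_hom \<Lambda> P X. \<forall>x\<in>carrier P. g (h' x) = h x))"

definition short_exact :: "('k::field, 'a) module \<Rightarrow> ('k, 'a) fmod \<Rightarrow> ((nat \<Rightarrow> 'k) \<Rightarrow> (nat \<Rightarrow> 'k)) \<Rightarrow>
    ('k, 'a) fmod \<Rightarrow> ((nat \<Rightarrow> 'k) \<Rightarrow> (nat \<Rightarrow> 'k)) \<Rightarrow> ('k, 'a) fmod \<Rightarrow> bool" where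
  "short_exact \<Lambda> N i E p M \<longleftrightarrow> fg_module \<Lambda> N \<and> fg_module \<Lambda> E \<and> fg_module \<Lambda> M \<and>
     i \<in> mod_hom \<Lambda> N E \<and> p \<in> mod_hom \<Lambda> E M \<and>
     inj_on i (carrier N) \<and> p ` carrier E = carrier M \<and> i ` carrier N = hom_kernel E M p"

definition proj_dim_le_1 :: "('k::field, 'a) module \<Rightarrow> ('k, 'a) fmod \<Rightarrow> bool" where
  "proj_dim_le_1 \<Lambda> M \<longleftrightarrow>
     (\<exists>P1 i P0 p. projective \<Lambda> P1 \<and> projective \<Lambda> P0 \<and> short_exact \<Lambda> P1 i P0 p M)"

text \<open>
  Ext is Yoneda's: the elements of \<open>Ext\<^sup>1(M, N)\<close> are the equivalence classes of extensions
  of \<open>M\<close> by \<open>N\<close>, and its zero is the class of the split ones.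
\<close>

definition Ext1_zero :: "('k::field, 'a) module \<Rightarrow> ('k, 'a) fmod \<Rightarrow> ('k, 'a) fmod \<Rightarrow> bool" where
  "Ext1_zero \<Lambda> M N \<longleftrightarrow> (\<forall>i E p. short_exact \<Lambda> N i E p M \<longrightarrow>
     (\<exists>s\<in>mod_hom \<Lambda> M E. \<forall>x\<in>carrier M. p (s x) = x))"


section \<open>The Auslander--Reiten translation\<close>

definition opp :: "('k, 'a) module \<Rightarrow> ('k, 'a) module" where
  "opp \<Lambda> = \<Lambda>\<lparr>mult := (\<lambda>a b. b \<otimes>\<^bsub>\<Lambda>\<^esub> a)\<rparr>"

text \<open>The right module \<open>Hom(M, \<Lambda>)\<close>, as a left module over the opposite algebra.\<close>

definition hom_to_algebra :: "('k, 'a) module \<Rightarrow> ('a, 'm) module \<Rightarrow> ('a, 'm \<Rightarrow> 'a) module" where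
  "hom_to_algebra \<Lambda> M = \<lparr>carrier = mod_hom \<Lambda> M (regular_module \<Lambda>), mult = undefined, one = undefined,
     zero = (\<lambda>x\<in>carrier M. \<zero>\<^bsub>\<Lambda>\<^esub>), add = (\<lambda>f g. \<lambda>x\<in>carrier M. f x \<oplus>\<^bsub>\<Lambda>\<^esub> g x),
     smult = (\<lambda>a f. \<lambda>x\<in>carrier M. f x \<otimes>\<^bsub>\<Lambda>\<^esub> a)\<rparr>"

text \<open>
  The \<open>k\<close>-dual of a left module over the algebra \<open>A\<close>, as a left module over \<open>opp A\<close>.
  The vector space structure of a module is given by the action of the multiples of \<open>\<one>\<^bsub>A\<^esub>\<close>.
\<close>

definition dual :: "('k::field, 'a) module \<Rightarrow> ('a, 'm) module \<Rightarrow> ('a, 'm \<Rightarrow> 'k) module" where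
  "dual A M = \<lparr>carrier = {\<phi> \<in> extensional (carrier M).
       (\<forall>x\<in>carrier M. \<forall>y\<in>carrier M. \<phi> (x \<oplus>\<^bsub>M\<^esub> y) = \<phi> x + \<phi> y) \<and>
       (\<forall>c. \<forall>x\<in>carrier M. \<phi> ((c \<odot>\<^bsub>A\<^esub> \<one>\<^bsub>A\<^esub>) \<odot>\<^bsub>M\<^esub> x) = c * \<phi> x)},
     mult = undefined, one = undefined,
     zero = (\<lambda>x\<in>carrier M. 0), add = (\<lambda>\<phi> \<psi>. \<lambda>x\<in>carrier M. \<phi> x + \<psi> x),
     smult = (\<lambda>a \<phi>. \<lambda>x\<in>carrier M. \<phi> (a \<odot>\<^bsub>M\<^esub> x))\<rparr>"

definition superfluous :: "('a, 'r) ring_scheme \<Rightarrow> ('a, 'm) module \<Rightarrow> 'm set \<Rightarrow> bool" where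
  "superfluous R M K \<longleftrightarrow> (\<forall>N. submodule N R M \<and> N <+>\<^bsub>M\<^esub> K = carrier M \<longrightarrow> N = carrier M)"

definition min_proj_presentation :: "('k::field, 'a) module \<Rightarrow> ('k, 'a) fmod \<Rightarrow>
    ((nat \<Rightarrow> 'k) \<Rightarrow> (nat \<Rightarrow> 'k)) \<Rightarrow> ('k, 'a) fmod \<Rightarrow> ((nat \<Rightarrow> 'k) \<Rightarrow> (nat \<Rightarrow> 'k)) \<Rightarrow>
    ('k, 'a) fmod \<Rightarrow> bool" where
  "min_proj_presentation \<Lambda> P1 f P0 p M \<longleftrightarrow> projective \<Lambda> P1 \<and> projective \<Lambda> P0 \<and>
     f \<in> mod_hom \<Lambda> P1 P0 \<and> p \<in> mod_hom \<Lambda> P0 M \<and>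
     p ` carrier P0 = carrier M \<and> f ` carrier P1 = hom_kernel P0 M p \<and>
     superfluous \<Lambda> P0 (hom_kernel P0 M p) \<and> superfluous \<Lambda> P1 (hom_kernel P1 P0 f)"

text \<open>The transpose: the cokernel of \<open>Hom(f, \<Lambda>) : Hom(P0, \<Lambda>) \<rightarrow> Hom(P1, \<Lambda>)\<close>.\<close>

definition Tr :: "('k, 'a) module \<Rightarrow> ('a, 'm) module \<Rightarrow> ('m \<Rightarrow> 'm) \<Rightarrow> ('a, 'm) module \<Rightarrow>
    ('a, ('m \<Rightarrow> 'a) set) module" where
  "Tr \<Lambda> P1 f P0 = quot (hom_to_algebra \<Lambda> P1)
     ((\<lambda>g. compose (carrier P1) g f) ` mod_hom \<Lambda> P0 (regular_module \<Lambda>))"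

text \<open>
  Minimal projective presentations of a module exist and are unique up to isomorphism;
  \<open>\<tau> M\<close> is computed from an arbitrary one.
\<close>

definition tau ::
    "('k::field, 'a) module \<Rightarrow> ('k, 'a) fmod \<Rightarrow> ('a, ((nat \<Rightarrow> 'k) \<Rightarrow> 'a) set \<Rightarrow> 'k) module" where
  "tau \<Lambda> M =
     (let (P1, f, P0) = (SOME (P1, f, P0). \<exists>p. min_proj_presentation \<Lambda> P1 f P0 p M)
      in dual (opp \<Lambda>) (Tr \<Lambda> P1 f P0))"


section \<open>Tilting, tau-tilting and support tau-tilting modules\<close>

definition tilting :: "('k::field, 'a) module \<Rightarrow> ('k, 'a) fmod \<Rightarrow> bool" where
  "tilting \<Lambda> M \<longleftrightarrow> fg_module \<Lambda> M \<and> proj_dim_le_1 \<Lambda> M \<and> Ext1_zero \<Lambda> M M \<and>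
     num_summands \<Lambda> M = num_summands \<Lambda> (regular_module \<Lambda>)"

definition tau_rigid :: "('k::field, 'a) module \<Rightarrow> ('k, 'a) fmod \<Rightarrow> bool" where
  "tau_rigid \<Lambda> M \<longleftrightarrow> fg_module \<Lambda> M \<and>
     mod_hom \<Lambda> M (tau \<Lambda> M) = {\<lambda>x\<in>carrier M. \<zero>\<^bsub>tau \<Lambda> M\<^esub>}"

definition tau_tilting :: "('k::field, 'a) module \<Rightarrow> ('k, 'a) fmod \<Rightarrow> bool" where
  "tau_tilting \<Lambda> M \<longleftrightarrow> tau_rigid \<Lambda> M \<and>
     num_summands \<Lambda> M = num_summands \<Lambda> (regular_module \<Lambda>)"

text \<open>The \<open>\<Lambda>\<close>-module obtained from a module over \<open>\<Lambda>/I\<close>.\<close>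

definition inflate :: "('k, 'a) module \<Rightarrow> 'a set \<Rightarrow> ('a set, 'm) module \<Rightarrow> ('a, 'm) module" where
  "inflate \<Lambda> I N = \<lparr>carrier = carrier N, mult = mult N, one = one N, zero = zero N, add = add N,
     smult = (\<lambda>a. smult N (I +>\<^bsub>\<Lambda>\<^esub> a))\<rparr>"

text \<open>\<open>Idl\<^bsub>\<Lambda>\<^esub> {e}\<close> is the two-sided ideal \<open>\<Lambda>e\<Lambda>\<close>.\<close>

definition support_tau_tilting :: "('k::field, 'a) module \<Rightarrow> ('k, 'a) fmod \<Rightarrow> bool" where
  "support_tau_tilting \<Lambda> M \<longleftrightarrow>
     (\<exists>e\<in>carrier \<Lambda>. e \<otimes>\<^bsub>\<Lambda>\<^esub> e = e \<and>
        (\<exists>N. tau_tilting (quot \<Lambda> (Idl\<^bsub>\<Lambda>\<^esub> {e})) N \<and> M = inflate \<Lambda> (Idl\<^bsub>\<Lambda>\<^esub> {e}) N))"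

definition tilt :: "('k::field, 'a) module \<Rightarrow> ('k, 'a) fmod set set" where
  "tilt \<Lambda> = iso_classes \<Lambda> {M. tilting \<Lambda> M \<and> basic \<Lambda> M}"

definition tau_tilt :: "('k::field, 'a) module \<Rightarrow> ('k, 'a) fmod set set" where
  "tau_tilt \<Lambda> = iso_classes \<Lambda> {M. tau_tilting \<Lambda> M \<and> basic \<Lambda> M}"

definition stau_tilt :: "('k::field, 'a) module \<Rightarrow> ('k, 'a) fmod set set" where
  "stau_tilt \<Lambda> = iso_classes \<Lambda> {M. support_tau_tilting \<Lambda> M \<and> basic \<Lambda> M}"


section \<open>Path algebras and their radical\<close>

text \<open>
  A path is a triple \<open>(u, p, v)\<close> of its source, its list of arrows and its target; \<open>(u, [], u)\<close>
  is the trivial path at \<open>u\<close>.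
\<close>

definition paths :: "('v, 'e) pre_digraph \<Rightarrow> ('v \<times> 'e list \<times> 'v) set" where
  "paths Q = {(u, p, v). pre_digraph.awalk Q u p v}"

text \<open>
  Elements are finitely supported functions on paths.  Paths are multiplied like functions:
  the product \<open>ba\<close> is the path \<open>a\<close> followed by the path \<open>b\<close>.  So an arrow \<open>x \<rightarrow> y\<close> acts on a
  left module \<open>M\<close> as a map from \<open>e\<^sub>x M\<close> to \<open>e\<^sub>y M\<close>, left modules are the representations of the
  quiver, and an arrow \<open>x \<rightarrow> y\<close> gives a nonsplit extension of \<open>S\<^sub>x\<close> by \<open>S\<^sub>y\<close>, that is, a nonzero
  element of \<open>Ext\<^sup>1(S\<^sub>x, S\<^sub>y)\<close>.
\<close>

definition path_algebra ::
    "('v, 'e) pre_digraph \<Rightarrow> ('k::field, 'v \<times> 'e list \<times> 'v \<Rightarrow> 'k) module" where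
  "path_algebra Q = \<lparr>
     carrier = {f. finite {w. f w \<noteq> 0} \<and> {w. f w \<noteq> 0} \<subseteq> paths Q},
     mult = (\<lambda>f g (u, p, v).
       \<Sum>(r, s, m)\<in>{(r, s, m). p = r @ s \<and> (u, r, m) \<in> paths Q \<and> (m, s, v) \<in> paths Q}.
         f (m, s, v) * g (u, r, m)),
     one = (\<lambda>(u, p, v). if u \<in> verts Q \<and> p = [] \<and> v = u then 1 else 0),
     zero = (\<lambda>w. 0),
     add = (\<lambda>f g w. f w + g w),
     smult = (\<lambda>c f w. c * f w)\<rparr>"

definition maximal_left_ideal :: "('a, 'r) ring_scheme \<Rightarrow> 'a set \<Rightarrow> bool" where
  "maximal_left_ideal R L \<longleftrightarrow> submodule L R (regular_module R) \<and> L \<noteq> carrier R \<and>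
     (\<forall>L'. submodule L' R (regular_module R) \<and> L \<subseteq> L' \<longrightarrow> L' = L \<or> L' = carrier R)"

definition jacobson_radical :: "('a, 'r) ring_scheme \<Rightarrow> 'a set" where
  "jacobson_radical R = carrier R \<inter> \<Inter>{L. maximal_left_ideal R L}"

definition mod_rad_square :: "('k::field, 'a) module \<Rightarrow> ('k, 'a set) module" where
  "mod_rad_square A = quot A (jacobson_radical A \<cdot>\<^bsub>A\<^esub> jacobson_radical A)"

definition A_quiver :: "nat \<Rightarrow> (nat, nat \<times> nat) pre_digraph" where
  "A_quiver n = \<lparr>verts = {1..n}, arcs = {(i + 1, i) |i. 1 \<le> i \<and> i < n}, tail = fst, head = snd\<rparr>"

definition D_quiver :: "nat \<Rightarrow> (nat, nat \<times> nat) pre_digraph" where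
  "D_quiver n = \<lparr>verts = {1..n}, arcs = {(i + 1, i) |i. 3 \<le> i \<and> i < n} \<union> {(3, 1), (3, 2)},
     tail = fst, head = snd\<rparr>"

type_synonym 'k radsq_algebra = "('k, (nat \<times> (nat \<times> nat) list \<times> nat \<Rightarrow> 'k) set) module"

definition A_radsq :: "nat \<Rightarrow> 'k::field radsq_algebra" where
  "A_radsq n = mod_rad_square (path_algebra (A_quiver n))"

definition D_radsq :: "nat \<Rightarrow> 'k::field radsq_algebra" where
  "D_radsq n = mod_rad_square (path_algebra (D_quiver n))"

end

theory Submission
  imports Defs "HOL-Library.Nat_Bijection" "HOL-Library.Multiset" "HOL-Library.Function_Algebras"
begin

text \<open>
  The indecomposable modules over a radical square zero algebra of a quiver in which every vertex is
  the target of at most one arrow and the source of at most two are the quotients of the projective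
  modules \<open>P\<^sub>x\<close> by sets of arrows, so that they are the pairs \<open>(x, A)\<close> of a vertex \<open>x\<close> and a set
  \<open>A\<close> of targets of arrows from \<open>x\<close>: the top is \<open>S\<^sub>x\<close> and the radical is the sum of
  the \<open>S\<^sub>y\<close> with \<open>y \<in> A\<close>. A homomorphism \<open>M \<rightarrow> \<tau>N\<close> is a family of linear
  forms on the \<open>e\<^sub>yM\<close>, one for each summand \<open>(x, A)\<close> of \<open>N\<close> and each arrow \<open>x \<rightarrow> y\<close> with
  \<open>y \<notin> A\<close>, subject to one linear relation for each summand of \<open>N\<close>. So \<open>\<tau>\<close>-rigidity is a
  condition on the set \<open>S\<close> of pairs alone. Removing the largest vertex \<open>x\<close>, together with the
  targets \<open>y\<close> of arrows from \<open>x\<close> with \<open>y \<notin> A\<close> for some \<open>(x, A) \<in> S\<close>, leaves a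
  rigid set of a smaller quiver. This gives \<open>t\<^sub>n = t\<^sub>n\<^sub>-\<^sub>1 + t\<^sub>n\<^sub>-\<^sub>2\<close> for \<open>\<tau>\<close>-tilting
  modules and, by summation over the supports, \<open>s\<^sub>n = 2s\<^sub>n\<^sub>-\<^sub>1 + s\<^sub>n\<^sub>-\<^sub>2\<close> for support
  \<open>\<tau>\<close>-tilting modules. Projective dimension at most one means that an arrow \<open>x \<rightarrow> y\<close> is missed
  only if \<open>y\<close> is a sink, which leaves no choice far from the sinks.
\<close>

section \<open>Modules over a ring\<close>

text \<open>Why pairs suffice: at a vertex the image of the incoming arrow lies in the kernels of
  the outgoing arrows, because products of arrows vanish. Up to two such kernels have a common
  adapted basis; three in general have none. The classification and the uniqueness of multiplicities
  have to come first, as \<open>basic\<close>, \<open>num_summands\<close> and isomorphism classes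
  are stated for arbitrary modules. Since \<open>tau\<close> is computed from an arbitrary minimal
  projective presentation, uniqueness of projective covers is proved before the explicit
  presentation is used. Why the recursion counts exactly the maximal rigid sets: the pairs at the
  largest vertex number at most one more than the targets that they miss, and these targets are
  removed along with the vertex. So a rigid set has at most as many elements as there are vertices,
  and equality must hold at every step. A vertex with 0, 1 or 2 targets then leaves 1, 2 or 5
  choices; the last number is the count of tilting modules in type D. For support tau-tilting
  modules a maximal rigid set determines its support, so the sum over supports counts nothing
  twice.\<close>

lemma mod_hom_closed: "[|f \<in> mod_hom R M N; x \<in> carrier M|] ==> f x \<in> carrier N"
  by (auto simp: mod_hom_def PiE_iff)

lemma mod_hom_add: "[|f \<in> mod_hom R M N; x \<in> carrier M; y \<in> carrier M|] ==> f (x \<oplus>\<^bsub>M\<^esub> y) = f x \<oplus>\<^bsub>N\<^esub> f y"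
  by (auto simp: mod_hom_def)

lemma mod_hom_smult: "[|f \<in> mod_hom R M N; a \<in> carrier R; x \<in> carrier M|] ==> f (a \<odot>\<^bsub>M\<^esub> x) = a \<odot>\<^bsub>N\<^esub> f x"
  by (auto simp: mod_hom_def)

lemma mod_hom_eqI:
  assumes "f \<in> mod_hom R M N" "g \<in> mod_hom R M N" "\<And>x. x \<in> carrier M ==> f x = g x"
  shows "f = g"
proof (rule PiE_ext)
  show "f \<in> carrier M \<rightarrow>\<^sub>E carrier N" "g \<in> carrier M \<rightarrow>\<^sub>E carrier N" using assms by (auto simp: mod_hom_def)
qed (rule assms(3))

lemma mod_hom_restrictI:
  assumes "\<And>x. x \<in> carrier M ==> f x \<in> carrier N"
    "\<And>x y. [|x \<in> carrier M; y \<in> carrier M|] ==> f (x \<oplus>\<^bsub>M\<^esub> y) = f x \<oplus>\<^bsub>N\<^esub> f y"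
    "\<And>a x. [|a \<in> carrier R; x \<in> carrier M|] ==> f (a \<odot>\<^bsub>M\<^esub> x) = a \<odot>\<^bsub>N\<^esub> f x"
    "\<And>x y. [|x \<in> carrier M; y \<in> carrier M|] ==> x \<oplus>\<^bsub>M\<^esub> y \<in> carrier M"
    "\<And>a x. [|a \<in> carrier R; x \<in> carrier M|] ==> a \<odot>\<^bsub>M\<^esub> x \<in> carrier M"
  shows "restrict f (carrier M) \<in> mod_hom R M N"
  using assms by (auto simp: mod_hom_def)

context left_module
begin

lemma smult_zero_right: "a \<in> carrier R ==> a \<odot>\<^bsub>M\<^esub> \<zero>\<^bsub>M\<^esub> = \<zero>\<^bsub>M\<^esub>"
  by (metis M.add.l_cancel_one M.r_zero M.zero_closed smult_closed smult_r_distr)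

lemma smult_zero_left: "x \<in> carrier M ==> \<zero>\<^bsub>R\<^esub> \<odot>\<^bsub>M\<^esub> x = \<zero>\<^bsub>M\<^esub>"
  by (metis M.add.l_cancel_one R.r_zero R.zero_closed smult_closed smult_l_distr)

lemma smult_minus_one: "x \<in> carrier M ==> (\<ominus>\<^bsub>R\<^esub> \<one>\<^bsub>R\<^esub>) \<odot>\<^bsub>M\<^esub> x = \<ominus>\<^bsub>M\<^esub> x"
  by (metis M.minus_equality R.add.inv_closed R.l_neg R.one_closed smult_closed smult_l_distr
      smult_one smult_zero_left)

lemma smult_minus: "[|a \<in> carrier R; x \<in> carrier M|] ==> a \<odot>\<^bsub>M\<^esub> (\<ominus>\<^bsub>M\<^esub> x) = \<ominus>\<^bsub>M\<^esub> (a \<odot>\<^bsub>M\<^esub> x)"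
  by (metis M.add.inv_closed M.minus_equality M.r_neg smult_closed smult_r_distr smult_zero_right
      M.a_comm)

lemma smult_minus_distr: "[|a \<in> carrier R; x \<in> carrier M; y \<in> carrier M|] ==>
    a \<odot>\<^bsub>M\<^esub> (x \<ominus>\<^bsub>M\<^esub> y) = a \<odot>\<^bsub>M\<^esub> x \<ominus>\<^bsub>M\<^esub> a \<odot>\<^bsub>M\<^esub> y"
  by (simp add: a_minus_def smult_minus smult_r_distr smult_closed)

lemma minus_eq_zero_iff: "[|x \<in> carrier M; y \<in> carrier M|] ==> x \<ominus>\<^bsub>M\<^esub> y = \<zero>\<^bsub>M\<^esub> \<longleftrightarrow> x = y"
  unfolding a_minus_def by (metis M.add.inv_closed M.add.inv_inv M.minus_equality M.r_neg)

text \<open>The inverses that \<open>submodule\<close> asks for are multiples by minus one, so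
  closure under addition and scalars is enough.\<close>

lemma submodule_iff: "submodule N R M \<longleftrightarrow> N \<subseteq> carrier M \<and> \<zero>\<^bsub>M\<^esub> \<in> N \<and>
    (\<forall>x\<in>N. \<forall>y\<in>N. x \<oplus>\<^bsub>M\<^esub> y \<in> N) \<and> (\<forall>a\<in>carrier R. \<forall>x\<in>N. a \<odot>\<^bsub>M\<^esub> x \<in> N)"
proof
  assume "submodule N R M"
  then interpret submodule N R M .
  show "N \<subseteq> carrier M \<and> \<zero>\<^bsub>M\<^esub> \<in> N \<and>
    (\<forall>x\<in>N. \<forall>y\<in>N. x \<oplus>\<^bsub>M\<^esub> y \<in> N) \<and> (\<forall>a\<in>carrier R. \<forall>x\<in>N. a \<odot>\<^bsub>M\<^esub> x \<in> N)"
    using subset m_closed one_closed by auto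
next
  assume N: "N \<subseteq> carrier M \<and> \<zero>\<^bsub>M\<^esub> \<in> N \<and>
    (\<forall>x\<in>N. \<forall>y\<in>N. x \<oplus>\<^bsub>M\<^esub> y \<in> N) \<and> (\<forall>a\<in>carrier R. \<forall>x\<in>N. a \<odot>\<^bsub>M\<^esub> x \<in> N)"
  have "\<ominus>\<^bsub>M\<^esub> x \<in> N" if "x \<in> N" for x
    using N that smult_minus_one[of x] by (metis R.add.inv_closed R.one_closed subsetD)
  then show "submodule N R M"
    using N by (intro submodule.intro subgroup.intro) (auto simp: submodule_axioms_def a_inv_def)
qed

lemma submodule_carrier: "submodule (carrier M) R M"
  by (simp add: submodule_iff smult_closed)

lemma submodule_minus:
  assumes "submodule N R M" "x \<in> N" "y \<in> N" shows "x \<ominus>\<^bsub>M\<^esub> y \<in> N"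
proof -
  have "\<ominus>\<^bsub>M\<^esub> y \<in> N"
    using assms smult_minus_one[of y] unfolding submodule_iff
    by (metis R.add.inv_closed R.one_closed subsetD)
  then show ?thesis using assms unfolding submodule_iff a_minus_def by blast
qed

lemma submodule_finsum:
  assumes "submodule N R M" "finite A" "\<And>i. i \<in> A ==> h i \<in> N"
  shows "finsum M h A \<in> N"
  using assms(2,3)
proof (induction A)
  case empty then show ?case using assms(1) by (simp add: submodule_iff)
next
  case (insert i A)
  then have "h \<in> insert i A \<rightarrow> carrier M" using assms(1) by (auto simp: submodule_iff)
  then show ?case using insert assms(1) by (subst M.finsum_insert) (auto simp: submodule_iff)
qed

lemma left_module_restrict:
  assumes "submodule N R M" shows "left_module R (M\<lparr>carrier := N\<rparr>)"
proof -
  note N = assms[unfolded submodule_iff]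
  have inv: "\<exists>y\<in>N. y \<oplus>\<^bsub>M\<^esub> x = \<zero>\<^bsub>M\<^esub>" if "x \<in> N" for x
    using N that smult_minus_one[of x] M.l_neg by (metis R.add.inv_closed R.one_closed subsetD)
  have "abelian_group (M\<lparr>carrier := N\<rparr>)"
    using N inv by (intro abelian_groupI) (auto simp: M.a_ac subset_iff)
  then show ?thesis using N
    by (intro left_module.intro left_module_axioms.intro)
      (auto simp: R.ring_axioms smult_l_distr smult_r_distr smult_assoc smult_one subset_iff)
qed

lemma smult_finsum:
  assumes "finite A" "a \<in> carrier R" "h \<in> A \<rightarrow> carrier M"
  shows "a \<odot>\<^bsub>M\<^esub> finsum M h A = finsum M (\<lambda>i. a \<odot>\<^bsub>M\<^esub> h i) A"
  using assms(1,3)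
proof (induction A)
  case empty then show ?case using assms(2) by (simp add: smult_zero_right)
next
  case (insert i A)
  then have "h \<in> A \<rightarrow> carrier M" "h i \<in> carrier M" by auto
  then show ?case using insert assms(2)
    by (simp add: smult_r_distr smult_closed Pi_def)
qed

lemma finsum_smult:
  assumes "finite A" "h \<in> A \<rightarrow> carrier R" "x \<in> carrier M"
  shows "finsum R h A \<odot>\<^bsub>M\<^esub> x = finsum M (\<lambda>i. h i \<odot>\<^bsub>M\<^esub> x) A"
  using assms(1,2)
proof (induction A)
  case empty then show ?case using assms(3) by (simp add: smult_zero_left)
next
  case (insert i A)
  then have "h \<in> A \<rightarrow> carrier R" "h i \<in> carrier R" by auto
  then show ?case using insert assms(3)
    by (simp add: smult_l_distr smult_closed Pi_def)
qed

end

lemma (in ring) left_module_regular: "left_module R (regular_module R)"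
proof -
  have "abelian_group (regular_module R)"
    by (rule abelian_groupI) (auto simp: regular_module_def a_ac add.l_inv_ex)
  then show ?thesis
    by (intro left_module.intro left_module_axioms.intro)
      (auto simp: regular_module_def ring_axioms l_distr r_distr m_assoc)
qed

section \<open>Homomorphisms, images and preimages\<close>

locale module_hom = M: left_module R M + N: left_module R N
  for R :: "('a, 'r) ring_scheme" and M :: "('a, 'm) module" and N :: "('a, 'n) module" +
  fixes f assumes hom: "f \<in> mod_hom R M N"
begin

lemmas closed = mod_hom_closed[OF hom]
lemmas add = mod_hom_add[OF hom]
lemmas smult = mod_hom_smult[OF hom]

lemma zero: "f \<zero>\<^bsub>M\<^esub> = \<zero>\<^bsub>N\<^esub>"
  by (metis M.R.zero_closed M.smult_zero_left M.M.zero_closed N.smult_zero_left closed smult)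

lemma minus: "x \<in> carrier M ==> f (\<ominus>\<^bsub>M\<^esub> x) = \<ominus>\<^bsub>N\<^esub> f x"
  by (metis M.R.add.inv_closed M.R.one_closed M.smult_minus_one N.smult_minus_one closed smult)

lemma diff: "[|x \<in> carrier M; y \<in> carrier M|] ==> f (x \<ominus>\<^bsub>M\<^esub> y) = f x \<ominus>\<^bsub>N\<^esub> f y"
  by (simp add: a_minus_def add minus)

lemma finsum:
  assumes "finite A" "h \<in> A \<rightarrow> carrier M"
  shows "f (finsum M h A) = finsum N (\<lambda>i. f (h i)) A"
  using assms
proof (induction A)
  case empty then show ?case by (simp add: zero)
next
  case (insert i A)
  then have "h \<in> A \<rightarrow> carrier M" "h i \<in> carrier M" by auto
  then show ?case using insert by (simp add: add closed Pi_def)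
qed

lemma submodule_image:
  assumes "submodule K R M" shows "submodule (f ` K) R N"
  unfolding N.submodule_iff
proof (intro conjI ballI)
  have K: "K \<subseteq> carrier M" "\<zero>\<^bsub>M\<^esub> \<in> K" using assms by (auto simp: M.submodule_iff)
  show "f ` K \<subseteq> carrier N" using K closed by auto
  show "\<zero>\<^bsub>N\<^esub> \<in> f ` K" using K zero by (metis imageI)
  show "x \<oplus>\<^bsub>N\<^esub> y \<in> f ` K" if "x \<in> f ` K" "y \<in> f ` K" for x y
  proof -
    obtain u v where "u \<in> K" "v \<in> K" "x = f u" "y = f v" using \<open>x \<in> f ` K\<close> \<open>y \<in> f ` K\<close> by blast
    then have "x \<oplus>\<^bsub>N\<^esub> y = f (u \<oplus>\<^bsub>M\<^esub> v)" "u \<oplus>\<^bsub>M\<^esub> v \<in> K"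
      using K assms add by (auto simp: M.submodule_iff subset_iff)
    then show ?thesis by blast
  qed
  show "a \<odot>\<^bsub>N\<^esub> x \<in> f ` K" if "a \<in> carrier R" "x \<in> f ` K" for a x
  proof -
    obtain u where "u \<in> K" "x = f u" using \<open>x \<in> f ` K\<close> by blast
    then have "a \<odot>\<^bsub>N\<^esub> x = f (a \<odot>\<^bsub>M\<^esub> u)" "a \<odot>\<^bsub>M\<^esub> u \<in> K"
      using K assms smult that by (auto simp: M.submodule_iff subset_iff)
    then show ?thesis by blast
  qed
qed

lemma submodule_preimage:
  assumes "submodule K R N" shows "submodule {x \<in> carrier M. f x \<in> K} R M"
  using assms by (auto simp: M.submodule_iff N.submodule_iff add smult zero M.smult_closed)

lemma submodule_kernel: "submodule (hom_kernel M N f) R M"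
  by (auto simp: M.submodule_iff hom_kernel_def zero add smult M.smult_closed N.smult_zero_right)

lemma inj_iff: "inj_on f (carrier M) \<longleftrightarrow> (\<forall>x\<in>carrier M. f x = \<zero>\<^bsub>N\<^esub> \<longrightarrow> x = \<zero>\<^bsub>M\<^esub>)"
proof
  assume "inj_on f (carrier M)"
  then show "\<forall>x\<in>carrier M. f x = \<zero>\<^bsub>N\<^esub> \<longrightarrow> x = \<zero>\<^bsub>M\<^esub>"
    using zero by (metis M.M.zero_closed inj_onD)
next
  assume *: "\<forall>x\<in>carrier M. f x = \<zero>\<^bsub>N\<^esub> \<longrightarrow> x = \<zero>\<^bsub>M\<^esub>"
  show "inj_on f (carrier M)"
  proof
    fix x y assume xy: "x \<in> carrier M" "y \<in> carrier M" "f x = f y"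
    then have "f (x \<ominus>\<^bsub>M\<^esub> y) = \<zero>\<^bsub>N\<^esub>" by (simp add: diff closed N.minus_eq_zero_iff)
    then have "x \<ominus>\<^bsub>M\<^esub> y = \<zero>\<^bsub>M\<^esub>" using xy * by auto
    then show "x = y" using xy by (simp add: M.minus_eq_zero_iff)
  qed
qed

text \<open>The equalizer of two homomorphisms is a submodule.\<close>

lemma eq_on_generators:
  assumes g: "g \<in> mod_hom R M N"
    and gen: "\<And>K. submodule K R M ==> S \<subseteq> K ==> K = carrier M" "S \<subseteq> carrier M"
    and "\<And>x. x \<in> S ==> f x = g x"
  shows "f = g"
proof -
  interpret g: module_hom R M N g by unfold_locales (rule g)
  have "submodule {x \<in> carrier M. f x = g x} R M"
    by (auto simp: M.submodule_iff add smult zero g.add g.smult g.zero M.smult_closed)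
  with gen(1)[OF this] gen(2) assms(4) have "{x \<in> carrier M. f x = g x} = carrier M" by blast
  then show ?thesis using mod_hom_eqI[OF hom g] by blast
qed

lemma inverse:
  assumes "bij_betw f (carrier M) (carrier N)"
  shows "restrict (inv_into (carrier M) f) (carrier N) \<in> mod_hom R N M"
    "\<And>x. x \<in> carrier M ==> restrict (inv_into (carrier M) f) (carrier N) (f x) = x"
    "\<And>y. y \<in> carrier N ==> f (restrict (inv_into (carrier M) f) (carrier N) y) = y"
    "bij_betw (restrict (inv_into (carrier M) f) (carrier N)) (carrier N) (carrier M)"
proof -
  let ?g = "inv_into (carrier M) f"
  have inj: "inj_on f (carrier M)" and im: "f ` carrier M = carrier N"
    using assms by (auto simp: bij_betw_def)
  have g: "?g y \<in> carrier M" "f (?g y) = y" if "y \<in> carrier N" for y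
    using that im by (auto simp: inv_into_into f_inv_into_f)
  show "restrict ?g (carrier N) \<in> mod_hom R N M"
  proof (rule mod_hom_restrictI)
    show "?g (x \<oplus>\<^bsub>N\<^esub> y) = ?g x \<oplus>\<^bsub>M\<^esub> ?g y" if "x \<in> carrier N" "y \<in> carrier N" for x y
      by (rule inj_onD[OF inj]) (use g that in \<open>auto simp: add\<close>)
    show "?g (a \<odot>\<^bsub>N\<^esub> x) = a \<odot>\<^bsub>M\<^esub> ?g x" if "a \<in> carrier R" "x \<in> carrier N" for a x
      by (rule inj_onD[OF inj]) (use g that in \<open>auto simp: smult N.smult_closed M.smult_closed\<close>)
  qed (use g in \<open>auto simp: N.smult_closed\<close>)
  show "restrict ?g (carrier N) (f x) = x" if "x \<in> carrier M" for x
    using that inj by (simp add: closed)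
  show "f (restrict ?g (carrier N) y) = y" if "y \<in> carrier N" for y
    using that g by simp
  show "bij_betw (restrict ?g (carrier N)) (carrier N) (carrier M)"
    using bij_betw_inv_into[OF assms] by (simp cong: bij_betw_cong)
qed

end

lemma mod_hom_compose:
  assumes "left_module R M" "f \<in> mod_hom R M N" "g \<in> mod_hom R N P"
  shows "compose (carrier M) g f \<in> mod_hom R M P"
proof -
  interpret left_module R M by fact
  show ?thesis using assms(2,3)
    by (auto simp: mod_hom_def compose_def smult_closed PiE_iff)
qed

lemma mod_hom_id: "left_module R M ==> restrict (\<lambda>x. x) (carrier M) \<in> mod_hom R M M"
proof -
  assume "left_module R M"
  then interpret left_module R M .
  show ?thesis by (rule mod_hom_restrictI) (auto simp: smult_closed)
qed

lemma mod_iso_refl: "left_module R M ==> mod_iso R M M"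
  unfolding mod_iso_def using mod_hom_id[of R M] bij_betw_id[of "carrier M"]
  by (metis (no_types, lifting) bij_betw_cong id_apply restrict_apply')

lemma mod_iso_sym:
  assumes "left_module R M" "left_module R N" "mod_iso R M N" shows "mod_iso R N M"
proof -
  obtain f where f: "f \<in> mod_hom R M N" "bij_betw f (carrier M) (carrier N)"
    using assms(3) by (auto simp: mod_iso_def)
  interpret module_hom R M N f using assms f by (simp add: module_hom_def module_hom_axioms_def)
  show ?thesis using inverse(1,4)[OF f(2)] unfolding mod_iso_def by blast
qed

lemma mod_iso_trans:
  assumes "left_module R M" "mod_iso R M N" "mod_iso R N P" shows "mod_iso R M P"
proof -
  obtain f g where f: "f \<in> mod_hom R M N" "bij_betw f (carrier M) (carrier N)"
    and g: "g \<in> mod_hom R N P" "bij_betw g (carrier N) (carrier P)"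
    using assms by (auto simp: mod_iso_def)
  have "bij_betw (compose (carrier M) g f) (carrier M) (carrier P)"
    using bij_betw_trans[OF f(2) g(2)] by (simp add: compose_def cong: bij_betw_cong)
  then show ?thesis using mod_hom_compose[OF assms(1) f(1) g(1)] by (auto simp: mod_iso_def)
qed

lemma fg_moduleD: "fg_module R M ==> left_module R M"
  by (simp add: fg_module_def)

lemma fg_module_image:
  assumes "fg_module R M" "left_module R N" "f \<in> mod_hom R M N" "f ` carrier M = carrier N"
  shows "fg_module R N"
proof -
  interpret module_hom R M N f
    using assms by (simp add: module_hom_def module_hom_axioms_def fg_module_def)
  obtain S where S: "finite S" "S \<subseteq> carrier M" "\<And>K. submodule K R M ==> S \<subseteq> K ==> K = carrier M"
    using assms(1) by (auto simp: fg_module_def)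
  have "K = carrier N" if K: "submodule K R N" "f ` S \<subseteq> K" for K
  proof -
    have "{x \<in> carrier M. f x \<in> K} = carrier M"
      using S(2) K by (intro S(3) submodule_preimage) auto
    then have "f ` carrier M \<subseteq> K" by blast
    then show ?thesis using assms(4) K(1) by (auto simp: N.submodule_iff)
  qed
  moreover have "finite (f ` S)" "f ` S \<subseteq> carrier N" using S closed by auto
  ultimately show ?thesis using assms(2) unfolding fg_module_def by blast
qed

lemma fg_module_iso:
  assumes "fg_module R M" "left_module R N" "mod_iso R M N" shows "fg_module R N"
  using assms fg_module_image by (fastforce simp: mod_iso_def bij_betw_def)

section \<open>Complementary submodules and isomorphism classes\<close>

lemma complementary_sym: "left_module R M ==> complementary R M N N' ==> complementary R M N' N"
proof -
  assume "left_module R M" and c: "complementary R M N N'"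
  then interpret left_module R M by simp
  have "N \<subseteq> carrier M" "N' \<subseteq> carrier M" using c by (auto simp: complementary_def submodule_iff)
  moreover have "A <+>\<^bsub>M\<^esub> B \<subseteq> B <+>\<^bsub>M\<^esub> A" if "A \<subseteq> carrier M" "B \<subseteq> carrier M" for A B
  proof
    fix x assume "x \<in> A <+>\<^bsub>M\<^esub> B"
    then obtain a b where "a \<in> A" "b \<in> B" "x = a \<oplus>\<^bsub>M\<^esub> b" by (auto simp: set_add_def')
    moreover from this that have "x = b \<oplus>\<^bsub>M\<^esub> a" by (auto simp: M.a_comm subset_iff)
    ultimately show "x \<in> B <+>\<^bsub>M\<^esub> A" unfolding set_add_def' by blast
  qed
  ultimately have "N' <+>\<^bsub>M\<^esub> N = N <+>\<^bsub>M\<^esub> N'" by blast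
  then show ?thesis using c by (auto simp: complementary_def)
qed

text \<open>\<open>left_module\<close> admits record extensions, while \<open>mod_hom\<close>,
  \<open>complementary\<close> and \<open>quot\<close> take plain records; this locale is
  \<open>left_module\<close> at that type.\<close>

locale plain_module = left_module R M
  for R :: "('a, 'r) ring_scheme" (structure) and M :: "('a, 'm) module" (structure)

lemma (in plain_module) complementary_decomp:
  assumes "complementary R M N N'" "x \<in> carrier M"
  obtains y z where "y \<in> N" "z \<in> N'" "x = y \<oplus>\<^bsub>M\<^esub> z"
proof -
  have "x \<in> N <+>\<^bsub>M\<^esub> N'" using assms by (simp add: complementary_def)
  then show thesis using that by (auto simp: set_add_def')
qed

lemma (in plain_module) complementary_unique:
  assumes c: "complementary R M N N'" and "y \<in> N" "y' \<in> N" "z \<in> N'" "z' \<in> N'"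
    "y \<oplus>\<^bsub>M\<^esub> z = y' \<oplus>\<^bsub>M\<^esub> z'"
  shows "y = y'" "z = z'"
proof -
  have sub: "submodule N R M" "submodule N' R M" and int: "N \<inter> N' = {\<zero>\<^bsub>M\<^esub>}"
    using c by (auto simp: complementary_def)
  then have car: "y \<in> carrier M" "y' \<in> carrier M" "z \<in> carrier M" "z' \<in> carrier M"
    using assms by (auto simp: submodule_iff)
  have "y \<ominus>\<^bsub>M\<^esub> y' = z' \<ominus>\<^bsub>M\<^esub> z"
    using car assms(6) unfolding a_minus_def
    by (smt (verit) M.add.inv_closed M.add.m_comm M.add.m_lcomm M.l_neg M.r_neg1 M.r_zero M.a_assoc M.a_closed)
  then have "y \<ominus>\<^bsub>M\<^esub> y' \<in> N \<inter> N'" using submodule_minus sub assms by (metis IntI)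
  then have "y \<ominus>\<^bsub>M\<^esub> y' = \<zero>\<^bsub>M\<^esub>" using int by blast
  then show "y = y'" using car by (simp add: minus_eq_zero_iff)
  then show "z = z'" using assms(6) car by simp
qed

text \<open>The projection onto \<open>N\<close> along \<open>N'\<close> is a surjective
  homomorphism, and finite generation passes to images. \<open>p\<close> picks the first term of the
  unique decomposition.\<close>

lemma (in plain_module) fg_summand:
  assumes fg: "fg_module R M" and c: "complementary R M N N'"
  shows "fg_module R (M\<lparr>carrier := N\<rparr>)"
proof -
  have sub: "submodule N R M" "submodule N' R M" using c by (auto simp: complementary_def)
  then have car: "N \<subseteq> carrier M" "N' \<subseteq> carrier M" by (auto simp: submodule_iff)
  have ex: "\<exists>!y. y \<in> N \<and> (\<exists>z\<in>N'. x = y \<oplus>\<^bsub>M\<^esub> z)" if "x \<in> carrier M" for x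
    using complementary_decomp[OF c that] complementary_unique[OF c] by metis
  define p where "p x = (THE y. y \<in> N \<and> (\<exists>z\<in>N'. x = y \<oplus>\<^bsub>M\<^esub> z))" for x
  have p: "p (y \<oplus>\<^bsub>M\<^esub> z) = y" if "y \<in> N" "z \<in> N'" for y z
    unfolding p_def using that complementary_unique[OF c]  by (intro the_equality) metis+
  have "restrict p (carrier M) \<in> mod_hom R M (M\<lparr>carrier := N\<rparr>)"
  proof (rule mod_hom_restrictI)
    show "p x \<in> carrier (M\<lparr>carrier := N\<rparr>)" if "x \<in> carrier M" for x
      using complementary_decomp[OF c that] p by (metis partial_object.select_convs(1) partial_object.surjective partial_object.update_convs(1))
    show "p (x \<oplus>\<^bsub>M\<^esub> y) = p x \<oplus>\<^bsub>M\<lparr>carrier := N\<rparr>\<^esub> p y" if xy: "x \<in> carrier M" "y \<in> carrier M" for x y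
    proof -
      obtain u v where u: "u \<in> N" "v \<in> N'" "x = u \<oplus>\<^bsub>M\<^esub> v" using complementary_decomp[OF c xy(1)] .
      obtain u' v' where u': "u' \<in> N" "v' \<in> N'" "y = u' \<oplus>\<^bsub>M\<^esub> v'" using complementary_decomp[OF c xy(2)] .
      have "x \<oplus>\<^bsub>M\<^esub> y = (u \<oplus>\<^bsub>M\<^esub> u') \<oplus>\<^bsub>M\<^esub> (v \<oplus>\<^bsub>M\<^esub> v')"
        using u u' car by (simp add: M.a_ac subset_iff)
      moreover have "u \<oplus>\<^bsub>M\<^esub> u' \<in> N" "v \<oplus>\<^bsub>M\<^esub> v' \<in> N'" using u u' sub by (auto simp: submodule_iff)
      ultimately show ?thesis using p u u' by simp
    qed
    show "p (a \<odot>\<^bsub>M\<^esub> x) = a \<odot>\<^bsub>M\<lparr>carrier := N\<rparr>\<^esub> p x" if ax: "a \<in> carrier R" "x \<in> carrier M" for a x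
    proof -
      obtain u v where u: "u \<in> N" "v \<in> N'" "x = u \<oplus>\<^bsub>M\<^esub> v" using complementary_decomp[OF c ax(2)] .
      have "a \<odot>\<^bsub>M\<^esub> x = a \<odot>\<^bsub>M\<^esub> u \<oplus>\<^bsub>M\<^esub> a \<odot>\<^bsub>M\<^esub> v"
        using u car ax by (simp add: smult_r_distr subset_iff)
      moreover have "a \<odot>\<^bsub>M\<^esub> u \<in> N" "a \<odot>\<^bsub>M\<^esub> v \<in> N'" using u ax sub by (auto simp: submodule_iff)
      ultimately show ?thesis using p u by simp
    qed
  qed (auto simp: smult_closed)
  moreover have "restrict p (carrier M) ` carrier M = carrier (M\<lparr>carrier := N\<rparr>)"
  proof -
    have "p x \<in> N" if "x \<in> carrier M" for x using complementary_decomp[OF c that] p by metis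
    moreover have "p y = y" if "y \<in> N" for y
      using p[of y "\<zero>\<^bsub>M\<^esub>"] that sub car by (auto simp: submodule_iff)
    ultimately have "p ` carrier M = N" using car
      by (intro equalityI subsetI) (blast, metis imageI subsetD)
    then show ?thesis by simp
  qed
  ultimately show ?thesis
    using fg_module_image[OF fg left_module_restrict[OF sub(1)]] by blast
qed

text \<open>Used with a complete invariant \<open>cl\<close>: isomorphism classes are then counted
  by the values that it takes.\<close>

lemma card_iso_classes:
  assumes "\<And>M N. M \<in> C ==> N \<in> C ==> mod_iso R M N \<longleftrightarrow> cl M = cl N"
  shows "card (iso_classes R C) = card (cl ` C)"
proof -
  have cls: "{(M, N). M \<in> C \<and> N \<in> C \<and> mod_iso R M N} `` {M} = {N \<in> C. cl M = cl N}"
    if "M \<in> C" for M using assms that by auto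
  have "iso_classes R C = (\<lambda>m. {N \<in> C. m = cl N}) ` cl ` C"
    unfolding iso_classes_def quotient_def image_image using cls by auto
  moreover have "inj_on (\<lambda>m. {N \<in> C. m = cl N}) (cl ` C)"
    by (rule inj_onI) blast
  ultimately show ?thesis by (simp add: card_image)
qed

section \<open>Radical square zero algebras of quivers\<close>

text \<open>The coordinate at the vertex \<open>v\<close> of the summand \<open>j\<close>, coded as
  one number so that all model modules live in the type \<open>fmod\<close>.\<close>

abbreviation pe :: "nat => nat => nat" where "pe j v \<equiv> prod_encode (j, v)"

lemma pe_ext: "(\<And>j v. f (pe j v) = g (pe j v)) ==> f = g"
  by (rule ext) (metis prod_decode_inverse surj_pair)

type_synonym shape = "nat => nat \<times> nat set"

text \<open>By \<open>arc_less\<close> no arrow of a full subquiver enters its largest vertex, which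
  drives the recursion. By \<open>indeg\<close> the radical of a module at a vertex is the image of
  a single arrow. By \<open>outdeg\<close> at most two kernels have to be decomposed
  simultaneously.\<close>

locale quiver =
  fixes V :: "nat set" and E :: "(nat \<times> nat) set"
  assumes finV: "finite V" and arcs: "E \<subseteq> V \<times> V"
    and arc_less: "(x, y) \<in> E ==> y < x"
    and indeg: "(x, y) \<in> E ==> (x', y) \<in> E ==> x = x'"
    and outdeg: "card (E `` {x}) \<le> 2"
begin

lemma arcD: "(x, y) \<in> E ==> x \<in> V \<and> y \<in> V \<and> x \<noteq> y \<and> y \<noteq> x"
  using arcs arc_less by fastforce

lemma no_loop [simp]: "(x, x) \<notin> E"
  using arc_less by blast

lemma finite_out: "finite (E `` {x})"
  by (rule finite_subset[OF _ finV]) (use arcs in auto)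

definition valid :: "nat set => shape => bool" where
  "valid J t \<longleftrightarrow> finite J \<and> (\<forall>j\<in>J. fst (t j) \<in> V \<and> snd (t j) \<subseteq> E `` {fst (t j)})"

lemma valid_subset: "valid J t ==> J' \<subseteq> J ==> valid J' t"
  by (auto simp: valid_def intro: finite_subset)

lemma valid_neq: "valid J t ==> j \<in> J ==> fst (t j) \<notin> snd (t j)"
  using arcD unfolding valid_def by blast

end

text \<open>
  \<open>cf a (x, x)\<close> is the coefficient of \<open>a\<close> at the trivial path of \<open>x\<close>, and \<open>cf a (x, y)\<close> the one at
  the arrow \<open>x \<rightarrow> y\<close>.
\<close>

locale radsq = quiver V E + R: ring L
  for V E and L :: "('k::field, 'a) module" (structure) +
  fixes cf :: "'a => nat \<times> nat => 'k"
  assumes cf_bij: "bij_betw cf (carrier L) {f. \<forall>x y. f (x, y) \<noteq> 0 \<longrightarrow> (x, y) \<in> E \<or> x = y \<and> x \<in> V}"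
    and cf_add: "[|a \<in> carrier L; b \<in> carrier L|] ==> cf (a \<oplus> b) w = cf a w + cf b w"
    and cf_mult: "[|a \<in> carrier L; b \<in> carrier L|] ==> cf (a \<otimes> b) (x, y) =
      (if x = y then cf a (x, x) * cf b (x, x)
       else cf a (y, y) * cf b (x, y) + cf a (x, y) * cf b (x, x))"
    and cf_one: "cf \<one> (x, y) = (if x = y \<and> x \<in> V then 1 else 0)"
    and alg_closed: "a \<in> carrier L ==> c \<odot> a \<in> carrier L"
    and cf_smult: "a \<in> carrier L ==> cf (c \<odot> a) w = c * cf a w"
begin

lemma cf_eqI: "[|a \<in> carrier L; b \<in> carrier L; \<And>x y. cf a (x, y) = cf b (x, y)|] ==> a = b"
  by (rule inj_onD[OF bij_betw_imp_inj_on[OF cf_bij]]) auto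

lemma cf_nonzero: "[|a \<in> carrier L; cf a (x, y) \<noteq> 0|] ==> (x, y) \<in> E \<or> x = y \<and> x \<in> V"
  using bij_betwE[OF cf_bij] by auto

lemma cf_zero: "cf \<zero> w = 0"
  using cf_add[of \<zero> \<zero> w] by (metis R.r_zero R.zero_closed add_cancel_left_right)

definition el :: "(nat \<times> nat => 'k) => 'a" where "el = inv_into (carrier L) cf"

lemma el:
  assumes "\<And>x y. f (x, y) \<noteq> 0 ==> (x, y) \<in> E \<or> x = y \<and> x \<in> V"
  shows "el f \<in> carrier L" "cf (el f) = f"
proof -
  have "f \<in> cf ` carrier L" using assms cf_bij by (auto simp: bij_betw_def)
  then show "el f \<in> carrier L" "cf (el f) = f"
    unfolding el_def by (auto intro: inv_into_into f_inv_into_f)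
qed

definition idem :: "nat => 'a" where "idem x = el (\<lambda>w. if w = (x, x) \<and> x \<in> V then 1 else 0)"
definition arr :: "nat => nat => 'a" where "arr x y = el (\<lambda>w. if w = (x, y) \<and> w \<in> E then 1 else 0)"
definition sc :: "'k => 'a" where "sc c = c \<odot> \<one>"

lemma idem [simp]: "idem x \<in> carrier L" and cf_idem: "cf (idem x) w = (if w = (x, x) \<and> x \<in> V then 1 else 0)"
  unfolding idem_def by (subst el | auto split: if_splits)+

lemma arr [simp]: "arr x y \<in> carrier L" and cf_arr: "cf (arr x y) w = (if w = (x, y) \<and> w \<in> E then 1 else 0)"
  unfolding arr_def by (subst el | auto split: if_splits)+

lemma sc [simp]: "sc c \<in> carrier L" and cf_sc: "cf (sc c) (x, y) = (if x = y \<and> x \<in> V then c else 0)"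
  by (auto simp: sc_def alg_closed cf_smult cf_one)

lemmas cf_simps = cf_add cf_mult cf_one cf_smult cf_zero cf_idem cf_arr cf_sc

lemma cf_finsum: "[|finite A; h \<in> A \<rightarrow> carrier L|] ==> cf (finsum L h A) w = (\<Sum>i\<in>A. cf (h i) w)"
proof (induction A rule: finite_induct)
  case empty then show ?case by (simp add: cf_zero)
next
  case (insert i A)
  then have "h \<in> A \<rightarrow> carrier L" "h i \<in> carrier L" by auto
  then show ?case using insert by (simp add: cf_add)
qed

lemma idem_sum: "finsum L idem V = \<one>"
proof (rule cf_eqI)
  fix x y
  have "cf (idem i) (x, y) = (if i = x then (if x = y \<and> x \<in> V then 1 else 0) else 0)" if "i \<in> V" for i
    using that by (auto simp: cf_idem)
  then show "cf (finsum L idem V) (x, y) = cf \<one> (x, y)" using finV by (auto simp: cf_finsum cf_one)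
qed auto

lemma mult_idem_idem: "idem x \<otimes> idem y = (if x = y then idem x else \<zero>)"
  by (rule cf_eqI) (auto simp: cf_simps)

lemma mult_arr_idem: "arr x y \<otimes> idem z = (if x = z then arr x y else \<zero>)"
  by (rule cf_eqI; use arcD[of x y] in \<open>auto simp: cf_simps\<close>)

lemma mult_idem_arr: "idem z \<otimes> arr x y = (if y = z then arr x y else \<zero>)"
  by (rule cf_eqI; use arcD[of x y] in \<open>auto simp: cf_simps\<close>)

lemma mult_arr_arr: "arr x y \<otimes> arr x' y' = \<zero>"
  by (rule cf_eqI) (auto simp: cf_simps)

lemma arr_zero: "(x, y) \<notin> E ==> arr x y = \<zero>"
  by (rule cf_eqI) (auto simp: cf_simps)

text \<open>Where \<open>a\<close> has a nonzero coefficient, both ends are vertices, and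
  \<open>sc c\<close> has the diagonal value \<open>c\<close> at both.\<close>

lemma sc_commute: "a \<in> carrier L ==> sc c \<otimes> a = a \<otimes> sc c"
proof (rule cf_eqI)
  fix x y assume a: "a \<in> carrier L"
  show "cf (sc c \<otimes> a) (x, y) = cf (a \<otimes> sc c) (x, y)"
    using a cf_nonzero[OF a, of x y] arcD[of x y] by (cases "cf a (x, y) = 0") (auto simp: cf_simps)
qed auto

lemma sc_add: "sc (c + d) = sc c \<oplus> sc d"
  by (rule cf_eqI) (auto simp: cf_simps)

lemma sc_one: "sc 1 = \<one>"
  by (rule cf_eqI) (auto simp: cf_simps)

lemma sc_zero: "sc 0 = \<zero>"
  by (rule cf_eqI) (auto simp: cf_simps)

definition idx :: "nat set => shape => nat set" where
  "idx J t = {pe j v |j v. j \<in> J \<and> (v = fst (t j) \<or> v \<in> snd (t j))}"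

text \<open>
  The direct sum over \<open>j \<in> J\<close> of the modules given by the pairs \<open>t j = (x, A)\<close>; the coordinate
  \<open>pe j v\<close> of an element is the component of its \<open>j\<close>-th summand at the vertex \<open>v\<close>.
\<close>

definition Md :: "nat set => shape => ('k, 'a) fmod" where
  "Md J t = \<lparr>carrier = {f. \<forall>i. i \<notin> idx J t \<longrightarrow> f i = 0}, mult = undefined, one = undefined,
     zero = (\<lambda>i. 0), add = (\<lambda>f g i. f i + g i),
     smult = (\<lambda>a f i. case prod_decode i of (j, v) =>
       if v = fst (t j) then cf a (v, v) * f i
       else if v \<in> snd (t j) then cf a (v, v) * f i + cf a (fst (t j), v) * f (pe j (fst (t j)))
       else 0)\<rparr>"

lemma Md_carrier: "f \<in> carrier (Md J t) \<longleftrightarrow> (\<forall>j v. f (pe j v) \<noteq> 0 \<longrightarrow> j \<in> J \<and> (v = fst (t j) \<or> v \<in> snd (t j)))"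
proof
  assume "f \<in> carrier (Md J t)"
  then show "\<forall>j v. f (pe j v) \<noteq> 0 \<longrightarrow> j \<in> J \<and> (v = fst (t j) \<or> v \<in> snd (t j))"
    by (force simp: Md_def idx_def)
next
  assume *: "\<forall>j v. f (pe j v) \<noteq> 0 \<longrightarrow> j \<in> J \<and> (v = fst (t j) \<or> v \<in> snd (t j))"
  have "f i = 0" if "i \<notin> idx J t" for i
    using that * by (cases "prod_decode i") (metis (mono_tags, lifting) idx_def mem_Collect_eq prod_decode_inverse)
  then show "f \<in> carrier (Md J t)" by (simp add: Md_def)
qed

lemma Md_zero: "\<zero>\<^bsub>Md J t\<^esub> = (\<lambda>i. 0)"
  and Md_add: "f \<oplus>\<^bsub>Md J t\<^esub> g = (\<lambda>i. f i + g i)"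
  and Md_smult: "(a \<odot>\<^bsub>Md J t\<^esub> f) (pe j v) = (if v = fst (t j) then cf a (v, v) * f (pe j v)
    else if v \<in> snd (t j) then cf a (v, v) * f (pe j v) + cf a (fst (t j), v) * f (pe j (fst (t j)))
    else 0)"
  by (auto simp: Md_def)

lemma Md_carrier_update: "(Md J t)\<lparr>carrier := carrier (Md J' t)\<rparr> = Md J' t"
  by (simp add: Md_def)

text \<open>Associativity holds because the product of the algebra combines an arrow only with
  trivial paths, just as the action on the coordinates does.\<close>

lemma left_module_Md:
  assumes "valid J t" shows "left_module L (Md J t)"
proof -
  have ab: "abelian_group (Md J t)"
  proof (rule abelian_groupI)
    show "\<exists>y\<in>carrier (Md J t). y \<oplus>\<^bsub>Md J t\<^esub> f = \<zero>\<^bsub>Md J t\<^esub>" if "f \<in> carrier (Md J t)" for f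
      using that by (intro bexI[of _ "\<lambda>i. - f i"]) (auto simp: Md_carrier Md_add Md_zero)
  next
    show "f \<oplus>\<^bsub>Md J t\<^esub> g \<in> carrier (Md J t)" if "f \<in> carrier (Md J t)" "g \<in> carrier (Md J t)" for f g
      using that unfolding Md_carrier Md_add by (metis add.right_neutral)
  qed (auto simp: Md_carrier Md_add Md_zero add.assoc add.commute)
  show ?thesis
  proof (intro left_module.intro left_module_axioms.intro R.ring_axioms ab)
    show "a \<odot>\<^bsub>Md J t\<^esub> f \<in> carrier (Md J t)" if "a \<in> carrier L" "f \<in> carrier (Md J t)" for a f
      unfolding Md_carrier
    proof (intro allI impI)
      fix j v assume "(a \<odot>\<^bsub>Md J t\<^esub> f) (pe j v) \<noteq> 0"
      then have "(v = fst (t j) \<or> v \<in> snd (t j)) \<and> (f (pe j v) \<noteq> 0 \<or> f (pe j (fst (t j))) \<noteq> 0)"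
        by (auto simp: Md_smult split: if_splits)
      then show "j \<in> J \<and> (v = fst (t j) \<or> v \<in> snd (t j))" using that(2) unfolding Md_carrier by blast
    qed
    show "(a \<oplus> b) \<odot>\<^bsub>Md J t\<^esub> f = a \<odot>\<^bsub>Md J t\<^esub> f \<oplus>\<^bsub>Md J t\<^esub> b \<odot>\<^bsub>Md J t\<^esub> f"
      if "a \<in> carrier L" "b \<in> carrier L" "f \<in> carrier (Md J t)" for a b f
      using that by (intro pe_ext) (simp add: Md_add Md_smult cf_add algebra_simps)
    show "a \<odot>\<^bsub>Md J t\<^esub> (f \<oplus>\<^bsub>Md J t\<^esub> g) = a \<odot>\<^bsub>Md J t\<^esub> f \<oplus>\<^bsub>Md J t\<^esub> a \<odot>\<^bsub>Md J t\<^esub> g"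
      if "a \<in> carrier L" "f \<in> carrier (Md J t)" "g \<in> carrier (Md J t)" for a f g
      using that by (intro pe_ext) (simp add: Md_add Md_smult algebra_simps)
    show "(a \<otimes> b) \<odot>\<^bsub>Md J t\<^esub> f = a \<odot>\<^bsub>Md J t\<^esub> (b \<odot>\<^bsub>Md J t\<^esub> f)"
      if "a \<in> carrier L" "b \<in> carrier L" "f \<in> carrier (Md J t)" for a b f
      using that by (intro pe_ext) (auto simp: Md_smult cf_mult algebra_simps)
    show "\<one> \<odot>\<^bsub>Md J t\<^esub> f = f" if f: "f \<in> carrier (Md J t)" for f
    proof (rule pe_ext)
      fix j v
      show "(\<one> \<odot>\<^bsub>Md J t\<^esub> f) (pe j v) = f (pe j v)"
      proof (cases "f (pe j v) = 0 \<and> f (pe j (fst (t j))) = 0")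
        case False
        then have "j \<in> J" using f unfolding Md_carrier by blast
        then have "fst (t j) \<in> V" "snd (t j) \<subseteq> V" using assms arcD unfolding valid_def by blast+
        then show ?thesis using f[unfolded Md_carrier] by (auto simp: Md_smult cf_one)
      qed (auto simp: Md_smult)
    qed
  qed
qed

lemma finsum_Md:
  assumes "valid J t" "finite A" "h \<in> A \<rightarrow> carrier (Md J t)"
  shows "finsum (Md J t) h A i = (\<Sum>a\<in>A. h a i)"
  using assms(2,3)
proof (induction A rule: finite_induct)
  interpret left_module L "Md J t" by (rule left_module_Md[OF assms(1)])
  case empty then show ?case by (simp add: Md_zero)
next
  interpret left_module L "Md J t" by (rule left_module_Md[OF assms(1)])
  case (insert a A)
  then have "h \<in> A \<rightarrow> carrier (Md J t)" "h a \<in> carrier (Md J t)" by auto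
  then show ?case using insert by (simp add: Md_add)
qed

definition gen :: "shape => nat => nat => 'k" where
  "gen t j = (\<lambda>i. if i = pe j (fst (t j)) then 1 else 0)"

text \<open>The component of \<open>f\<close> in the summand \<open>j\<close>, turned into an
  element of the algebra: applied to \<open>gen t j\<close> it gives the component back, see
  \<open>Md_expand\<close>.\<close>

definition lam :: "shape => (nat => 'k) => nat => 'a" where
  "lam t f j = el (\<lambda>(x, y). if x = fst (t j) \<and> (y = x \<or> y \<in> snd (t j)) then f (pe j y) else 0)"

lemma gen_carrier: "j \<in> J ==> gen t j \<in> carrier (Md J t)"
  by (auto simp: Md_carrier gen_def)

lemma lam:
  assumes "valid J t" "j \<in> J"
  shows "lam t f j \<in> carrier L"
    "cf (lam t f j) (x, y) = (if x = fst (t j) \<and> (y = x \<or> y \<in> snd (t j)) then f (pe j y) else 0)"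
  unfolding lam_def
  by (subst el; use assms in \<open>force simp: valid_def split: if_splits\<close>)+

lemma Md_expand:
  assumes v: "valid J t" and f: "f \<in> carrier (Md J t)"
  shows "f = finsum (Md J t) (\<lambda>j. lam t f j \<odot>\<^bsub>Md J t\<^esub> gen t j) J"
proof (rule pe_ext)
  interpret left_module L "Md J t" by (rule left_module_Md[OF v])
  fix j v
  have fin: "finite J" using v by (simp add: valid_def)
  have car: "(\<lambda>j. lam t f j \<odot>\<^bsub>Md J t\<^esub> gen t j) \<in> J \<rightarrow> carrier (Md J t)"
    by (auto intro!: smult_closed gen_carrier lam[OF v])
  have "(lam t f j' \<odot>\<^bsub>Md J t\<^esub> gen t j') (pe j v) = (if j' = j then f (pe j v) else 0)" if "j' \<in> J" for j'
    using that f valid_neq[OF v that] lam(2)[OF v that]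
    by (auto simp: Md_smult gen_def Md_carrier)
  then have "(\<Sum>j'\<in>J. (lam t f j' \<odot>\<^bsub>Md J t\<^esub> gen t j') (pe j v)) = (\<Sum>j'\<in>J. if j' = j then f (pe j v) else 0)"
    by simp
  also have "\<dots> = f (pe j v)" using fin f by (auto simp: Md_carrier)
  finally show "f (pe j v) = finsum (Md J t) (\<lambda>j. lam t f j \<odot>\<^bsub>Md J t\<^esub> gen t j) J (pe j v)"
    using finsum_Md[OF v fin car] by simp
qed

lemma Md_generated:
  assumes v: "valid J t" and K: "submodule K L (Md J t)" "\<And>j. j \<in> J ==> gen t j \<in> K"
  shows "K = carrier (Md J t)"
proof -
  interpret left_module L "Md J t" by (rule left_module_Md[OF v])
  have fin: "finite J" using v by (simp add: valid_def)
  have "f \<in> K" if f: "f \<in> carrier (Md J t)" for f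
    using submodule_finsum[OF K(1) fin, of "\<lambda>j. lam t f j \<odot>\<^bsub>Md J t\<^esub> gen t j"] K lam[OF v]
    by (subst Md_expand[OF v f]) (auto simp: submodule_iff)
  then show ?thesis using K by (auto simp: submodule_iff)
qed

lemma fg_Md: "valid J t ==> fg_module L (Md J t)"
  unfolding fg_module_def
  by (intro conjI exI[of _ "gen t ` J"])
    (use left_module_Md Md_generated gen_carrier in \<open>auto simp: image_subset_iff valid_def\<close>)

text \<open>Such a \<open>b\<close> is a linear combination of arrows from \<open>x\<close>, each of
  which either kills \<open>g\<close> or has coefficient zero.\<close>

lemma arr_annihilates:
  assumes "left_module L M" "g \<in> carrier M" "b \<in> carrier L"
    and "\<And>u v. cf b (u, v) \<noteq> 0 ==> u = x \<and> (u, v) \<in> E \<and> arr x v \<odot>\<^bsub>M\<^esub> g = \<zero>\<^bsub>M\<^esub>"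
  shows "b \<odot>\<^bsub>M\<^esub> g = \<zero>\<^bsub>M\<^esub>"
proof -
  interpret left_module L M by fact
  let ?h = "\<lambda>y. sc (cf b (x, y)) \<otimes> arr x y"
  have "b = finsum L ?h (E `` {x})"
  proof (rule cf_eqI)
    fix u v
    have "cf (?h y) (u, v) = (if y = v then cf b (u, v) else 0)" if "y \<in> E `` {x}" for y
    proof -
      have "(x, y) \<in> E" "x \<noteq> y" "y \<in> V" using that arcD by blast+
      then show ?thesis using assms(4)[of u v] by (auto simp: cf_simps)
    qed
    then show "cf b (u, v) = cf (finsum L ?h (E `` {x})) (u, v)"
      using finite_out[of x] assms(4)[of u v] by (cases "cf b (u, v) = 0") (auto simp add: cf_finsum)
  qed (use assms in auto)
  then have "b \<odot>\<^bsub>M\<^esub> g = finsum M (\<lambda>y. ?h y \<odot>\<^bsub>M\<^esub> g) (E `` {x})"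
    using finite_out assms(2) finsum_smult[of "E `` {x}" ?h g] by simp
  also have "\<dots> = finsum M (\<lambda>y. \<zero>\<^bsub>M\<^esub>) (E `` {x})"
  proof (rule M.finsum_cong')
    show "?h y \<odot>\<^bsub>M\<^esub> g = \<zero>\<^bsub>M\<^esub>" if "y \<in> E `` {x}" for y
    proof (cases "cf b (x, y) = 0")
      case True then show ?thesis using assms(2) by (simp add: sc_zero smult_zero_left)
    next
      case False then show ?thesis using assms(4)[OF False] assms(2) by (simp add: smult_assoc smult_zero_right)
    qed
  qed auto
  finally show ?thesis by simp
qed

section \<open>Homomorphisms out of the model modules\<close>

definition hext :: "('a, 'm) module => nat set => shape => (nat => 'm) => (nat => 'k) => 'm" where
  "hext M J t g = (\<lambda>f\<in>carrier (Md J t). finsum M (\<lambda>j. lam t f j \<odot>\<^bsub>M\<^esub> g j) J)"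

text \<open>\<open>Md J t\<close> is presented by the generators \<open>gen t j\<close>, lying over
  their vertices, with the missed arrows as relations. \<open>hext\<close> is the universal property
  of this presentation.\<close>

definition relations :: "('a, 'm) module => nat set => shape => (nat => 'm) => bool" where
  "relations M J t g \<longleftrightarrow> (\<forall>j\<in>J. g j \<in> carrier M \<and> idem (fst (t j)) \<odot>\<^bsub>M\<^esub> g j = g j \<and>
     (\<forall>y\<in>E `` {fst (t j)} - snd (t j). arr (fst (t j)) y \<odot>\<^bsub>M\<^esub> g j = \<zero>\<^bsub>M\<^esub>))"

lemma hext:
  fixes M :: "('a, 'm) module"
  assumes M: "left_module L M" and v: "valid J t" and g: "relations M J t g"
  shows "hext M J t g \<in> mod_hom L (Md J t) M" "\<And>j. j \<in> J ==> hext M J t g (gen t j) = g j"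
proof -
  interpret left_module L M by fact
  interpret S: left_module L "Md J t" by (rule left_module_Md[OF v])
  have fin: "finite J" using v by (simp add: valid_def)
  note lm = lam[OF v]
  have gc: "g j \<in> carrier M" if "j \<in> J" for j using g that by (simp add: relations_def)
  show "hext M J t g \<in> mod_hom L (Md J t) M" unfolding hext_def
  proof (rule mod_hom_restrictI)
    show "(\<Oplus>\<^bsub>M\<^esub>j\<in>J. lam t f j \<odot>\<^bsub>M\<^esub> g j) \<in> carrier M" for f
      using gc lm by (auto intro!: M.finsum_closed smult_closed)
    show "(\<Oplus>\<^bsub>M\<^esub>j\<in>J. lam t (f \<oplus>\<^bsub>Md J t\<^esub> h) j \<odot>\<^bsub>M\<^esub> g j) =
      (\<Oplus>\<^bsub>M\<^esub>j\<in>J. lam t f j \<odot>\<^bsub>M\<^esub> g j) \<oplus>\<^bsub>M\<^esub> (\<Oplus>\<^bsub>M\<^esub>j\<in>J. lam t h j \<odot>\<^bsub>M\<^esub> g j)" for f h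
    proof -
      have "lam t (f \<oplus>\<^bsub>Md J t\<^esub> h) j = lam t f j \<oplus> lam t h j" if "j \<in> J" for j
        using that by (intro cf_eqI) (auto simp: lm cf_add Md_add)
      then have "(\<Oplus>\<^bsub>M\<^esub>j\<in>J. lam t (f \<oplus>\<^bsub>Md J t\<^esub> h) j \<odot>\<^bsub>M\<^esub> g j) =
        (\<Oplus>\<^bsub>M\<^esub>j\<in>J. lam t f j \<odot>\<^bsub>M\<^esub> g j \<oplus>\<^bsub>M\<^esub> lam t h j \<odot>\<^bsub>M\<^esub> g j)"
        using gc lm by (intro M.finsum_cong') (auto simp: smult_closed smult_l_distr)
      then show ?thesis using gc lm by (simp add: M.finsum_addf smult_closed Pi_def)
    qed
    show "(\<Oplus>\<^bsub>M\<^esub>j\<in>J. lam t (a \<odot>\<^bsub>Md J t\<^esub> f) j \<odot>\<^bsub>M\<^esub> g j) = a \<odot>\<^bsub>M\<^esub> (\<Oplus>\<^bsub>M\<^esub>j\<in>J. lam t f j \<odot>\<^bsub>M\<^esub> g j)"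
      if a: "a \<in> carrier L" and f: "f \<in> carrier (Md J t)" for a f
    proof -
      have "lam t (a \<odot>\<^bsub>Md J t\<^esub> f) j \<odot>\<^bsub>M\<^esub> g j = (a \<otimes> lam t f j) \<odot>\<^bsub>M\<^esub> g j" if j: "j \<in> J" for j
      proof -
        \<comment> \<open>The product \<open>a \<otimes> lam t f j\<close> may have coefficients on
          missed arrows, which \<open>lam\<close> of the product in the module lacks.
          \<open>?d\<close> is this surplus, and the missed arrows kill \<open>g j\<close>.\<close>
        let ?d = "a \<otimes> lam t f j \<oplus> sc (-1) \<otimes> lam t (a \<odot>\<^bsub>Md J t\<^esub> f) j"
        have dc: "?d \<in> carrier L" using a lm[OF j] by simp
        have xA: "fst (t j) \<notin> snd (t j)" "snd (t j) \<subseteq> E `` {fst (t j)}" "fst (t j) \<in> V"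
          using valid_neq[OF v j] v j by (auto simp: valid_def)
        have vV: "w \<in> V" if "w \<in> snd (t j)" for w using that xA arcD by blast
        have "?d \<odot>\<^bsub>M\<^esub> g j = \<zero>\<^bsub>M\<^esub>"
        proof (rule arr_annihilates[OF M gc[OF j] dc])
          fix u w assume nz: "cf ?d (u, w) \<noteq> 0"
          have "u = fst (t j) \<and> w \<in> E `` {fst (t j)} - snd (t j)"
          proof (cases "u = fst (t j)")
            case False
            then show ?thesis using nz a lm[OF j] by (auto simp: cf_simps split: if_splits)
          next
            case True
            then show ?thesis
              using nz a lm[OF j] xA vV cf_nonzero[OF dc nz]
              by (auto simp: cf_simps Md_smult split: if_splits)
          qed
          then show "u = fst (t j) \<and> (u, w) \<in> E \<and> arr (fst (t j)) w \<odot>\<^bsub>M\<^esub> g j = \<zero>\<^bsub>M\<^esub>"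
            using g j by (auto simp: relations_def)
        qed
        then have "(a \<otimes> lam t f j) \<odot>\<^bsub>M\<^esub> g j \<oplus>\<^bsub>M\<^esub> (sc (-1) \<otimes> lam t (a \<odot>\<^bsub>Md J t\<^esub> f) j) \<odot>\<^bsub>M\<^esub> g j = \<zero>\<^bsub>M\<^esub>"
          using gc[OF j] a lm[OF j] by (simp add: smult_l_distr)
        moreover have "sc (-1) = \<ominus> \<one>"
          by (rule R.minus_equality[symmetric]) (auto simp: sc_one[symmetric] sc_add[symmetric] sc_zero)
        ultimately have "(a \<otimes> lam t f j) \<odot>\<^bsub>M\<^esub> g j \<ominus>\<^bsub>M\<^esub> lam t (a \<odot>\<^bsub>Md J t\<^esub> f) j \<odot>\<^bsub>M\<^esub> g j = \<zero>\<^bsub>M\<^esub>"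
          using gc[OF j] a lm(1)[OF j]
          by (simp add: smult_assoc[of "\<ominus> \<one>"] smult_closed smult_minus_one a_minus_def)
        then show ?thesis using gc[OF j] a lm(1)[OF j]
          by (simp add: minus_eq_zero_iff smult_closed)
      qed
      then show ?thesis using a gc lm fin
        by (subst smult_finsum) (auto intro!: M.finsum_cong' smult_closed simp: smult_assoc)
    qed
  qed (auto simp: S.smult_closed)
  show "hext M J t g (gen t j) = g j" if j: "j \<in> J" for j
  proof -
    have 1: "lam t (gen t j) j' = (if j' = j then idem (fst (t j)) else \<zero>)" if "j' \<in> J" for j'
    proof (rule cf_eqI)
      fix x y
      have "fst (t j) \<in> V" using v j by (simp add: valid_def)
      then show "cf (lam t (gen t j) j') (x, y) = cf (if j' = j then idem (fst (t j)) else \<zero>) (x, y)"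
        using valid_neq[OF v j] by (cases "j' = j") (auto simp: lm(2)[OF that] lm(2)[OF j] cf_zero cf_idem gen_def)
    qed (use lm that in auto)
    have "hext M J t g (gen t j) = (\<Oplus>\<^bsub>M\<^esub>j'\<in>J. if j = j' then g j' else \<zero>\<^bsub>M\<^esub>)"
      unfolding hext_def using j g gc gen_carrier[OF j] 1
      by (auto intro!: M.finsum_cong' simp: relations_def smult_zero_left smult_closed)
    then show ?thesis using M.finsum_singleton[OF j fin, of g] gc by auto
  qed
qed

lemma Md_hom_eqI:
  assumes "left_module L M" "valid J t" "f \<in> mod_hom L (Md J t) M" "g \<in> mod_hom L (Md J t) M"
    and "\<And>j. j \<in> J ==> f (gen t j) = g (gen t j)"
  shows "f = g"
proof -
  interpret module_hom L "Md J t" M f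
    using assms left_module_Md by (simp add: module_hom_def module_hom_axioms_def)
  show ?thesis
    by (rule eq_on_generators[OF assms(4), of "gen t ` J"])
      (use Md_generated[OF assms(2)] gen_carrier assms(5) in \<open>auto simp: image_subset_iff\<close>)
qed

end

section \<open>Classification of the finitely generated modules\<close>

context vector_space
begin

text \<open>Subtracting an expression of the same vector over \<open>C\<close> gives a linear
  relation on \<open>B\<close>.\<close>

lemma independent_coeffs:
  assumes "independent B" "finite B" "C \<subseteq> B" "(\<Sum>b\<in>B. c b *s b) \<in> span C" "b \<in> B - C"
  shows "c b = 0"
proof -
  have fC: "finite C" using assms finite_subset by blast
  obtain d where d: "(\<Sum>b\<in>B. c b *s b) = (\<Sum>b\<in>C. d b *s b)"
    using assms(4) unfolding span_finite[OF fC] by blast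
  have "(\<Sum>b\<in>C. d b *s b) = (\<Sum>b\<in>B. (if b \<in> C then d b else 0) *s b)"
    using assms(2,3) by (intro sum.mono_neutral_cong_left) auto
  with d have "(\<Sum>b\<in>B. (c b - (if b \<in> C then d b else 0)) *s b) = 0"
    by (simp add: scale_left_diff_distrib sum_subtractf)
  then show ?thesis using independentD[OF assms(1,2) order_refl] assms(5) by force
qed

text \<open>Two subspaces have a common adapted basis: a basis of the intersection extends to each
  of them, and the union of the two extensions is still independent. Starting from a basis of
  \<open>R\<close> and dropping it at the end leaves a basis \<open>T\<close> of \<open>W\<close>
  modulo \<open>R\<close> for which membership in \<open>K1\<close> or \<open>K2\<close> is decided
  coefficient by coefficient. Three lines in a plane show that three subspaces need not have such a
  basis; hence the bound two on the arrows from a vertex.\<close>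

lemma adapted_complement:
  assumes sub: "subspace R" "subspace K1" "subspace K2" "subspace W"
    and incl: "R \<subseteq> K1" "R \<subseteq> K2" "K1 \<subseteq> W" "K2 \<subseteq> W" and F: "finite F" "W \<subseteq> span F"
  obtains T where "finite T" "T \<subseteq> W" "\<And>w. w \<in> W ==> \<exists>c. w - (\<Sum>t\<in>T. c t *s t) \<in> R"
    "\<And>c t. (\<Sum>t\<in>T. c t *s t) \<in> R ==> t \<in> T ==> c t = 0"
    "\<And>c t K. K = K1 \<or> K = K2 ==> (\<Sum>t\<in>T. c t *s t) \<in> K ==> t \<in> T ==> c t = 0 \<or> t \<in> K"
proof -
  have fin: "finite B" if "independent B" "B \<subseteq> W" for B
    using independent_span_bound[OF F(1) that(1) order_trans[OF that(2) F(2)]] by simp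
  have ext: "\<exists>B. A \<subseteq> B \<and> B \<subseteq> S \<and> independent B \<and> span B = S \<and> finite B"
    if A: "A \<subseteq> S" "independent A" and S: "subspace S" "S \<subseteq> W" for A S
  proof -
    obtain B where "A \<subseteq> B" "B \<subseteq> S" "independent B" "S \<subseteq> span B"
      using maximal_independent_subset_extend[OF A] by blast
    moreover from this have "span B = S" using span_minimal S by blast
    ultimately show ?thesis using fin[of B] S(2) by (intro exI[of _ B]) auto
  qed
  obtain BR where BR: "BR \<subseteq> R" "independent BR" "span BR = R" "finite BR"
    using ext[of "{}" R] sub incl independent_empty by auto
  have sub12: "subspace (K1 \<inter> K2)" using sub by (simp add: subspace_inter)
  obtain B12 where B12: "BR \<subseteq> B12" "B12 \<subseteq> K1 \<inter> K2" "independent B12" "span B12 = K1 \<inter> K2" "finite B12"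
    using ext[of BR "K1 \<inter> K2"] BR incl sub12 by blast
  obtain B1 where B1: "B12 \<subseteq> B1" "B1 \<subseteq> K1" "independent B1" "span B1 = K1" "finite B1"
    using ext[of B12 K1] B12 incl sub by blast
  obtain B2 where B2: "B12 \<subseteq> B2" "B2 \<subseteq> K2" "independent B2" "span B2 = K2" "finite B2"
    using ext[of B12 K2] B12 incl sub by blast
  have "independent (B1 \<union> B2)"
  proof
    assume "dependent (B1 \<union> B2)"
    then obtain u v where v: "v \<in> B1 \<union> B2" "u v \<noteq> 0" and 0: "(\<Sum>v\<in>B1 \<union> B2. u v *s v) = 0"
      using B1(5) B2(5) by (auto simp: dependent_finite)
    \<comment> \<open>\<open>?s\<close> lies in the span of \<open>B2\<close> and, being minus the
      sum over \<open>B1\<close>, also in that of \<open>B1\<close>, hence in the span of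
      \<open>B12\<close>. As it involves only elements of \<open>B2\<close> outside
      \<open>B1\<close>, its coefficients vanish.\<close>
    let ?s = "\<Sum>v\<in>B2 - B1. u v *s v"
    have split: "(\<Sum>v\<in>B1. u v *s v) + ?s = 0"
      using 0 B1(5) B2(5) sum.union_disjoint[of B1 "B2 - B1" "\<lambda>v. u v *s v"] by (simp add: Un_Diff_cancel)
    then have "?s = - (\<Sum>v\<in>B1. u v *s v)" by (metis add_eq_0_iff)
    then have "?s \<in> span B1"
      by (metis (no_types, lifting) span_neg span_sum span_scale span_base)
    moreover have "?s \<in> span B2" by (intro span_sum span_scale span_base) blast
    ultimately have "?s \<in> span B12" using B1(4) B2(4) B12(4) by simp
    moreover have "?s = (\<Sum>v\<in>B2. (if v \<in> B1 then 0 else u v) *s v)"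
      using B2(5) by (intro sum.mono_neutral_cong_left) auto
    ultimately have z2: "u w = 0" if "w \<in> B2 - B1" for w
      using independent_coeffs[OF B2(3,5,1), of "\<lambda>v. if v \<in> B1 then 0 else u v" w] that B1(1) by auto
    then have "?s = 0" by simp
    then have "(\<Sum>v\<in>B1. u v *s v) = 0" using split by simp
    then have "u w = 0" if "w \<in> B1" for w using independentD[OF B1(3,5) order_refl] that by blast
    then show False using z2 v by blast
  qed
  moreover have "B1 \<union> B2 \<subseteq> W" using B1(2) B2(2) incl by blast
  ultimately obtain B where B: "B1 \<union> B2 \<subseteq> B" "B \<subseteq> W" "independent B" "span B = W" "finite B"
    using ext[OF _ _ sub(4) order_refl] by metis
  have sumT: "(\<Sum>t\<in>B - BR. c t *s t) = (\<Sum>t\<in>B. (if t \<in> BR then 0 else c t) *s t)" for c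
    using B(5) by (intro sum.mono_neutral_cong_left) auto
  have coeff: "c t = 0 \<or> t \<in> C" if "C \<subseteq> B" "(\<Sum>t\<in>B - BR. c t *s t) \<in> span C" "t \<in> B - BR" for c t C
    using independent_coeffs[OF B(3,5) that(1), of "\<lambda>t. if t \<in> BR then 0 else c t" t] that sumT by auto
  have BRB: "BR \<subseteq> B" using B B1 B12 by blast
  show thesis
  proof (rule that[of "B - BR"])
    show "\<exists>c. w - (\<Sum>t\<in>B - BR. c t *s t) \<in> R" if "w \<in> W" for w
    proof -
      have "w \<in> range (\<lambda>u. \<Sum>v\<in>B. u v *s v)" using that B(4) span_finite[OF B(5)] by simp
      then obtain c where c: "w = (\<Sum>t\<in>B. c t *s t)" by auto
      have "(\<Sum>t\<in>B. c t *s t) = (\<Sum>t\<in>B - BR. c t *s t) + (\<Sum>t\<in>BR. c t *s t)"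
        using sum.subset_diff[OF BRB B(5)] .
      then have "w - (\<Sum>t\<in>B - BR. c t *s t) = (\<Sum>t\<in>BR. c t *s t)" using c by simp
      also have "\<dots> \<in> R" using BR(3) by (metis (no_types, lifting) span_base span_scale span_sum)
      finally show ?thesis by blast
    qed
    show "c t = 0" if "(\<Sum>t\<in>B - BR. c t *s t) \<in> R" "t \<in> B - BR" for c t
      using coeff[OF BRB _ that(2)] that BR(3) by auto
    show "c t = 0 \<or> t \<in> K" if "K = K1 \<or> K = K2" "(\<Sum>t\<in>B - BR. c t *s t) \<in> K" "t \<in> B - BR" for c t K
      using coeff[of B1 c t] coeff[of B2 c t] that B B1 B2 by blast
  qed (use B in auto)
qed

end

context radsq
begin

lemma module_idem_sum:
  assumes "left_module L M" "m \<in> carrier M"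
  shows "m = finsum M (\<lambda>x. idem x \<odot>\<^bsub>M\<^esub> m) V"
proof -
  interpret left_module L M by fact
  have "m = finsum L idem V \<odot>\<^bsub>M\<^esub> m" using assms(2) by (simp add: idem_sum smult_one)
  then show ?thesis using finsum_smult[OF finV _ assms(2), of idem] by simp
qed

text \<open>The trivial paths sum to one, so an element is the sum of its parts at the
  vertices.\<close>

lemma submodule_idemI:
  assumes "left_module L M" "submodule K L M" "m \<in> carrier M" "\<And>x. x \<in> V ==> idem x \<odot>\<^bsub>M\<^esub> m \<in> K"
  shows "m \<in> K"
proof -
  interpret left_module L M by fact
  show ?thesis
    using submodule_finsum[OF assms(2) finV, of "\<lambda>x. idem x \<odot>\<^bsub>M\<^esub> m"] assms(4) module_idem_sum[OF assms(1,3)]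
    by simp
qed

text \<open>One copy of P_x for each generator \<open>s\<close> and each vertex \<open>x\<close>,
  with its own generator going to the part of \<open>s\<close> at \<open>x\<close>.\<close>

lemma projective_cover_ex:
  assumes fg: "fg_module L M"
  obtains J t q where "valid J t" "\<forall>j\<in>J. snd (t j) = E `` {fst (t j)}"
    "q \<in> mod_hom L (Md J t) M" "q ` carrier (Md J t) = carrier M"
proof -
  interpret left_module L M using fg by (simp add: fg_module_def)
  have M: "left_module L M" by unfold_locales
  obtain S where S: "finite S" "S \<subseteq> carrier M" "\<And>K. submodule K L M ==> S \<subseteq> K ==> K = carrier M"
    using fg by (auto simp: fg_module_def)
  obtain h where h: "bij_betw h {0..<card (S \<times> V)} (S \<times> V)"
    using ex_bij_betw_nat_finite[of "S \<times> V"] S finV by blast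
  define J where "J = {0..<card (S \<times> V)}"
  define t where "t j = (snd (h j), E `` {snd (h j)})" for j
  define g where "g j = idem (snd (h j)) \<odot>\<^bsub>M\<^esub> fst (h j)" for j
  have hm: "fst (h j) \<in> S" "snd (h j) \<in> V" if "j \<in> J" for j
    using h that unfolding J_def by (metis bij_betwE mem_Times_iff)+
  have v: "valid J t" using hm by (auto simp: valid_def t_def J_def)
  have rel: "relations M J t g"
    unfolding relations_def g_def t_def using hm S(2)
    by (auto simp: smult_closed smult_assoc[symmetric] mult_idem_idem subset_iff)
  note q = hext[OF M v rel]
  interpret q: module_hom L "Md J t" M "hext M J t g"
    using M left_module_Md[OF v] q by (simp add: module_hom_def module_hom_axioms_def)
  have sub: "submodule (hext M J t g ` carrier (Md J t)) L M"
    by (rule q.submodule_image[OF q.M.submodule_carrier])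
  have "s \<in> hext M J t g ` carrier (Md J t)" if "s \<in> S" for s
  proof (rule submodule_idemI[OF M sub])
    fix x assume "x \<in> V"
    then have "(s, x) \<in> h ` J" using h \<open>s \<in> S\<close> by (simp add: J_def bij_betw_def)
    then obtain j where "j \<in> J" "h j = (s, x)" by auto
    then show "idem x \<odot>\<^bsub>M\<^esub> s \<in> hext M J t g ` carrier (Md J t)"
      using q(2)[of j] imageI[OF gen_carrier[of j J t], of "hext M J t g"] by (simp add: g_def)
  qed (use S that in auto)
  then have "hext M J t g ` carrier (Md J t) = carrier M" using S(3)[OF sub] by blast
  then show thesis using that[OF v _ q(1)] by (simp add: t_def)
qed

abbreviation scl :: "'k => (nat => 'k) => nat => 'k" where "scl c f \<equiv> (\<lambda>i. c * f i)"

sublocale vs: vector_space "scl :: 'k => _"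
  by unfold_locales (auto simp: algebra_simps)

lemma Md_sc: "[|valid J t; f \<in> carrier (Md J t)|] ==> sc c \<odot>\<^bsub>Md J t\<^esub> f = scl c f"
proof (rule pe_ext)
  fix j v assume v: "valid J t" and f: "f \<in> carrier (Md J t)"
  show "(sc c \<odot>\<^bsub>Md J t\<^esub> f) (pe j v) = c * f (pe j v)"
  proof (cases "j \<in> J \<and> (v = fst (t j) \<or> v \<in> snd (t j))")
    case True
    then have "v \<in> V" "fst (t j) \<notin> snd (t j)" using v valid_neq[OF v] arcD unfolding valid_def by blast+
    then show ?thesis using True by (auto simp: Md_smult cf_sc)
  next
    case False
    then have "f (pe j v) = 0" "j \<notin> J ==> f (pe j (fst (t j))) = 0" using f unfolding Md_carrier by blast+
    then show ?thesis using False by (auto simp: Md_smult)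
  qed
qed

lemma Md_subspace_span:
  assumes "valid J t" shows "carrier (Md J t) \<subseteq> vs.span ((\<lambda>i k. if k = i then 1 else 0) ` idx J t)"
    "finite (idx J t)"
proof -
  have "idx J t = (\<lambda>(j, v). pe j v) ` Sigma J (\<lambda>j. insert (fst (t j)) (snd (t j)))"
    by (auto simp: idx_def image_iff)
  moreover have "finite (snd (t j))" if "j \<in> J" for j
    using assms that finite_out finite_subset unfolding valid_def by blast
  ultimately show fin: "finite (idx J t)" using assms by (simp add: valid_def)
  show "carrier (Md J t) \<subseteq> vs.span ((\<lambda>i k. if k = i then 1 else 0) ` idx J t)"
  proof
    fix f assume f: "f \<in> carrier (Md J t)"
    have "f = (\<Sum>i\<in>idx J t. scl (f i) (\<lambda>k. if k = i then 1 else 0))"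
    proof
      fix k
      have "(\<Sum>i\<in>idx J t. scl (f i) (\<lambda>k. if k = i then 1 else 0)) k = (\<Sum>i\<in>idx J t. if k = i then f i else 0)"
        using fin by (induction rule: finite_induct) auto
      also have "\<dots> = f k" using f fin by (auto simp: Md_def)
      finally show "f k = (\<Sum>i\<in>idx J t. scl (f i) (\<lambda>k. if k = i then 1 else 0)) k" by simp
    qed
    also have "\<dots> \<in> vs.span ((\<lambda>i k. if k = i then 1 else 0) ` idx J t)"
      by (intro vs.span_sum vs.span_scale vs.span_base) auto
    finally show "f \<in> vs.span ((\<lambda>i k. if k = i then 1 else 0) ` idx J t)" .
  qed
qed

text \<open>The source of the arrow into \<open>x\<close>. If there is no such arrow the value is
  arbitrary, but then \<open>arr (inc x) x\<close> is zero by \<open>arr_zero\<close>, so that this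
  expression can be used for every \<open>x\<close>.\<close>

definition inc :: "nat => nat" where "inc x = (SOME w. (w, x) \<in> E)"

lemma inc: "(w, x) \<in> E ==> inc x = w"
  unfolding inc_def using indeg by blast


text \<open>At each vertex choose elements that complete the image of the incoming arrow and are
  adapted to the kernels of the outgoing arrows. Every outgoing arrow sends the chosen elements that
  it does not kill to independent elements. So each chosen element generates a summand of its own,
  whose shape records the arrows that do not kill it.\<close>

lemma classification:
  assumes fg: "fg_module L M"
  obtains J t where "valid J t" "mod_iso L (Md J t) M"
proof -
  interpret M: left_module L M using fg by (simp add: fg_module_def)
  have M: "left_module L M" by unfold_locales
  obtain J0 t0 q where v0: "valid J0 t0" and q: "q \<in> mod_hom L (Md J0 t0) M"
    "q ` carrier (Md J0 t0) = carrier M"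
    using projective_cover_ex[OF fg] by metis
  interpret q: module_hom L "Md J0 t0" M q
    using M left_module_Md[OF v0] q by (simp add: module_hom_def module_hom_axioms_def)
  \<comment> \<open>The elements of \<open>M\<close> have an arbitrary type, so the linear algebra
    takes place in the covering module \<open>U\<close>, with subspaces of \<open>M\<close> replaced
    by their preimages under \<open>q\<close>.\<close>
  define U where "U = carrier (Md J0 t0)"
  have qc: "q u \<in> carrier M" if "u \<in> U" for u using that q.closed by (simp add: U_def)
  have Uadd: "u + u' \<in> U" "q (u + u') = q u \<oplus>\<^bsub>M\<^esub> q u'" if "u \<in> U" "u' \<in> U" for u u'
    using that q.add q.M.M.a_closed by (auto simp: U_def Md_add plus_fun_def)
  have Uscl: "scl c u \<in> U" "q (scl c u) = sc c \<odot>\<^bsub>M\<^esub> q u" if "u \<in> U" for u c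
    using that q.smult[of "sc c" u] q.M.smult_closed[of "sc c" u] Md_sc[OF v0] by (auto simp: U_def)
  have U0: "0 \<in> U" "q 0 = \<zero>\<^bsub>M\<^esub>"
    using q.zero q.M.M.zero_closed by (auto simp: U_def Md_zero zero_fun_def)
  have Usum: "(\<Sum>t\<in>T. scl (c t) (h t)) \<in> U"
    "q (\<Sum>t\<in>T. scl (c t) (h t)) = finsum M (\<lambda>t. sc (c t) \<odot>\<^bsub>M\<^esub> q (h t)) T" if "finite T" "h ` T \<subseteq> U" for c T and h :: "'z => _"
    using that
  proof (induction T rule: finite_induct)
    case empty
    { case 1 then show ?case using U0 by (simp add: zero_fun_def) }
    { case 2 then show ?case using U0 by (simp add: zero_fun_def) }
  next
    case (insert x T)
    have hx: "h x \<in> U" "h ` T \<subseteq> U" if "h ` insert x T \<subseteq> U" using that by auto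
    have mc: "(\<lambda>t. sc (c t) \<odot>\<^bsub>M\<^esub> q (h t)) \<in> T \<rightarrow> carrier M" if "h ` T \<subseteq> U"
      using that qc by (auto intro!: M.smult_closed)
    have s: "(\<Sum>t\<in>insert x T. scl (c t) (h t)) = scl (c x) (h x) + (\<Sum>t\<in>T. scl (c t) (h t))"
      using insert by simp
    { case 1 show ?case unfolding s
        by (rule Uadd(1)[OF Uscl(1)[OF hx(1)[OF 1]] insert(3)[OF hx(2)[OF 1]]]) }
    { case 2
      then have "q (\<Sum>t\<in>insert x T. scl (c t) (h t)) =
          sc (c x) \<odot>\<^bsub>M\<^esub> q (h x) \<oplus>\<^bsub>M\<^esub> finsum M (\<lambda>t. sc (c t) \<odot>\<^bsub>M\<^esub> q (h t)) T"
        unfolding s Uadd(2)[OF Uscl(1)[OF hx(1)[OF 2]] insert(3)[OF hx(2)[OF 2]]]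
          Uscl(2)[OF hx(1)[OF 2]] insert(4)[OF hx(2)[OF 2]] by simp
      also have "\<dots> = finsum M (\<lambda>t. sc (c t) \<odot>\<^bsub>M\<^esub> q (h t)) (insert x T)"
        using insert(1,2) mc[OF hx(2)[OF 2]] qc[OF hx(1)[OF 2]] by (simp add: M.smult_closed)
      finally show ?case . }
  qed
  have subspaceI: "vs.subspace {u \<in> U. P (q u)}"
    if "P \<zero>\<^bsub>M\<^esub>" "\<And>m m'. [|m \<in> carrier M; m' \<in> carrier M; P m; P m'|] ==> P (m \<oplus>\<^bsub>M\<^esub> m')"
      "\<And>m c. [|m \<in> carrier M; P m|] ==> P (sc c \<odot>\<^bsub>M\<^esub> m)" for P
    unfolding vs.subspace_def using that by (auto simp: U0 Uadd Uscl qc)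
  have scc: "a \<odot>\<^bsub>M\<^esub> (sc c \<odot>\<^bsub>M\<^esub> m) = sc c \<odot>\<^bsub>M\<^esub> (a \<odot>\<^bsub>M\<^esub> m)" if "a \<in> carrier L" "m \<in> carrier M" for a c m
    using that by (simp add: M.smult_assoc[symmetric] sc_commute)
  \<comment> \<open>Preimages of the part of \<open>M\<close> at \<open>x\<close>, of the image of
    the incoming arrow (\<open>Rd\<close>) and of the kernel of the arrow to \<open>y\<close> in
    that part (\<open>K\<close>). \<open>Rd x\<close> lies in every \<open>K x y\<close> since
    products of two arrows are zero.\<close>
  define W where "W x = {u \<in> U. idem x \<odot>\<^bsub>M\<^esub> q u = q u}" for x
  define Rd where "Rd x = {u \<in> U. \<exists>m\<in>carrier M. q u = arr (inc x) x \<odot>\<^bsub>M\<^esub> m}" for x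
  define K where "K x y = {u \<in> U. idem x \<odot>\<^bsub>M\<^esub> q u = q u \<and> arr x y \<odot>\<^bsub>M\<^esub> q u = \<zero>\<^bsub>M\<^esub>}" for x y
  have subW: "vs.subspace (W x)" for x unfolding W_def
    by (rule subspaceI) (auto simp: M.smult_zero_right M.smult_r_distr scc)
  have subK: "vs.subspace (K x y)" for x y unfolding K_def
    by (rule subspaceI) (auto simp: M.smult_zero_right M.smult_r_distr scc)
  have subR: "vs.subspace (Rd x)" for x unfolding Rd_def
  proof (rule subspaceI)
    show "\<exists>m\<in>carrier M. \<zero>\<^bsub>M\<^esub> = arr (inc x) x \<odot>\<^bsub>M\<^esub> m"
      by (rule bexI[of _ "\<zero>\<^bsub>M\<^esub>"]) (auto simp: M.smult_zero_right)
    show "\<exists>m''\<in>carrier M. m \<oplus>\<^bsub>M\<^esub> m' = arr (inc x) x \<odot>\<^bsub>M\<^esub> m''"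
      if "\<exists>n\<in>carrier M. m = arr (inc x) x \<odot>\<^bsub>M\<^esub> n" "\<exists>n\<in>carrier M. m' = arr (inc x) x \<odot>\<^bsub>M\<^esub> n" for m m'
      using that by (metis M.smult_r_distr M.M.a_closed arr(1))
    show "\<exists>m'\<in>carrier M. sc c \<odot>\<^bsub>M\<^esub> m = arr (inc x) x \<odot>\<^bsub>M\<^esub> m'"
      if "\<exists>n\<in>carrier M. m = arr (inc x) x \<odot>\<^bsub>M\<^esub> n" for m c
      using that by (metis scc M.smult_closed arr(1) sc(1))
  qed
  have RK: "Rd x \<subseteq> K x y" for x y
    by (auto simp: Rd_def K_def M.smult_assoc[symmetric] mult_idem_arr mult_arr_arr M.smult_zero_left)
  have KW: "K x y \<subseteq> W x" for x y by (auto simp: K_def W_def)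
  have WU: "W x \<subseteq> U" for x by (auto simp: W_def)
  have ex: "\<exists>T. finite T \<and> T \<subseteq> W x \<and> (\<forall>w\<in>W x. \<exists>c. w - (\<Sum>t\<in>T. scl (c t) t) \<in> Rd x) \<and>
    (\<forall>c. (\<Sum>t\<in>T. scl (c t) t) \<in> Rd x \<longrightarrow> (\<forall>t\<in>T. c t = 0)) \<and>
    (\<forall>y c. (x, y) \<in> E \<longrightarrow> (\<Sum>t\<in>T. scl (c t) t) \<in> K x y \<longrightarrow> (\<forall>t\<in>T. c t = 0 \<or> t \<in> K x y))" for x
  proof -
    \<comment> \<open>With fewer than two arrows from \<open>x\<close> these may coincide or fail to
      be targets; the corresponding \<open>K\<close> are subspaces all the same.\<close>
    obtain y1 y2 where y: "E `` {x} \<subseteq> {y1, y2}"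
    proof -
      have "card (E `` {x}) = 0 \<or> card (E `` {x}) = 1 \<or> card (E `` {x}) = 2"
        using outdeg[of x] by linarith
      then show thesis using that finite_out[of x]
        by (auto simp: card_1_singleton_iff card_2_iff)
    qed
    have WF: "W x \<subseteq> vs.span ((\<lambda>i k. if k = i then 1 else 0) ` idx J0 t0)"
      using WU[of x] Md_subspace_span(1)[OF v0] unfolding U_def by blast
    obtain T where T: "finite T" "T \<subseteq> W x" "\<And>w. w \<in> W x ==> \<exists>c. w - (\<Sum>t\<in>T. scl (c t) t) \<in> Rd x"
      "\<And>c t. (\<Sum>t\<in>T. scl (c t) t) \<in> Rd x ==> t \<in> T ==> c t = 0"
      "\<And>c t K'. K' = K x y1 \<or> K' = K x y2 ==> (\<Sum>t\<in>T. scl (c t) t) \<in> K' ==> t \<in> T ==> c t = 0 \<or> t \<in> K'"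
      by (rule vs.adapted_complement[OF subR[of x] subK[of x y1] subK[of x y2] subW[of x] RK RK KW KW
          finite_imageI[OF Md_subspace_span(2)[OF v0]] WF]) (rule that; assumption)
    have "\<forall>y c. (x, y) \<in> E \<longrightarrow> (\<Sum>t\<in>T. scl (c t) t) \<in> K x y \<longrightarrow> (\<forall>t\<in>T. c t = 0 \<or> t \<in> K x y)"
    proof (intro allI impI ballI)
      fix y c t assume "(x, y) \<in> E" and c: "(\<Sum>t\<in>T. scl (c t) t) \<in> K x y" "t \<in> T"
      then have "K x y = K x y1 \<or> K x y = K x y2" using y by auto
      from T(5)[OF this c] show "c t = 0 \<or> t \<in> K x y" .
    qed
    moreover have "\<forall>c. (\<Sum>t\<in>T. scl (c t) t) \<in> Rd x \<longrightarrow> (\<forall>t\<in>T. c t = 0)" using T(4) by simp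
    moreover have "\<forall>w\<in>W x. \<exists>c. w - (\<Sum>t\<in>T. scl (c t) t) \<in> Rd x" using T(3) by simp
    ultimately show ?thesis using T(1,2) by (intro exI[of _ T] conjI)
  qed
  from choice[OF allI, OF ex] obtain T where T': "\<forall>x. finite (T x) \<and> T x \<subseteq> W x \<and> (\<forall>w\<in>W x. \<exists>c. w - (\<Sum>t\<in>T x. scl (c t) t) \<in> Rd x) \<and>
    (\<forall>c. (\<Sum>t\<in>T x. scl (c t) t) \<in> Rd x \<longrightarrow> (\<forall>t\<in>T x. c t = 0)) \<and>
    (\<forall>y c. (x, y) \<in> E \<longrightarrow> (\<Sum>t\<in>T x. scl (c t) t) \<in> K x y \<longrightarrow> (\<forall>t\<in>T x. c t = 0 \<or> t \<in> K x y))" ..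
  have T: "finite (T x)" "T x \<subseteq> W x" "w \<in> W x ==> \<exists>c. w - (\<Sum>t\<in>T x. scl (c t) t) \<in> Rd x"
    "(\<Sum>t\<in>T x. scl (c t) t) \<in> Rd x ==> t \<in> T x ==> c t = 0"
    "(x, y) \<in> E ==> (\<Sum>t\<in>T x. scl (c t) t) \<in> K x y ==> t \<in> T x ==> c t = 0 \<or> t \<in> K x y" for x w c t y
    using T'[THEN spec, of x] by simp_all
  obtain h where h: "bij_betw h {0..<card (Sigma V T)} (Sigma V T)"
    using ex_bij_betw_nat_finite[of "Sigma V T"] T(1) finV by blast
  define J where "J = {0..<card (Sigma V T)}"
  \<comment> \<open>One summand for each chosen element: its vertex and the arrows that do not kill
    it.\<close>
  define t where "t j = (fst (h j), {y. (fst (h j), y) \<in> E \<and> arr (fst (h j)) y \<odot>\<^bsub>M\<^esub> q (snd (h j)) \<noteq> \<zero>\<^bsub>M\<^esub>})" for j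
  define g where "g j = q (snd (h j))" for j
  have hJ: "fst (h j) \<in> V" "snd (h j) \<in> T (fst (h j))" if "j \<in> J" for j
    using bij_betwE[OF h] that unfolding J_def by (metis SigmaD1 SigmaD2 prod.collapse)+
  have finJ: "finite J" by (simp add: J_def)
  have v: "valid J t" using hJ by (auto simp: valid_def t_def finJ)
  have hU: "snd (h j) \<in> U" if "j \<in> J" for j using hJ[OF that] T(2) WU by blast
  have rel: "relations M J t g"
    unfolding relations_def g_def t_def using hJ T(2) by (auto simp: W_def qc[OF hU])
  define F where "F = hext M J t g"
  note F = hext[OF M v rel, folded F_def]
  interpret F: module_hom L "Md J t" M F
    using M left_module_Md[OF v] F by (simp add: module_hom_def module_hom_axioms_def)
  define k where "k v s = inv_into J h (v, s)" for v s
  have k: "k v s \<in> J" "h (k v s) = (v, s)" if "v \<in> V" "s \<in> T v" for v s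
  proof -
    have "(v, s) \<in> h ` J" using h that unfolding J_def bij_betw_def by auto
    then show "k v s \<in> J" "h (k v s) = (v, s)" unfolding k_def by (auto intro: inv_into_into f_inv_into_f)
  qed
  have kh: "k (fst (h j)) (snd (h j)) = j" if "j \<in> J" for j
    using that h unfolding k_def J_def bij_betw_def by simp
  \<comment> \<open>On elements with only top coordinates at one vertex, \<open>F\<close> is
    \<open>q\<close> of a combination of the chosen elements. This is the form to which the
    properties of \<open>T\<close> apply.\<close>
  have top: "F f = q (\<Sum>s\<in>T v. scl (f (pe (k v s) v)) s)"
    if f: "f \<in> carrier (Md J t)" and v: "v \<in> V" and ft: "\<And>j u. f (pe j u) \<noteq> 0 ==> u = v \<and> fst (t j) = v" for f v
  proof -
    let ?d = "\<lambda>j. if fst (h j) = v then f (pe j v) else 0"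
    have "lam t f j \<odot>\<^bsub>M\<^esub> g j = sc (?d j) \<odot>\<^bsub>M\<^esub> q (snd (h j))" if j: "j \<in> J" for j
    proof -
      have "lam t f j = sc (?d j) \<otimes> idem (fst (t j))"
      proof (rule cf_eqI)
        fix x y
        have "f (pe j y) = 0" if "y \<in> snd (t j)"
          using ft[of j y] that valid_neq[OF \<open>valid J t\<close> j] by auto
        moreover have "f (pe j (fst (t j))) = 0" if "fst (h j) \<noteq> v" using ft that by (auto simp: t_def)
        ultimately show "cf (lam t f j) (x, y) = cf (sc (?d j) \<otimes> idem (fst (t j))) (x, y)"
          using hJ[OF j] lam(2)[OF \<open>valid J t\<close> j] by (auto simp: cf_simps t_def)
      qed (use lam[OF \<open>valid J t\<close> j] in auto)
      then show ?thesis using rel j qc hU by (simp add: M.smult_assoc relations_def g_def)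
    qed
    then have "F f = finsum M (\<lambda>j. sc (?d j) \<odot>\<^bsub>M\<^esub> q (snd (h j))) J"
      unfolding F_def hext_def using f hU qc by (auto intro!: M.M.finsum_cong' M.smult_closed)
    also have "\<dots> = q (\<Sum>j\<in>J. scl (?d j) (snd (h j)))"
      by (subst Usum(2)[OF finJ]) (use hU in auto)
    also have "(\<Sum>j\<in>J. scl (?d j) (snd (h j))) = (\<Sum>j\<in>{j\<in>J. fst (h j) = v}. scl (f (pe j v)) (snd (h j)))"
      using finJ by (intro sum.mono_neutral_cong_right) (auto simp: zero_fun_def)
    also have "\<dots> = (\<Sum>s\<in>T v. scl (f (pe (k v s) v)) s)"
      by (rule sum.reindex_bij_witness[of _ "k v" "snd \<circ> h"]) (use k kh hJ v in auto)
    finally show ?thesis .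
  qed
  have "f = \<zero>\<^bsub>Md J t\<^esub>" if f: "f \<in> carrier (Md J t)" and 0: "F f = \<zero>\<^bsub>M\<^esub>" for f
  proof -
    have *: "(v = fst (t j) \<longrightarrow> f (pe j v) = 0) \<and> (v \<in> snd (t j) \<longrightarrow> f (pe j v) = 0)" if j: "j \<in> J" and vV: "v \<in> V" for j v
    proof -
      \<comment> \<open>The part of \<open>f\<close> at \<open>v\<close> consists of the top
        coordinates \<open>tp\<close> of summands with top at \<open>v\<close> and of the image of
        \<open>sb\<close> under the incoming arrow, where \<open>sb\<close> moves the radical
        coordinates at \<open>v\<close> back to the tops above them.\<close>
      let ?w = "inc v"
      define tp where "tp = (\<lambda>i. case prod_decode i of (j, u) => if u = v \<and> fst (t j) = v then f i else 0)"
      define sb where "sb = (\<lambda>i. case prod_decode i of (j, u) => if u = fst (t j) \<and> v \<in> snd (t j) then f (pe j v) else 0)"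
      have tp_pe: "tp (pe j u) = (if u = v \<and> fst (t j) = v then f (pe j u) else 0)" for j u by (simp add: tp_def)
      have sb_pe: "sb (pe j u) = (if u = fst (t j) \<and> v \<in> snd (t j) then f (pe j v) else 0)" for j u by (simp add: sb_def)
      have tpc: "tp \<in> carrier (Md J t)" "sb \<in> carrier (Md J t)"
        unfolding Md_carrier tp_pe sb_pe
      proof safe
        have *: "f (pe j u) \<noteq> 0 ==> j \<in> J \<and> (u = fst (t j) \<or> u \<in> snd (t j))" for j u
          using f unfolding Md_carrier by blast
        show "j \<in> J" if "(if u = v \<and> fst (t j) = v then f (pe j u) else 0) \<noteq> 0" for j u
          using that *[of j u] by (simp split: if_splits)
        show "u = fst (t j)" if "(if u = v \<and> fst (t j) = v then f (pe j u) else 0) \<noteq> 0" "u \<notin> snd (t j)" for j u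
          using that *[of j u] by (simp split: if_splits)
        show "j \<in> J" if "(if u = fst (t j) \<and> v \<in> snd (t j) then f (pe j v) else 0) \<noteq> 0" for j u
          using that *[of j v] by (simp split: if_splits)
        show "u = fst (t j)" if "(if u = fst (t j) \<and> v \<in> snd (t j) then f (pe j v) else 0) \<noteq> 0" "u \<notin> snd (t j)" for j u
          using that by (simp split: if_splits)
      qed
      have fJ: "j \<in> J" if "f (pe j u) \<noteq> 0" for j u using f that unfolding Md_carrier by blast
      have incw: "fst (t j) = ?w \<and> (?w, v) \<in> E" if "j \<in> J" "v \<in> snd (t j)" for j
      proof -
        have "(fst (t j), v) \<in> E" using that \<open>valid J t\<close> unfolding valid_def by blast
        then show ?thesis using inc by metis
      qed
      have "idem v \<odot>\<^bsub>Md J t\<^esub> f = tp \<oplus>\<^bsub>Md J t\<^esub> arr ?w v \<odot>\<^bsub>Md J t\<^esub> sb"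
      proof (rule pe_ext)
        fix j u
        show "(idem v \<odot>\<^bsub>Md J t\<^esub> f) (pe j u) = (tp \<oplus>\<^bsub>Md J t\<^esub> arr ?w v \<odot>\<^bsub>Md J t\<^esub> sb) (pe j u)"
        proof (cases "j \<in> J")
          case True
          then show ?thesis using valid_neq[OF v True] incw[OF True] vV
            by (auto simp: Md_smult Md_add tp_pe sb_pe cf_idem cf_arr)
        next
          case False
          then have "f (pe j u) = 0" for u using fJ by blast
          then show ?thesis by (auto simp: Md_smult Md_add tp_pe sb_pe)
        qed
      qed
      then have "idem v \<odot>\<^bsub>M\<^esub> F f = F tp \<oplus>\<^bsub>M\<^esub> arr ?w v \<odot>\<^bsub>M\<^esub> F sb"
        using f tpc F.smult F.add F.M.smult_closed by (metis arr(1) idem(1))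
      then have eq: "F tp \<oplus>\<^bsub>M\<^esub> arr ?w v \<odot>\<^bsub>M\<^esub> F sb = \<zero>\<^bsub>M\<^esub>" using 0 by (simp add: M.smult_zero_right)
      let ?s1 = "\<Sum>s\<in>T v. scl (tp (pe (k v s) v)) s"
      have F1: "F tp = q ?s1"
        by (rule top[OF tpc(1) vV]) (simp add: tp_pe split: if_splits)
      have "F tp = arr ?w v \<odot>\<^bsub>M\<^esub> (\<ominus>\<^bsub>M\<^esub> F sb)"
        using M.M.minus_equality[OF eq] F.closed[OF tpc(1)] F.closed[OF tpc(2)]
        by (simp add: M.smult_minus M.smult_closed)
      moreover have "?s1 \<in> U"
        using Usum(1)[OF T(1), of "\<lambda>s. s"] order_trans[OF T(2) WU, of v] by simp
      \<comment> \<open>The chosen elements are independent modulo the image of the incoming arrow,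
        which kills the top coordinates.\<close>
      ultimately have "?s1 \<in> Rd v" unfolding Rd_def using F1 F.closed[OF tpc(2)] by auto
      then have z1: "tp (pe (k v s) v) = 0" if "s \<in> T v" for s
        using T(4)[of "\<lambda>s. tp (pe (k v s) v)" v s] \<open>?s1 \<in> Rd v\<close> that by simp
      have top0: "f (pe j v) = 0" if "v = fst (t j)" "j \<in> J" for j
      proof -
        have "h j = (v, snd (h j))" "snd (h j) \<in> T v" using that hJ[of j] by (auto simp: t_def prod_eq_iff)
        then show ?thesis using z1[of "snd (h j)"] kh[OF that(2)] that by (auto simp: tp_pe t_def)
      qed
      have "tp = \<zero>\<^bsub>Md J t\<^esub>" by (rule pe_ext) (use top0 fJ in \<open>auto simp: tp_pe Md_zero\<close>)
      then have eq2: "arr ?w v \<odot>\<^bsub>M\<^esub> F sb = \<zero>\<^bsub>M\<^esub>"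
        using eq F.zero F.closed[OF tpc(2)] by (simp add: M.smult_closed)
      have "f (pe j v) = 0" if vj: "v \<in> snd (t j)" and jJ: "j \<in> J" for j
      proof -
        have w: "fst (h j) = ?w" "(?w, v) \<in> E" using incw[OF jJ vj] by (auto simp: t_def)
        then have wV: "?w \<in> V" using arcD by blast
        let ?s2 = "\<Sum>s\<in>T ?w. scl (sb (pe (k ?w s) ?w)) s"
        have "fst (t j') = ?w" if "f (pe j' v) \<noteq> 0" "v \<in> snd (t j')" for j'
          using incw[OF fJ[OF that(1)] that(2)] by simp
        then have F2: "F sb = q ?s2" by (intro top[OF tpc(2) wV]) (auto simp: sb_pe split: if_splits)
        have "?s2 \<in> W ?w" using T(2)[of ?w] vs.subspace_sum[OF subW, of "T ?w" "\<lambda>s. scl (sb (pe (k ?w s) ?w)) s"]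
            vs.subspace_scale[OF subW] by blast
        \<comment> \<open>The arrow to \<open>v\<close> kills this combination. By adaptedness the
          coefficients vanish at all chosen elements that the arrow does not kill, and these are the
          ones with \<open>v\<close> in their shape.\<close>
        then have "?s2 \<in> K ?w v" using eq2 F2 by (simp add: K_def W_def)
        moreover have "snd (h j) \<in> T ?w" using hJ[OF jJ] w by simp
        ultimately have "sb (pe (k ?w (snd (h j))) ?w) = 0 \<or> snd (h j) \<in> K ?w v"
          using T(5)[OF w(2), of "\<lambda>s. sb (pe (k ?w s) ?w)" "snd (h j)"] by simp
        moreover have "snd (h j) \<notin> K ?w v" using vj w by (auto simp: t_def K_def)
        ultimately show ?thesis using kh[OF jJ] w vj by (simp add: sb_pe t_def)
      qed
      then show ?thesis using top0 j by blast
    qed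
    show ?thesis
    proof (rule pe_ext)
      fix j v
      show "f (pe j v) = \<zero>\<^bsub>Md J t\<^esub> (pe j v)"
      proof (rule ccontr)
        assume "f (pe j v) \<noteq> \<zero>\<^bsub>Md J t\<^esub> (pe j v)"
        then have nz: "f (pe j v) \<noteq> 0" by (simp add: Md_zero)
        then have "j \<in> J" "v = fst (t j) \<or> v \<in> snd (t j)" using f unfolding Md_carrier by blast+
        moreover from this have "v \<in> V" using v arcD unfolding valid_def by blast
        ultimately show False using * nz by blast
      qed
    qed
  qed
  then have inj: "inj_on F (carrier (Md J t))" by (simp add: F.inj_iff)
  have subI: "submodule (F ` carrier (Md J t)) L M" by (rule F.submodule_image[OF F.M.submodule_carrier])
  let ?I = "F ` carrier (Md J t)"
  have qT: "q s \<in> ?I" if "x \<in> V" "s \<in> T x" for x s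
  proof -
    have "F (gen t (k x s)) = q s" using F(2)[OF k(1)[OF that]] k(2)[OF that] by (simp add: g_def)
    then show ?thesis using gen_carrier[OF k(1)[OF that], of t] by (metis imageI)
  qed
  have qsum: "q (\<Sum>s\<in>T x. scl (c s) s) \<in> ?I" if "x \<in> V" for x c
  proof -
    have "T x \<subseteq> U" using T(2) WU by blast
    then have "q (\<Sum>s\<in>T x. scl (c s) s) = finsum M (\<lambda>s. sc (c s) \<odot>\<^bsub>M\<^esub> q s) (T x)"
      using Usum(2)[OF T(1), of "\<lambda>s. s"] by auto
    also have "\<dots> \<in> ?I"
    proof (rule M.submodule_finsum[OF subI T(1)])
      fix s assume "s \<in> T x"
      then show "sc (c s) \<odot>\<^bsub>M\<^esub> q s \<in> ?I" using qT[OF that, of s] subI sc unfolding M.submodule_iff by blast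
    qed
    finally show ?thesis .
  qed
  have dec: "\<exists>c. \<exists>m\<in>carrier M. q u = q (\<Sum>s\<in>T x. scl (c s) s) \<oplus>\<^bsub>M\<^esub> arr (inc x) x \<odot>\<^bsub>M\<^esub> m" if "u \<in> W x" for x u
  proof -
    obtain c where c: "u - (\<Sum>s\<in>T x. scl (c s) s) \<in> Rd x" using T(3)[OF \<open>u \<in> W x\<close>] by blast
    moreover have "(\<Sum>s\<in>T x. scl (c s) s) \<in> U"
      using Usum(1)[OF T(1), of "\<lambda>s. s"] order_trans[OF T(2) WU, of x] by simp
    ultimately have "q u = q (\<Sum>s\<in>T x. scl (c s) s) \<oplus>\<^bsub>M\<^esub> q (u - (\<Sum>s\<in>T x. scl (c s) s))"
      using Uadd(2)[of "\<Sum>s\<in>T x. scl (c s) s" "u - (\<Sum>s\<in>T x. scl (c s) s)"] by (simp add: Rd_def)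
    moreover obtain m where m: "m \<in> carrier M" "q (u - (\<Sum>s\<in>T x. scl (c s) s)) = arr (inc x) x \<odot>\<^bsub>M\<^esub> m"
      using c unfolding Rd_def by auto
    ultimately have "q u = q (\<Sum>s\<in>T x. scl (c s) s) \<oplus>\<^bsub>M\<^esub> arr (inc x) x \<odot>\<^bsub>M\<^esub> m" by simp
    then show ?thesis using m(1) by blast
  qed
  have lift: "\<exists>u\<in>W x. q u = idem x \<odot>\<^bsub>M\<^esub> m" if "m \<in> carrier M" for x m
  proof -
    have "idem x \<odot>\<^bsub>M\<^esub> m \<in> q ` carrier (Md J0 t0)" using q(2) M.smult_closed[OF idem that] by simp
    then obtain u where u: "u \<in> U" "idem x \<odot>\<^bsub>M\<^esub> m = q u" unfolding U_def by (rule imageE)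
    then have "idem x \<odot>\<^bsub>M\<^esub> q u = q u"
      using that by (simp flip: u(2) M.smult_assoc add: mult_idem_idem)
    then show ?thesis using u unfolding W_def by auto
  qed
  have "m \<in> ?I" if m: "m \<in> carrier M" for m
  proof (rule submodule_idemI[OF M subI m])
    fix x assume x: "x \<in> V"
    obtain u where u: "u \<in> W x" "q u = idem x \<odot>\<^bsub>M\<^esub> m" using lift[OF m] by blast
    obtain c n where n: "n \<in> carrier M" "q u = q (\<Sum>s\<in>T x. scl (c s) s) \<oplus>\<^bsub>M\<^esub> arr (inc x) x \<odot>\<^bsub>M\<^esub> n"
      using dec[OF u(1)] by blast
    have "arr (inc x) x \<odot>\<^bsub>M\<^esub> n \<in> ?I"
    proof (cases "(inc x, x) \<in> E")
      case False
      then show ?thesis using n(1) subI by (simp add: arr_zero M.smult_zero_left M.submodule_iff)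
    next
      case True
      let ?w = "inc x"
      have wV: "?w \<in> V" using True arcD by blast
      \<comment> \<open>Decompose once more at the source of the arrow. What is left over there is
        in the image of an arrow and dies under the next one.\<close>
      obtain u' where u': "u' \<in> W ?w" "q u' = idem ?w \<odot>\<^bsub>M\<^esub> n" using lift[OF n(1)] by blast
      obtain c' n' where n': "n' \<in> carrier M" "q u' = q (\<Sum>s\<in>T ?w. scl (c' s) s) \<oplus>\<^bsub>M\<^esub> arr (inc ?w) ?w \<odot>\<^bsub>M\<^esub> n'"
        using dec[OF u'(1)] by blast
      have "arr ?w x \<odot>\<^bsub>M\<^esub> n = arr ?w x \<odot>\<^bsub>M\<^esub> q u'"
        using n(1) u'(2) by (simp add: M.smult_assoc[symmetric] mult_arr_idem)
      also have "\<dots> = arr ?w x \<odot>\<^bsub>M\<^esub> q (\<Sum>s\<in>T ?w. scl (c' s) s)"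
        using n' qsum[OF wV, of c'] subI
        by (auto simp: M.smult_r_distr M.smult_closed M.smult_assoc[symmetric] mult_arr_arr M.smult_zero_left
            M.submodule_iff subset_iff)
      also have "\<dots> \<in> ?I" using qsum[OF wV, of c'] subI by (auto simp: M.submodule_iff)
      finally show ?thesis .
    qed
    then show "idem x \<odot>\<^bsub>M\<^esub> m \<in> ?I" using n(2) u(2) qsum[OF x, of c] subI by (auto simp: M.submodule_iff)
  qed
  then have "F ` carrier (Md J t) = carrier M" using F.closed by blast
  then have "mod_iso L (Md J t) M" using inj F(1) by (auto simp: mod_iso_def bij_betw_def)
  then show thesis using that v by blast
qed

end

section \<open>Uniqueness of the decomposition\<close>

lemma module_homI: "[|left_module R M; left_module R N; f \<in> mod_hom R M N|] ==> module_hom R M N f"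
  by (simp add: module_hom_def module_hom_axioms_def)

text \<open>Bijections between fibres of equal size are glued together.\<close>

lemma equal_fibres_bij:
  assumes "finite J" "finite J'" "\<And>X. card {j \<in> J. t j = X} = card {j \<in> J'. t' j = X}"
  obtains p where "bij_betw p J J'" "\<And>j. j \<in> J ==> t' (p j) = t j"
proof -
  have "\<exists>b. bij_betw b {j \<in> J. t j = X} {j \<in> J'. t' j = X}" for X
    by (rule finite_same_card_bij) (use assms in auto)
  then obtain b where b: "\<And>X. bij_betw (b X) {j \<in> J. t j = X} {j \<in> J'. t' j = X}" by metis
  define p where "p j = b (t j) j" for j
  have p: "p j \<in> J'" "t' (p j) = t j" if "j \<in> J" for j
    using bij_betwE[OF b[of "t j"]] that by (auto simp: p_def)
  have "inj_on p J"
  proof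
    fix i j assume ij: "i \<in> J" "j \<in> J" "p i = p j"
    then have "t i = t j" using p by metis
    then show "i = j" using ij bij_betw_imp_inj_on[OF b[of "t j"]] by (auto simp: p_def inj_on_def)
  qed
  moreover have "\<exists>i\<in>J. p i = j" if jJ: "j \<in> J'" for j
  proof -
    have "j \<in> b (t' j) ` {i \<in> J. t i = t' j}" using bij_betw_imp_surj_on[OF b[of "t' j"]] jJ by simp
    then obtain i where i: "j = b (t' j) i" "i \<in> {i \<in> J. t i = t' j}" by (rule imageE)
    then have "p i = j" by (simp add: p_def)
    then show ?thesis using i(2) by blast
  qed
  ultimately have "bij_betw p J J'" using p by (auto simp: bij_betw_def)
  then show thesis using that p by blast
qed

context radsq
begin

text \<open>A coordinate subspace; for finite \<open>I\<close> its dimension is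
  \<open>card I\<close>.\<close>

definition Sp :: "nat set => (nat => 'k) set" where "Sp I = {f. \<forall>i. i \<notin> I \<longrightarrow> f i = 0}"

lemma SpI:
  assumes "\<And>j u. f (pe j u) \<noteq> 0 ==> pe j u \<in> I" shows "f \<in> Sp I"
  unfolding Sp_def
proof safe
  fix i assume "i \<notin> I"
  obtain j u where "prod_decode i = (j, u)" by (cases "prod_decode i")
  then have "i = pe j u" using prod_decode_inverse[of i] by simp
  then show "f i = 0" using assms \<open>i \<notin> I\<close> by blast
qed

lemma SpD: "[|f \<in> Sp ((\<lambda>j. pe j x) ` B); f (pe j u) \<noteq> 0|] ==> u = x \<and> j \<in> B"
proof -
  assume "f \<in> Sp ((\<lambda>j. pe j x) ` B)" "f (pe j u) \<noteq> 0"
  then have "pe j u \<in> (\<lambda>j. pe j x) ` B" unfolding Sp_def by blast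
  then show "u = x \<and> j \<in> B" by auto
qed

text \<open>The images of the unit vectors are independent in a space spanned by
  \<open>card I'\<close> unit vectors.\<close>

lemma linear_inj_card_le:
  assumes fin: "finite I" "finite I'"
    and add: "\<And>f g. f \<in> Sp I ==> g \<in> Sp I ==> h (f + g) = h f + h g"
    and scale: "\<And>c f. f \<in> Sp I ==> h (scl c f) = scl c (h f)"
    and into: "\<And>f. f \<in> Sp I ==> h f \<in> Sp I'"
    and inj: "\<And>f. f \<in> Sp I ==> h f = 0 ==> f = 0"
  shows "card I \<le> card I'"
proof -
  define u where "u i = (\<lambda>k. if k = i then 1 else 0 :: 'k)" for i :: nat
  have uI: "u i \<in> Sp I" if "i \<in> I" for i using that by (auto simp: u_def Sp_def)
  have lin: "(\<Sum>i\<in>A. scl (c i) (u i)) \<in> Sp I \<and> h (\<Sum>i\<in>A. scl (c i) (u i)) = (\<Sum>i\<in>A. scl (c i) (h (u i)))"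
    if "A \<subseteq> I" for c A
    using finite_subset[OF that fin(1)] that
  proof (induction A rule: finite_induct)
    case empty
    have "h 0 = 0" using scale[of 0 0] by (simp add: Sp_def zero_fun_def)
    then show ?case by (simp add: Sp_def zero_fun_def)
  next
    case (insert i A)
    then have "scl (c i) (u i) \<in> Sp I" "(\<Sum>i\<in>A. scl (c i) (u i)) \<in> Sp I" using uI by (auto simp: Sp_def)
    moreover from this have "scl (c i) (u i) + (\<Sum>i\<in>A. scl (c i) (u i)) \<in> Sp I" by (auto simp: Sp_def)
    ultimately show ?case using insert(1,2,4) insert(3)
      by (simp only: sum.insert[OF insert(1,2)] add) (auto simp: scale[OF uI])
  qed
  have sum_u: "(\<Sum>i\<in>A. scl (c i) (u i)) k = (if k \<in> A then c k else 0)" if "finite A" for A c k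
  proof -
    have "(\<Sum>i\<in>A. scl (c i) (u i)) k = (\<Sum>i\<in>A. if k = i then c i else 0)"
      using that by (induction rule: finite_induct) (auto simp: u_def)
    then show ?thesis using that by simp
  qed
  have coef: "c i = 0" if "(\<Sum>i\<in>I. scl (c i) (h (u i))) = 0" "i \<in> I" for c i
  proof -
    have "(\<Sum>i\<in>I. scl (c i) (u i)) = 0" using lin[of I c] inj that by auto
    then show ?thesis using sum_u[OF fin(1), of c i] that(2) by (simp add: zero_fun_def)
  qed
  have inju: "inj_on (\<lambda>i. h (u i)) I"
  proof
    fix i j assume ij: "i \<in> I" "j \<in> I" "h (u i) = h (u j)"
    show "i = j"
    proof (rule ccontr)
      assume "i \<noteq> j"
      let ?c = "\<lambda>k. if k = i then 1 else if k = j then -1 else 0 :: 'k"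
      have "(\<Sum>k\<in>I. scl (?c k) (h (u k))) = (\<Sum>k\<in>{i, j}. scl (?c k) (h (u k)))"
        using fin(1) ij by (intro sum.mono_neutral_right) (auto simp: zero_fun_def)
      also have "\<dots> = 0" using \<open>i \<noteq> j\<close> ij(3) by (auto simp: zero_fun_def plus_fun_def)
      finally show False using coef[of ?c i] ij(1) by simp
    qed
  qed
  have indep: "vs.independent ((\<lambda>i. h (u i)) ` I)"
  proof
    assume "vs.dependent ((\<lambda>i. h (u i)) ` I)"
    then obtain c v where c: "v \<in> (\<lambda>i. h (u i)) ` I" "c v \<noteq> 0" "(\<Sum>v\<in>(\<lambda>i. h (u i)) ` I. scl (c v) v) = 0"
      using fin(1) by (auto simp: vs.dependent_finite)
    have "(\<Sum>i\<in>I. scl (c (h (u i))) (h (u i))) = 0" using c(3) by (simp add: sum.reindex[OF inju])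
    then show False using coef[of "\<lambda>i. c (h (u i))"] c by auto
  qed
  have "f \<in> vs.span (u ` I')" if "f \<in> Sp I'" for f
  proof -
    have "f = (\<Sum>i\<in>I'. scl (f i) (u i))" using that by (auto simp: sum_u[OF fin(2)] Sp_def)
    also have "\<dots> \<in> vs.span (u ` I')" by (intro vs.span_sum vs.span_scale vs.span_base) auto
    finally show ?thesis .
  qed
  then have "(\<lambda>i. h (u i)) ` I \<subseteq> vs.span (u ` I')" using into uI by blast
  from vs.independent_span_bound[OF _ indep this] have "card ((\<lambda>i. h (u i)) ` I) \<le> card (u ` I')"
    using fin(2) by simp
  also have "\<dots> \<le> card I'" by (rule card_image_le[OF fin(2)])
  finally show ?thesis by (simp add: card_image[OF inju])
qed

text \<open>The left side is described by the module action alone, hence respected by homomorphisms,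
  while the right side makes its dimension a count of summands. This is how isomorphisms are forced
  to preserve multiplicities.\<close>

lemma Md_top_part:
  assumes v: "valid J t" and x: "x \<in> V"
  shows "{f \<in> carrier (Md J t). idem x \<odot>\<^bsub>Md J t\<^esub> f = f \<and> (\<forall>y\<in>E `` {x} - A. arr x y \<odot>\<^bsub>Md J t\<^esub> f = \<zero>\<^bsub>Md J t\<^esub>)}
    = Sp ((\<lambda>j. pe j x) ` {j \<in> J. fst (t j) = x \<and> snd (t j) \<subseteq> A \<or> x \<in> snd (t j)})" (is "?D = Sp ?I")
proof (intro equalityI subsetI)
  fix f assume "f \<in> ?D"
  then have f: "f \<in> carrier (Md J t)" "idem x \<odot>\<^bsub>Md J t\<^esub> f = f"
    "\<And>y. y \<in> E `` {x} - A ==> arr x y \<odot>\<^bsub>Md J t\<^esub> f = \<zero>\<^bsub>Md J t\<^esub>" by auto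
  have "pe j u \<in> ?I" if nz: "f (pe j u) \<noteq> 0" for j u
  proof -
    have j: "j \<in> J" "u = fst (t j) \<or> u \<in> snd (t j)" using f(1) nz unfolding Md_carrier by blast+
    have "(idem x \<odot>\<^bsub>Md J t\<^esub> f) (pe j u) \<noteq> 0" using f(2) nz by simp
    then have ux: "u = x" using j valid_neq[OF v j(1)] by (auto simp: Md_smult cf_idem split: if_splits)
    have "snd (t j) \<subseteq> A" if "fst (t j) = x"
    proof
      fix y assume y: "y \<in> snd (t j)"
      show "y \<in> A"
      proof (rule ccontr)
        assume "y \<notin> A"
        moreover have "(x, y) \<in> E" using y v j(1) that unfolding valid_def by blast
        ultimately have "(arr x y \<odot>\<^bsub>Md J t\<^esub> f) (pe j y) = 0" using f(3)[of y] by (simp add: Md_zero)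
        then show False using y that nz ux valid_neq[OF v j(1)] \<open>(x, y) \<in> E\<close> by (auto simp: Md_smult cf_arr split: if_splits)
      qed
    qed
    then show ?thesis using j ux by auto
  qed
  then show "f \<in> Sp ?I" by (intro SpI) auto
next
  fix f assume "f \<in> Sp ?I"
  then have nz: "u = x \<and> j \<in> J \<and> (fst (t j) = x \<and> snd (t j) \<subseteq> A \<or> x \<in> snd (t j))" if "f (pe j u) \<noteq> 0" for j u
    using SpD[OF \<open>f \<in> Sp ?I\<close> that] by simp
  have "f \<in> carrier (Md J t)" unfolding Md_carrier using nz by blast
  moreover have "idem x \<odot>\<^bsub>Md J t\<^esub> f = f"
  proof (rule pe_ext)
    fix j u show "(idem x \<odot>\<^bsub>Md J t\<^esub> f) (pe j u) = f (pe j u)"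
      using nz[of j u] x by (auto simp: Md_smult cf_idem)
  qed
  moreover have "arr x y \<odot>\<^bsub>Md J t\<^esub> f = \<zero>\<^bsub>Md J t\<^esub>" if y: "y \<in> E `` {x} - A" for y
  proof (rule pe_ext)
    fix j u show "(arr x y \<odot>\<^bsub>Md J t\<^esub> f) (pe j u) = \<zero>\<^bsub>Md J t\<^esub> (pe j u)"
      using nz[of j x] y valid_neq[OF v, of j] by (auto simp: Md_smult cf_arr Md_zero)
  qed
  ultimately show "f \<in> ?D" by blast
qed

text \<open>A second invariant subspace, used to subtract the summands that have \<open>x\<close> in
  their radical from the count given by \<open>Md_top_part\<close>.\<close>

lemma Md_rad_part:
  assumes v: "valid J t"
  shows "(\<lambda>f. arr (inc x) x \<odot>\<^bsub>Md J t\<^esub> f) ` carrier (Md J t) = Sp ((\<lambda>j. pe j x) ` {j \<in> J. x \<in> snd (t j)})"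
    (is "?D = Sp ?I")
proof (intro equalityI subsetI)
  fix f assume "f \<in> ?D"
  then obtain g where g: "g \<in> carrier (Md J t)" "f = arr (inc x) x \<odot>\<^bsub>Md J t\<^esub> g" by blast
  have "pe j u \<in> ?I" if nz: "f (pe j u) \<noteq> 0" for j u
  proof -
    have "u \<in> snd (t j) \<and> u = x \<and> g (pe j (fst (t j))) \<noteq> 0"
      using nz g(2) by (auto simp: Md_smult cf_arr split: if_splits)
    moreover from this have "j \<in> J" using g(1) unfolding Md_carrier by blast
    ultimately show ?thesis by auto
  qed
  then show "f \<in> Sp ?I" by (intro SpI) auto
next
  fix f assume "f \<in> Sp ?I"
  then have nz: "u = x \<and> j \<in> J \<and> x \<in> snd (t j)" if "f (pe j u) \<noteq> 0" for j u
    using SpD[OF \<open>f \<in> Sp ?I\<close> that] by simp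
  define g where "g = (\<lambda>i. case prod_decode i of (j, u) => if u = fst (t j) then f (pe j x) else 0)"
  have g_pe: "g (pe j u) = (if u = fst (t j) then f (pe j x) else 0)" for j u by (simp add: g_def)
  have "g \<in> carrier (Md J t)" unfolding Md_carrier g_pe using nz by auto
  moreover have "f = arr (inc x) x \<odot>\<^bsub>Md J t\<^esub> g"
  proof (rule pe_ext)
    fix j u
    show "f (pe j u) = (arr (inc x) x \<odot>\<^bsub>Md J t\<^esub> g) (pe j u)"
    proof (cases "j \<in> J \<and> x \<in> snd (t j) \<and> u = x")
      case True
      then have E: "(fst (t j), x) \<in> E" using v unfolding valid_def by blast
      have "x \<noteq> fst (t j)" using valid_neq[OF v, of j] True by auto
      then show ?thesis using inc[OF E] E True by (simp add: Md_smult cf_arr g_pe)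
    next
      case False
      then have "f (pe j u) = 0" using nz[of j u] by blast
      moreover have "(arr (inc x) x \<odot>\<^bsub>Md J t\<^esub> g) (pe j u) = 0"
      proof (cases "u \<in> snd (t j) \<and> u = x")
        case True
        then have "f (pe j x) = 0" using False nz[of j x] by blast
        then show ?thesis by (simp add: Md_smult cf_arr g_pe)
      next
        case False
        then show ?thesis by (auto simp: Md_smult cf_arr)
      qed
      ultimately show ?thesis by simp
    qed
  qed
  ultimately show "f \<in> ?D" by blast
qed

definition mtype :: "nat set => shape => (nat \<times> nat set) multiset" where
  "mtype J t = image_mset t (mset_set J)"

lemma count_mtype: "finite J ==> count (mtype J t) X = card {j \<in> J. t j = X}"
  by (simp add: mtype_def count_image_mset Collect_conj_eq Int_commute vimage_def)

lemma mtype_eqI: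
  assumes "finite J" "finite J'" "\<And>X. card {j \<in> J. t j = X} = card {j \<in> J'. t' j = X}"
  shows "mtype J t = mtype J' t'"
  by (rule multiset_eqI) (simp add: count_mtype assms)

text \<open>An injection embeds each of the two invariant subspaces of \<open>Md J t\<close> in its
  counterpart for \<open>Md J' t'\<close>.\<close>

lemma Md_inj_hom_counts:
  assumes v: "valid J t" "valid J' t'" and h: "h \<in> mod_hom L (Md J t) (Md J' t')" "inj_on h (carrier (Md J t))"
    and x: "x \<in> V"
  shows "card {j \<in> J. fst (t j) = x \<and> snd (t j) \<subseteq> A \<or> x \<in> snd (t j)} \<le>
      card {j \<in> J'. fst (t' j) = x \<and> snd (t' j) \<subseteq> A \<or> x \<in> snd (t' j)}"
    "card {j \<in> J. x \<in> snd (t j)} \<le> card {j \<in> J'. x \<in> snd (t' j)}"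
proof -
  interpret h: module_hom L "Md J t" "Md J' t'" h
    using v h left_module_Md by (intro module_homI) auto
  have fin: "finite J" "finite J'" using v by (auto simp: valid_def)
  have main: "card B \<le> card B'"
    if sub: "Sp ((\<lambda>j. pe j x) ` B) \<subseteq> carrier (Md J t)" and fB: "finite B" "finite B'"
      and into: "\<And>f. f \<in> Sp ((\<lambda>j. pe j x) ` B) ==> h f \<in> Sp ((\<lambda>j. pe j x) ` B')" for B B'
  proof -
    have "card ((\<lambda>j. pe j x) ` B) \<le> card ((\<lambda>j. pe j x) ` B')"
    proof (rule linear_inj_card_le[of _ _ h])
      show "h (f + g) = h f + h g" if "f \<in> Sp ((\<lambda>j. pe j x) ` B)" "g \<in> Sp ((\<lambda>j. pe j x) ` B)" for f g
        using h.add[of f g] that sub by (auto simp: Md_add plus_fun_def)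
      show "h (scl c f) = scl c (h f)" if "f \<in> Sp ((\<lambda>j. pe j x) ` B)" for f c
        using h.smult[of "sc c" f] that sub h.closed by (auto simp: Md_sc[OF v(1)] Md_sc[OF v(2)] subset_iff)
      show "f = 0" if "f \<in> Sp ((\<lambda>j. pe j x) ` B)" "h f = 0" for f
        using h(2) that sub h.inj_iff by (auto simp: Md_zero zero_fun_def)
    qed (use fB into in auto)
    then show ?thesis by (simp add: card_image inj_on_def)
  qed
  show "card {j \<in> J. fst (t j) = x \<and> snd (t j) \<subseteq> A \<or> x \<in> snd (t j)} \<le>
      card {j \<in> J'. fst (t' j) = x \<and> snd (t' j) \<subseteq> A \<or> x \<in> snd (t' j)}"
  proof (rule main, goal_cases)
    case 1 show ?case unfolding Md_top_part[OF v(1) x, symmetric] by blast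
  next
    case (4 f)
    then show ?case unfolding Md_top_part[OF v(1) x, symmetric] Md_top_part[OF v(2) x, symmetric]
      using h.closed h.zero h.smult[symmetric] by auto
  qed (use fin in auto)
  show "card {j \<in> J. x \<in> snd (t j)} \<le> card {j \<in> J'. x \<in> snd (t' j)}"
  proof (rule main, goal_cases)
    case 1 show ?case unfolding Md_rad_part[OF v(1), symmetric] using h.M.smult_closed by auto
  next
    case (4 f)
    then show ?case unfolding Md_rad_part[OF v(1), symmetric] Md_rad_part[OF v(2), symmetric]
      using h.closed h.smult by auto
  qed (use fin in auto)
qed

text \<open>Injections in both directions give equal numbers of summands \<open>(x, B)\<close> with
  \<open>B \<subseteq> A\<close>. Induction over \<open>A\<close> extracts the multiplicity of each
  single pair.\<close>

lemma Md_iso_mtype: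
  assumes v: "valid J t" "valid J' t'" and iso: "mod_iso L (Md J t) (Md J' t')"
  shows "mtype J t = mtype J' t'"
proof -
  have fin: "finite J" "finite J'" using v by (auto simp: valid_def)
  obtain h where h: "h \<in> mod_hom L (Md J t) (Md J' t')" "inj_on h (carrier (Md J t))"
    using iso by (auto simp: mod_iso_def bij_betw_def)
  obtain h' where h': "h' \<in> mod_hom L (Md J' t') (Md J t)" "inj_on h' (carrier (Md J' t'))"
    using mod_iso_sym[OF left_module_Md left_module_Md iso] v by (auto simp: mod_iso_def bij_betw_def)
  \<comment> \<open>A summand with top at \<open>x\<close> does not have \<open>x\<close> in its
    radical, so the two conditions exclude each other.\<close>
  have split: "card {j \<in> J. fst (t j) = x \<and> snd (t j) \<subseteq> A \<or> x \<in> snd (t j)} =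
      card {j \<in> J. fst (t j) = x \<and> snd (t j) \<subseteq> A} + card {j \<in> J. x \<in> snd (t j)}"
    if "valid J t" for J t x A
  proof -
    have "{j \<in> J. fst (t j) = x \<and> snd (t j) \<subseteq> A \<or> x \<in> snd (t j)} =
        {j \<in> J. fst (t j) = x \<and> snd (t j) \<subseteq> A} \<union> {j \<in> J. x \<in> snd (t j)}" by auto
    moreover have "{j \<in> J. fst (t j) = x \<and> snd (t j) \<subseteq> A} \<inter> {j \<in> J. x \<in> snd (t j)} = {}"
      using valid_neq[OF that] by auto
    ultimately show ?thesis using that by (simp add: card_Un_disjoint valid_def)
  qed
  have cum: "card {j \<in> J. fst (t j) = x \<and> snd (t j) \<subseteq> A} = card {j \<in> J'. fst (t' j) = x \<and> snd (t' j) \<subseteq> A}"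
    if "x \<in> V" for x A
    using Md_inj_hom_counts(1)[OF v h that, of A] Md_inj_hom_counts(1)[OF v(2,1) h' that, of A]
      Md_inj_hom_counts(2)[OF v h that] Md_inj_hom_counts(2)[OF v(2,1) h' that]
    by (simp add: split[OF v(1)] split[OF v(2)])
  have part: "card {j \<in> J. fst (t j) = x \<and> snd (t j) \<subseteq> A} = (\<Sum>B\<in>Pow A. card {j \<in> J. t j = (x, B)})"
    if "finite A" "finite J" for J x A and t :: "shape"
  proof -
    have "{j \<in> J. fst (t j) = x \<and> snd (t j) \<subseteq> A} = (\<Union>B\<in>Pow A. {j \<in> J. t j = (x, B)})"
      by (auto simp: prod_eq_iff)
    then show ?thesis using that by (simp only:) (subst card_UN_disjoint; auto)
  qed
  have eq: "card {j \<in> J. t j = (x, A)} = card {j \<in> J'. t' j = (x, A)}" if "x \<in> V" "finite A" for x A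
    using that(2)
  proof (induction A rule: finite_psubset_induct)
    case (psubset A)
    have "(\<Sum>B\<in>Pow A. card {j \<in> J. t j = (x, B)}) = (\<Sum>B\<in>Pow A. card {j \<in> J'. t' j = (x, B)})"
      using cum[OF that(1), of A] part[OF psubset(1)] fin by simp
    moreover have "(\<Sum>B\<in>Pow A - {A}. card {j \<in> J. t j = (x, B)}) = (\<Sum>B\<in>Pow A - {A}. card {j \<in> J'. t' j = (x, B)})"
      by (intro sum.cong psubset.IH) auto
    ultimately show ?case using psubset(1) by (simp add: sum.remove[of "Pow A" A])
  qed
  show ?thesis
  proof (rule mtype_eqI[OF fin])
    fix X :: "nat \<times> nat set"
    show "card {j \<in> J. t j = X} = card {j \<in> J'. t' j = X}"
    proof (cases "fst X \<in> V \<and> snd X \<subseteq> E `` {fst X}")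
      case True then show ?thesis using eq[of "fst X" "snd X"] finite_out finite_subset by (simp) blast
    next
      case False
      then have "{j \<in> J. t j = X} = {}" "{j \<in> J'. t' j = X} = {}" using v unfolding valid_def by blast+
      then show ?thesis by (simp only:)
    qed
  qed
qed

text \<open>A bijection of the indices that preserves shapes permutes the coordinates.\<close>

lemma Md_iso_mtypeI:
  assumes v: "valid J t" "valid J' t'" and m: "mtype J t = mtype J' t'"
  shows "mod_iso L (Md J t) (Md J' t')"
proof -
  have fin: "finite J" "finite J'" using v by (auto simp: valid_def)
  have "card {j \<in> J'. t' j = X} = card {j \<in> J. t j = X}" for X
    using m count_mtype[OF fin(1)] count_mtype[OF fin(2)] by metis
  then obtain p where p: "bij_betw p J' J" "\<And>j. j \<in> J' ==> t (p j) = t' j"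
    using equal_fibres_bij[OF fin(2,1), of t' t] by metis
  define h where "h f = (\<lambda>i. case prod_decode i of (j, v) => if j \<in> J' then f (pe (p j) v) else 0)" for f :: "nat => 'k"
  have h_pe: "h f (pe j v) = (if j \<in> J' then f (pe (p j) v) else 0)" for f j v by (simp add: h_def)
  have pJ: "p j \<in> J" if "j \<in> J'" for j using p(1) that bij_betwE by blast
  interpret left_module L "Md J t" by (rule left_module_Md[OF v(1)])
  have "restrict h (carrier (Md J t)) \<in> mod_hom L (Md J t) (Md J' t')"
  proof (rule mod_hom_restrictI)
    show "h f \<in> carrier (Md J' t')" if "f \<in> carrier (Md J t)" for f
      using that p(2) unfolding Md_carrier h_pe by (metis (full_types))
    show "h (f \<oplus>\<^bsub>Md J t\<^esub> g) = h f \<oplus>\<^bsub>Md J' t'\<^esub> h g" for f g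
      by (rule pe_ext) (simp add: Md_add h_pe)
    show "h (a \<odot>\<^bsub>Md J t\<^esub> f) = a \<odot>\<^bsub>Md J' t'\<^esub> h f" for a f
      by (rule pe_ext) (simp add: Md_smult h_pe p(2))
  qed (auto simp: smult_closed)
  moreover have "bij_betw (restrict h (carrier (Md J t))) (carrier (Md J t)) (carrier (Md J' t'))"
  proof (rule bij_betw_imageI)
    show "inj_on (restrict h (carrier (Md J t))) (carrier (Md J t))"
    proof
      fix f g assume fg: "f \<in> carrier (Md J t)" "g \<in> carrier (Md J t)"
        "restrict h (carrier (Md J t)) f = restrict h (carrier (Md J t)) g"
      then have "h f (pe j v) = h g (pe j v)" for j v by simp
      then have eq: "f (pe (p j) v) = g (pe (p j) v)" if "j \<in> J'" for j v using that unfolding h_pe by metis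
      show "f = g"
      proof (rule pe_ext)
        fix j v
        show "f (pe j v) = g (pe j v)"
        proof (cases "j \<in> J")
          case True then show ?thesis using eq p(1) by (metis bij_betw_def imageE)
        next
          case False then show ?thesis using fg(1,2) unfolding Md_carrier by metis
        qed
      qed
    qed
    show "restrict h (carrier (Md J t)) ` carrier (Md J t) = carrier (Md J' t')"
    proof (intro equalityI subsetI)
      fix g assume "g \<in> restrict h (carrier (Md J t)) ` carrier (Md J t)"
      then obtain f where "f \<in> carrier (Md J t)" "g = h f" by auto
      then show "g \<in> carrier (Md J' t')" using p(2) unfolding Md_carrier by (metis (full_types) h_pe)
    next
      fix g assume g: "g \<in> carrier (Md J' t')"
      define f where "f = (\<lambda>i. case prod_decode i of (j, v) => if j \<in> J then g (pe (inv_into J' p j) v) else 0)"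
      have f_pe: "f (pe j v) = (if j \<in> J then g (pe (inv_into J' p j) v) else 0)" for j v by (simp add: f_def)
      have iv: "inv_into J' p j \<in> J' \<and> p (inv_into J' p j) = j" if "j \<in> J" for j
        using p(1) that by (metis bij_betw_def f_inv_into_f inv_into_into)
      have "f \<in> carrier (Md J t)" unfolding Md_carrier f_pe
        using g iv p(2) unfolding Md_carrier by (metis (full_types))
      moreover have "h f = g"
      proof (rule pe_ext)
        fix j v
        show "h f (pe j v) = g (pe j v)" using g pJ p(1) unfolding Md_carrier
          by (cases "j \<in> J'") (auto simp: h_pe f_pe bij_betw_def)
      qed
      ultimately show "g \<in> restrict h (carrier (Md J t)) ` carrier (Md J t)" by (force simp: image_iff)
    qed
  qed
  ultimately show ?thesis unfolding mod_iso_def by blast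
qed

text \<open>The multiset of pairs in a decomposition of \<open>M\<close>. It exists for finitely
  generated modules by \<open>classification\<close> and is unique by
  \<open>has_type_unique\<close>: the Krull-Schmidt theorem for these algebras.\<close>

definition has_type :: "('a, 'm) module => (nat \<times> nat set) multiset => bool" where
  "has_type M m \<longleftrightarrow> (\<exists>J t. valid J t \<and> mtype J t = m \<and> mod_iso L (Md J t) M)"

lemma has_type_ex: "fg_module L M ==> \<exists>m. has_type M m"
  unfolding has_type_def using classification by metis

lemma has_type_Md: "valid J t ==> has_type (Md J t) (mtype J t)"
  unfolding has_type_def using mod_iso_refl left_module_Md by blast

lemma has_typeD:
  assumes "has_type M m" "valid J t" "mtype J t = m" shows "mod_iso L (Md J t) M"
proof -
  obtain J' t' where J': "valid J' t'" "mtype J' t' = m" "mod_iso L (Md J' t') M"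
    using assms(1) by (auto simp: has_type_def)
  show ?thesis using mod_iso_trans[OF left_module_Md Md_iso_mtypeI] J' assms by metis
qed

lemma has_type_iso_iff:
  assumes "left_module L M" "left_module L N" "has_type M m" "has_type N n"
  shows "mod_iso L M N \<longleftrightarrow> m = n"
proof -
  obtain J t where J: "valid J t" "mtype J t = m" "mod_iso L (Md J t) M"
    using assms(3) by (auto simp: has_type_def)
  obtain J' t' where J': "valid J' t'" "mtype J' t' = n" "mod_iso L (Md J' t') N"
    using assms(4) by (auto simp: has_type_def)
  note lm = left_module_Md[OF J(1)] left_module_Md[OF J'(1)]
  show ?thesis
  proof
    assume "mod_iso L M N"
    then have "mod_iso L (Md J t) (Md J' t')"
      using mod_iso_trans[OF lm(1) mod_iso_trans[OF lm(1) J(3)]] mod_iso_sym[OF lm(2) assms(2) J'(3)] by blast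
    then show "m = n" using Md_iso_mtype J J' by metis
  next
    assume "m = n"
    then have "mod_iso L (Md J t) N" using has_typeD[OF assms(4) J(1)] J(2) by simp
    then show "mod_iso L M N" using mod_iso_trans[OF assms(1) mod_iso_sym[OF lm(1) assms(1) J(3)]] by blast
  qed
qed

lemma has_type_unique: "[|left_module L M; has_type M m; has_type M n|] ==> m = n"
  using has_type_iso_iff mod_iso_refl by blast

lemma has_type_iso: "[|has_type M m; mod_iso L M N|] ==> has_type N m"
  unfolding has_type_def using mod_iso_trans left_module_Md by blast

lemma has_type_valid: "[|has_type M m; X \<in># m|] ==> fst X \<in> V \<and> snd X \<subseteq> E `` {fst X}"
  unfolding has_type_def mtype_def valid_def by fastforce

end

section \<open>Types of direct summands\<close>

lemma complementary_image:
  assumes M: "left_module R M" "left_module R M'" and h: "h \<in> mod_hom R M M'" "bij_betw h (carrier M) (carrier M')"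
    and c: "complementary R M N N'"
  shows "complementary R M' (h ` N) (h ` N')"
    "mod_iso R (M\<lparr>carrier := N\<rparr>) (M'\<lparr>carrier := h ` N\<rparr>)"
proof -
  interpret module_hom R M M' h using M h by (intro module_homI)
  have inj: "inj_on h (carrier M)" and im: "h ` carrier M = carrier M'" using h(2) by (auto simp: bij_betw_def)
  have sub: "submodule N R M" "submodule N' R M" and int: "N \<inter> N' = {\<zero>\<^bsub>M\<^esub>}" and sum: "N <+>\<^bsub>M\<^esub> N' = carrier M"
    using c by (auto simp: complementary_def)
  then have car: "N \<subseteq> carrier M" "N' \<subseteq> carrier M" by (auto simp: M.submodule_iff)
  have "h ` N \<inter> h ` N' = h ` (N \<inter> N')" using inj_on_image_Int[OF inj car] by simp
  then have 1: "h ` N \<inter> h ` N' = {\<zero>\<^bsub>M'\<^esub>}" using int zero by simp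
  have "h ` N <+>\<^bsub>M'\<^esub> h ` N' = h ` (N <+>\<^bsub>M\<^esub> N')"
  proof -
    have "h y \<oplus>\<^bsub>M'\<^esub> h z = h (y \<oplus>\<^bsub>M\<^esub> z)" if "y \<in> N" "z \<in> N'" for y z
      using that car add[of y z] by (simp add: subset_iff)
    then show ?thesis unfolding set_add_def' by (auto simp: image_iff)
  qed
  then show "complementary R M' (h ` N) (h ` N')"
    using 1 sum im submodule_image sub by (simp add: complementary_def)
  have "restrict h N \<in> mod_hom R (M\<lparr>carrier := N\<rparr>) (M'\<lparr>carrier := h ` N\<rparr>)"
  proof -
    interpret N: left_module R "M\<lparr>carrier := N\<rparr>" by (rule M.left_module_restrict[OF sub(1)])
    show ?thesis using mod_hom_restrictI[of "M\<lparr>carrier := N\<rparr>" h "M'\<lparr>carrier := h ` N\<rparr>" R] N.M.a_closed N.smult_closed car add smult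
      by (auto simp: subset_iff)
  qed
  moreover have "bij_betw (restrict h N) (carrier (M\<lparr>carrier := N\<rparr>)) (carrier (M'\<lparr>carrier := h ` N\<rparr>))"
    using inj car by (auto simp: bij_betw_def inj_on_def subset_iff)
  ultimately show "mod_iso R (M\<lparr>carrier := N\<rparr>) (M'\<lparr>carrier := h ` N\<rparr>)"
    unfolding mod_iso_def by - (rule bexI)
qed

context radsq
begin

text \<open>The projection onto the summands with index in \<open>J\<close>. Addition and action of
  \<open>Md K t\<close> do not depend on \<open>K\<close>, which is why \<open>res_add\<close> and
  \<open>res_smult\<close> hold for any \<open>K\<close> and \<open>K'\<close>.\<close>

definition res :: "nat set => (nat => 'k) => nat => 'k" where
  "res J f = (\<lambda>i. if fst (prod_decode i) \<in> J then f i else 0)"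

lemma res_pe: "res J f (pe j v) = (if j \<in> J then f (pe j v) else 0)"
  by (simp add: res_def)

lemma res_carrier: "f \<in> carrier (Md J t) ==> res J' f \<in> carrier (Md (J \<inter> J') t)"
  unfolding Md_carrier res_pe by auto

lemma res_add: "res J (f \<oplus>\<^bsub>Md K t\<^esub> g) = res J f \<oplus>\<^bsub>Md K' t\<^esub> res J g"
  by (rule pe_ext) (simp add: res_pe Md_add)

lemma res_smult: "res J (a \<odot>\<^bsub>Md K t\<^esub> f) = a \<odot>\<^bsub>Md K' t\<^esub> res J f"
  by (rule pe_ext) (simp add: res_pe Md_smult)

lemma Md_mono: "J' \<subseteq> J ==> carrier (Md J' t) \<subseteq> carrier (Md J t)"
  by (rule subsetI) (auto simp: Md_carrier)

lemma submodule_Md: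
  assumes "valid J t" "J' \<subseteq> J" shows "submodule (carrier (Md J' t)) L (Md J t)"
proof -
  interpret left_module L "Md J t" by (rule left_module_Md[OF assms(1)])
  interpret J': left_module L "Md J' t" by (rule left_module_Md[OF valid_subset[OF assms]])
  show ?thesis unfolding submodule_iff
    using Md_mono[OF assms(2)] J'.M.zero_closed J'.M.a_closed J'.smult_closed by (simp add: Md_def)
qed

lemma complementary_Md:
  assumes v: "valid J t" and J: "J = J1 \<union> J2" "J1 \<inter> J2 = {}"
  shows "complementary L (Md J t) (carrier (Md J1 t)) (carrier (Md J2 t))"
proof -
  interpret left_module L "Md J t" by (rule left_module_Md[OF v])
  have sub: "submodule (carrier (Md J1 t)) L (Md J t)" "submodule (carrier (Md J2 t)) L (Md J t)"
    using submodule_Md[OF v] J by auto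
  have "f = \<zero>\<^bsub>Md J t\<^esub>" if "f \<in> carrier (Md J1 t)" "f \<in> carrier (Md J2 t)" for f
    by (rule pe_ext) (use that J(2) in \<open>auto simp: Md_carrier Md_zero\<close>)
  then have int: "carrier (Md J1 t) \<inter> carrier (Md J2 t) = {\<zero>\<^bsub>Md J t\<^esub>}" using sub by (auto simp: submodule_iff)
  have "f \<in> carrier (Md J1 t) <+>\<^bsub>Md J t\<^esub> carrier (Md J2 t)" if f: "f \<in> carrier (Md J t)" for f
  proof -
    have "f = res J1 f \<oplus>\<^bsub>Md J t\<^esub> res J2 f"
      by (rule pe_ext) (use f J in \<open>auto simp: Md_carrier Md_add res_pe\<close>)
    moreover have "res J1 f \<in> carrier (Md J1 t)" "res J2 f \<in> carrier (Md J2 t)"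
      using res_carrier[OF f, of J1] res_carrier[OF f, of J2] J by (simp_all add: Int_absorb1 Int_absorb2)
    ultimately show ?thesis unfolding set_add_def' by blast
  qed
  moreover have "carrier (Md J1 t) <+>\<^bsub>Md J t\<^esub> carrier (Md J2 t) \<subseteq> carrier (Md J t)"
    using sub unfolding submodule_iff set_add_def' by auto
  ultimately show ?thesis using sub int unfolding complementary_def by blast
qed

lemma mtype_Un: "[|finite J1; finite J2; J1 \<inter> J2 = {}|] ==> mtype (J1 \<union> J2) t = mtype J1 t + mtype J2 t"
  by (simp add: mtype_def mset_set_Union)

lemma mtype_realize:
  assumes "\<forall>X\<in>#m. fst X \<in> V \<and> snd X \<subseteq> E `` {fst X}"
  obtains J t where "valid J t" "mtype J t = m"
proof -
  obtain xs where xs: "mset xs = m" using ex_mset by blast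
  have "mtype {0..<length xs} (nth xs) = mset (map (nth xs) [0..<length xs])"
    by (simp add: mtype_def flip: mset_upt)
  then have "mtype {0..<length xs} (nth xs) = m" by (simp add: map_nth xs)
  moreover have "valid {0..<length xs} (nth xs)" using assms xs unfolding valid_def by auto
  ultimately show thesis using that by blast
qed

text \<open>Even and odd indices keep the two families apart.\<close>

lemma mtype_realize2:
  assumes v: "valid J1 t1" "valid J2 t2"
  obtains K1 K2 t where "valid (K1 \<union> K2) t" "K1 \<inter> K2 = {}" "mtype K1 t = mtype J1 t1" "mtype K2 t = mtype J2 t2"
proof -
  define t where "t j = (if even j then t1 (j div 2) else t2 (j div 2))" for j
  let ?K1 = "(\<lambda>j. 2 * j) ` J1" and ?K2 = "(\<lambda>j. 2 * j + 1) ` J2"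
  have "mtype ?K1 t = mtype J1 t1"
    by (simp add: mtype_def image_mset_mset_set[symmetric] inj_on_def multiset.map_comp comp_def t_def)
  moreover have "mtype ?K2 t = mtype J2 t2"
    by (simp add: mtype_def image_mset_mset_set[symmetric] inj_on_def multiset.map_comp comp_def t_def)
  moreover have "?K1 \<inter> ?K2 = {}" by (auto, presburger)
  moreover have "valid (?K1 \<union> ?K2) t" using v by (auto simp: valid_def t_def)
  ultimately show thesis using that by blast
qed

text \<open>The sum of an isomorphism onto \<open>N\<close> and one onto \<open>N'\<close> is an
  isomorphism onto \<open>M\<close>.\<close>

lemma has_type_complementary:
  fixes M :: "('a, 'm) module"
  assumes M: "left_module L M" and c: "complementary L M N N'"
    and t: "has_type (M\<lparr>carrier := N\<rparr>) m" "has_type (M\<lparr>carrier := N'\<rparr>) n"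
  shows "has_type M (m + n)"
proof -
  interpret plain_module L M using M by (simp add: plain_module_def)
  have sub: "submodule N L M" "submodule N' L M" using c by (auto simp: complementary_def)
  then have car: "N \<subseteq> carrier M" "N' \<subseteq> carrier M" by (auto simp: submodule_iff)
  obtain J1 t1 J2 t2 where "valid J1 t1" "mtype J1 t1 = m" "valid J2 t2" "mtype J2 t2 = n"
    using t by (auto simp: has_type_def)
  then obtain K1 K2 t' where K: "valid (K1 \<union> K2) t'" "K1 \<inter> K2 = {}" "mtype K1 t' = m" "mtype K2 t' = n"
    using mtype_realize2 by metis
  let ?J = "K1 \<union> K2"
  have v: "valid K1 t'" "valid K2 t'" and fin: "finite K1" "finite K2" using K(1) by (auto simp: valid_def)
  interpret J: left_module L "Md ?J t'" by (rule left_module_Md[OF K(1)])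
  interpret J1: left_module L "Md K1 t'" by (rule left_module_Md[OF v(1)])
  interpret J2: left_module L "Md K2 t'" by (rule left_module_Md[OF v(2)])
  obtain h1 where h1: "h1 \<in> mod_hom L (Md K1 t') (M\<lparr>carrier := N\<rparr>)" "bij_betw h1 (carrier (Md K1 t')) N"
    using has_typeD[OF t(1) v(1) K(3)] by (auto simp: mod_iso_def)
  obtain h2 where h2: "h2 \<in> mod_hom L (Md K2 t') (M\<lparr>carrier := N'\<rparr>)" "bij_betw h2 (carrier (Md K2 t')) N'"
    using has_typeD[OF t(2) v(2) K(4)] by (auto simp: mod_iso_def)
  have rc: "res K1 f \<in> carrier (Md K1 t')" "res K2 f \<in> carrier (Md K2 t')" if "f \<in> carrier (Md ?J t')" for f
    using res_carrier[OF that, of K1] res_carrier[OF that, of K2] by (simp_all add: Int_absorb1)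
  have hc: "h1 f \<in> N" if "f \<in> carrier (Md K1 t')" for f using mod_hom_closed[OF h1(1) that] by simp
  have hc2: "h2 f \<in> N'" if "f \<in> carrier (Md K2 t')" for f using mod_hom_closed[OF h2(1) that] by simp
  define h where "h f = h1 (res K1 f) \<oplus>\<^bsub>M\<^esub> h2 (res K2 f)" for f
  have "restrict h (carrier (Md ?J t')) \<in> mod_hom L (Md ?J t') M"
  proof (rule mod_hom_restrictI)
    show "h f \<in> carrier M" if "f \<in> carrier (Md ?J t')" for f
      using hc[OF rc(1)[OF that]] hc2[OF rc(2)[OF that]] car by (auto simp: h_def)
    show "h (f \<oplus>\<^bsub>Md ?J t'\<^esub> g) = h f \<oplus>\<^bsub>M\<^esub> h g" if fg: "f \<in> carrier (Md ?J t')" "g \<in> carrier (Md ?J t')" for f g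
    proof -
      note r = rc[OF fg(1)] rc[OF fg(2)]
      have "h (f \<oplus>\<^bsub>Md ?J t'\<^esub> g) = (h1 (res K1 f) \<oplus>\<^bsub>M\<^esub> h1 (res K1 g)) \<oplus>\<^bsub>M\<^esub> (h2 (res K2 f) \<oplus>\<^bsub>M\<^esub> h2 (res K2 g))"
        unfolding h_def res_add[where J = K1 and K' = K1] res_add[where J = K2 and K' = K2]
        using mod_hom_add[OF h1(1) r(1,3)] mod_hom_add[OF h2(1) r(2,4)] by simp
      then show ?thesis unfolding h_def
        using hc[OF r(1)] hc[OF r(3)] hc2[OF r(2)] hc2[OF r(4)] car by (simp add: subset_iff M.a_ac)
    qed
    show "h (a \<odot>\<^bsub>Md ?J t'\<^esub> f) = a \<odot>\<^bsub>M\<^esub> h f" if a: "a \<in> carrier L" and f: "f \<in> carrier (Md ?J t')" for a f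
      unfolding h_def res_smult[where J = K1 and K' = K1] res_smult[where J = K2 and K' = K2]
      using mod_hom_smult[OF h1(1) a rc(1)[OF f]] mod_hom_smult[OF h2(1) a rc(2)[OF f]]
        hc[OF rc(1)[OF f]] hc2[OF rc(2)[OF f]] car a by (simp add: smult_r_distr subset_iff)
  qed (auto simp: J.smult_closed)
  moreover have "bij_betw (restrict h (carrier (Md ?J t'))) (carrier (Md ?J t')) (carrier M)"
  proof (rule bij_betw_imageI)
    show "inj_on (restrict h (carrier (Md ?J t'))) (carrier (Md ?J t'))"
    proof
      fix f g assume fg: "f \<in> carrier (Md ?J t')" "g \<in> carrier (Md ?J t')"
        "restrict h (carrier (Md ?J t')) f = restrict h (carrier (Md ?J t')) g"
      note r = rc[OF fg(1)] rc[OF fg(2)]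
      have "h1 (res K1 f) = h1 (res K1 g)" "h2 (res K2 f) = h2 (res K2 g)"
        using complementary_unique[OF c hc[OF r(1)] hc[OF r(3)] hc2[OF r(2)] hc2[OF r(4)]] fg
        by (auto simp: h_def)
      then have "res K1 f = res K1 g" "res K2 f = res K2 g"
        using h1(2) h2(2) r by (auto simp: bij_betw_def dest: inj_onD)
      then have e: "res K1 f (pe j v) = res K1 g (pe j v)" "res K2 f (pe j v) = res K2 g (pe j v)" for j v by simp_all
      show "f = g"
      proof (rule pe_ext)
        fix j v
        show "f (pe j v) = g (pe j v)"
          using e[of j v] fg(1,2) unfolding Md_carrier res_pe by (metis Un_iff)
      qed
    qed
    show "restrict h (carrier (Md ?J t')) ` carrier (Md ?J t') = carrier M"
    proof (intro equalityI subsetI)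
      fix x assume "x \<in> restrict h (carrier (Md ?J t')) ` carrier (Md ?J t')"
      then obtain f where f: "f \<in> carrier (Md ?J t')" "x = h f" by auto
      then show "x \<in> carrier M" using hc[OF rc(1)[OF f(1)]] hc2[OF rc(2)[OF f(1)]] car by (auto simp: h_def)
    next
      fix x assume "x \<in> carrier M"
      then obtain y z where yz: "y \<in> N" "z \<in> N'" "x = y \<oplus>\<^bsub>M\<^esub> z" using complementary_decomp[OF c] by metis
      obtain f where f: "f \<in> carrier (Md K1 t')" "y = h1 f" using yz(1) h1(2) unfolding bij_betw_def by blast
      obtain g where g: "g \<in> carrier (Md K2 t')" "z = h2 g" using yz(2) h2(2) unfolding bij_betw_def by blast
      let ?f = "f \<oplus>\<^bsub>Md ?J t'\<^esub> g"
      have "f \<in> carrier (Md ?J t')" "g \<in> carrier (Md ?J t')" using f g Md_mono[of K1 ?J t'] Md_mono[of K2 ?J t'] by auto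
      then have fc: "?f \<in> carrier (Md ?J t')" by simp
      have "g (pe j v) = 0" if "j \<in> K1" for j v using that g(1) K(2) unfolding Md_carrier by blast
      moreover have "f (pe j v) = 0" if "j \<in> K2" for j v using that f(1) K(2) unfolding Md_carrier by blast
      ultimately have "res K1 ?f = f" "res K2 ?f = g"
        by (rule_tac [!] pe_ext) (use f(1) g(1) in \<open>auto simp: res_pe Md_add Md_carrier\<close>)
      then have "h ?f = x" using yz f g by (simp add: h_def)
      then show "x \<in> restrict h (carrier (Md ?J t')) ` carrier (Md ?J t')" using fc by (force simp: image_iff)
    qed
  qed
  ultimately have "mod_iso L (Md ?J t') M" unfolding mod_iso_def by blast
  moreover have "mtype ?J t' = m + n" using mtype_Un[OF fin K(2)] K by simp
  ultimately show ?thesis using K(1) unfolding has_type_def by blast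
qed

text \<open>The model splits along a splitting of its index set, and an isomorphism carries this to
  \<open>M\<close>.\<close>

lemma has_type_split:
  fixes M :: "('a, 'm) module"
  assumes M: "left_module L M" and t: "has_type M (m + n)"
  obtains N N' where "complementary L M N N'" "has_type (M\<lparr>carrier := N\<rparr>) m" "has_type (M\<lparr>carrier := N'\<rparr>) n"
proof -
  have "\<forall>X\<in>#m. fst X \<in> V \<and> snd X \<subseteq> E `` {fst X}" "\<forall>X\<in>#n. fst X \<in> V \<and> snd X \<subseteq> E `` {fst X}"
    using has_type_valid[OF t] by auto
  then obtain J1 t1 J2 t2 where "valid J1 t1" "mtype J1 t1 = m" "valid J2 t2" "mtype J2 t2 = n"
    using mtype_realize by metis
  then obtain K1 K2 t' where K: "valid (K1 \<union> K2) t'" "K1 \<inter> K2 = {}" "mtype K1 t' = m" "mtype K2 t' = n"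
    using mtype_realize2 by metis
  let ?J = "K1 \<union> K2"
  have v: "valid K1 t'" "valid K2 t'" and fin: "finite K1" "finite K2" using K(1) by (auto simp: valid_def)
  have "mtype ?J t' = m + n" using mtype_Un[OF fin K(2)] K by simp
  from has_typeD[OF t K(1) this] obtain h where h: "h \<in> mod_hom L (Md ?J t') M" "bij_betw h (carrier (Md ?J t')) (carrier M)"
    by (auto simp: mod_iso_def)
  note J = left_module_Md[OF K(1)]
  have c: "complementary L (Md ?J t') (carrier (Md K1 t')) (carrier (Md K2 t'))"
    by (rule complementary_Md[OF K(1) refl K(2)])
  note i1 = complementary_image[OF J M h c]
  note i2 = complementary_image[OF J M h complementary_sym[OF J c]]
  have "has_type (M\<lparr>carrier := h ` carrier (Md K1 t')\<rparr>) m" "has_type (M\<lparr>carrier := h ` carrier (Md K2 t')\<rparr>) n"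
    using has_type_iso[OF _ i1(2)] has_type_iso[OF _ i2(2)] has_type_Md[OF v(1)] has_type_Md[OF v(2)] K
    by (simp_all add: Md_carrier_update)
  then show thesis using that i1(1) by blast
qed

lemma has_type_empty_iff:
  assumes M: "left_module L M" and t: "has_type M m"
  shows "carrier M = {\<zero>\<^bsub>M\<^esub>} \<longleftrightarrow> m = {#}"
proof -
  obtain J t' where J: "valid J t'" "mtype J t' = m" "mod_iso L (Md J t') M" using t by (auto simp: has_type_def)
  obtain h where h: "h \<in> mod_hom L (Md J t') M" "bij_betw h (carrier (Md J t')) (carrier M)"
    using J(3) by (auto simp: mod_iso_def)
  interpret module_hom L "Md J t'" M h using M h left_module_Md[OF J(1)] by (intro module_homI)
  have fin: "finite J" using J(1) by (simp add: valid_def)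
  have "carrier M = {\<zero>\<^bsub>M\<^esub>} \<longleftrightarrow> carrier (Md J t') = {\<zero>\<^bsub>Md J t'\<^esub>}"
  proof
    assume "carrier M = {\<zero>\<^bsub>M\<^esub>}"
    then have "x = \<zero>\<^bsub>Md J t'\<^esub>" if "x \<in> carrier (Md J t')" for x
      using closed[OF that] inj_iff h(2) that by (auto simp: bij_betw_def)
    then show "carrier (Md J t') = {\<zero>\<^bsub>Md J t'\<^esub>}" using M.M.zero_closed by blast
  next
    assume "carrier (Md J t') = {\<zero>\<^bsub>Md J t'\<^esub>}"
    then show "carrier M = {\<zero>\<^bsub>M\<^esub>}" using h(2) zero by (auto simp: bij_betw_def)
  qed
  also have "\<dots> \<longleftrightarrow> J = {}"
  proof
    assume *: "carrier (Md J t') = {\<zero>\<^bsub>Md J t'\<^esub>}"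
    have "False" if "j \<in> J" for j
    proof -
      have "gen t' j (pe j (fst (t' j))) = \<zero>\<^bsub>Md J t'\<^esub> (pe j (fst (t' j)))"
        using gen_carrier[OF that, of t'] * by simp
      then show False by (simp add: gen_def Md_zero)
    qed
    then show "J = {}" by blast
  next
    assume "J = {}"
    then show "carrier (Md J t') = {\<zero>\<^bsub>Md J t'\<^esub>}" by (auto simp: Md_def idx_def)
  qed
  also have "\<dots> \<longleftrightarrow> m = {#}" using J(2) fin by (auto simp: mtype_def mset_set_empty_iff)
  finally show ?thesis .
qed

lemma complementary_types:
  fixes M :: "('a, 'm) module"
  assumes fg: "fg_module L M" and c: "complementary L M N N'" and t: "has_type M m"
  obtains n n' where "has_type (M\<lparr>carrier := N\<rparr>) n" "has_type (M\<lparr>carrier := N'\<rparr>) n'" "m = n + n'"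
proof -
  have M: "left_module L M" using fg by (rule fg_moduleD)
  interpret plain_module L M using M by (simp add: plain_module_def)
  obtain n n' where n: "has_type (M\<lparr>carrier := N\<rparr>) n" "has_type (M\<lparr>carrier := N'\<rparr>) n'"
    using has_type_ex[OF fg_summand[OF fg c]] has_type_ex[OF fg_summand[OF fg complementary_sym[OF M c]]] by blast
  then show thesis using that has_type_unique[OF M t has_type_complementary[OF M c n]] by blast
qed

text \<open>Complementary submodules split the type into a sum of multisets and every such splitting
  occurs; a summand is zero exactly when its type is empty.\<close>

lemma indecomposable_iff:
  fixes M :: "('a, 'm) module"
  assumes fg: "fg_module L M" and t: "has_type M m"
  shows "indecomposable L M \<longleftrightarrow> size m = 1"
proof
  have M: "left_module L M" using fg by (rule fg_moduleD)
  interpret plain_module L M using M by (simp add: plain_module_def)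
  have empty: "N = {\<zero>\<^bsub>M\<^esub>} \<longleftrightarrow> n = {#}" if "submodule N L M" "has_type (M\<lparr>carrier := N\<rparr>) n" for N n
    using has_type_empty_iff[OF left_module_restrict[OF that(1)] that(2)] by simp
  {
    assume ind: "indecomposable L M"
    then have "m \<noteq> {#}" using has_type_empty_iff[OF M t] by (simp add: indecomposable_def)
    then obtain X n where m: "m = {#X#} + n" by (metis add_mset_add_single multiset_cases union_commute)
    obtain N N' where N: "complementary L M N N'" "has_type (M\<lparr>carrier := N\<rparr>) {#X#}" "has_type (M\<lparr>carrier := N'\<rparr>) n"
      using has_type_split[OF M t[unfolded m]] .
    then have "N = {\<zero>\<^bsub>M\<^esub>} \<or> N' = {\<zero>\<^bsub>M\<^esub>}" using ind by (simp add: indecomposable_def)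
    then have "n = {#}" using empty N by (auto simp: complementary_def)
    then show "size m = 1" using m by simp
  next
    assume s: "size m = 1"
    then have "m \<noteq> {#}" by auto
    moreover have "N = {\<zero>\<^bsub>M\<^esub>} \<or> N' = {\<zero>\<^bsub>M\<^esub>}" if c: "complementary L M N N'" for N N'
    proof -
      obtain n n' where n: "has_type (M\<lparr>carrier := N\<rparr>) n" "has_type (M\<lparr>carrier := N'\<rparr>) n'" "m = n + n'"
        using complementary_types[OF fg c t] .
      then have "size n + size n' = 1" using s by simp
      then have "n = {#} \<or> n' = {#}" by (metis One_nat_def add_is_1 size_eq_0_iff_empty)
      then show ?thesis using empty n c by (auto simp: complementary_def)
    qed
    ultimately show "indecomposable L M" using has_type_empty_iff[OF M t] by (simp add: indecomposable_def)
  }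
qed

text \<open>Every element of the type splits off as a summand, and by uniqueness of types no other
  indecomposable summand exists.\<close>

lemma num_summands_has_type:
  fixes M :: "('a, 'm) module"
  assumes fg: "fg_module L M" and t: "has_type M m"
  shows "num_summands L M = card (set_mset m)"
proof -
  have M: "left_module L M" using fg by (rule fg_moduleD)
  interpret plain_module L M using M by (simp add: plain_module_def)
  define cl where "cl N = (SOME n. has_type N n)" for N :: "('a, 'm) module"
  have sm: "fg_module L N \<and> has_type N (cl N)" if "N \<in> indec_summands L M" for N
  proof -
    have "fg_module L N" using that fg_summand[OF fg] by (auto simp: indec_summands_def)
    then show ?thesis using has_type_ex someI_ex unfolding cl_def by metis
  qed
  have "card (iso_classes L (indec_summands L M)) = card (cl ` indec_summands L M)"
    by (rule card_iso_classes) (use sm has_type_iso_iff fg_moduleD in metis)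
  also have "cl ` indec_summands L M = (\<lambda>X. {#X#}) ` set_mset m"
  proof (intro equalityI subsetI)
    fix n assume "n \<in> cl ` indec_summands L M"
    then obtain N where N: "N \<in> indec_summands L M" "n = cl N" by blast
    then obtain K K' where K: "N = M\<lparr>carrier := K\<rparr>" "complementary L M K K'" "indecomposable L N"
      by (auto simp: indec_summands_def)
    have nt: "has_type N n" "size n = 1" using sm[OF N(1)] N(2) indecomposable_iff K(3) by metis+
    obtain k k' where k: "has_type (M\<lparr>carrier := K\<rparr>) k" "m = k + k'" using complementary_types[OF fg K(2) t] by metis
    have "k = n" using has_type_unique[OF fg_moduleD k(1)] sm[OF N(1)] nt(1) K(1) by metis
    moreover obtain X where "n = {#X#}" using nt(2) size_1_singleton_mset by blast
    ultimately show "n \<in> (\<lambda>X. {#X#}) ` set_mset m" using k(2) by auto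
  next
    fix n assume "n \<in> (\<lambda>X. {#X#}) ` set_mset m"
    then obtain X m' where X: "n = {#X#}" "m = {#X#} + m'"
      by (auto dest!: multi_member_split)
    obtain N N' where N: "complementary L M N N'" "has_type (M\<lparr>carrier := N\<rparr>) {#X#}" "has_type (M\<lparr>carrier := N'\<rparr>) m'"
      using has_type_split[OF M t[unfolded X(2)]] .
    let ?N = "M\<lparr>carrier := N\<rparr>"
    have fgN: "fg_module L ?N" by (rule fg_summand[OF fg N(1)])
    then have "?N \<in> indec_summands L M" using indecomposable_iff[OF fgN N(2)] N(1) by (auto simp: indec_summands_def)
    moreover from sm[OF this] have "cl ?N = n" using has_type_unique[OF fg_moduleD[OF fgN] N(2)] X(1) by metis
    ultimately show "n \<in> cl ` indec_summands L M" by blast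
  qed
  also have "card \<dots> = card (set_mset m)" by (rule card_image) (auto simp: inj_on_def)
  finally show ?thesis by (simp add: num_summands_def)
qed

end

section \<open>Basic modules\<close>

lemma mod_isoI: "[|f \<in> mod_hom R M N; bij_betw f (carrier M) (carrier N)|] ==> mod_iso R M N"
  unfolding mod_iso_def by blast

context radsq
begin

lemma mtype_singleton: "mtype {j} t = {#t j#}"
  by (simp add: mtype_def)

text \<open>The summands of the given decomposition are images of \<open>M\<close> under the
  coordinate projections, hence finitely generated and of singleton type. Assembling their models
  gives \<open>M\<close> a type with pairwise different elements, and the type is unique.\<close>

lemma basic_imp_distinct:
  fixes M :: "('a, 'm) module"
  assumes fg: "fg_module L M" and t: "has_type M m" and b: "basic L M"
  shows "count m X \<le> 1"
proof -
  have M: "left_module L M" using fg by (rule fg_moduleD)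
  interpret plain_module L M using M by (simp add: plain_module_def)
  obtain F where F: "internal_direct_sum L M F" "\<And>N. N \<in> F ==> indecomposable L (M\<lparr>carrier := N\<rparr>)"
    "\<And>N N'. [|N \<in> F; N' \<in> F; N \<noteq> N'|] ==> \<not> mod_iso L (M\<lparr>carrier := N\<rparr>) (M\<lparr>carrier := N'\<rparr>)"
    using b by (auto simp: basic_def)
  have fin: "finite F" and sub: "\<And>N. N \<in> F ==> submodule N L M"
    and ex1: "\<And>x. x \<in> carrier M ==> \<exists>!c. c \<in> (\<Pi>\<^sub>E N\<in>F. N) \<and> x = finsum M c F"
    using F(1) by (auto simp: internal_direct_sum_def)
  have car: "x \<in> carrier M" if "N \<in> F" "x \<in> N" for N x using sub[OF that(1)] that(2) by (auto simp: submodule_iff)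
  \<comment> \<open>The family of components of \<open>x\<close>; by its uniqueness every component
    is a homomorphism in \<open>x\<close>.\<close>
  define C where "C x = (THE c. c \<in> (\<Pi>\<^sub>E N\<in>F. N) \<and> x = finsum M c F)" for x
  have C: "C x \<in> (\<Pi>\<^sub>E N\<in>F. N)" "x = finsum M (C x) F" if "x \<in> carrier M" for x
    using theI'[OF ex1[OF that]] by (simp_all add: C_def)
  have CN: "C x N \<in> N" if "x \<in> carrier M" "N \<in> F" for x N using C(1)[OF that(1)] that(2) by (auto simp: PiE_iff)
  have Cpi: "C x \<in> F \<rightarrow> carrier M" if "x \<in> carrier M" for x using CN[OF that] car by blast
  have Cuniq: "C x = c" if "x \<in> carrier M" "c \<in> (\<Pi>\<^sub>E N\<in>F. N)" "x = finsum M c F" for x c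
    using ex1[OF that(1)] C[OF that(1)] that by blast
  have fgN: "fg_module L (M\<lparr>carrier := N\<rparr>)" if N: "N \<in> F" for N
  proof (rule fg_module_image[OF fg left_module_restrict[OF sub[OF N]]])
    show "(\<lambda>x\<in>carrier M. C x N) \<in> mod_hom L M (M\<lparr>carrier := N\<rparr>)"
    proof (rule mod_hom_restrictI)
      show "C x N \<in> carrier (M\<lparr>carrier := N\<rparr>)" if "x \<in> carrier M" for x using CN[OF that N] by simp
      show "C (x \<oplus>\<^bsub>M\<^esub> y) N = C x N \<oplus>\<^bsub>M\<lparr>carrier := N\<rparr>\<^esub> C y N" if xy: "x \<in> carrier M" "y \<in> carrier M" for x y
      proof -
        have "C (x \<oplus>\<^bsub>M\<^esub> y) = (\<lambda>N\<in>F. C x N \<oplus>\<^bsub>M\<^esub> C y N)"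
        proof (rule Cuniq)
          show "(\<lambda>N\<in>F. C x N \<oplus>\<^bsub>M\<^esub> C y N) \<in> (\<Pi>\<^sub>E N\<in>F. N)"
            using sub CN[OF xy(1)] CN[OF xy(2)] unfolding submodule_iff by auto
          have "x \<oplus>\<^bsub>M\<^esub> y = finsum M (\<lambda>N. C x N \<oplus>\<^bsub>M\<^esub> C y N) F"
            using C(2)[OF xy(1)] C(2)[OF xy(2)] M.finsum_addf[OF Cpi[OF xy(1)] Cpi[OF xy(2)]] by simp
          then show "x \<oplus>\<^bsub>M\<^esub> y = finsum M (\<lambda>N\<in>F. C x N \<oplus>\<^bsub>M\<^esub> C y N) F"
            using Cpi[OF xy(1)] Cpi[OF xy(2)] by (simp only:) (rule M.finsum_cong'; auto)
        qed (use xy in auto)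
        then show ?thesis using N by simp
      qed
      show "C (a \<odot>\<^bsub>M\<^esub> x) N = a \<odot>\<^bsub>M\<lparr>carrier := N\<rparr>\<^esub> C x N" if ax: "a \<in> carrier L" "x \<in> carrier M" for a x
      proof -
        have "C (a \<odot>\<^bsub>M\<^esub> x) = (\<lambda>N\<in>F. a \<odot>\<^bsub>M\<^esub> C x N)"
        proof (rule Cuniq)
          show "(\<lambda>N\<in>F. a \<odot>\<^bsub>M\<^esub> C x N) \<in> (\<Pi>\<^sub>E N\<in>F. N)"
            using sub CN[OF ax(2)] ax(1) unfolding submodule_iff by auto
          have "a \<odot>\<^bsub>M\<^esub> x = finsum M (\<lambda>N. a \<odot>\<^bsub>M\<^esub> C x N) F"
            using C(2)[OF ax(2)] smult_finsum[OF fin ax(1) Cpi[OF ax(2)]] by simp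
          then show "a \<odot>\<^bsub>M\<^esub> x = finsum M (\<lambda>N\<in>F. a \<odot>\<^bsub>M\<^esub> C x N) F"
            using Cpi[OF ax(2)] ax(1) smult_closed by (simp only:) (rule M.finsum_cong'; auto)
        qed (use ax smult_closed in auto)
        then show ?thesis using N by simp
      qed
    qed (auto simp: smult_closed)
    have "C x N = x" if x: "x \<in> N" for x
    proof -
      have xc: "x \<in> carrier M" using car[OF N x] .
      have "C x = (\<lambda>N'\<in>F. if N = N' then x else \<zero>\<^bsub>M\<^esub>)"
      proof (rule Cuniq[OF xc])
        show "(\<lambda>N'\<in>F. if N = N' then x else \<zero>\<^bsub>M\<^esub>) \<in> (\<Pi>\<^sub>E N\<in>F. N)" using x sub by (auto simp: submodule_iff)
        have "finsum M (\<lambda>N'\<in>F. if N = N' then x else \<zero>\<^bsub>M\<^esub>) F = finsum M (\<lambda>N'. if N = N' then x else \<zero>\<^bsub>M\<^esub>) F"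
          using xc by (intro M.finsum_cong') auto
        then show "x = finsum M (\<lambda>N'\<in>F. if N = N' then x else \<zero>\<^bsub>M\<^esub>) F"
          using M.finsum_singleton[OF N fin, of "\<lambda>_. x"] xc by simp
      qed
      then show ?thesis using N by simp
    qed
    then have "x \<in> (\<lambda>x\<in>carrier M. C x N) ` carrier M" if "x \<in> N" for x
      using that car[OF N that] by (force simp: image_iff)
    then show "(\<lambda>x\<in>carrier M. C x N) ` carrier M = carrier (M\<lparr>carrier := N\<rparr>)"
      using CN N by auto
  qed
  have "\<exists>X. has_type (M\<lparr>carrier := N\<rparr>) {#X#}" if N: "N \<in> F" for N
  proof -
    obtain n where n: "has_type (M\<lparr>carrier := N\<rparr>) n" using has_type_ex[OF fgN[OF N]] by blast
    then show ?thesis using indecomposable_iff[OF fgN[OF N] n] F(2)[OF N] size_1_singleton_mset by metis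
  qed
  then obtain T where T: "\<And>N. N \<in> F ==> has_type (M\<lparr>carrier := N\<rparr>) {#T N#}" by metis
  obtain h where h: "bij_betw h {0..<card F} F" using ex_bij_betw_nat_finite[OF fin] by blast
  define J where "J = {0..<card F}"
  define t' where "t' j = T (h j)" for j
  have hJ: "h j \<in> F" if "j \<in> J" for j using bij_betwE[OF h] that by (simp add: J_def)
  define k where "k N = inv_into J h N" for N
  have k: "k N \<in> J" "h (k N) = N" if "N \<in> F" for N
    using h that unfolding k_def J_def bij_betw_def by (metis inv_into_into, metis f_inv_into_f)
  have kh: "k (h j) = j" if "j \<in> J" for j using h that unfolding k_def J_def bij_betw_def by simp
  have v: "valid J t'"
    using has_type_valid[OF T[OF hJ]] unfolding valid_def t'_def by (auto simp: J_def)
  have vN: "valid {k N} t'" if "N \<in> F" for N using valid_subset[OF v] k that by auto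
  interpret J: left_module L "Md J t'" by (rule left_module_Md[OF v])
  have "\<exists>g. g \<in> mod_hom L (Md {k N} t') (M\<lparr>carrier := N\<rparr>) \<and> bij_betw g (carrier (Md {k N} t')) N" if N: "N \<in> F" for N
    using has_typeD[OF T[OF N] vN[OF N]] k[OF N] by (auto simp: mtype_singleton t'_def mod_iso_def)
  then obtain g where g: "\<And>N. N \<in> F ==> g N \<in> mod_hom L (Md {k N} t') (M\<lparr>carrier := N\<rparr>)"
    "\<And>N. N \<in> F ==> bij_betw (g N) (carrier (Md {k N} t')) N" by metis
  have rc: "res {k N} f \<in> carrier (Md {k N} t')" if "f \<in> carrier (Md J t')" "N \<in> F" for f N
    using res_carrier[OF that(1), of "{k N}"] k[OF that(2)] by (simp add: Int_absorb1)
  have gN: "g N f \<in> N" if "N \<in> F" "f \<in> carrier (Md {k N} t')" for N f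
    using mod_hom_closed[OF g(1)[OF that(1)] that(2)] by simp
  define c where "c f = (\<lambda>N\<in>F. g N (res {k N} f))" for f
  have cpi: "c f \<in> (\<Pi>\<^sub>E N\<in>F. N)" if "f \<in> carrier (Md J t')" for f
    using gN rc[OF that] by (auto simp: c_def)
  have ccar: "c f \<in> F \<rightarrow> carrier M" if "f \<in> carrier (Md J t')" for f
    using cpi[OF that] car by (auto simp: PiE_iff)
  \<comment> \<open>The sum over \<open>F\<close> of the isomorphisms \<open>g N\<close> from the
    models onto the summands.\<close>
  define H where "H f = finsum M (c f) F" for f
  have Hc: "H f \<in> carrier M" if "f \<in> carrier (Md J t')" for f
    using ccar[OF that] by (auto simp: H_def)
  have CH: "C (H f) = c f" if "f \<in> carrier (Md J t')" for f
    using Cuniq[OF Hc[OF that] cpi[OF that]] by (simp add: H_def)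
  have "restrict H (carrier (Md J t')) \<in> mod_hom L (Md J t') M"
  proof (rule mod_hom_restrictI)
    show "H (f \<oplus>\<^bsub>Md J t'\<^esub> f') = H f \<oplus>\<^bsub>M\<^esub> H f'" if f: "f \<in> carrier (Md J t')" "f' \<in> carrier (Md J t')" for f f'
    proof -
      have "H (f \<oplus>\<^bsub>Md J t'\<^esub> f') = finsum M (\<lambda>N. c f N \<oplus>\<^bsub>M\<^esub> c f' N) F" unfolding H_def
      proof (rule M.finsum_cong')
        fix N assume N: "N \<in> F"
        show "c (f \<oplus>\<^bsub>Md J t'\<^esub> f') N = c f N \<oplus>\<^bsub>M\<^esub> c f' N"
          using mod_hom_add[OF g(1)[OF N] rc[OF f(1) N] rc[OF f(2) N]] N
          unfolding c_def by (simp add: res_add[where K' = "{k N}"])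
      qed (use ccar f in auto)
      then show ?thesis using M.finsum_addf[OF ccar[OF f(1)] ccar[OF f(2)]] by (simp add: H_def)
    qed
    show "H (a \<odot>\<^bsub>Md J t'\<^esub> f) = a \<odot>\<^bsub>M\<^esub> H f" if a: "a \<in> carrier L" and f: "f \<in> carrier (Md J t')" for a f
    proof -
      have "H (a \<odot>\<^bsub>Md J t'\<^esub> f) = finsum M (\<lambda>N. a \<odot>\<^bsub>M\<^esub> c f N) F" unfolding H_def
      proof (rule M.finsum_cong')
        fix N assume N: "N \<in> F"
        show "c (a \<odot>\<^bsub>Md J t'\<^esub> f) N = a \<odot>\<^bsub>M\<^esub> c f N"
          using mod_hom_smult[OF g(1)[OF N] a rc[OF f N]] N
          unfolding c_def by (simp add: res_smult[where K' = "{k N}"])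
      qed (use ccar[OF f] a smult_closed in auto)
      then show ?thesis using smult_finsum[OF fin a ccar[OF f]] by (simp add: H_def)
    qed
  qed (use Hc J.smult_closed in auto)
  moreover have "bij_betw (restrict H (carrier (Md J t'))) (carrier (Md J t')) (carrier M)"
  proof (rule bij_betw_imageI)
    show "inj_on (restrict H (carrier (Md J t'))) (carrier (Md J t'))"
    proof
      fix f f' assume f: "f \<in> carrier (Md J t')" "f' \<in> carrier (Md J t')"
        "restrict H (carrier (Md J t')) f = restrict H (carrier (Md J t')) f'"
      then have cc: "c f = c f'" using CH[OF f(1)] CH[OF f(2)] by simp
      have r: "res {j} f = res {j} f'" if j: "j \<in> J" for j
      proof -
        have "g (h j) (res {j} f) = g (h j) (res {j} f')"
          using fun_cong[OF cc, of "h j"] hJ[OF j] kh[OF j] by (simp add: c_def)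
        then show ?thesis using g(2)[OF hJ[OF j]] rc[OF f(1) hJ[OF j]] rc[OF f(2) hJ[OF j]] kh[OF j]
          by (auto simp: bij_betw_def dest: inj_onD)
      qed
      show "f = f'"
      proof (rule pe_ext)
        fix j u
        show "f (pe j u) = f' (pe j u)"
        proof (cases "j \<in> J")
          case True then show ?thesis using fun_cong[OF r[OF True], of "pe j u"] by (simp add: res_pe)
        next
          case False then show ?thesis using f(1,2) unfolding Md_carrier by metis
        qed
      qed
    qed
    show "restrict H (carrier (Md J t')) ` carrier (Md J t') = carrier M"
    proof (intro equalityI subsetI)
      fix x assume x: "x \<in> carrier M"
      have "\<exists>f. f \<in> carrier (Md {k N} t') \<and> g N f = C x N" if N: "N \<in> F" for N
        using CN[OF x N] g(2)[OF N] unfolding bij_betw_def by (metis imageE)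
      then obtain f where f: "\<And>N. N \<in> F ==> f N \<in> carrier (Md {k N} t')" "\<And>N. N \<in> F ==> g N (f N) = C x N" by metis
      define f' where "f' = (\<lambda>i. f (h (fst (prod_decode i))) i)"
      have f'_pe: "f' (pe j u) = f (h j) (pe j u)" for j u by (simp add: f'_def)
      let ?f = "res J f'"
      have fj: "f (h j) \<in> carrier (Md {j} t')" if "j \<in> J" for j using f(1)[OF hJ[OF that]] kh[OF that] by simp
      have fc: "?f \<in> carrier (Md J t')" unfolding Md_carrier res_pe f'_pe
        using fj unfolding Md_carrier by (metis (full_types))
      have "res {j} ?f = f (h j)" if j: "j \<in> J" for j
        by (rule pe_ext) (use fj[OF j] j in \<open>auto simp: res_pe f'_pe Md_carrier\<close>)
      then have "g N (res {k N} ?f) = C x N" if "N \<in> F" for N using k[OF that] f(2)[OF that] by simp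
      then have "H ?f = finsum M (C x) F" unfolding H_def
        using Cpi[OF x] by (intro M.finsum_cong') (auto simp: c_def)
      then have "H ?f = x" using C(2)[OF x] by simp
      then show "x \<in> restrict H (carrier (Md J t')) ` carrier (Md J t')" using fc by (force simp: image_iff)
    qed (use Hc in auto)
  qed
  ultimately have "mod_iso L (Md J t') M" by (rule mod_isoI)
  then have "has_type M (mtype J t')" using v unfolding has_type_def by blast
  then have m: "m = mtype J t'" using has_type_unique[OF M t] by blast
  have inj: "i = j" if ij: "i \<in> J" "j \<in> J" "t' i = t' j" for i j
  proof (rule ccontr)
    assume "i \<noteq> j"
    then have "h i \<noteq> h j" using kh ij by metis
    moreover have "mod_iso L (M\<lparr>carrier := h i\<rparr>) (M\<lparr>carrier := h j\<rparr>)"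
      using has_type_iso_iff[OF left_module_restrict left_module_restrict T T, of "h i" "h j"] sub hJ ij
      by (simp add: t'_def)
    ultimately show False using F(3) hJ ij by blast
  qed
  have "card {j \<in> J. t' j = X} \<le> Suc 0"
    by (subst card_le_Suc0_iff_eq) (auto simp: J_def intro: inj[unfolded J_def])
  then show ?thesis by (simp add: m count_mtype J_def)
qed

text \<open>The summands \<open>Md {j} t\<close> of the model, carried to \<open>M\<close> by an
  isomorphism, form the required family.\<close>

lemma distinct_imp_basic:
  fixes M :: "('a, 'm) module"
  assumes fg: "fg_module L M" and ty: "has_type M m" and b: "\<And>X. count m X \<le> 1"
  shows "basic L M"
proof -
  have M: "left_module L M" using fg by (rule fg_moduleD)
  interpret plain_module L M using M by (simp add: plain_module_def)
  obtain J t where J: "valid J t" "mtype J t = m" "mod_iso L (Md J t) M" using ty by (auto simp: has_type_def)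
  obtain h where h: "h \<in> mod_hom L (Md J t) M" "bij_betw h (carrier (Md J t)) (carrier M)"
    using J(3) by (auto simp: mod_iso_def)
  interpret h: module_hom L "Md J t" M h using M left_module_Md[OF J(1)] h(1) by (intro module_homI)
  have fin: "finite J" using J(1) by (simp add: valid_def)
  have inj: "i = j" if "i \<in> J" "j \<in> J" "t i = t j" for i j
  proof (rule ccontr)
    assume "i \<noteq> j"
    then have "card {i, j} \<le> card {l \<in> J. t l = t j}" using that fin by (intro card_mono) auto
    then show False using b[of "t j"] \<open>i \<noteq> j\<close> by (simp add: J(2)[symmetric] count_mtype fin)
  qed
  define S where "S j = h ` carrier (Md {j} t)" for j
  have vj: "valid {j} t" if "j \<in> J" for j using valid_subset[OF J(1)] that by auto
  have inJ: "f \<in> carrier (Md J t)" if "j \<in> J" "f \<in> carrier (Md {j} t)" for f j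
    using Md_mono[of "{j}" J t] that by auto
  have cS: "complementary L M (S j) (h ` carrier (Md (J - {j}) t))"
    "mod_iso L (Md {j} t) (M\<lparr>carrier := S j\<rparr>)" if "j \<in> J" for j
  proof -
    have "complementary L (Md J t) (carrier (Md {j} t)) (carrier (Md (J - {j}) t))"
      by (rule complementary_Md[OF J(1)]) (use that in auto)
    from complementary_image[OF h.M.left_module_axioms M h this]
    show "complementary L M (S j) (h ` carrier (Md (J - {j}) t))" "mod_iso L (Md {j} t) (M\<lparr>carrier := S j\<rparr>)"
      by (simp_all add: S_def Md_carrier_update)
  qed
  have subS: "submodule (S j) L M" if "j \<in> J" for j using cS(1)[OF that] by (simp add: complementary_def)
  have tS: "has_type (M\<lparr>carrier := S j\<rparr>) {#t j#}" if "j \<in> J" for j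
    using has_type_iso[OF has_type_Md[OF vj[OF that]] cS(2)[OF that]] by (simp add: mtype_singleton)
  have indec: "indecomposable L (M\<lparr>carrier := S j\<rparr>)" if "j \<in> J" for j
    using indecomposable_iff[OF fg_summand[OF fg cS(1)[OF that]] tS[OF that]] by simp
  have noniso: "i = j" if "i \<in> J" "j \<in> J" "mod_iso L (M\<lparr>carrier := S i\<rparr>) (M\<lparr>carrier := S j\<rparr>)" for i j
    using has_type_iso_iff[OF left_module_restrict[OF subS] left_module_restrict[OF subS] tS tS] that inj by auto
  have injS: "inj_on S J"
  proof
    fix i j assume ij: "i \<in> J" "j \<in> J" "S i = S j"
    then show "i = j" using noniso[OF ij(1,2)] mod_iso_refl[OF left_module_restrict[OF subS[OF ij(2)]]] by simp
  qed
  have "internal_direct_sum L M (S ` J)" unfolding internal_direct_sum_def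
  proof (intro conjI ballI)
    fix x assume "x \<in> carrier M"
    then obtain f where f: "f \<in> carrier (Md J t)" "x = h f" using h(2) unfolding bij_betw_def by blast
    have rc: "res {j} f \<in> carrier (Md {j} t)" if "j \<in> J" for j
      using res_carrier[OF f(1), of "{j}"] that by (simp add: Int_absorb1)
    define c where "c = (\<lambda>N\<in>S ` J. h (res {inv_into J S N} f))"
    have cS: "c (S j) = h (res {j} f)" if "j \<in> J" for j using that injS by (simp add: c_def)
    have sumj: "finsum M c' (S ` J) = h (finsum (Md J t) g J)"
      if "\<And>j. j \<in> J ==> g j \<in> carrier (Md {j} t)" "\<And>j. j \<in> J ==> c' (S j) = h (g j)" for c' g
    proof -
      have gJ: "g \<in> J \<rightarrow> carrier (Md J t)" using that(1) inJ by blast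
      have hg: "h (g j) \<in> carrier M" if "j \<in> J" for j using gJ that h.closed by blast
      then have "c' \<in> S ` J \<rightarrow> carrier M" using that(2) by auto
      then have "finsum M c' (S ` J) = finsum M (\<lambda>j. c' (S j)) J" using M.finsum_reindex injS by blast
      also have "\<dots> = finsum M (\<lambda>j. h (g j)) J" using that(2) hg by (intro M.finsum_cong') auto
      finally show ?thesis using h.finsum[OF fin gJ] by simp
    qed
    \<comment> \<open>In the model the components of \<open>f\<close> are its restrictions to single
      summands, and there is no other choice. This gives existence and uniqueness in
      \<open>M\<close>.\<close>
    have fg: "f = finsum (Md J t) g J \<longleftrightarrow> (\<forall>j\<in>J. g j = res {j} f)" if g: "\<And>j. j \<in> J ==> g j \<in> carrier (Md {j} t)" for g
    proof -
      have gJ: "g \<in> J \<rightarrow> carrier (Md J t)" using g inJ by blast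
      have gz: "g i (pe j u) = 0" if "i \<in> J" "i \<noteq> j" for i j u using g[OF that(1)] that(2) unfolding Md_carrier by blast
      have val: "finsum (Md J t) g J (pe j u) = (if j \<in> J then g j (pe j u) else 0)" for j u
      proof -
        have "(\<Sum>i\<in>J. g i (pe j u)) = (\<Sum>i\<in>J. if i = j then g i (pe j u) else 0)"
          by (rule sum.cong) (use gz in auto)
        then show ?thesis using finsum_Md[OF J(1) fin gJ] fin by simp
      qed
      show ?thesis
      proof
        assume eq: "f = finsum (Md J t) g J"
        show "\<forall>j\<in>J. g j = res {j} f"
        proof
          fix j assume j: "j \<in> J"
          show "g j = res {j} f"
          proof (rule pe_ext)
            fix i u show "g j (pe i u) = res {j} f (pe i u)"
              using val[of i u] gz[OF j, of i u] j unfolding eq by (cases "i = j") (simp_all add: res_pe)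
          qed
        qed
      next
        assume eq: "\<forall>j\<in>J. g j = res {j} f"
        show "f = finsum (Md J t) g J"
        proof (rule pe_ext)
          fix i u show "f (pe i u) = finsum (Md J t) g J (pe i u)"
            using eq f(1) unfolding val by (auto simp: res_pe Md_carrier)
        qed
      qed
    qed
    show "\<exists>!c. c \<in> (\<Pi>\<^sub>E N\<in>S ` J. N) \<and> x = finsum M c (S ` J)"
    proof (rule ex1I[of _ c], intro conjI)
      show "c \<in> (\<Pi>\<^sub>E N\<in>S ` J. N)" using cS rc by (auto simp: S_def c_def)
      show "x = finsum M c (S ` J)"
        using sumj[of "\<lambda>j. res {j} f" c] rc cS fg[of "\<lambda>j. res {j} f"] f(2) by auto
      fix c' assume c': "c' \<in> (\<Pi>\<^sub>E N\<in>S ` J. N) \<and> x = finsum M c' (S ` J)"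
      have "\<exists>g. g \<in> carrier (Md {j} t) \<and> c' (S j) = h g" if "j \<in> J" for j
        using c' that by (auto simp: PiE_iff S_def)
      then obtain g where g: "\<And>j. j \<in> J ==> g j \<in> carrier (Md {j} t)" "\<And>j. j \<in> J ==> c' (S j) = h (g j)" by metis
      have "h f = h (finsum (Md J t) g J)" using sumj[OF g] c' f(2) by simp
      moreover have "finsum (Md J t) g J \<in> carrier (Md J t)" using g(1) inJ by (intro h.M.M.finsum_closed) blast
      ultimately have "f = finsum (Md J t) g J" using h(2) f(1) unfolding bij_betw_def by (meson inj_onD)
      then have "g j = res {j} f" if "j \<in> J" for j using fg[OF g(1)] that by blast
      then have "c' N = c N" if "N \<in> S ` J" for N using that g(2) cS by auto
      then show "c' = c" using c' \<open>c \<in> (\<Pi>\<^sub>E N\<in>S ` J. N)\<close> by (metis (no_types, lifting) PiE_ext)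
    qed
  qed (use fin subS in auto)
  then show ?thesis unfolding basic_def using indec noniso by (intro exI[of _ "S ` J"]) auto
qed

lemma basic_iff:
  "[|fg_module L M; has_type M m|] ==> basic L M \<longleftrightarrow> (\<forall>X. count m X \<le> 1)"
  using basic_imp_distinct distinct_imp_basic by blast

lemma cf_support: "[|a \<in> carrier L; cf a (x, y) \<noteq> 0|] ==> x \<in> V \<and> (y = x \<or> y \<in> E `` {x})"
  using cf_nonzero[of a x y] arcD by blast

text \<open>The elements with coefficients only at the pairs (x, y) for a fixed \<open>x\<close>
  form the left ideal generated by the trivial path of \<open>x\<close>, that is P_x.
  \<open>G\<close> files the coefficient at (x, y) under the coordinate \<open>y\<close> of the
  summand \<open>x\<close>.\<close>

lemma regular_module_type:
  "has_type (regular_module L) (mtype V (\<lambda>x. (x, E `` {x})))" "fg_module L (regular_module L)"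
proof -
  let ?t = "\<lambda>x. (x, E `` {x})"
  have v: "valid V ?t" using finV by (simp add: valid_def)
  define G where "G a = (\<lambda>i. cf a (prod_decode i))" for a
  have G_pe: "G a (pe x y) = cf a (x, y)" for a x y by (simp add: G_def)
  have "restrict G (carrier (regular_module L)) \<in> mod_hom L (regular_module L) (Md V ?t)"
  proof (rule mod_hom_restrictI)
    show "G a \<in> carrier (Md V ?t)" if "a \<in> carrier (regular_module L)" for a
      unfolding Md_carrier G_pe using cf_support that by (auto simp: regular_module_def)
    show "G (a \<oplus>\<^bsub>regular_module L\<^esub> b) = G a \<oplus>\<^bsub>Md V ?t\<^esub> G b"
      if "a \<in> carrier (regular_module L)" "b \<in> carrier (regular_module L)" for a b
      by (rule pe_ext) (use that in \<open>simp add: Md_add G_pe regular_module_def cf_add\<close>)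
    show "G (a \<odot>\<^bsub>regular_module L\<^esub> b) = a \<odot>\<^bsub>Md V ?t\<^esub> G b"
      if ab: "a \<in> carrier L" "b \<in> carrier (regular_module L)" for a b
    proof (rule pe_ext)
      fix x y
      have ab': "a \<in> carrier L" "b \<in> carrier L" using ab by (auto simp: regular_module_def)
      show "G (a \<odot>\<^bsub>regular_module L\<^esub> b) (pe x y) = (a \<odot>\<^bsub>Md V ?t\<^esub> G b) (pe x y)"
        using cf_nonzero[OF ab'(1), of x y] cf_nonzero[OF ab'(2), of x y]
        by (cases "cf a (x, y) = 0"; cases "cf b (x, y) = 0")
          (auto simp: G_pe Md_smult regular_module_def cf_mult[OF ab'])
    qed
  qed (auto simp: regular_module_def)
  moreover have "bij_betw (restrict G (carrier (regular_module L))) (carrier (regular_module L)) (carrier (Md V ?t))"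
  proof (rule bij_betw_imageI)
    show "inj_on (restrict G (carrier (regular_module L))) (carrier (regular_module L))"
    proof
      fix a b assume ab: "a \<in> carrier (regular_module L)" "b \<in> carrier (regular_module L)"
        "restrict G (carrier (regular_module L)) a = restrict G (carrier (regular_module L)) b"
      then have "G a (pe x y) = G b (pe x y)" for x y by simp
      then show "a = b" using ab by (intro cf_eqI) (auto simp: G_pe regular_module_def)
    qed
    have "f \<in> G ` carrier L" if f: "f \<in> carrier (Md V ?t)" for f
    proof -
      have "el (\<lambda>(x, y). f (pe x y)) \<in> carrier L" "cf (el (\<lambda>(x, y). f (pe x y))) = (\<lambda>(x, y). f (pe x y))"
        using f unfolding Md_carrier by (subst el; auto)+
      moreover from this have "f = G (el (\<lambda>(x, y). f (pe x y)))"
        by (intro pe_ext) (simp add: G_pe)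
      ultimately show ?thesis by blast
    qed
    moreover have "G a \<in> carrier (Md V ?t)" if "a \<in> carrier L" for a
      unfolding Md_carrier G_pe using cf_support that by auto
    ultimately show "restrict G (carrier (regular_module L)) ` carrier (regular_module L) = carrier (Md V ?t)"
      by (auto simp: regular_module_def)
  qed
  ultimately have "mod_iso L (regular_module L) (Md V ?t)" by (rule mod_isoI)
  then have iso: "mod_iso L (Md V ?t) (regular_module L)"
    by (rule mod_iso_sym[OF R.left_module_regular left_module_Md[OF v]])
  show "has_type (regular_module L) (mtype V ?t)" using iso v unfolding has_type_def by blast
  show "fg_module L (regular_module L)" by (rule fg_module_iso[OF fg_Md[OF v] R.left_module_regular iso])
qed

lemma num_summands_regular: "num_summands L (regular_module L) = card V"
proof -
  have "set_mset (mtype V (\<lambda>x. (x, E `` {x}))) = (\<lambda>x. (x, E `` {x})) ` V" using finV by (simp add: mtype_def)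
  then show ?thesis using num_summands_has_type[OF regular_module_type(2,1)]
    by (simp add: card_image inj_on_def)
qed

end

section \<open>Minimal projective presentations\<close>

context plain_module
begin

text \<open>The scalar action of \<open>quot\<close> is a union of cosets over all representatives;
  these cosets coincide because \<open>N\<close> is a submodule.\<close>

lemma quot_cosets:
  assumes N: "submodule N R M"
  shows "carrier (quot M N) = (\<lambda>x. N +>\<^bsub>M\<^esub> x) ` carrier M"
    "[|x \<in> carrier M; y \<in> carrier M|] ==> (N +>\<^bsub>M\<^esub> x) \<oplus>\<^bsub>quot M N\<^esub> (N +>\<^bsub>M\<^esub> y) = N +>\<^bsub>M\<^esub> (x \<oplus>\<^bsub>M\<^esub> y)"
    "[|a \<in> carrier R; x \<in> carrier M|] ==> a \<odot>\<^bsub>quot M N\<^esub> (N +>\<^bsub>M\<^esub> x) = N +>\<^bsub>M\<^esub> (a \<odot>\<^bsub>M\<^esub> x)"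
    "[|x \<in> carrier M; y \<in> carrier M|] ==> N +>\<^bsub>M\<^esub> x = N +>\<^bsub>M\<^esub> y \<longleftrightarrow> x \<ominus>\<^bsub>M\<^esub> y \<in> N"
    "x \<in> carrier M ==> x \<in> N +>\<^bsub>M\<^esub> x"
    "[|x \<in> carrier M; y \<in> N +>\<^bsub>M\<^esub> x|] ==> y \<in> carrier M \<and> N +>\<^bsub>M\<^esub> y = N +>\<^bsub>M\<^esub> x"
proof -
  interpret N: abelian_subgroup N M
    using N by (intro abelian_subgroupI3) (auto simp: submodule_def additive_subgroup_def M.abelian_group_axioms)
  show "carrier (quot M N) = (\<lambda>x. N +>\<^bsub>M\<^esub> x) ` carrier M"
    by (auto simp: quot_def FactRing_def A_RCOSETS_def')
  show "(N +>\<^bsub>M\<^esub> x) \<oplus>\<^bsub>quot M N\<^esub> (N +>\<^bsub>M\<^esub> y) = N +>\<^bsub>M\<^esub> (x \<oplus>\<^bsub>M\<^esub> y)" if "x \<in> carrier M" "y \<in> carrier M"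
    using N.a_rcos_sum[OF that] by (simp add: quot_def FactRing_def)
  show self: "x \<in> N +>\<^bsub>M\<^esub> x" if "x \<in> carrier M" for x using N.a_rcos_self[OF that] .
  show eq: "N +>\<^bsub>M\<^esub> x = N +>\<^bsub>M\<^esub> y \<longleftrightarrow> x \<ominus>\<^bsub>M\<^esub> y \<in> N" if "x \<in> carrier M" "y \<in> carrier M" for x y
    using N.a_rcos_module[OF that(2,1)] N.a_repr_independence'[of x y] self[OF that(1)] that
    by (auto simp: a_minus_def)
  show mem: "y \<in> carrier M \<and> N +>\<^bsub>M\<^esub> y = N +>\<^bsub>M\<^esub> x" if "x \<in> carrier M" "y \<in> N +>\<^bsub>M\<^esub> x" for x y
    using that N.a_repr_independence'[OF that(2,1)] N.a_elemrcos_carrier[OF that] by simp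
  show "a \<odot>\<^bsub>quot M N\<^esub> (N +>\<^bsub>M\<^esub> x) = N +>\<^bsub>M\<^esub> (a \<odot>\<^bsub>M\<^esub> x)" if "a \<in> carrier R" "x \<in> carrier M"
  proof -
    have "N +>\<^bsub>M\<^esub> (a \<odot>\<^bsub>M\<^esub> y) = N +>\<^bsub>M\<^esub> (a \<odot>\<^bsub>M\<^esub> x)" if y: "y \<in> N +>\<^bsub>M\<^esub> x" for y
    proof -
      have yc: "y \<in> carrier M" "y \<ominus>\<^bsub>M\<^esub> x \<in> N" using mem[OF \<open>x \<in> carrier M\<close> y] eq \<open>x \<in> carrier M\<close> by auto
      then have "a \<odot>\<^bsub>M\<^esub> y \<ominus>\<^bsub>M\<^esub> a \<odot>\<^bsub>M\<^esub> x \<in> N"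
        using N \<open>a \<in> carrier R\<close> \<open>x \<in> carrier M\<close> by (simp add: submodule_iff smult_minus_distr[symmetric])
      then show ?thesis
        using eq[OF smult_closed[OF \<open>a \<in> carrier R\<close> yc(1)] smult_closed[OF \<open>a \<in> carrier R\<close> \<open>x \<in> carrier M\<close>]] by simp
    qed
    then have "(\<Union>y\<in>N +>\<^bsub>M\<^esub> x. N +>\<^bsub>M\<^esub> (a \<odot>\<^bsub>M\<^esub> y)) = (\<Union>y\<in>N +>\<^bsub>M\<^esub> x. N +>\<^bsub>M\<^esub> (a \<odot>\<^bsub>M\<^esub> x))"
      by (rule SUP_cong[OF refl])
    also have "\<dots> = N +>\<^bsub>M\<^esub> (a \<odot>\<^bsub>M\<^esub> x)" using self[OF that(2)] by blast
    finally have "(\<Union>y\<in>N +>\<^bsub>M\<^esub> x. N +>\<^bsub>M\<^esub> (a \<odot>\<^bsub>M\<^esub> y)) = N +>\<^bsub>M\<^esub> (a \<odot>\<^bsub>M\<^esub> x)" .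
    then show ?thesis by (simp add: quot_def)
  qed
qed

end

lemma projectiveD:
  fixes A :: "('k::field, 'a) module" and P X Y :: "('k, 'a) fmod"
  assumes "projective A P" "fg_module A X" "fg_module A Y" "g \<in> mod_hom A X Y" "g ` carrier X = carrier Y" "h \<in> mod_hom A P Y"
  obtains h' where "h' \<in> mod_hom A P X" "\<And>x. x \<in> carrier P ==> g (h' x) = h x"
proof -
  have "\<exists>h'\<in>mod_hom A P X. \<forall>x\<in>carrier P. g (h' x) = h x"
    using assms unfolding projective_def by blast
  then show thesis using that by blast
qed

lemma superfluous_kernel_onto:
  assumes P: "left_module R P" "left_module R P'" "left_module R X"
    and hom: "u \<in> mod_hom R P P'" "p \<in> mod_hom R P X" "p' \<in> mod_hom R P' X"
    and onto: "p ` carrier P = carrier X" and comm: "\<And>x. x \<in> carrier P ==> p' (u x) = p x"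
    and sf: "superfluous R P' (hom_kernel P' X p')"
  shows "u ` carrier P = carrier P'"
proof -
  interpret u: module_hom R P P' u using P hom by (intro module_homI)
  interpret p: module_hom R P X p using P hom by (intro module_homI)
  interpret p': module_hom R P' X p' using P hom by (intro module_homI)
  have sub: "submodule (u ` carrier P) R P'" by (rule u.submodule_image[OF u.M.submodule_carrier])
  have "y \<in> (u ` carrier P) <+>\<^bsub>P'\<^esub> hom_kernel P' X p'" if y: "y \<in> carrier P'" for y
  proof -
    obtain x where x: "x \<in> carrier P" "p x = p' y" using onto p'.closed[OF y] by (metis imageE)
    have "y \<ominus>\<^bsub>P'\<^esub> u x \<in> hom_kernel P' X p'"
      using x y comm u.closed by (simp add: hom_kernel_def p'.diff p'.closed p.N.minus_eq_zero_iff)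
    moreover have "y = u x \<oplus>\<^bsub>P'\<^esub> (y \<ominus>\<^bsub>P'\<^esub> u x)"
      using y u.closed[OF x(1)] by (simp add: a_minus_def u.N.M.a_comm[of y] u.N.M.r_neg2)
    ultimately show ?thesis unfolding set_add_def' using x(1) by blast
  qed
  moreover have "(u ` carrier P) <+>\<^bsub>P'\<^esub> hom_kernel P' X p' \<subseteq> carrier P'"
    unfolding set_add_def' hom_kernel_def using u.closed by auto
  ultimately show ?thesis using sf sub unfolding superfluous_def by blast
qed

text \<open>A lift \<open>u\<close> from one cover to the other is onto. A section \<open>s\<close>
  of \<open>u\<close> is again a map of covers, hence also onto, and so \<open>u\<close> is
  injective.\<close>

lemma superfluous_cover_iso:
  fixes A :: "('k::field, 'a) module" and P P' X :: "('k, 'a) fmod"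
  assumes P: "projective A P" "projective A P'" and X: "left_module A X"
    and p: "p \<in> mod_hom A P X" "p ` carrier P = carrier X" "superfluous A P (hom_kernel P X p)"
    and p': "p' \<in> mod_hom A P' X" "p' ` carrier P' = carrier X" "superfluous A P' (hom_kernel P' X p')"
  obtains u where "u \<in> mod_hom A P P'" "bij_betw u (carrier P) (carrier P')" "\<And>x. x \<in> carrier P ==> p' (u x) = p x"
proof -
  have fg: "fg_module A P" "fg_module A P'" using P by (auto simp: projective_def)
  then have lm: "left_module A P" "left_module A P'" by (auto simp: fg_module_def)
  have fgX: "fg_module A X" by (rule fg_module_image[OF fg(1) X p(1,2)])
  obtain u where u: "u \<in> mod_hom A P P'" "\<And>x. x \<in> carrier P ==> p' (u x) = p x"
    using projectiveD[OF P(1) fg(2) fgX p'(1,2) p(1)] by blast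
  have onto: "u ` carrier P = carrier P'"
    by (rule superfluous_kernel_onto[OF lm X u(1) p(1) p'(1) p(2) u(2) p'(3)])
  obtain s where s: "s \<in> mod_hom A P' P" "\<And>y. y \<in> carrier P' ==> u (s y) = y"
    using projectiveD[OF P(2) fg(1) fg(2) u(1) onto mod_hom_id[OF lm(2)]] by (metis restrict_apply')
  have "p (s y) = p' y" if "y \<in> carrier P'" for y
    using u(2)[OF mod_hom_closed[OF s(1) that]] s(2)[OF that] by simp
  then have sonto: "s ` carrier P' = carrier P"
    by (rule superfluous_kernel_onto[OF lm(2,1) X s(1) p'(1) p(1) p'(2) _ p(3)])
  have "inj_on u (carrier P)"
  proof
    fix x y assume xy: "x \<in> carrier P" "y \<in> carrier P" "u x = u y"
    obtain x' where "x' \<in> carrier P'" "x = s x'" using sonto xy(1) by blast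
    moreover obtain y' where "y' \<in> carrier P'" "y = s y'" using sonto xy(2) by blast
    ultimately show "x = y" using xy(3) s(2) by metis
  qed
  then show thesis using that u onto by (auto simp: bij_betw_def)
qed

text \<open>Uniqueness of covers is applied to \<open>M\<close> and then to the kernel of the cover
  of \<open>M\<close>. This allows \<open>tau\<close> to be computed from the explicit presentation
  whichever one was chosen.\<close>

lemma min_proj_presentation_unique:
  fixes A :: "('k::field, 'a) module" and M :: "('k, 'a) fmod"
  assumes M: "left_module A M"
    and a: "min_proj_presentation A P1 f P0 p M" and b: "min_proj_presentation A P1' f' P0' p' M"
  obtains u1 u0 where "u1 \<in> mod_hom A P1 P1'" "bij_betw u1 (carrier P1) (carrier P1')"
    "u0 \<in> mod_hom A P0 P0'" "bij_betw u0 (carrier P0) (carrier P0')"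
    "\<And>x. x \<in> carrier P1 ==> f' (u1 x) = u0 (f x)"
proof -
  note a = a[unfolded min_proj_presentation_def] and b = b[unfolded min_proj_presentation_def]
  have lm: "left_module A P1" "left_module A P1'" "left_module A P0" "left_module A P0'"
    using a b by (auto simp: projective_def fg_module_def)
  obtain u0 where u0: "u0 \<in> mod_hom A P0 P0'" "bij_betw u0 (carrier P0) (carrier P0')" "\<And>x. x \<in> carrier P0 ==> p' (u0 x) = p x"
    by (rule superfluous_cover_iso[of A P0 P0' M p p']) (use M a b in auto)
  interpret u0: module_hom A P0 P0' u0 using lm u0 by (intro module_homI)
  interpret p: module_hom A P0 M p using lm a M by (intro module_homI) auto
  interpret p': module_hom A P0' M p' using lm b M by (intro module_homI) auto
  interpret f: module_hom A P1 P0 f using lm a by (intro module_homI) auto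
  interpret f': module_hom A P1' P0' f' using lm b by (intro module_homI) auto
  let ?K = "hom_kernel P0' M p'"
  let ?X = "P0'\<lparr>carrier := ?K\<rparr>"
  have X: "left_module A ?X" by (rule u0.N.left_module_restrict[OF p'.submodule_kernel])
  have imK: "u0 ` hom_kernel P0 M p = ?K"
  proof (intro equalityI subsetI)
    fix y assume "y \<in> u0 ` hom_kernel P0 M p"
    then show "y \<in> ?K" using u0(3) u0.closed by (auto simp: hom_kernel_def)
  next
    fix y assume y: "y \<in> ?K"
    then obtain x where "x \<in> carrier P0" "y = u0 x" using u0(2) by (auto simp: hom_kernel_def bij_betw_def)
    then show "y \<in> u0 ` hom_kernel P0 M p" using y u0(3) by (auto simp: hom_kernel_def)
  qed
  have fK: "f ` carrier P1 = hom_kernel P0 M p" "f' ` carrier P1' = ?K" using a b by auto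
  have q: "compose (carrier P1) u0 f \<in> mod_hom A P1 P0'" by (rule mod_hom_compose[OF lm(1) f.hom u0(1)])
  have im: "compose (carrier P1) u0 f ` carrier P1 = ?K" using fK imK by (auto simp: compose_def image_image[symmetric])
  have q': "compose (carrier P1) u0 f \<in> mod_hom A P1 ?X"
    using q im by (auto simp: mod_hom_def PiE_iff)
  have f': "f' \<in> mod_hom A P1' ?X"
    using f'.hom fK(2) by (auto simp: mod_hom_def PiE_iff)
  have "hom_kernel P1 ?X (compose (carrier P1) u0 f) = hom_kernel P1 P0 f"
    using u0(2) u0.zero f.closed u0.inj_iff by (auto simp: hom_kernel_def compose_def bij_betw_def)
  moreover have "hom_kernel P1' ?X f' = hom_kernel P1' P0' f'" by (simp add: hom_kernel_def)
  ultimately obtain u1 where "u1 \<in> mod_hom A P1 P1'" "bij_betw u1 (carrier P1) (carrier P1')"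
    "\<And>x. x \<in> carrier P1 ==> f' (u1 x) = compose (carrier P1) u0 f x"
    using superfluous_cover_iso[of A P1 P1' ?X "compose (carrier P1) u0 f" f'] X q' f' im fK(2) a b by auto
  then show thesis using that u0 by (simp add: compose_def)
qed

section \<open>The explicit minimal projective presentation\<close>

context radsq
begin

definition prj :: "nat set => shape => bool" where
  "prj J t \<longleftrightarrow> valid J t \<and> (\<forall>j\<in>J. snd (t j) = E `` {fst (t j)})"

text \<open>Without missed arrows the only relation is that the image of a generator lies over its
  vertex, and multiplication by the trivial path moves any preimage there.\<close>

lemma projective_Md:
  assumes "prj J t" shows "projective L (Md J t)"
proof -
  have v: "valid J t" using assms by (simp add: prj_def)
  show ?thesis unfolding projective_def
  proof (intro conjI fg_Md[OF v] allI ballI impI)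
    fix X Y :: "('k, 'a) fmod" and g h
    assume g: "g \<in> mod_hom L X Y" and h: "h \<in> mod_hom L (Md J t) Y"
      and fg: "fg_module L X \<and> fg_module L Y \<and> g ` carrier X = carrier Y"
    have X: "left_module L X" and Y: "left_module L Y" using fg by (auto simp: fg_module_def)
    interpret g: module_hom L X Y g using X Y g by (intro module_homI)
    interpret h: module_hom L "Md J t" Y h using left_module_Md[OF v] Y h by (intro module_homI)
    have "\<exists>x. x \<in> carrier X \<and> g x = h (gen t j)" if "j \<in> J" for j
    proof -
      have "h (gen t j) \<in> g ` carrier X" using fg h.closed[OF gen_carrier[OF that]] by simp
      then show ?thesis by auto
    qed
    then obtain x where x: "\<And>j. j \<in> J ==> x j \<in> carrier X \<and> g (x j) = h (gen t j)" by metis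
    define w where "w j = idem (fst (t j)) \<odot>\<^bsub>X\<^esub> x j" for j
    have rel: "relations X J t w" unfolding relations_def
    proof (intro ballI conjI)
      fix j assume j: "j \<in> J"
      show "w j \<in> carrier X" "idem (fst (t j)) \<odot>\<^bsub>X\<^esub> w j = w j"
        using x[OF j] by (simp_all add: w_def g.M.smult_closed g.M.smult_assoc[symmetric] mult_idem_idem)
      fix y assume "y \<in> E `` {fst (t j)} - snd (t j)"
      then show "arr (fst (t j)) y \<odot>\<^bsub>X\<^esub> w j = \<zero>\<^bsub>X\<^esub>" using assms j by (auto simp: prj_def)
    qed
    note he = hext[OF X v rel]
    have "compose (carrier (Md J t)) g (hext X J t w) = h"
    proof (rule Md_hom_eqI[OF Y v mod_hom_compose[OF left_module_Md[OF v] he(1) g] h])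
      fix j assume j: "j \<in> J"
      have "idem (fst (t j)) \<odot>\<^bsub>Md J t\<^esub> gen t j = gen t j"
      proof (rule pe_ext)
        fix i u show "(idem (fst (t j)) \<odot>\<^bsub>Md J t\<^esub> gen t j) (pe i u) = gen t j (pe i u)"
          using v j valid_neq[OF v j] by (auto simp: Md_smult gen_def cf_idem valid_def)
      qed
      then show "compose (carrier (Md J t)) g (hext X J t w) (gen t j) = h (gen t j)"
        using he(2)[OF j] gen_carrier[OF j, of t] x[OF j] h.smult[of "idem (fst (t j))" "gen t j"]
        by (simp add: compose_def w_def g.smult)
    qed
    then show "\<exists>h'\<in>mod_hom L (Md J t) X. \<forall>x\<in>carrier (Md J t). g (h' x) = h x"
      using he(1) by (metis compose_eq)
  qed
qed

text \<open>\<open>pt0\<close> enlarges each summand \<open>(x, A)\<close> to P_x. The kernel of the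
  projection \<open>pp\<close> is a sum of simple modules S_y, one for each missed arrow of each
  summand, and \<open>pf\<close> covers it by the P_y. These are indexed in \<open>J1\<close> by the
  codes \<open>pe j y\<close> of summand and missed target, from which \<open>pt1\<close> reads off
  the vertex \<open>y\<close>.\<close>

definition pt0 :: "shape => shape" where
  "pt0 t j = (fst (t j), E `` {fst (t j)})"
definition pp :: "nat set => shape => (nat => 'k) => nat => 'k" where
  "pp J t = (\<lambda>f\<in>carrier (Md J (pt0 t)). \<lambda>i. case prod_decode i of (j, v) =>
     if v = fst (t j) \<or> v \<in> snd (t j) then f i else 0)"
definition J1 :: "nat set => shape => nat set" where
  "J1 J t = {pe j y |j y. j \<in> J \<and> y \<in> E `` {fst (t j)} - snd (t j)}"
definition pt1 :: "shape" where
  "pt1 i = (snd (prod_decode i), E `` {snd (prod_decode i)})"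
definition pf :: "nat set => shape => (nat => 'k) => nat => 'k" where
  "pf J t = (\<lambda>u\<in>carrier (Md (J1 J t) pt1). \<lambda>i. case prod_decode i of (j, v) =>
     if v \<in> E `` {fst (t j)} - snd (t j) then u (pe i v) else 0)"

lemma prj_pt0: "valid J t ==> prj J (pt0 t)"
  by (simp add: prj_def valid_def pt0_def)

lemma J1_iff: "pe j y \<in> J1 J t \<longleftrightarrow> j \<in> J \<and> y \<in> E `` {fst (t j)} - snd (t j)"
  by (auto simp: J1_def)

lemma prj_pt1: "valid J t ==> prj (J1 J t) pt1"
proof -
  assume v: "valid J t"
  have "J1 J t \<subseteq> (\<lambda>(j, y). pe j y) ` Sigma J (\<lambda>j. E `` {fst (t j)})" by (auto simp: J1_def)
  then have "finite (J1 J t)" by (rule finite_subset) (use v finite_out in \<open>auto simp: valid_def\<close>)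
  then show ?thesis using arcD by (auto simp: prj_def valid_def pt1_def J1_def)
qed

lemma pp_pe: "f \<in> carrier (Md J (pt0 t)) ==> pp J t f (pe j v) = (if v = fst (t j) \<or> v \<in> snd (t j) then f (pe j v) else 0)"
  by (simp add: pp_def)

lemma pf_pe: "u \<in> carrier (Md (J1 J t) pt1) ==> pf J t u (pe j v) = (if v \<in> E `` {fst (t j)} - snd (t j) then u (pe (pe j v) v) else 0)"
  by (simp add: pf_def)

text \<open>Nakayama's lemma by hand. \<open>K\<close> has no top coordinates, so arrows kill it. If
  \<open>N\<close> and \<open>K\<close> generate the module, applying arrows shows that
  \<open>N\<close> contains every image of an arrow, hence the radical and with it
  \<open>K\<close>.\<close>

lemma superfluous_rad:
  assumes pj: "prj J t" and K: "submodule K L (Md J t)" "\<And>f j. f \<in> K ==> f (pe j (fst (t j))) = 0"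
  shows "superfluous L (Md J t) K"
  unfolding superfluous_def
proof (intro allI impI)
  fix N assume N: "submodule N L (Md J t) \<and> N <+>\<^bsub>Md J t\<^esub> K = carrier (Md J t)"
  have v: "valid J t" using pj by (simp add: prj_def)
  interpret left_module L "Md J t" by (rule left_module_Md[OF v])
  have killK: "arr x y \<odot>\<^bsub>Md J t\<^esub> f = \<zero>\<^bsub>Md J t\<^esub>" if f: "f \<in> K" for f x y
  proof (rule pe_ext)
    fix j u show "(arr x y \<odot>\<^bsub>Md J t\<^esub> f) (pe j u) = \<zero>\<^bsub>Md J t\<^esub> (pe j u)"
      using K(2)[OF f, of j] by (auto simp: Md_smult Md_zero cf_arr)
  qed
  have car: "N \<subseteq> carrier (Md J t)" "K \<subseteq> carrier (Md J t)" using N K by (auto simp: submodule_iff)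
  have dec: "\<exists>n\<in>N. \<exists>k\<in>K. f = n \<oplus>\<^bsub>Md J t\<^esub> k" if "f \<in> carrier (Md J t)" for f
  proof -
    have "f \<in> N <+>\<^bsub>Md J t\<^esub> K" using N that by simp
    then show ?thesis unfolding set_add_def' by blast
  qed
  have arrN: "arr x y \<odot>\<^bsub>Md J t\<^esub> f \<in> N" if f: "f \<in> carrier (Md J t)" for f x y
  proof -
    obtain n k where nk: "n \<in> N" "k \<in> K" "f = n \<oplus>\<^bsub>Md J t\<^esub> k" using dec[OF f] by blast
    then have "arr x y \<odot>\<^bsub>Md J t\<^esub> f = arr x y \<odot>\<^bsub>Md J t\<^esub> n"
      using killK[OF nk(2)] car by (simp add: smult_r_distr subset_iff smult_closed)
    then show ?thesis using N nk(1) by (simp add: submodule_iff)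
  qed
  have "K \<subseteq> N"
  proof
    fix k assume k: "k \<in> K"
    have "idem x \<odot>\<^bsub>Md J t\<^esub> k \<in> N" for x
    proof -
      \<comment> \<open>\<open>g\<close> puts the radical coordinates of \<open>k\<close> at
        \<open>x\<close> on the tops above them, so that the arrow into \<open>x\<close> brings them
        back.\<close>
      define g where "g = (\<lambda>i. case prod_decode i of (j, u) => if u = fst (t j) \<and> x \<in> snd (t j) then k (pe j x) else 0)"
      have g_pe: "g (pe j u) = (if u = fst (t j) \<and> x \<in> snd (t j) then k (pe j x) else 0)" for j u by (simp add: g_def)
      have kc: "k \<in> carrier (Md J t)" using k car by blast
      have gc: "g \<in> carrier (Md J t)" unfolding Md_carrier g_pe using kc unfolding Md_carrier by auto
      have "idem x \<odot>\<^bsub>Md J t\<^esub> k = arr (inc x) x \<odot>\<^bsub>Md J t\<^esub> g"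
      proof (rule pe_ext)
        fix j u
        show "(idem x \<odot>\<^bsub>Md J t\<^esub> k) (pe j u) = (arr (inc x) x \<odot>\<^bsub>Md J t\<^esub> g) (pe j u)"
        proof (cases "j \<in> J")
          case False
          then have "k (pe j u) = 0" for u using kc unfolding Md_carrier by blast
          then show ?thesis by (auto simp: Md_smult g_pe)
        next
          case True
          have E: "(fst (t j), y) \<in> E \<and> inc y = fst (t j) \<and> y \<in> V" if "y \<in> snd (t j)" for y
            using v True that inc arcD unfolding valid_def by blast
          show ?thesis using valid_neq[OF v True] K(2)[OF k, of j] E[of x]
            by (cases "x \<in> snd (t j)") (auto simp: Md_smult g_pe cf_idem cf_arr)
        qed
      qed
      then show ?thesis using arrN[OF gc] by simp
    qed
    then show "k \<in> N" using submodule_idemI[OF left_module_Md[OF v]] N k car by blast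
  qed
  have "f \<in> N" if f: "f \<in> carrier (Md J t)" for f
  proof -
    obtain n k where "n \<in> N" "k \<in> K" "f = n \<oplus>\<^bsub>Md J t\<^esub> k" using dec[OF f] by blast
    then show ?thesis using N \<open>K \<subseteq> N\<close> unfolding submodule_iff by blast
  qed
  then show "N = carrier (Md J t)" using car by blast
qed

lemma min_proj_presentation_Md:
  assumes v: "valid J t"
  shows "min_proj_presentation L (Md (J1 J t) pt1) (pf J t) (Md J (pt0 t)) (pp J t) (Md J t)"
proof -
  note pj0 = prj_pt0[OF v] and pj1 = prj_pt1[OF v]
  have v0: "valid J (pt0 t)" and v1: "valid (J1 J t) pt1" using pj0 pj1 by (auto simp: prj_def)
  interpret M: left_module L "Md J t" by (rule left_module_Md[OF v])
  interpret P0: left_module L "Md J (pt0 t)" by (rule left_module_Md[OF v0])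
  interpret P1: left_module L "Md (J1 J t) pt1" by (rule left_module_Md[OF v1])
  have pf: "pf J t \<in> mod_hom L (Md (J1 J t) pt1) (Md J (pt0 t))"
  proof -
    have c: "pf J t u \<in> carrier (Md J (pt0 t))" if u: "u \<in> carrier (Md (J1 J t) pt1)" for u
      unfolding Md_carrier pf_pe[OF u]
    proof (intro allI impI)
      fix j v assume "(if v \<in> E `` {fst (t j)} - snd (t j) then u (pe (pe j v) v) else 0) \<noteq> 0"
      then have "pe j v \<in> J1 J t" using u unfolding Md_carrier by (metis (full_types))
      then show "j \<in> J \<and> (v = fst (pt0 t j) \<or> v \<in> snd (pt0 t j))" by (auto simp: J1_iff pt0_def)
    qed
    have "restrict (pf J t) (carrier (Md (J1 J t) pt1)) \<in> mod_hom L (Md (J1 J t) pt1) (Md J (pt0 t))"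
    proof (rule mod_hom_restrictI[OF c])
      fix u w assume uw: "u \<in> carrier (Md (J1 J t) pt1)" "w \<in> carrier (Md (J1 J t) pt1)"
      show "pf J t (u \<oplus>\<^bsub>Md (J1 J t) pt1\<^esub> w) = pf J t u \<oplus>\<^bsub>Md J (pt0 t)\<^esub> pf J t w"
      proof (rule pe_ext)
        fix j v
        show "pf J t (u \<oplus>\<^bsub>Md (J1 J t) pt1\<^esub> w) (pe j v) = (pf J t u \<oplus>\<^bsub>Md J (pt0 t)\<^esub> pf J t w) (pe j v)"
          unfolding pf_pe[OF P1.M.a_closed[OF uw]] by (simp add: Md_add pf_pe uw)
      qed
    next
      fix a u assume au: "a \<in> carrier L" "u \<in> carrier (Md (J1 J t) pt1)"
      show "pf J t (a \<odot>\<^bsub>Md (J1 J t) pt1\<^esub> u) = a \<odot>\<^bsub>Md J (pt0 t)\<^esub> pf J t u"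
      proof (rule pe_ext)
        fix j v
        show "pf J t (a \<odot>\<^bsub>Md (J1 J t) pt1\<^esub> u) (pe j v) = (a \<odot>\<^bsub>Md J (pt0 t)\<^esub> pf J t u) (pe j v)"
          using P1.smult_closed[OF au] au(2) by (auto simp: pf_pe Md_smult pt0_def pt1_def)
      qed
    qed (auto simp: P1.smult_closed)
    then show ?thesis by (simp add: pf_def)
  qed
  have pp: "pp J t \<in> mod_hom L (Md J (pt0 t)) (Md J t)"
  proof -
    have "restrict (pp J t) (carrier (Md J (pt0 t))) \<in> mod_hom L (Md J (pt0 t)) (Md J t)"
    proof (rule mod_hom_restrictI)
      show "pp J t f \<in> carrier (Md J t)" if "f \<in> carrier (Md J (pt0 t))" for f
        unfolding Md_carrier pp_pe[OF that] using that unfolding Md_carrier by metis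
      fix f g assume fg: "f \<in> carrier (Md J (pt0 t))" "g \<in> carrier (Md J (pt0 t))"
      show "pp J t (f \<oplus>\<^bsub>Md J (pt0 t)\<^esub> g) = pp J t f \<oplus>\<^bsub>Md J t\<^esub> pp J t g"
      proof (rule pe_ext)
        fix j v
        show "pp J t (f \<oplus>\<^bsub>Md J (pt0 t)\<^esub> g) (pe j v) = (pp J t f \<oplus>\<^bsub>Md J t\<^esub> pp J t g) (pe j v)"
          unfolding pp_pe[OF P0.M.a_closed[OF fg]] by (simp add: Md_add pp_pe fg)
      qed
    next
      fix a f assume af: "a \<in> carrier L" "f \<in> carrier (Md J (pt0 t))"
      show "pp J t (a \<odot>\<^bsub>Md J (pt0 t)\<^esub> f) = a \<odot>\<^bsub>Md J t\<^esub> pp J t f"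
      proof (rule pe_ext)
        fix j v
        have "snd (t j) \<subseteq> E `` {fst (t j)}" if "f (pe j w) \<noteq> 0" for w
          using that af(2) v unfolding Md_carrier valid_def by blast
        then show "pp J t (a \<odot>\<^bsub>Md J (pt0 t)\<^esub> f) (pe j v) = (a \<odot>\<^bsub>Md J t\<^esub> pp J t f) (pe j v)"
          using P0.smult_closed[OF af] af(2)
          by (cases "f (pe j v) = 0"; cases "f (pe j (fst (t j))) = 0") (auto simp: pp_pe Md_smult pt0_def)
      qed
    qed (auto simp: P0.smult_closed)
    then show ?thesis by (simp add: pp_def)
  qed
  interpret pf: module_hom L "Md (J1 J t) pt1" "Md J (pt0 t)" "pf J t" using pf by unfold_locales
  interpret pp: module_hom L "Md J (pt0 t)" "Md J t" "pp J t" using pp by unfold_locales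
  have onto: "pp J t ` carrier (Md J (pt0 t)) = carrier (Md J t)"
  proof (intro equalityI subsetI)
    fix f assume f: "f \<in> carrier (Md J t)"
    then have f0: "f \<in> carrier (Md J (pt0 t))" using v unfolding Md_carrier pt0_def valid_def by (metis fst_conv snd_conv subsetD)
    have "pp J t f = f"
    proof (rule pe_ext)
      fix j v show "pp J t f (pe j v) = f (pe j v)" using f unfolding pp_pe[OF f0] Md_carrier by auto
    qed
    then show "f \<in> pp J t ` carrier (Md J (pt0 t))" using f0 by (metis imageI)
  qed (use pp.closed in auto)
  have kerp: "f \<in> hom_kernel (Md J (pt0 t)) (Md J t) (pp J t) \<longleftrightarrow>
      f \<in> carrier (Md J (pt0 t)) \<and> (\<forall>j v. v = fst (t j) \<or> v \<in> snd (t j) \<longrightarrow> f (pe j v) = 0)" for f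
  proof -
    have "pp J t f = (\<lambda>i. 0) \<longleftrightarrow> (\<forall>j v. v = fst (t j) \<or> v \<in> snd (t j) \<longrightarrow> f (pe j v) = 0)" if f: "f \<in> carrier (Md J (pt0 t))"
    proof
      assume "pp J t f = (\<lambda>i. 0)"
      then have "pp J t f (pe j v) = 0" for j v by simp
      then show "\<forall>j v. v = fst (t j) \<or> v \<in> snd (t j) \<longrightarrow> f (pe j v) = 0" unfolding pp_pe[OF f] by metis
    next
      assume "\<forall>j v. v = fst (t j) \<or> v \<in> snd (t j) \<longrightarrow> f (pe j v) = 0"
      then show "pp J t f = (\<lambda>i. 0)" by (intro pe_ext) (simp add: pp_pe[OF f])
    qed
    then show ?thesis by (auto simp: hom_kernel_def Md_zero)
  qed
  have im: "pf J t ` carrier (Md (J1 J t) pt1) = hom_kernel (Md J (pt0 t)) (Md J t) (pp J t)"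
  proof (intro equalityI subsetI)
    fix f assume "f \<in> pf J t ` carrier (Md (J1 J t) pt1)"
    then obtain u where u: "u \<in> carrier (Md (J1 J t) pt1)" "f = pf J t u" by blast
    then show "f \<in> hom_kernel (Md J (pt0 t)) (Md J t) (pp J t)"
      unfolding kerp using pf.closed[OF u(1)] by (auto simp: pf_pe[OF u(1)])
  next
    fix f assume f: "f \<in> hom_kernel (Md J (pt0 t)) (Md J t) (pp J t)"
    \<comment> \<open>The coordinate of \<open>f\<close> at the missed target \<open>y\<close> of
      the summand \<open>j\<close> becomes the top coordinate of the corresponding P_y.\<close>
    define u where "u = (\<lambda>i. case prod_decode i of (k, w) => case prod_decode k of (j, y) => if w = y then f (pe j y) else 0)"
    have u_pe: "u (pe (pe j y) w) = (if w = y then f (pe j y) else 0)" for j y w by (simp add: u_def)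
    have fnz: "j \<in> J \<and> v \<in> E `` {fst (t j)} - snd (t j)" if "f (pe j v) \<noteq> 0" for j v
      using that f unfolding kerp Md_carrier pt0_def by (auto)
    have uc: "u \<in> carrier (Md (J1 J t) pt1)" unfolding Md_carrier
    proof (intro allI impI)
      fix k w assume "u (pe k w) \<noteq> 0"
      moreover obtain j y where k: "k = pe j y" by (metis prod_decode_inverse surj_pair)
      ultimately show "k \<in> J1 J t \<and> (w = fst (pt1 k) \<or> w \<in> snd (pt1 k))"
        using fnz by (auto simp: u_pe J1_iff pt1_def split: if_splits)
    qed
    have "pf J t u = f"
    proof (rule pe_ext)
      fix j v show "pf J t u (pe j v) = f (pe j v)" using fnz[of j v] by (auto simp: pf_pe[OF uc] u_pe)
    qed
    then show "f \<in> pf J t ` carrier (Md (J1 J t) pt1)" using uc by (metis imageI)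
  qed
  have sf0: "superfluous L (Md J (pt0 t)) (hom_kernel (Md J (pt0 t)) (Md J t) (pp J t))"
    by (rule superfluous_rad[OF pj0 pp.submodule_kernel]) (simp add: kerp pt0_def)
  have sf1: "superfluous L (Md (J1 J t) pt1) (hom_kernel (Md (J1 J t) pt1) (Md J (pt0 t)) (pf J t))"
  proof (rule superfluous_rad[OF pj1 pf.submodule_kernel])
    fix u k assume "u \<in> hom_kernel (Md (J1 J t) pt1) (Md J (pt0 t)) (pf J t)"
    then have u: "u \<in> carrier (Md (J1 J t) pt1)" "pf J t u = (\<lambda>i. 0)" by (auto simp: hom_kernel_def Md_zero)
    obtain j y where k: "k = pe j y" by (metis prod_decode_inverse surj_pair)
    show "u (pe k (fst (pt1 k))) = 0"
    proof (cases "k \<in> J1 J t")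
      case True
      then show ?thesis using fun_cong[OF u(2), of "pe j y"] k by (simp add: pf_pe[OF u(1)] J1_iff pt1_def)
    next
      case False then show ?thesis using u(1) unfolding Md_carrier by blast
    qed
  qed
  show ?thesis unfolding min_proj_presentation_def
    using projective_Md[OF pj0] projective_Md[OF pj1] pf pp onto im sf0 sf1 by blast
qed

text \<open>On generators the presentation is multiplication by the missed arrow. The transpose is
  computed from this.\<close>

lemma pf_gen:
  assumes v: "valid J t" and k: "pe j y \<in> J1 J t"
  shows "pf J t (gen pt1 (pe j y)) = arr (fst (t j)) y \<odot>\<^bsub>Md J (pt0 t)\<^esub> gen (pt0 t) j"
proof (rule pe_ext)
  fix i u
  have y: "(fst (t j), y) \<in> E" "y \<notin> snd (t j)" "fst (t j) \<noteq> y" using k by (auto simp: J1_iff)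
  show "pf J t (gen pt1 (pe j y)) (pe i u) = (arr (fst (t j)) y \<odot>\<^bsub>Md J (pt0 t)\<^esub> gen (pt0 t) j) (pe i u)"
    unfolding pf_pe[OF gen_carrier[OF k]] using y by (auto simp: gen_def pt1_def pt0_def Md_smult cf_arr)
qed

end

section \<open>Homomorphisms to the Auslander--Reiten translate\<close>

lemma (in left_module) additive_finsum:
  fixes \<phi> :: "'m => 'k::field"
  assumes "\<And>x y. [|x \<in> carrier M; y \<in> carrier M|] ==> \<phi> (x \<oplus>\<^bsub>M\<^esub> y) = \<phi> x + \<phi> y"
    and "finite A" "h \<in> A \<rightarrow> carrier M"
  shows "\<phi> (finsum M h A) = (\<Sum>a\<in>A. \<phi> (h a))"
  using assms(2,3)
proof (induction A rule: finite_induct)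
  case empty
  have "\<phi> \<zero>\<^bsub>M\<^esub> = \<phi> \<zero>\<^bsub>M\<^esub> + \<phi> \<zero>\<^bsub>M\<^esub>" using assms(1)[of "\<zero>\<^bsub>M\<^esub>" "\<zero>\<^bsub>M\<^esub>"] by simp
  then have "\<phi> \<zero>\<^bsub>M\<^esub> = 0" by (metis add_cancel_right_right)
  then show ?case by simp
next
  case (insert a A)
  then have "h \<in> A \<rightarrow> carrier M" "h a \<in> carrier M" by auto
  then show ?case using insert assms(1) by simp
qed

lemma opp_simps [simp]: "carrier (opp R) = carrier R" "add (opp R) = add R" "zero (opp R) = zero R"
  "one (opp R) = one R" "smult (opp R) = smult R" "a \<otimes>\<^bsub>opp R\<^esub> b = b \<otimes>\<^bsub>R\<^esub> a"
  by (simp_all add: opp_def)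

lemma ring_opp: "ring R ==> ring (opp R)"
proof -
  assume "ring R" then interpret ring R .
  have "abelian_group (opp R)"
    by (rule abelian_groupI) (auto simp: a_ac add.l_inv_ex)
  moreover have "Group.monoid (opp R)" by (rule monoidI) (auto simp: m_assoc)
  ultimately show ?thesis by (rule ringI) (auto simp: l_distr r_distr)
qed

lemma hom_to_algebra_simps [simp]: "carrier (hom_to_algebra R P) = mod_hom R P (regular_module R)"
  "\<zero>\<^bsub>hom_to_algebra R P\<^esub> = (\<lambda>x\<in>carrier P. \<zero>\<^bsub>R\<^esub>)"
  "f \<oplus>\<^bsub>hom_to_algebra R P\<^esub> g = (\<lambda>x\<in>carrier P. f x \<oplus>\<^bsub>R\<^esub> g x)"
  "a \<odot>\<^bsub>hom_to_algebra R P\<^esub> f = (\<lambda>x\<in>carrier P. f x \<otimes>\<^bsub>R\<^esub> a)"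
  by (simp_all add: hom_to_algebra_def)

lemma mod_hom_regular: "f \<in> mod_hom R P (regular_module R) \<longleftrightarrow> f \<in> carrier P \<rightarrow>\<^sub>E carrier R \<and>
    (\<forall>x\<in>carrier P. \<forall>y\<in>carrier P. f (x \<oplus>\<^bsub>P\<^esub> y) = f x \<oplus>\<^bsub>R\<^esub> f y) \<and>
    (\<forall>a\<in>carrier R. \<forall>x\<in>carrier P. f (a \<odot>\<^bsub>P\<^esub> x) = a \<otimes>\<^bsub>R\<^esub> f x)"
  by (simp add: mod_hom_def regular_module_def)

lemma left_module_hom_to_algebra:
  fixes R :: "('k, 'a) module" and P :: "('a, 'm) module"
  assumes P: "left_module R P" shows "left_module (opp R) (hom_to_algebra R P)"
proof -
  interpret left_module R P by fact
  let ?H = "hom_to_algebra R P"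
  have c: "f x \<in> carrier R" if "f \<in> mod_hom R P (regular_module R)" "x \<in> carrier P" for f x
    using that by (auto simp: mod_hom_regular)
  have e: "f \<in> carrier P \<rightarrow>\<^sub>E carrier R" if "f \<in> mod_hom R P (regular_module R)" for f
    using that by (simp add: mod_hom_regular)
  have eqI: "f = g" if "f \<in> extensional (carrier P)" "g \<in> extensional (carrier P)" "\<And>x. x \<in> carrier P ==> f x = g x" for f g :: "'m => 'a"
    using that by (rule extensionalityI)
  have ext: "f \<in> extensional (carrier P)" if "f \<in> mod_hom R P (regular_module R)" for f
    using e[OF that] by (simp add: PiE_def)
  have add: "(\<lambda>x\<in>carrier P. f x \<oplus>\<^bsub>R\<^esub> g x) \<in> mod_hom R P (regular_module R)"
    if "f \<in> mod_hom R P (regular_module R)" "g \<in> mod_hom R P (regular_module R)" for f g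
    using that c[OF that(1)] c[OF that(2)] by (auto simp: mod_hom_regular smult_closed R.a_ac R.r_distr)
  have ab: "abelian_group ?H"
  proof (rule abelian_groupI)
    show "\<exists>g\<in>carrier ?H. g \<oplus>\<^bsub>?H\<^esub> f = \<zero>\<^bsub>?H\<^esub>" if f: "f \<in> carrier ?H" for f
    proof (rule bexI)
      have f: "f \<in> mod_hom R P (regular_module R)" using f by simp
      show "(\<lambda>x\<in>carrier P. \<ominus>\<^bsub>R\<^esub> f x) \<in> carrier ?H"
        using f c[OF f] by (auto simp: mod_hom_regular smult_closed R.minus_add R.r_minus)
      show "(\<lambda>x\<in>carrier P. \<ominus>\<^bsub>R\<^esub> f x) \<oplus>\<^bsub>?H\<^esub> f = \<zero>\<^bsub>?H\<^esub>"
        using c[OF f] by (auto simp: R.l_neg)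
    qed
    show "\<zero>\<^bsub>?H\<^esub> \<in> carrier ?H" by (auto simp: mod_hom_regular smult_closed)
    show "f \<oplus>\<^bsub>?H\<^esub> g \<in> carrier ?H" if "f \<in> carrier ?H" "g \<in> carrier ?H" for f g
      using add that by simp
    show "\<zero>\<^bsub>?H\<^esub> \<oplus>\<^bsub>?H\<^esub> f = f" if "f \<in> carrier ?H" for f
      by (rule eqI) (use that c[of f] ext[of f] in auto)
    show "f \<oplus>\<^bsub>?H\<^esub> g \<oplus>\<^bsub>?H\<^esub> h = f \<oplus>\<^bsub>?H\<^esub> (g \<oplus>\<^bsub>?H\<^esub> h)" if "f \<in> carrier ?H" "g \<in> carrier ?H" "h \<in> carrier ?H" for f g h
      by (rule eqI) (use that c[of f] c[of g] c[of h] in \<open>auto simp: R.a_assoc\<close>)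
    show "f \<oplus>\<^bsub>?H\<^esub> g = g \<oplus>\<^bsub>?H\<^esub> f" if "f \<in> carrier ?H" "g \<in> carrier ?H" for f g
      by (rule eqI) (use that c[of f] c[of g] in \<open>auto simp: R.a_comm\<close>)
  qed
  show ?thesis
  proof (intro left_module.intro left_module_axioms.intro ring_opp R.ring_axioms ab)
    show "a \<odot>\<^bsub>?H\<^esub> f \<in> carrier ?H" if "a \<in> carrier (opp R)" "f \<in> carrier ?H" for a f
      using that c[of f] by (auto simp: mod_hom_regular smult_closed R.l_distr R.m_assoc)
    show "(a \<oplus>\<^bsub>opp R\<^esub> b) \<odot>\<^bsub>?H\<^esub> f = a \<odot>\<^bsub>?H\<^esub> f \<oplus>\<^bsub>?H\<^esub> b \<odot>\<^bsub>?H\<^esub> f"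
      if "a \<in> carrier (opp R)" "b \<in> carrier (opp R)" "f \<in> carrier ?H" for a b f
      by (rule eqI) (use that c[of f] in \<open>auto simp: R.r_distr\<close>)
    show "a \<odot>\<^bsub>?H\<^esub> (f \<oplus>\<^bsub>?H\<^esub> g) = a \<odot>\<^bsub>?H\<^esub> f \<oplus>\<^bsub>?H\<^esub> a \<odot>\<^bsub>?H\<^esub> g"
      if "a \<in> carrier (opp R)" "f \<in> carrier ?H" "g \<in> carrier ?H" for a f g
      by (rule eqI) (use that c[of f] c[of g] in \<open>auto simp: R.l_distr\<close>)
    show "(a \<otimes>\<^bsub>opp R\<^esub> b) \<odot>\<^bsub>?H\<^esub> f = a \<odot>\<^bsub>?H\<^esub> (b \<odot>\<^bsub>?H\<^esub> f)"
      if "a \<in> carrier (opp R)" "b \<in> carrier (opp R)" "f \<in> carrier ?H" for a b f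
      by (rule eqI) (use that c[of f] in \<open>auto simp: R.m_assoc\<close>)
    show "\<one>\<^bsub>opp R\<^esub> \<odot>\<^bsub>?H\<^esub> f = f" if "f \<in> carrier ?H" for f
      by (rule eqI) (use that c[of f] ext[of f] in auto)
  qed
qed

text \<open>The presentation chosen by \<open>tau\<close> is only isomorphic to the explicit one, so
  the data used are listed abstractly: generators \<open>p i\<close> of \<open>P1\<close> with
  coordinate functionals \<open>g i\<close>, elements \<open>q j\<close> of \<open>P0\<close> with
  functionals \<open>G j\<close>, and a map \<open>f\<close> that sends \<open>p i\<close> to a
  multiple \<open>w i\<close> of the single element \<open>q (src i)\<close>. In the application
  \<open>w i\<close> is a missed arrow and \<open>y i\<close> its target.\<close>

locale tau_data = radsq V E L cf
  for V E and L :: "('k::field, 'a) module" (structure) and cf +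
  fixes P1 P0 :: "('k, 'a) fmod" and f and I J :: "nat set"
    and p g q G and y :: "nat => nat" and src :: "nat => nat" and w :: "nat => 'a"
  assumes lmP1: "left_module L P1" and lmP0: "left_module L P0" and f: "f \<in> mod_hom L P1 P0"
    and finI: "finite I" and finJ: "finite J"
    and p: "i \<in> I ==> p i \<in> carrier P1"
    and g: "i \<in> I ==> g i \<in> mod_hom L P1 (regular_module L)"
    and expand1: "x \<in> carrier P1 ==> x = finsum P1 (\<lambda>i. g i x \<odot>\<^bsub>P1\<^esub> p i) I"
    and g_idem: "i \<in> I ==> x \<in> carrier P1 ==> g i x \<otimes> idem (y i) = g i x"
    and g_p: "i \<in> I ==> i' \<in> I ==> g i (p i') = (if i = i' then idem (y i) else \<zero>)"
    and q: "j \<in> J ==> q j \<in> carrier P0"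
    and G: "j \<in> J ==> G j \<in> mod_hom L P0 (regular_module L)"
    and src: "i \<in> I ==> src i \<in> J" and w: "i \<in> I ==> w i \<in> carrier L"
    and f_p: "i \<in> I ==> f (p i) = w i \<odot>\<^bsub>P0\<^esub> q (src i)"
    and G_f_p: "i \<in> I ==> j \<in> J ==> G j (f (p i)) = (if src i = j then w i else \<zero>)"
begin

text \<open>A homomorphism from \<open>X\<close> to the dual of the transpose is determined by its
  values on the classes of the functionals \<open>g i\<close>; these are the forms
  \<open>\<beta> i\<close>. They live on the part of \<open>X\<close> at \<open>y i\<close> because
  \<open>g i\<close> takes values there. The relation for \<open>j\<close> expresses that
  \<open>G j\<close> composed with \<open>f\<close>, a sum of multiples of the \<open>g i\<close> by
  the \<open>w i\<close>, vanishes in the transpose.\<close>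

definition Fam :: "('a, 'm) module => (nat => 'm => 'k) => bool" where
  "Fam X \<beta> \<longleftrightarrow> (\<forall>i\<in>I. (\<forall>m\<in>carrier X. \<forall>n\<in>carrier X. \<beta> i (m \<oplus>\<^bsub>X\<^esub> n) = \<beta> i m + \<beta> i n) \<and>
     (\<forall>m\<in>carrier X. (\<forall>c. \<beta> i (sc c \<odot>\<^bsub>X\<^esub> m) = c * \<beta> i m) \<and> \<beta> i (idem (y i) \<odot>\<^bsub>X\<^esub> m) = \<beta> i m)) \<and>
     (\<forall>j\<in>J. \<forall>m\<in>carrier X. (\<Sum>i | i \<in> I \<and> src i = j. \<beta> i (w i \<odot>\<^bsub>X\<^esub> m)) = 0)"

abbreviation "H \<equiv> hom_to_algebra L P1"
abbreviation "W \<equiv> (\<lambda>h. compose (carrier P1) h f) ` mod_hom L P0 (regular_module L)"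
abbreviation "T \<equiv> dual (opp L) (Tr L P1 f P0)"

sublocale P1: left_module L P1 by (rule lmP1)
sublocale P0: left_module L P0 by (rule lmP0)
sublocale H: plain_module "opp L" H
  unfolding plain_module_def by (rule left_module_hom_to_algebra[OF lmP1])
sublocale f: module_hom L P1 P0 f
  by unfold_locales (rule f)

lemma hc: "h \<in> mod_hom L P1 (regular_module L) ==> x \<in> carrier P1 ==> h x \<in> carrier L"
  by (auto simp: mod_hom_regular)

lemma hc0: "h \<in> mod_hom L P0 (regular_module L) ==> x \<in> carrier P0 ==> h x \<in> carrier L"
  by (auto simp: mod_hom_regular)

lemma subW: "submodule W (opp L) H"
  unfolding H.submodule_iff
proof (intro conjI ballI)
  show "W \<subseteq> carrier H"
    using mod_hom_compose[OF lmP1 f] by auto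
  have Z: "(\<lambda>x\<in>carrier P0. \<zero>) \<in> mod_hom L P0 (regular_module L)"
    by (auto simp: mod_hom_regular P0.smult_closed)
  have "compose (carrier P1) (\<lambda>x\<in>carrier P0. \<zero>) f = \<zero>\<^bsub>H\<^esub>"
    using f.closed by (auto simp: compose_def)
  then show "\<zero>\<^bsub>H\<^esub> \<in> W" using Z by (metis imageI)
next
  fix h h' assume "h \<in> W" "h' \<in> W"
  then obtain u u' where u: "u \<in> mod_hom L P0 (regular_module L)" "h = compose (carrier P1) u f"
    "u' \<in> mod_hom L P0 (regular_module L)" "h' = compose (carrier P1) u' f" by auto
  interpret H0: left_module "opp L" "hom_to_algebra L P0" by (rule left_module_hom_to_algebra[OF lmP0])
  have "h \<oplus>\<^bsub>H\<^esub> h' = compose (carrier P1) (u \<oplus>\<^bsub>hom_to_algebra L P0\<^esub> u') f"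
    using u f.closed by (auto simp: compose_def)
  moreover have "u \<oplus>\<^bsub>hom_to_algebra L P0\<^esub> u' \<in> mod_hom L P0 (regular_module L)"
    using H0.M.a_closed[of u u'] u by simp
  ultimately show "h \<oplus>\<^bsub>H\<^esub> h' \<in> W" by blast
next
  fix a h assume a: "a \<in> carrier (opp L)" and "h \<in> W"
  then obtain u where u: "u \<in> mod_hom L P0 (regular_module L)" "h = compose (carrier P1) u f" by auto
  interpret H0: left_module "opp L" "hom_to_algebra L P0" by (rule left_module_hom_to_algebra[OF lmP0])
  have "a \<odot>\<^bsub>H\<^esub> h = compose (carrier P1) (a \<odot>\<^bsub>hom_to_algebra L P0\<^esub> u) f"
    using u f.closed by (auto simp: compose_def)
  moreover have "a \<odot>\<^bsub>hom_to_algebra L P0\<^esub> u \<in> mod_hom L P0 (regular_module L)"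
    using H0.smult_closed[of a u] u a by simp
  ultimately show "a \<odot>\<^bsub>H\<^esub> h \<in> W" by blast
qed

lemma Tr_eq: "Tr L P1 f P0 = quot H W"
  by (simp add: Tr_def)

lemmas qc = H.quot_cosets[OF subW]

lemma finsum_H:
  assumes "finite A" "k \<in> A \<rightarrow> carrier H" "x \<in> carrier P1"
  shows "finsum H k A x = finsum L (\<lambda>i. k i x) A"
  using assms(1,2)
proof (induction A rule: finite_induct)
  case empty then show ?case using assms(3) by simp
next
  case (insert a A)
  then have k: "k \<in> A \<rightarrow> carrier H" "k a \<in> carrier H" by auto
  then have "(\<lambda>i. k i x) \<in> A \<rightarrow> carrier L" "k a x \<in> carrier L" using hc assms(3) by auto
  then show ?case using insert k assms(3) by simp
qed

text \<open>Dual bases: apply \<open>h\<close> to the expansion of \<open>x\<close> along the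
  \<open>p i\<close>.\<close>

lemma expand_H:
  assumes h: "h \<in> mod_hom L P1 (regular_module L)"
  shows "h = finsum H (\<lambda>i. h (p i) \<odot>\<^bsub>H\<^esub> g i) I"
proof -
  have kc: "(\<lambda>i. h (p i) \<odot>\<^bsub>H\<^esub> g i) \<in> I \<rightarrow> carrier H"
    using H.smult_closed[of "h (p _)" "g _"] hc[OF h p] g by (auto simp del: hom_to_algebra_simps(4))
  have hH: "finsum H (\<lambda>i. h (p i) \<odot>\<^bsub>H\<^esub> g i) I \<in> mod_hom L P1 (regular_module L)"
    using H.M.finsum_closed[OF kc] by simp
  interpret h: module_hom L P1 "regular_module L" h
    by (rule module_homI[OF lmP1 R.left_module_regular h])
  show ?thesis
  proof (rule mod_hom_eqI[OF h hH])
    fix x assume x: "x \<in> carrier P1"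
    have gp: "(\<lambda>i. g i x \<odot>\<^bsub>P1\<^esub> p i) \<in> I \<rightarrow> carrier P1" using hc[OF g x] p P1.smult_closed by auto
    have "h x = h (finsum P1 (\<lambda>i. g i x \<odot>\<^bsub>P1\<^esub> p i) I)" using expand1[OF x] by simp
    also have "\<dots> = finsum (regular_module L) (\<lambda>i. h (g i x \<odot>\<^bsub>P1\<^esub> p i)) I" by (rule h.finsum[OF finI gp])
    also have "\<dots> = finsum L (\<lambda>i. h (g i x \<odot>\<^bsub>P1\<^esub> p i)) I"
      by (simp add: finsum_def finprod_def regular_module_def)
    also have "\<dots> = finsum L (\<lambda>i. (h (p i) \<odot>\<^bsub>H\<^esub> g i) x) I"
      using h.smult[OF hc[OF g x] p] x hc[OF g x] hc[OF h p]
      by (intro R.finsum_cong') (auto simp: regular_module_def)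
    finally show "h x = finsum H (\<lambda>i. h (p i) \<odot>\<^bsub>H\<^esub> g i) I x" using finsum_H[OF finI kc x] by simp
  qed
qed

text \<open>By \<open>G_f_p\<close> only the indices with source \<open>j\<close> survive in the
  dual basis expansion.\<close>

lemma compose_G:
  assumes j: "j \<in> J"
  shows "compose (carrier P1) (G j) f = finsum H (\<lambda>i. w i \<odot>\<^bsub>H\<^esub> g i) {i \<in> I. src i = j}"
proof -
  have c: "compose (carrier P1) (G j) f \<in> mod_hom L P1 (regular_module L)"
    by (rule mod_hom_compose[OF lmP1 f G[OF j]])
  have wg: "w i \<odot>\<^bsub>H\<^esub> g i \<in> carrier H" if "i \<in> I" for i
    using H.smult_closed[of "w i" "g i"] w[OF that] g[OF that] by (simp del: hom_to_algebra_simps(4))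
  have "compose (carrier P1) (G j) f = finsum H (\<lambda>i. compose (carrier P1) (G j) f (p i) \<odot>\<^bsub>H\<^esub> g i) I"
    by (rule expand_H[OF c])
  also have "\<dots> = finsum H (\<lambda>i. if src i = j then w i \<odot>\<^bsub>H\<^esub> g i else \<zero>\<^bsub>H\<^esub>) I"
  proof (rule H.M.finsum_cong')
    show "(\<lambda>i. if src i = j then w i \<odot>\<^bsub>H\<^esub> g i else \<zero>\<^bsub>H\<^esub>) \<in> I \<rightarrow> carrier H"
      using wg H.M.zero_closed by (auto simp del: hom_to_algebra_simps(2,4))
    show "compose (carrier P1) (G j) f (p i) \<odot>\<^bsub>H\<^esub> g i = (if src i = j then w i \<odot>\<^bsub>H\<^esub> g i else \<zero>\<^bsub>H\<^esub>)" if i: "i \<in> I" for i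
      using p[OF i] G_f_p[OF i j] hc[OF g[OF i]] by (auto simp: compose_def)
  qed simp
  also have "\<dots> = finsum H (\<lambda>i. w i \<odot>\<^bsub>H\<^esub> g i) {i \<in> I. src i = j}"
    using wg finI H.M.zero_closed
    by (intro H.M.add.finprod_mono_neutral_cong_right) (auto simp del: hom_to_algebra_simps)
  finally show ?thesis .
qed

text \<open>A homomorphism \<open>b\<close> yields the family of the \<open>c m (g i)\<close>. Every
  functional is a combination of the \<open>g i\<close>, so \<open>b\<close> is zero as soon as this
  family is.\<close>

lemma hom_tau_zeroI:
  fixes X :: "('a, 'm) module"
  assumes X: "left_module L X"
    and F: "\<And>\<beta> i m. [|Fam X \<beta>; i \<in> I; m \<in> carrier X|] ==> \<beta> i m = 0"
  shows "mod_hom L X T = {\<lambda>x\<in>carrier X. \<zero>\<^bsub>T\<^esub>}"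
proof -
  interpret X: left_module L X by fact
  have "b = (\<lambda>x\<in>carrier X. \<zero>\<^bsub>T\<^esub>)" if b: "b \<in> mod_hom L X T" for b
  proof -
    define c where "c m h = b m (W +>\<^bsub>H\<^esub> h)" for m h
    have cl: "W +>\<^bsub>H\<^esub> h \<in> carrier (quot H W)" if "h \<in> carrier H" for h using qc(1) that by blast
    have bm: "b m \<in> carrier T" if "m \<in> carrier X" for m by (rule mod_hom_closed[OF b that])
    have b_add: "b m (Y \<oplus>\<^bsub>quot H W\<^esub> Y') = b m Y + b m Y'"
      if "m \<in> carrier X" "Y \<in> carrier (quot H W)" "Y' \<in> carrier (quot H W)" for m Y Y'
      using bm[OF that(1)] that(2,3) unfolding dual_def Tr_eq by (auto simp del: hom_to_algebra_simps)
    have b_sc: "b m (sc k \<odot>\<^bsub>quot H W\<^esub> Y) = k * b m Y"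
      if "m \<in> carrier X" "Y \<in> carrier (quot H W)" for m Y k
      using bm[OF that(1)] that(2) unfolding dual_def Tr_eq
      by (auto simp del: hom_to_algebra_simps simp: sc_def)
    have c_add: "c m (h \<oplus>\<^bsub>H\<^esub> h') = c m h + c m h'" if "m \<in> carrier X" "h \<in> carrier H" "h' \<in> carrier H" for m h h'
      using b_add[OF that(1) cl[OF that(2)] cl[OF that(3)]] unfolding c_def qc(2)[OF that(2,3)] .
    have c_sc: "c m (sc k \<odot>\<^bsub>H\<^esub> h) = k * c m h" if "m \<in> carrier X" "h \<in> carrier H" for m h k
      using b_sc[OF that(1) cl[OF that(2)], of k] qc(3)[OF _ that(2), of "sc k"]
      by (simp del: hom_to_algebra_simps add: c_def)
    have c_mult: "c (a \<odot>\<^bsub>X\<^esub> m) h = c m (a \<odot>\<^bsub>H\<^esub> h)" if "a \<in> carrier L" "m \<in> carrier X" "h \<in> carrier H" for a m h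
      using mod_hom_smult[OF b that(1,2)] cl[OF that(3)] qc(3)[OF _ that(3), of a] that(1)
      unfolding c_def dual_def Tr_eq by (auto simp del: hom_to_algebra_simps)
    have c_addm: "c (m \<oplus>\<^bsub>X\<^esub> n) h = c m h + c n h" if "m \<in> carrier X" "n \<in> carrier X" "h \<in> carrier H" for m n h
      using mod_hom_add[OF b that(1,2)] cl[OF that(3)]
      unfolding c_def dual_def Tr_eq by (auto simp del: hom_to_algebra_simps)
    have c_zero: "c m h = 0" if m: "m \<in> carrier X" and h: "h \<in> W" for m h
    proof -
      have hH: "h \<in> carrier H" using subW h unfolding H.submodule_iff by blast
      have "h \<ominus>\<^bsub>H\<^esub> \<zero>\<^bsub>H\<^esub> \<in> W" using h hH subW by (intro H.submodule_minus[OF subW]) (auto simp: H.submodule_iff)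
      then have "W +>\<^bsub>H\<^esub> h = W +>\<^bsub>H\<^esub> \<zero>\<^bsub>H\<^esub>" using qc(4)[OF hH H.M.zero_closed] by blast
      then have "c m h = c m \<zero>\<^bsub>H\<^esub>" by (simp add: c_def)
      moreover have "c m \<zero>\<^bsub>H\<^esub> = c m \<zero>\<^bsub>H\<^esub> + c m \<zero>\<^bsub>H\<^esub>"
        using c_add[OF m H.M.zero_closed H.M.zero_closed] H.M.l_zero[OF H.M.zero_closed] by metis
      then have "c m \<zero>\<^bsub>H\<^esub> = 0" by (metis add_cancel_right_right)
      ultimately show ?thesis by metis
    qed
    have gH: "g i \<in> carrier H" if "i \<in> I" for i using g[OF that] by simp
    have wgH: "w i \<odot>\<^bsub>H\<^esub> g i \<in> carrier H" if "i \<in> I" for i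
      using H.smult_closed[of "w i" "g i"] w[OF that] gH[OF that] by (simp del: hom_to_algebra_simps)
    have fam: "Fam X (\<lambda>i m. c m (g i))" unfolding Fam_def
    proof (intro conjI ballI allI)
      fix i m n assume i: "i \<in> I" and m: "m \<in> carrier X"
      show "c (m \<oplus>\<^bsub>X\<^esub> n) (g i) = c m (g i) + c n (g i)" if "n \<in> carrier X" by (rule c_addm[OF m that gH[OF i]])
      show "c (sc k \<odot>\<^bsub>X\<^esub> m) (g i) = k * c m (g i)" for k
        using c_mult[OF _ m gH[OF i], of "sc k"] c_sc[OF m gH[OF i]] by simp
      have "idem (y i) \<odot>\<^bsub>H\<^esub> g i = g i"
        using g_idem[OF i] g[OF i]
        by (intro extensionalityI[of _ "carrier P1"]) (auto simp: mod_hom_regular PiE_def)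
      then show "c (idem (y i) \<odot>\<^bsub>X\<^esub> m) (g i) = c m (g i)"
        using c_mult[OF _ m gH[OF i], of "idem (y i)"] by simp
    next
      fix j m assume j: "j \<in> J" and m: "m \<in> carrier X"
      have "(\<Sum>i | i \<in> I \<and> src i = j. c (w i \<odot>\<^bsub>X\<^esub> m) (g i)) = (\<Sum>i | i \<in> I \<and> src i = j. c m (w i \<odot>\<^bsub>H\<^esub> g i))"
        by (rule sum.cong) (auto simp del: hom_to_algebra_simps simp: c_mult[OF w m gH])
      also have "\<dots> = c m (finsum H (\<lambda>i. w i \<odot>\<^bsub>H\<^esub> g i) {i \<in> I. src i = j})"
        using H.additive_finsum[of "c m" "{i \<in> I. src i = j}" "\<lambda>i. w i \<odot>\<^bsub>H\<^esub> g i"] c_add[OF m] wgH finI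
        by (auto simp del: hom_to_algebra_simps)
      also have "\<dots> = 0" unfolding compose_G[OF j, symmetric] using c_zero[OF m] G[OF j] by blast
      finally show "(\<Sum>i | i \<in> I \<and> src i = j. c (w i \<odot>\<^bsub>X\<^esub> m) (g i)) = 0" .
    qed
    have "c m h = 0" if m: "m \<in> carrier X" and h: "h \<in> carrier H" for m h
    proof -
      have h': "h \<in> mod_hom L P1 (regular_module L)" using h by simp
      have hp: "h (p i) \<in> carrier L" if "i \<in> I" for i using hc[OF h' p[OF that]] .
      have kc: "(\<lambda>i. h (p i) \<odot>\<^bsub>H\<^esub> g i) \<in> I \<rightarrow> carrier H"
        using H.smult_closed hp gH by (auto simp del: hom_to_algebra_simps)
      have "c m h = c m (finsum H (\<lambda>i. h (p i) \<odot>\<^bsub>H\<^esub> g i) I)" using expand_H[OF h'] by simp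
      also have "\<dots> = (\<Sum>i\<in>I. c m (h (p i) \<odot>\<^bsub>H\<^esub> g i))" by (rule H.additive_finsum[OF c_add[OF m] finI kc])
      also have "\<dots> = (\<Sum>i\<in>I. c (h (p i) \<odot>\<^bsub>X\<^esub> m) (g i))"
        by (rule sum.cong) (auto simp del: hom_to_algebra_simps simp: c_mult[OF hp m gH])
      also have "\<dots> = 0" using F[OF fam] hp m X.smult_closed by (intro sum.neutral) auto
      finally show ?thesis .
    qed
    then have "b m Y = 0" if "m \<in> carrier X" "Y \<in> carrier (quot H W)" for m Y
      using that unfolding qc(1) c_def by blast
    then have "b m = \<zero>\<^bsub>T\<^esub>" if "m \<in> carrier X" for m
      using bm[OF that] that unfolding dual_def Tr_eq by (auto intro!: extensionalityI[of _ "carrier (quot H W)"])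
    moreover have "b \<in> extensional (carrier X)" using b by (auto simp: mod_hom_def PiE_def)
    ultimately show ?thesis by (intro extensionalityI[of _ "carrier X"]) auto
  qed
  moreover have "(\<lambda>x\<in>carrier X. \<zero>\<^bsub>T\<^esub>) \<in> mod_hom L X T"
  proof -
    have "Z \<oplus>\<^bsub>quot H W\<^esub> Z' \<in> carrier (quot H W)" if "Z \<in> carrier (quot H W)" "Z' \<in> carrier (quot H W)" for Z Z'
      using that qc(2) H.M.a_closed unfolding qc(1) by (auto simp del: hom_to_algebra_simps)
    moreover have "a \<odot>\<^bsub>quot H W\<^esub> Z \<in> carrier (quot H W)" if "a \<in> carrier L" "Z \<in> carrier (quot H W)" for a Z
      using that qc(3) H.smult_closed unfolding qc(1) by (auto simp del: hom_to_algebra_simps)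
    ultimately show ?thesis
      unfolding mod_hom_def dual_def Tr_eq by (auto simp: X.smult_closed sc_def[symmetric])
  qed
  ultimately show ?thesis by blast
qed

text \<open>Conversely a family of forms defines a homomorphism whose value on the class of
  \<open>g i\<close> is \<open>\<beta> i\<close>.\<close>

lemma hom_tau_zeroD:
  fixes X :: "('a, 'm) module"
  assumes X: "left_module L X" and Z: "mod_hom L X T = {\<lambda>x\<in>carrier X. \<zero>\<^bsub>T\<^esub>}"
    and F: "Fam X \<beta>" and i: "i \<in> I" and m: "m \<in> carrier X"
  shows "\<beta> i m = 0"
proof -
  interpret X: left_module L X by fact
  note F = F[unfolded Fam_def]
  \<comment> \<open>The only possible value on the class of \<open>h\<close>, by the expansion of
    \<open>h\<close> along the \<open>g i\<close>.\<close>
  define B where "B m h = (\<Sum>i\<in>I. \<beta> i (h (p i) \<odot>\<^bsub>X\<^esub> m))" for m h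
  have hp: "h (p i) \<in> carrier L" if "h \<in> carrier H" "i \<in> I" for h i using hc[of h, OF _ p] that by simp
  have \<beta>0: "\<beta> i \<zero>\<^bsub>X\<^esub> = 0" if "i \<in> I" for i
  proof -
    have "\<beta> i (\<zero>\<^bsub>X\<^esub> \<oplus>\<^bsub>X\<^esub> \<zero>\<^bsub>X\<^esub>) = \<beta> i \<zero>\<^bsub>X\<^esub> + \<beta> i \<zero>\<^bsub>X\<^esub>" using F that by blast
    then show ?thesis by (metis X.M.l_zero X.M.zero_closed add_cancel_right_right)
  qed
  have B_add: "B m (h \<oplus>\<^bsub>H\<^esub> h') = B m h + B m h'" if "m \<in> carrier X" "h \<in> carrier H" "h' \<in> carrier H" for m h h'
    unfolding B_def sum.distrib[symmetric]
    by (rule sum.cong) (use that F p hp X.smult_closed in \<open>auto simp: X.smult_l_distr\<close>)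
  have B_addm: "B (m \<oplus>\<^bsub>X\<^esub> n) h = B m h + B n h" if "m \<in> carrier X" "n \<in> carrier X" "h \<in> carrier H" for m n h
    unfolding B_def sum.distrib[symmetric]
    by (rule sum.cong) (use that F hp X.smult_closed in \<open>auto simp: X.smult_r_distr\<close>)
  have B_mult: "B (a \<odot>\<^bsub>X\<^esub> m) h = B m (a \<odot>\<^bsub>H\<^esub> h)" if "a \<in> carrier L" "m \<in> carrier X" "h \<in> carrier H" for a m h
    unfolding B_def
    by (rule sum.cong) (use that p hp in \<open>auto simp: X.smult_assoc\<close>)
  have B_sc: "B m (sc k \<odot>\<^bsub>H\<^esub> h) = k * B m h" if "m \<in> carrier X" "h \<in> carrier H" for m h k
    unfolding B_def sum_distrib_left
  proof (rule sum.cong)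
    fix i assume i: "i \<in> I"
    have "(sc k \<odot>\<^bsub>H\<^esub> h) (p i) \<odot>\<^bsub>X\<^esub> m = sc k \<odot>\<^bsub>X\<^esub> (h (p i) \<odot>\<^bsub>X\<^esub> m)"
      using that hp[OF that(2) i] p[OF i] by (simp add: X.smult_assoc[symmetric] sc_commute)
    then show "\<beta> i ((sc k \<odot>\<^bsub>H\<^esub> h) (p i) \<odot>\<^bsub>X\<^esub> m) = k * \<beta> i (h (p i) \<odot>\<^bsub>X\<^esub> m)"
      using F i hp[OF that(2) i] that(1) X.smult_closed by simp
  qed simp
  have B_W: "B m h = 0" if m: "m \<in> carrier X" and h: "h \<in> W" for m h
  proof -
    obtain u where u: "u \<in> mod_hom L P0 (regular_module L)" "h = compose (carrier P1) u f" using h by auto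
    have uq: "u (q j) \<in> carrier L" if "j \<in> J" for j using hc0[OF u(1) q[OF that]] .
    have "h (p i) = w i \<otimes> u (q (src i))" if "i \<in> I" for i
      using u p[OF that] f_p[OF that] w[OF that] q[OF src[OF that]] by (simp add: compose_def mod_hom_regular)
    then have "B m h = (\<Sum>i\<in>I. \<beta> i (w i \<odot>\<^bsub>X\<^esub> (u (q (src i)) \<odot>\<^bsub>X\<^esub> m)))"
      unfolding B_def using uq src w m by (intro sum.cong) (auto simp: X.smult_assoc)
    \<comment> \<open>Grouped by the element of \<open>P0\<close> that \<open>f\<close> hits, the
      terms become instances of the relations of the family.\<close>
    also have "\<dots> = (\<Sum>j\<in>J. \<Sum>i | i \<in> I \<and> src i = j. \<beta> i (w i \<odot>\<^bsub>X\<^esub> (u (q (src i)) \<odot>\<^bsub>X\<^esub> m)))"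
      by (rule sum.group[OF finI finJ, symmetric]) (use src in auto)
    also have "\<dots> = (\<Sum>j\<in>J. \<Sum>i | i \<in> I \<and> src i = j. \<beta> i (w i \<odot>\<^bsub>X\<^esub> (u (q j) \<odot>\<^bsub>X\<^esub> m)))"
      by (intro sum.cong) auto
    also have "\<dots> = 0" using F uq m X.smult_closed by (intro sum.neutral) auto
    finally show ?thesis .
  qed
  have B_eq: "B m h = B m h'" if "m \<in> carrier X" "h \<in> carrier H" "h' \<in> carrier H" "W +>\<^bsub>H\<^esub> h = W +>\<^bsub>H\<^esub> h'" for m h h'
  proof -
    have d: "h \<ominus>\<^bsub>H\<^esub> h' \<in> W" using qc(4)[OF that(2,3)] that(4) by blast
    have "h = (h \<ominus>\<^bsub>H\<^esub> h') \<oplus>\<^bsub>H\<^esub> h'" using that(2,3)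
      by (simp add: a_minus_def H.M.a_assoc H.M.l_neg del: hom_to_algebra_simps)
    then have "B m h = B m (h \<ominus>\<^bsub>H\<^esub> h') + B m h'"
      using B_add[OF that(1) H.M.minus_closed[OF that(2,3)] that(3)] by metis
    then show ?thesis using B_W[OF that(1) d] by simp
  qed
  define b where "b = (\<lambda>m\<in>carrier X. \<lambda>Y\<in>carrier (quot H W). B m (SOME h. h \<in> carrier H \<and> W +>\<^bsub>H\<^esub> h = Y))"
  have b_eq: "b m (W +>\<^bsub>H\<^esub> h) = B m h" if "m \<in> carrier X" "h \<in> carrier H" for m h
  proof -
    have "\<exists>h'. h' \<in> carrier H \<and> W +>\<^bsub>H\<^esub> h' = W +>\<^bsub>H\<^esub> h" using that by blast
    from someI_ex[OF this] have s: "(SOME h'. h' \<in> carrier H \<and> W +>\<^bsub>H\<^esub> h' = W +>\<^bsub>H\<^esub> h) \<in> carrier H"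
      "W +>\<^bsub>H\<^esub> (SOME h'. h' \<in> carrier H \<and> W +>\<^bsub>H\<^esub> h' = W +>\<^bsub>H\<^esub> h) = W +>\<^bsub>H\<^esub> h" by auto
    have "W +>\<^bsub>H\<^esub> h \<in> carrier (quot H W)" using qc(1) that(2) by blast
    then show ?thesis using B_eq[OF that(1) s(1) that(2) s(2)] that(1) by (simp only: b_def restrict_apply' if_True)
  qed
  have Yex: "\<exists>h\<in>carrier H. Y = W +>\<^bsub>H\<^esub> h" if "Y \<in> carrier (quot H W)" for Y using that unfolding qc(1) by blast
  have bext: "b m \<in> extensional (carrier (quot H W))" if "m \<in> carrier X" for m using that by (simp add: b_def)
  have bT: "b m \<in> carrier T" if m: "m \<in> carrier X" for m
  proof -
    have "b m (Y \<oplus>\<^bsub>quot H W\<^esub> Y') = b m Y + b m Y'" if Y: "Y \<in> carrier (quot H W)" "Y' \<in> carrier (quot H W)" for Y Y'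
      using Yex[OF Y(1)] Yex[OF Y(2)] b_eq[OF m] qc(2) B_add[OF m] H.M.a_closed by (auto simp del: hom_to_algebra_simps)
    moreover have "b m (sc k \<odot>\<^bsub>quot H W\<^esub> Y) = k * b m Y" if Y: "Y \<in> carrier (quot H W)" for Y k
      using Yex[OF Y] b_eq[OF m] qc(3)[of "sc k"] B_sc[OF m] H.smult_closed[of "sc k"] by (auto simp del: hom_to_algebra_simps)
    ultimately show ?thesis using bext[OF m] unfolding dual_def Tr_eq by (simp add: sc_def del: hom_to_algebra_simps)
  qed
  have "b \<in> mod_hom L X T"
  proof -
    have "b (m \<oplus>\<^bsub>X\<^esub> n) Y = b m Y + b n Y" if "m \<in> carrier X" "n \<in> carrier X" "Y \<in> carrier (quot H W)" for m n Y
      using Yex[OF that(3)] b_eq that(1,2) B_addm by (auto simp del: hom_to_algebra_simps)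
    then have "b (m \<oplus>\<^bsub>X\<^esub> n) = b m \<oplus>\<^bsub>T\<^esub> b n" if "m \<in> carrier X" "n \<in> carrier X" for m n
      using that bext unfolding dual_def Tr_eq by (auto intro!: extensionalityI[of _ "carrier (quot H W)"] simp del: hom_to_algebra_simps)
    moreover have "b (a \<odot>\<^bsub>X\<^esub> m) Y = b m (a \<odot>\<^bsub>quot H W\<^esub> Y)" if "a \<in> carrier L" "m \<in> carrier X" "Y \<in> carrier (quot H W)" for a m Y
      using Yex[OF that(3)] b_eq that(1,2) B_mult qc(3)[of a] H.smult_closed[of a] X.smult_closed by (auto simp del: hom_to_algebra_simps)
    then have "b (a \<odot>\<^bsub>X\<^esub> m) = a \<odot>\<^bsub>T\<^esub> b m" if "a \<in> carrier L" "m \<in> carrier X" for a m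
      using that bext X.smult_closed unfolding dual_def Tr_eq by (auto intro!: extensionalityI[of _ "carrier (quot H W)"] simp del: hom_to_algebra_simps)
    moreover have "b \<in> extensional (carrier X)" by (simp add: b_def)
    ultimately show ?thesis using bT unfolding mod_hom_def by (auto simp: PiE_def)
  qed
  then have "b m = \<zero>\<^bsub>T\<^esub>" using Z m by auto
  moreover have gH: "g i \<in> carrier H" using g[OF i] by simp
  ultimately have "B m (g i) = 0" using b_eq[OF m gH] qc(1) unfolding dual_def Tr_eq by (simp del: hom_to_algebra_simps(2-))
  moreover have "B m (g i) = (\<Sum>i'\<in>I. if i' = i then \<beta> i m else 0)"
    unfolding B_def by (rule sum.cong) (use F i m \<beta>0 in \<open>auto simp: g_p X.smult_zero_left\<close>)
  ultimately show ?thesis using i finI by simp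
qed

end

section \<open>Rigidity as a condition on pairs\<close>

lemma min_proj_presentation_iso:
  fixes A :: "('k::field, 'a) module" and M N :: "('k, 'a) fmod"
  assumes a: "min_proj_presentation A P1 f P0 p M" and M: "left_module A M" "left_module A N"
    and h: "h \<in> mod_hom A M N" "bij_betw h (carrier M) (carrier N)"
  shows "min_proj_presentation A P1 f P0 (compose (carrier P0) h p) N"
proof -
  note a = a[unfolded min_proj_presentation_def]
  have lm: "left_module A P0" using a by (auto simp: projective_def fg_module_def)
  interpret p: module_hom A P0 M p using lm M a by (intro module_homI) auto
  interpret h: module_hom A M N h using M h by (intro module_homI)
  have "hom_kernel P0 N (compose (carrier P0) h p) = hom_kernel P0 M p"
    using h(2) h.zero p.closed h.inj_iff by (auto simp: hom_kernel_def compose_def bij_betw_def)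
  moreover have "compose (carrier P0) h p ` carrier P0 = carrier N"
    using a h(2) by (auto simp: compose_def bij_betw_def image_image[symmetric])
  ultimately show ?thesis
    using a mod_hom_compose[OF lm p.hom h(1)] by (simp add: min_proj_presentation_def)
qed

lemma tau_presentation:
  fixes A :: "('k::field, 'a) module" and M :: "('k, 'a) fmod"
  assumes "min_proj_presentation A P1 f P0 p M"
  obtains P1' f' P0' p' where "min_proj_presentation A P1' f' P0' p' M"
    "tau A M = dual (opp A) (Tr A P1' f' P0')"
proof -
  let ?Q = "\<lambda>(P1, f, P0). \<exists>p. min_proj_presentation A P1 f P0 p M"
  have "?Q (Eps ?Q)" by (rule someI[of ?Q "(P1, f, P0)"]) (use assms in auto)
  moreover obtain P1' f' P0' where e: "Eps ?Q = (P1', f', P0')" by (cases "Eps ?Q") auto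
  ultimately have "\<exists>p. min_proj_presentation A P1' f' P0' p M" by simp
  moreover have "tau A M = dual (opp A) (Tr A P1' f' P0')" by (simp add: tau_def e)
  ultimately show thesis using that by blast
qed

lemma hom_zero_iso:
  assumes M: "left_module A M" "left_module A N" "mod_iso A M N"
    and z: "mod_hom A M T = {\<lambda>x\<in>carrier M. \<zero>\<^bsub>T\<^esub>}"
  shows "mod_hom A N T = {\<lambda>x\<in>carrier N. \<zero>\<^bsub>T\<^esub>}"
proof -
  obtain h where h: "h \<in> mod_hom A M N" "bij_betw h (carrier M) (carrier N)" using M(3) by (auto simp: mod_iso_def)
  interpret h: module_hom A M N h using M h by (intro module_homI)
  note i = h.inverse[OF h(2)]
  have "b = (\<lambda>x\<in>carrier N. \<zero>\<^bsub>T\<^esub>)" if b: "b \<in> mod_hom A N T" for b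
  proof -
    have "compose (carrier M) b h \<in> mod_hom A M T" by (rule mod_hom_compose[OF M(1) h(1) b])
    then have e: "compose (carrier M) b h = (\<lambda>x\<in>carrier M. \<zero>\<^bsub>T\<^esub>)" using z by simp
    have "b y = \<zero>\<^bsub>T\<^esub>" if y: "y \<in> carrier N" for y
    proof -
      obtain x where "x \<in> carrier M" "y = h x" using y h(2) unfolding bij_betw_def by blast
      then show ?thesis using fun_cong[OF e, of x] by (simp add: compose_def)
    qed
    then show ?thesis using b by (intro extensionalityI[of _ "carrier N"]) (auto simp: mod_hom_def PiE_def)
  qed
  moreover have "(\<lambda>x\<in>carrier N. \<zero>\<^bsub>T\<^esub>) \<in> mod_hom A N T"
  proof -
    have "(\<lambda>x\<in>carrier M. \<zero>\<^bsub>T\<^esub>) \<in> mod_hom A M T" using z by simp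
    from mod_hom_compose[OF M(2) i(1) this]
    have "compose (carrier N) (\<lambda>x\<in>carrier M. \<zero>\<^bsub>T\<^esub>) (restrict (inv_into (carrier M) h) (carrier N)) \<in> mod_hom A N T" .
    moreover have "compose (carrier N) (\<lambda>x\<in>carrier M. \<zero>\<^bsub>T\<^esub>) (restrict (inv_into (carrier M) h) (carrier N)) = (\<lambda>x\<in>carrier N. \<zero>\<^bsub>T\<^esub>)"
      using i(4) by (auto simp: compose_def bij_betw_def intro!: restrict_ext dest: inv_into_into)
    ultimately show ?thesis by simp
  qed
  ultimately show ?thesis by blast
qed

text \<open>The condition under which all families of forms vanish. The form for a missed arrow from
  x to y meets two kinds of coordinates at y. On the top of a summand \<open>(y, C)\<close> no
  relation restricts it, so there must be no such summand. On the radical of a summand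
  \<open>(x, B)\<close> the relation for \<open>(x, A)\<close> makes the forms of the missed targets
  in B cancel: a single form must then be zero, but two can cancel each other.\<close>

definition rigid_set :: "(nat \<times> nat) set => (nat \<times> nat set) set => bool" where
  "rigid_set E S \<longleftrightarrow> (\<forall>(x, A)\<in>S. (\<forall>y\<in>E `` {x} - A. \<forall>C. (y, C) \<notin> S) \<and> (\<forall>B. (x, B) \<in> S \<longrightarrow> card (B - A) \<le> 1))"

context radsq
begin

lemma lam_gen:
  assumes "valid J t" "j \<in> J" "i \<in> J"
  shows "lam t (gen t j) i = (if i = j then idem (fst (t j)) else \<zero>)"
proof (rule cf_eqI)
  fix x y
  have "fst (t j) \<in> V" using assms by (simp add: valid_def)
  then show "cf (lam t (gen t j) i) (x, y) = cf (if i = j then idem (fst (t j)) else \<zero>) (x, y)"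
    using valid_neq[OF assms(1,2)]
    by (cases "i = j") (auto simp: lam(2)[OF assms(1,2)] lam(2)[OF assms(1,3)] cf_zero cf_idem gen_def)
qed (use lam assms in auto)

lemma lam_idem:
  assumes "valid J t" "j \<in> J"
  shows "lam t f j \<otimes> idem (fst (t j)) = lam t f j"
proof (rule cf_eqI)
  fix x y
  have "fst (t j) \<in> V" using assms by (simp add: valid_def)
  then show "cf (lam t f j \<otimes> idem (fst (t j))) (x, y) = cf (lam t f j) (x, y)"
    using lam[OF assms] by (auto simp: cf_mult cf_idem)
qed (use lam assms in auto)

lemma lam_hom:
  assumes pj: "prj J t" and j: "j \<in> J"
  shows "(\<lambda>f\<in>carrier (Md J t). lam t f j) \<in> mod_hom L (Md J t) (regular_module L)"
proof -
  have v: "valid J t" using pj by (simp add: prj_def)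
  interpret left_module L "Md J t" by (rule left_module_Md[OF v])
  note lm = lam[OF v j]
  show ?thesis
  proof (rule mod_hom_restrictI)
    show "lam t f j \<in> carrier (regular_module L)" for f using lm by (simp add: regular_module_def)
    show "lam t (f \<oplus>\<^bsub>Md J t\<^esub> g) j = lam t f j \<oplus>\<^bsub>regular_module L\<^esub> lam t g j" for f g
      unfolding regular_module_def by (simp, intro cf_eqI) (auto simp: lm cf_add Md_add)
    show "lam t (a \<odot>\<^bsub>Md J t\<^esub> f) j = a \<odot>\<^bsub>regular_module L\<^esub> lam t f j" if a: "a \<in> carrier L" for a f
    proof -
      have sn: "snd (t j) = E `` {fst (t j)}" using pj j by (simp add: prj_def)
      have "lam t (a \<odot>\<^bsub>Md J t\<^esub> f) j = a \<otimes> lam t f j"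
      proof (rule cf_eqI)
        fix x y
        show "cf (lam t (a \<odot>\<^bsub>Md J t\<^esub> f) j) (x, y) = cf (a \<otimes> lam t f j) (x, y)"
        proof (cases "x = fst (t j) \<and> (y = x \<or> y \<in> snd (t j))")
          case True
          then show ?thesis using a lm valid_neq[OF v j] by (auto simp: cf_mult Md_smult)
        next
          case False
          then have "cf a (x, y) = 0" if "x = fst (t j)" using cf_nonzero[OF a, of x y] sn that by auto
          then show ?thesis using False a lm by (auto simp: cf_mult)
        qed
      qed (use a lm in auto)
      then show ?thesis by (simp add: regular_module_def)
    qed
  qed (auto simp: smult_closed)
qed

text \<open>\<open>Fam\<close> for the explicit presentation of \<open>Md J t\<close>.\<close>

definition Fm :: "nat set => shape => ('a, 'm) module => (nat => 'm => 'k) => bool" where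
  "Fm J t X \<beta> \<longleftrightarrow> (\<forall>i\<in>J1 J t. (\<forall>m\<in>carrier X. \<forall>n\<in>carrier X. \<beta> i (m \<oplus>\<^bsub>X\<^esub> n) = \<beta> i m + \<beta> i n) \<and>
     (\<forall>m\<in>carrier X. (\<forall>c. \<beta> i (sc c \<odot>\<^bsub>X\<^esub> m) = c * \<beta> i m) \<and> \<beta> i (idem (snd (prod_decode i)) \<odot>\<^bsub>X\<^esub> m) = \<beta> i m)) \<and>
     (\<forall>j\<in>J. \<forall>m\<in>carrier X. (\<Sum>i | i \<in> J1 J t \<and> fst (prod_decode i) = j.
        \<beta> i (arr (fst (t (fst (prod_decode i)))) (snd (prod_decode i)) \<odot>\<^bsub>X\<^esub> m)) = 0)"

lemma tau_hom_zero_iff: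
  fixes M :: "('k, 'a) fmod" and X :: "('a, 'm) module"
  assumes M: "left_module L M" and v: "valid J t" and iso: "mod_iso L (Md J t) M" and X: "left_module L X"
  shows "mod_hom L X (tau L M) = {\<lambda>x\<in>carrier X. \<zero>\<^bsub>tau L M\<^esub>} \<longleftrightarrow>
    (\<forall>\<beta>. Fm J t X \<beta> \<longrightarrow> (\<forall>i\<in>J1 J t. \<forall>m\<in>carrier X. \<beta> i m = 0))"
proof -
  obtain h where h: "h \<in> mod_hom L (Md J t) M" "bij_betw h (carrier (Md J t)) (carrier M)"
    using iso by (auto simp: mod_iso_def)
  note mp = min_proj_presentation_iso[OF min_proj_presentation_Md[OF v] left_module_Md[OF v] M h]
  obtain P1 f P0 p' where P: "min_proj_presentation L P1 f P0 p' M" "tau L M = dual (opp L) (Tr L P1 f P0)"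
    using tau_presentation[OF mp] .
  obtain u1 u0 where u: "u1 \<in> mod_hom L (Md (J1 J t) pt1) P1" "bij_betw u1 (carrier (Md (J1 J t) pt1)) (carrier P1)"
    "u0 \<in> mod_hom L (Md J (pt0 t)) P0" "bij_betw u0 (carrier (Md J (pt0 t))) (carrier P0)"
    "\<And>x. x \<in> carrier (Md (J1 J t) pt1) ==> f (u1 x) = u0 (pf J t x)"
    by (rule min_proj_presentation_unique[OF M mp P(1)]) (rule that; assumption)
  note pj0 = prj_pt0[OF v] and pj1 = prj_pt1[OF v]
  have v0: "valid J (pt0 t)" and v1: "valid (J1 J t) pt1" using pj0 pj1 by (auto simp: prj_def)
  have lm: "left_module L P1" "left_module L P0" "f \<in> mod_hom L P1 P0"
    using P(1) by (auto simp: min_proj_presentation_def projective_def fg_module_def)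
  interpret u1: module_hom L "Md (J1 J t) pt1" P1 u1 by (rule module_homI[OF left_module_Md[OF v1] lm(1) u(1)])
  interpret u0: module_hom L "Md J (pt0 t)" P0 u0 by (rule module_homI[OF left_module_Md[OF v0] lm(2) u(3)])
  note i1 = u1.inverse[OF u(2)] and i0 = u0.inverse[OF u(4)]
  \<comment> \<open>Generators and functionals of the chosen presentation are those of the explicit
    one, transported by \<open>u1\<close> and \<open>u0\<close> and their inverses.\<close>
  define w1 where "w1 = restrict (inv_into (carrier (Md (J1 J t) pt1)) u1) (carrier P1)"
  define w0 where "w0 = restrict (inv_into (carrier (Md J (pt0 t))) u0) (carrier P0)"
  note i1 = i1[folded w1_def] and i0 = i0[folded w0_def]
  define g where "g i = compose (carrier P1) (\<lambda>f\<in>carrier (Md (J1 J t) pt1). lam pt1 f i) w1" for i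
  define G where "G j = compose (carrier P0) (\<lambda>f\<in>carrier (Md J (pt0 t)). lam (pt0 t) f j) w0" for j
  have w1c: "w1 x \<in> carrier (Md (J1 J t) pt1)" if "x \<in> carrier P1" for x using mod_hom_closed[OF i1(1) that] .
  have w0c: "w0 x \<in> carrier (Md J (pt0 t))" if "x \<in> carrier P0" for x using mod_hom_closed[OF i0(1) that] .
  have g_eq: "g i x = lam pt1 (w1 x) i" if "x \<in> carrier P1" for i x using that w1c[OF that] by (simp add: g_def compose_def)
  have G_eq: "G j x = lam (pt0 t) (w0 x) j" if "x \<in> carrier P0" for j x using that w0c[OF that] by (simp add: G_def compose_def)
  have srcJ: "fst (prod_decode i) \<in> J" "i = pe (fst (prod_decode i)) (snd (prod_decode i))" if "i \<in> J1 J t" for i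
    using that by (auto simp: J1_def)
  have fin: "finite J" "finite (J1 J t)" using v0 v1 by (auto simp: valid_def)
  have fp: "f (u1 (gen pt1 i)) = arr (fst (t (fst (prod_decode i)))) (snd (prod_decode i)) \<odot>\<^bsub>P0\<^esub> u0 (gen (pt0 t) (fst (prod_decode i)))"
    if i: "i \<in> J1 J t" for i
  proof -
    have "pf J t (gen pt1 i) = arr (fst (t (fst (prod_decode i)))) (snd (prod_decode i)) \<odot>\<^bsub>Md J (pt0 t)\<^esub> gen (pt0 t) (fst (prod_decode i))"
      using pf_gen[OF v, of "fst (prod_decode i)" "snd (prod_decode i)"] srcJ[OF i] i by simp
    then show ?thesis using u(5)[OF gen_carrier[OF i]] u0.smult[OF _ gen_carrier[OF srcJ(1)[OF i]]] by simp
  qed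
  interpret tau_data V E L cf P1 P0 f "J1 J t" J "\<lambda>i. u1 (gen pt1 i)" g "\<lambda>j. u0 (gen (pt0 t) j)" G
    "\<lambda>i. snd (prod_decode i)" "\<lambda>i. fst (prod_decode i)" "\<lambda>i. arr (fst (t (fst (prod_decode i)))) (snd (prod_decode i))"
  proof unfold_locales
    show "u1 (gen pt1 i) \<in> carrier P1" if "i \<in> J1 J t" for i by (rule u1.closed[OF gen_carrier[OF that]])
    show "g i \<in> mod_hom L P1 (regular_module L)" if "i \<in> J1 J t" for i
      unfolding g_def by (rule mod_hom_compose[OF lm(1) i1(1) lam_hom[OF pj1 that]])
    show "x = finsum P1 (\<lambda>i. g i x \<odot>\<^bsub>P1\<^esub> u1 (gen pt1 i)) (J1 J t)" if x: "x \<in> carrier P1" for x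
    proof -
      have c: "(\<lambda>i. lam pt1 (w1 x) i \<odot>\<^bsub>Md (J1 J t) pt1\<^esub> gen pt1 i) \<in> J1 J t \<rightarrow> carrier (Md (J1 J t) pt1)"
        using lam(1)[OF v1] gen_carrier u1.M.smult_closed by auto
      have "x = u1 (w1 x)" using i1(3)[OF x] by simp
      also have "\<dots> = u1 (finsum (Md (J1 J t) pt1) (\<lambda>i. lam pt1 (w1 x) i \<odot>\<^bsub>Md (J1 J t) pt1\<^esub> gen pt1 i) (J1 J t))"
        using Md_expand[OF v1 w1c[OF x]] by simp
      also have "\<dots> = finsum P1 (\<lambda>i. u1 (lam pt1 (w1 x) i \<odot>\<^bsub>Md (J1 J t) pt1\<^esub> gen pt1 i)) (J1 J t)"
        by (rule u1.finsum[OF fin(2) c])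
      also have "\<dots> = finsum P1 (\<lambda>i. g i x \<odot>\<^bsub>P1\<^esub> u1 (gen pt1 i)) (J1 J t)"
        using lam(1)[OF v1] gen_carrier u1.closed u1.N.smult_closed
        by (intro u1.N.M.finsum_cong') (auto simp: g_eq[OF x] u1.smult)
      finally show ?thesis .
    qed
    show "g i x \<otimes> idem (snd (prod_decode i)) = g i x" if "i \<in> J1 J t" "x \<in> carrier P1" for i x
      using lam_idem[OF v1 that(1), of "w1 x"] that(2) by (simp add: g_eq pt1_def)
    show "g i (u1 (gen pt1 i')) = (if i = i' then idem (snd (prod_decode i)) else \<zero>)"
      if "i \<in> J1 J t" "i' \<in> J1 J t" for i i'
      using lam_gen[OF v1 that(2,1)] i1(2)[OF gen_carrier[OF that(2)]] u1.closed[OF gen_carrier[OF that(2)]]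
      by (auto simp: g_eq pt1_def)
    show "u0 (gen (pt0 t) j) \<in> carrier P0" if "j \<in> J" for j by (rule u0.closed[OF gen_carrier[OF that]])
    show "G j \<in> mod_hom L P0 (regular_module L)" if "j \<in> J" for j
      unfolding G_def by (rule mod_hom_compose[OF lm(2) i0(1) lam_hom[OF pj0 that]])
    show "G j (f (u1 (gen pt1 i))) = (if fst (prod_decode i) = j then arr (fst (t (fst (prod_decode i)))) (snd (prod_decode i)) else \<zero>)"
      if i: "i \<in> J1 J t" and j: "j \<in> J" for i j
    proof -
      let ?a = "arr (fst (t (fst (prod_decode i)))) (snd (prod_decode i))" and ?s = "fst (prod_decode i)"
      note gc = gen_carrier[OF srcJ(1)[OF i], of "pt0 t"]
      interpret Gj: module_hom L P0 "regular_module L" "G j"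
        by (rule module_homI[OF lm(2) R.left_module_regular]) (unfold G_def, rule mod_hom_compose[OF lm(2) i0(1) lam_hom[OF pj0 j]])
      have "G j (f (u1 (gen pt1 i))) = ?a \<otimes> G j (u0 (gen (pt0 t) ?s))"
        using fp[OF i] Gj.smult[OF _ u0.closed[OF gc], of ?a] by (simp add: regular_module_def)
      also have "G j (u0 (gen (pt0 t) ?s)) = lam (pt0 t) (gen (pt0 t) ?s) j"
        using G_eq[OF u0.closed[OF gc]] i0(2)[OF gc] by simp
      also have "\<dots> = (if j = ?s then idem (fst (t ?s)) else \<zero>)"
        using lam_gen[OF v0 srcJ(1)[OF i] j] by (simp add: pt0_def)
      finally show ?thesis by (auto simp: mult_arr_idem)
    qed
  qed (use lm fin srcJ fp in auto)
  have F: "Fam X \<beta> = Fm J t X \<beta>" for \<beta> unfolding Fam_def Fm_def ..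
  show ?thesis unfolding P(2) using hom_tau_zeroI[OF X] hom_tau_zeroD[OF X] F by blast
qed

lemma Fm_zero_iff_rigid:
  assumes v: "valid J t"
  shows "(\<forall>\<beta>. Fm J t (Md J t) \<beta> \<longrightarrow> (\<forall>i\<in>J1 J t. \<forall>m\<in>carrier (Md J t). \<beta> i m = 0)) \<longleftrightarrow> rigid_set E (t ` J)"
proof
  interpret left_module L "Md J t" by (rule left_module_Md[OF v])
  have fin: "finite (J1 J t)" using prj_pt1[OF v] by (auto simp: prj_def valid_def)
  have xA: "fst (t j) \<notin> snd (t j)" "snd (t j) \<subseteq> E `` {fst (t j)}" "fst (t j) \<in> V" if "j \<in> J" for j
    using valid_neq[OF v that] v that by (auto simp: valid_def)
  {
    assume zero: "\<forall>\<beta>. Fm J t (Md J t) \<beta> \<longrightarrow> (\<forall>i\<in>J1 J t. \<forall>m\<in>carrier (Md J t). \<beta> i m = 0)"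
    have 1: "fst (t i0) \<noteq> y" if j: "j \<in> J" and y: "y \<in> E `` {fst (t j)} - snd (t j)" and i0: "i0 \<in> J" for j y i0
    proof
      assume t0: "fst (t i0) = y"
      \<comment> \<open>The coordinate form on the top of the summand \<open>i0\<close>. Arrows
        never reach top coordinates, so all relations hold.\<close>
      define \<beta> where "\<beta> i m = (if i = pe j y then m (pe i0 y) else 0)" for i :: nat and m :: "nat => 'k"
      have yV: "y \<in> V" using y arcD by blast
      have "Fm J t (Md J t) \<beta>" unfolding Fm_def
      proof (intro conjI ballI allI)
        fix i m assume "i \<in> J1 J t" and m: "m \<in> carrier (Md J t)"
        show "\<beta> i (m \<oplus>\<^bsub>Md J t\<^esub> n) = \<beta> i m + \<beta> i n" for n by (simp add: \<beta>_def Md_add)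
        show "\<beta> i (sc c \<odot>\<^bsub>Md J t\<^esub> m) = c * \<beta> i m" for c by (simp add: \<beta>_def Md_sc[OF v m])
        show "\<beta> i (idem (snd (prod_decode i)) \<odot>\<^bsub>Md J t\<^esub> m) = \<beta> i m"
          using yV t0 by (auto simp: \<beta>_def Md_smult cf_idem)
      next
        fix j' m
        show "(\<Sum>i | i \<in> J1 J t \<and> fst (prod_decode i) = j'. \<beta> i (arr (fst (t (fst (prod_decode i)))) (snd (prod_decode i)) \<odot>\<^bsub>Md J t\<^esub> m)) = 0"
          using t0 by (intro sum.neutral) (auto simp: \<beta>_def Md_smult cf_arr)
      qed
      then have "\<beta> (pe j y) (gen t i0) = 0" using zero j y gen_carrier[OF i0] J1_iff by blast
      then show False using t0 by (simp add: \<beta>_def gen_def)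
    qed
    have 2: "card (snd (t i0) - snd (t j)) \<le> 1" if j: "j \<in> J" and i0: "i0 \<in> J" and x: "fst (t i0) = fst (t j)" for j i0
    proof (rule ccontr)
      assume nc: "\<not> card (snd (t i0) - snd (t j)) \<le> 1"
      then have "finite (snd (t i0) - snd (t j))" by (rule contrapos_np) simp
      then obtain y1 y2 where y: "y1 \<in> snd (t i0) - snd (t j)" "y2 \<in> snd (t i0) - snd (t j)" "y1 \<noteq> y2"
        using nc by (metis One_nat_def card_le_Suc0_iff_eq)
      \<comment> \<open>Two forms that cancel in the one relation where they occur, since both
        arrows carry the same top coordinate of \<open>i0\<close> to their targets.\<close>
      define \<beta> where "\<beta> i m = (if i = pe j y1 then m (pe i0 y1) else if i = pe j y2 then - m (pe i0 y2) else 0)" for i :: nat and m :: "nat => 'k"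
      have E12: "(fst (t j), y1) \<in> E" "(fst (t j), y2) \<in> E" "y1 \<in> V" "y2 \<in> V" "fst (t i0) \<noteq> y1" "fst (t i0) \<noteq> y2"
      proof -
        show e: "(fst (t j), y1) \<in> E" "(fst (t j), y2) \<in> E" using xA(2)[OF i0] y x by auto
        show "y1 \<in> V" "y2 \<in> V" using e arcD by blast+
        show "fst (t i0) \<noteq> y1" "fst (t i0) \<noteq> y2" using xA(1)[OF i0] y by auto
      qed
      have k: "pe j y1 \<in> J1 J t" "pe j y2 \<in> J1 J t" using j y E12 by (auto simp: J1_iff)
      have "Fm J t (Md J t) \<beta>" unfolding Fm_def
      proof (intro conjI ballI allI)
        fix i m assume "i \<in> J1 J t" and m: "m \<in> carrier (Md J t)"
        show "\<beta> i (m \<oplus>\<^bsub>Md J t\<^esub> n) = \<beta> i m + \<beta> i n" for n by (simp add: \<beta>_def Md_add)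
        show "\<beta> i (sc c \<odot>\<^bsub>Md J t\<^esub> m) = c * \<beta> i m" for c by (simp add: \<beta>_def Md_sc[OF v m])
        show "\<beta> i (idem (snd (prod_decode i)) \<odot>\<^bsub>Md J t\<^esub> m) = \<beta> i m"
          using y E12 by (auto simp: \<beta>_def Md_smult cf_idem)
      next
        fix j' m
        let ?S = "{i. i \<in> J1 J t \<and> fst (prod_decode i) = j'}"
        let ?f = "\<lambda>i. \<beta> i (arr (fst (t (fst (prod_decode i)))) (snd (prod_decode i)) \<odot>\<^bsub>Md J t\<^esub> m)"
        have f1: "?f (pe j y1) = m (pe i0 (fst (t j)))" "?f (pe j y2) = - m (pe i0 (fst (t j)))"
          using y E12 x by (auto simp: \<beta>_def Md_smult cf_arr)
        have f0: "?f i = 0" if "i \<noteq> pe j y1" "i \<noteq> pe j y2" for i using that by (simp add: \<beta>_def)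
        show "sum ?f ?S = 0"
        proof (cases "j' = j")
          case True
          then have sub: "{pe j y1, pe j y2} \<subseteq> ?S" using k by auto
          have "sum ?f ?S = sum ?f {pe j y1, pe j y2}"
            using fin sub f0 by (intro sum.mono_neutral_right) auto
          also have "\<dots> = 0" using f1 y(3) by (simp del: fst_conv snd_conv prod_encode_inverse)
          finally show ?thesis .
        next
          case False then show ?thesis by (intro sum.neutral) (auto intro!: f0)
        qed
      qed
      moreover define m where "m = (\<lambda>i. if i = pe i0 y1 then 1 else 0 :: 'k)"
      moreover have "m \<in> carrier (Md J t)" using i0 y by (auto simp: m_def Md_carrier)
      ultimately have "\<beta> (pe j y1) m = 0" using zero k by blast
      then show False by (simp add: \<beta>_def m_def)
    qed
    show "rigid_set E (t ` J)" unfolding rigid_set_def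
    proof safe
      fix x A j y C i0
      assume j: "(x, A) = t j" "j \<in> J" and y: "(x, y) \<in> E" "y \<notin> A" and "(y, C) = t i0" "i0 \<in> J"
      then show False using 1[OF j(2), of y i0] by (metis DiffI Image_singleton_iff fst_conv snd_conv)
    next
      fix x A j B i0
      assume "(x, A) = t j" "j \<in> J" "(x, B) = t i0" "i0 \<in> J"
      then show "card (B - A) \<le> 1" using 2[of j i0] by (metis fst_conv snd_conv)
    qed
  }
  assume rig: "rigid_set E (t ` J)"
  have r1: "fst (t i0) \<noteq> y" if "j \<in> J" "y \<in> E `` {fst (t j)} - snd (t j)" "i0 \<in> J" for j y i0
  proof
    assume "fst (t i0) = y"
    then have "(y, snd (t i0)) \<in> t ` J" using that(3) by (metis imageI prod.collapse)
    moreover have "(fst (t j), snd (t j)) \<in> t ` J" using that(1) by simp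
    ultimately show False using rig that(2) unfolding rigid_set_def by blast
  qed
  have r2: "card (snd (t i0) - snd (t j)) \<le> 1" if "j \<in> J" "i0 \<in> J" "fst (t i0) = fst (t j)" for j i0
  proof -
    have "(fst (t j), snd (t i0)) \<in> t ` J" using that(2,3) by (metis imageI prod.collapse)
    moreover have "(fst (t j), snd (t j)) \<in> t ` J" using that(1) by simp
    ultimately show ?thesis using rig unfolding rigid_set_def by blast
  qed
  show "\<forall>\<beta>. Fm J t (Md J t) \<beta> \<longrightarrow> (\<forall>i\<in>J1 J t. \<forall>m\<in>carrier (Md J t). \<beta> i m = 0)"
  proof (intro allI impI ballI)
    fix \<beta> i m assume F: "Fm J t (Md J t) \<beta>" and i: "i \<in> J1 J t" and m: "m \<in> carrier (Md J t)"
    obtain j y where k: "i = pe j y" "j \<in> J" "y \<in> E `` {fst (t j)} - snd (t j)" using i by (auto simp: J1_def)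
    note F = F[unfolded Fm_def]
    have add: "\<beta> i (m \<oplus>\<^bsub>Md J t\<^esub> n) = \<beta> i m + \<beta> i n" if "i \<in> J1 J t" "m \<in> carrier (Md J t)" "n \<in> carrier (Md J t)" for i m n
      using F that by blast
    have idm: "\<beta> i m = \<beta> i (idem y \<odot>\<^bsub>Md J t\<^esub> m)" if "m \<in> carrier (Md J t)" for m
    proof -
      have "\<beta> i (idem (snd (prod_decode i)) \<odot>\<^bsub>Md J t\<^esub> m) = \<beta> i m" using F i that by blast
      then show ?thesis using k(1) by simp
    qed
    have \<beta>0: "\<beta> i \<zero>\<^bsub>Md J t\<^esub> = 0" if "i \<in> J1 J t" for i
      using add[OF that M.zero_closed M.zero_closed] by (metis M.l_zero M.zero_closed add_cancel_right_right)
    \<comment> \<open>By additivity it is enough to treat elements of a single summand.\<close>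
    have single: "\<beta> i n = 0" if n: "n \<in> carrier (Md {i0} t)" and i0: "i0 \<in> J" for n i0
    proof -
      have nz: "n (pe a u) \<noteq> 0 ==> a = i0 \<and> (u = fst (t i0) \<or> u \<in> snd (t i0))" for a u
        using n unfolding Md_carrier by blast
      have nJ: "n \<in> carrier (Md J t)" using n i0 Md_mono[of "{i0}" J t] by blast
      have yV: "y \<in> V" "(fst (t j), y) \<in> E" using k arcD by blast+
      show ?thesis
      proof (cases "y \<in> snd (t i0)")
        case True
        then have x: "fst (t i0) = fst (t j)" using xA(2)[OF i0] yV(2) indeg by blast
        \<comment> \<open>The arrow to \<open>y\<close> takes \<open>n'\<close> to the part of
          \<open>n\<close> at \<open>y\<close>. Every other missed arrow of \<open>j\<close> kills
          \<open>n'\<close>, since by rigidity \<open>y\<close> is the only target missed by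
          \<open>j\<close> in the shape of \<open>i0\<close>. So the relation of \<open>j\<close> at
          \<open>n'\<close> has a single term.\<close>
        define n' where "n' = scl (n (pe i0 y)) (gen t i0)"
        have n': "n' \<in> carrier (Md J t)" using gen_carrier[OF i0, of t] by (auto simp: n'_def Md_carrier)
        have n'_pe: "n' (pe a u) = (if a = i0 \<and> u = fst (t i0) then n (pe i0 y) else 0)" for a u by (simp add: n'_def gen_def)
        have e: "idem y \<odot>\<^bsub>Md J t\<^esub> n = arr (fst (t j)) y \<odot>\<^bsub>Md J t\<^esub> n'"
        proof (rule pe_ext)
          fix a u
          show "(idem y \<odot>\<^bsub>Md J t\<^esub> n) (pe a u) = (arr (fst (t j)) y \<odot>\<^bsub>Md J t\<^esub> n') (pe a u)"
          proof (cases "a = i0")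
            case True
            then show ?thesis using \<open>y \<in> snd (t i0)\<close> x yV xA(1)[OF i0] by (auto simp: Md_smult cf_idem cf_arr n'_pe)
          next
            case False
            then have "n (pe a w) = 0" for w using nz by blast
            then show ?thesis using False by (auto simp: Md_smult n'_pe)
          qed
        qed
        have kill: "arr (fst (t j)) y' \<odot>\<^bsub>Md J t\<^esub> n' = \<zero>\<^bsub>Md J t\<^esub>" if y': "y' \<in> E `` {fst (t j)} - snd (t j)" "y' \<noteq> y" for y'
        proof -
          have "y' \<notin> snd (t i0)"
          proof
            assume "y' \<in> snd (t i0)"
            then have "{y, y'} \<subseteq> snd (t i0) - snd (t j)" using True k y' by blast
            moreover have "finite (snd (t i0) - snd (t j))" using xA(2)[OF i0] finite_out finite_subset by blast
            ultimately have "card {y, y'} \<le> 1" using r2[OF k(2) i0 x] by (meson card_mono le_trans)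
            then show False using y'(2) by simp
          qed
          then show ?thesis by (intro pe_ext) (auto simp: Md_smult Md_zero cf_arr n'_pe)
        qed
        let ?S = "{i'. i' \<in> J1 J t \<and> fst (prod_decode i') = j}"
        let ?f = "\<lambda>i'. \<beta> i' (arr (fst (t (fst (prod_decode i')))) (snd (prod_decode i')) \<odot>\<^bsub>Md J t\<^esub> n')"
        have "sum ?f ?S = 0" using F k(2) n' by blast
        moreover have "sum ?f ?S = sum ?f {i}"
        proof (rule sum.mono_neutral_right)
          show "\<forall>i'\<in>?S - {i}. ?f i' = 0"
          proof
            fix i' assume i': "i' \<in> ?S - {i}"
            then obtain y' where "i' = pe j y'" "y' \<in> E `` {fst (t j)} - snd (t j)" "y' \<noteq> y" using k(1) by (auto simp: J1_def)
            then show "?f i' = 0" using kill[of y'] \<beta>0[of i'] i' by simp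
          qed
        qed (use fin i k(1) in auto)
        ultimately have "\<beta> i (arr (fst (t j)) y \<odot>\<^bsub>Md J t\<^esub> n') = 0" using k(1) by simp
        then show ?thesis using idm[OF nJ] e by simp
      next
        case False
        have "idem y \<odot>\<^bsub>Md J t\<^esub> n = \<zero>\<^bsub>Md J t\<^esub>"
        proof (rule pe_ext)
          fix a u show "(idem y \<odot>\<^bsub>Md J t\<^esub> n) (pe a u) = \<zero>\<^bsub>Md J t\<^esub> (pe a u)"
          proof (cases "a = i0")
            case True
            then show ?thesis using \<open>y \<notin> snd (t i0)\<close> r1[OF k(2,3) i0] by (auto simp: Md_smult cf_idem Md_zero)
          next
            case False
            then have "n (pe a w) = 0" for w using nz by blast
            then show ?thesis by (auto simp: Md_smult Md_zero)
          qed
        qed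
        then show ?thesis using idm[OF nJ] \<beta>0[OF i] by simp
      qed
    qed
    have c1: "lam t m i0 \<odot>\<^bsub>Md J t\<^esub> gen t i0 \<in> carrier (Md {i0} t)" if "i0 \<in> J" for i0
    proof -
      interpret S: left_module L "Md {i0} t" by (rule left_module_Md[OF valid_subset[OF v]]) (use that in auto)
      have "lam t m i0 \<odot>\<^bsub>Md {i0} t\<^esub> gen t i0 \<in> carrier (Md {i0} t)"
        by (rule S.smult_closed[OF lam(1)[OF v that] gen_carrier]) simp
      then show ?thesis by (simp add: Md_def)
    qed
    have c: "(\<lambda>i0. lam t m i0 \<odot>\<^bsub>Md J t\<^esub> gen t i0) \<in> J \<rightarrow> carrier (Md J t)"
      using lam(1)[OF v] gen_carrier smult_closed by auto
    have "\<beta> i m = \<beta> i (finsum (Md J t) (\<lambda>i0. lam t m i0 \<odot>\<^bsub>Md J t\<^esub> gen t i0) J)"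
      using Md_expand[OF v m] by simp
    also have "\<dots> = (\<Sum>i0\<in>J. \<beta> i (lam t m i0 \<odot>\<^bsub>Md J t\<^esub> gen t i0))"
      by (rule additive_finsum[OF add[OF i] _ c]) (use v in \<open>simp_all add: valid_def\<close>)
    also have "\<dots> = 0" using single c1 by (intro sum.neutral) auto
    finally show "\<beta> i m = 0" .
  qed
qed

lemma tau_rigid_iff:
  fixes M :: "('k, 'a) fmod"
  assumes fg: "fg_module L M" and t: "has_type M m"
  shows "tau_rigid L M \<longleftrightarrow> rigid_set E (set_mset m)"
proof -
  have M: "left_module L M" using fg by (rule fg_moduleD)
  obtain J t' where J: "valid J t'" "mtype J t' = m" "mod_iso L (Md J t') M" using t by (auto simp: has_type_def)
  note Jm = left_module_Md[OF J(1)]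
  have "tau_rigid L M \<longleftrightarrow> mod_hom L (Md J t') (tau L M) = {\<lambda>x\<in>carrier (Md J t'). \<zero>\<^bsub>tau L M\<^esub>}"
    using fg hom_zero_iso[OF Jm M J(3), of "tau L M"] hom_zero_iso[OF M Jm mod_iso_sym[OF Jm M J(3)], of "tau L M"]
    by (auto simp: tau_rigid_def)
  also have "\<dots> \<longleftrightarrow> rigid_set E (t' ` J)"
    using tau_hom_zero_iff[OF M J(1,3) Jm] Fm_zero_iff_rigid[OF J(1)] by simp
  also have "t' ` J = set_mset m" using J(1,2) by (auto simp: mtype_def valid_def)
  finally show ?thesis .
qed

end

section \<open>Projective dimension and extensions\<close>

text \<open>Images of generators of \<open>N\<close> together with lifts of generators of
  \<open>M\<close> generate \<open>E\<close>.\<close>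

lemma fg_extension:
  fixes R :: "('a, 'r) ring_scheme"
  assumes fg: "fg_module R N" "fg_module R M" and E: "left_module R E"
    and i: "i \<in> mod_hom R N E" and p: "p \<in> mod_hom R E M" "p ` carrier E = carrier M"
    and ex: "i ` carrier N = hom_kernel E M p"
  shows "fg_module R E"
proof -
  interpret LN: left_module R N using fg by (simp add: fg_module_def)
  interpret LM: left_module R M using fg by (simp add: fg_module_def)
  interpret LE: left_module R E by (rule E)
  interpret i: module_hom R N E i using fg E i by (intro module_homI) (auto simp: fg_module_def)
  interpret p: module_hom R E M p using fg E p by (intro module_homI) (auto simp: fg_module_def)
  obtain S where S: "finite S" "S \<subseteq> carrier N" "\<And>K. submodule K R N ==> S \<subseteq> K ==> K = carrier N"
    using fg(1) by (auto simp: fg_module_def)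
  obtain S' where S': "finite S'" "S' \<subseteq> carrier M" "\<And>K. submodule K R M ==> S' \<subseteq> K ==> K = carrier M"
    using fg(2) by (auto simp: fg_module_def)
  define l where "l = inv_into (carrier E) p"
  have l: "l x \<in> carrier E" "p (l x) = x" if "x \<in> S'" for x
    using S'(2) p(2) that by (auto simp: l_def inv_into_into f_inv_into_f)
  have "K = carrier E" if K: "submodule K R E" "i ` S \<union> l ` S' \<subseteq> K" for K
  proof -
    have 1: "{x \<in> carrier N. i x \<in> K} = carrier N"
      using S(2) K by (intro S(3) i.submodule_preimage) auto
    have "p ` K = carrier M" using K(2) l(2) by (intro S'(3) p.submodule_image K(1)) (force simp: image_iff)
    have "e \<in> K" if e: "e \<in> carrier E" for e
    proof -
      have "p e \<in> p ` K" using \<open>p ` K = carrier M\<close> p.closed[OF e] by simp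
      then obtain k where k: "p e = p k" "k \<in> K" by (rule imageE)
      have kc: "k \<in> carrier E" using k(2) K(1) by (auto simp: LE.submodule_iff)
      have "e \<ominus>\<^bsub>E\<^esub> k \<in> hom_kernel E M p"
        using e kc k(1) by (simp add: hom_kernel_def p.diff p.closed LM.minus_eq_zero_iff)
      then obtain v where "e \<ominus>\<^bsub>E\<^esub> k = i v" "v \<in> carrier N" unfolding ex[symmetric] by (rule imageE)
      then have "e \<ominus>\<^bsub>E\<^esub> k \<in> K" using 1 by auto
      then have "k \<oplus>\<^bsub>E\<^esub> (e \<ominus>\<^bsub>E\<^esub> k) \<in> K" using k(2) K(1) by (auto simp: LE.submodule_iff)
      moreover have "k \<oplus>\<^bsub>E\<^esub> (e \<ominus>\<^bsub>E\<^esub> k) = e" using e kc by (simp add: a_minus_def LE.M.a_comm[of e] LE.M.r_neg2)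
      ultimately show ?thesis by simp
    qed
    then show ?thesis using K(1) by (auto simp: LE.submodule_iff)
  qed
  moreover have "finite (i ` S \<union> l ` S')" "i ` S \<union> l ` S' \<subseteq> carrier E" using S S' l i.closed by auto
  ultimately show ?thesis using E unfolding fg_module_def
    by (intro conjI exI[of _ "i ` S \<union> l ` S'"]) auto
qed

text \<open>Lift the cover \<open>p\<close> to a map \<open>q\<close> into the extension. On the
  kernel of \<open>p\<close> it lands in \<open>N\<close>; factoring the resulting map through
  \<open>P0\<close> corrects \<open>q\<close> to a map \<open>r\<close> that vanishes on this
  kernel, and \<open>r\<close> descends to a section.\<close>

lemma Ext1_zeroI:
  fixes A :: "('k::field, 'a) module" and M N P1 P0 :: "('k, 'a) fmod"
  assumes P0: "projective A P0" and P1: "left_module A P1" and p: "p \<in> mod_hom A P0 M" "p ` carrier P0 = carrier M"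
    and f: "f \<in> mod_hom A P1 P0" "f ` carrier P1 = hom_kernel P0 M p"
    and fac: "\<And>\<psi>. \<psi> \<in> mod_hom A P1 N ==> \<exists>h\<in>mod_hom A P0 N. \<forall>x\<in>carrier P1. h (f x) = \<psi> x"
  shows "Ext1_zero A M N"
  unfolding Ext1_zero_def
proof (intro allI impI)
  fix i E \<pi> assume se: "short_exact A N i E \<pi> M"
  note se = se[unfolded short_exact_def]
  have fgs: "fg_module A N" "fg_module A E" "fg_module A M" using se by auto
  have lm: "left_module A N" "left_module A E" "left_module A M" "left_module A P0"
    using fgs P0 by (auto simp: projective_def fg_module_def)
  obtain q where q: "q \<in> mod_hom A P0 E" "\<And>x. x \<in> carrier P0 ==> \<pi> (q x) = p x"
    using projectiveD[OF P0 fgs(2,3) _ _ p(1)] se by metis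
  interpret LN: left_module A N by (rule lm)
  interpret LE: left_module A E by (rule lm)
  interpret LM: left_module A M by (rule lm)
  interpret LP0: left_module A P0 by (rule lm)
  interpret LP1: left_module A P1 by (rule P1)
  interpret i: module_hom A N E i using lm se by (intro module_homI) auto
  interpret \<pi>: module_hom A E M \<pi> using lm se by (intro module_homI) auto
  interpret q: module_hom A P0 E q using lm q by (intro module_homI) auto
  interpret p: module_hom A P0 M p using lm p by (intro module_homI) auto
  interpret f: module_hom A P1 P0 f using lm P1 f by (intro module_homI) auto
  have inj: "inj_on i (carrier N)" and ker: "i ` carrier N = hom_kernel E M \<pi>" and onto: "\<pi> ` carrier E = carrier M"
    using se by auto
  have qf: "q (f x) \<in> i ` carrier N" if "x \<in> carrier P1" for x
  proof -
    have "f x \<in> hom_kernel P0 M p" using f(2) that by blast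
    then show ?thesis unfolding ker using q(2)[OF f.closed[OF that]] q.closed[OF f.closed[OF that]] by (simp add: hom_kernel_def)
  qed
  define g where "g = inv_into (carrier N) i"
  have g: "g (q (f x)) \<in> carrier N" "i (g (q (f x))) = q (f x)" if "x \<in> carrier P1" for x
    using qf[OF that] by (auto simp: g_def inv_into_into f_inv_into_f)
  have "(\<lambda>x\<in>carrier P1. g (q (f x))) \<in> mod_hom A P1 N"
  proof (rule mod_hom_restrictI)
    show "g (q (f (x \<oplus>\<^bsub>P1\<^esub> y))) = g (q (f x)) \<oplus>\<^bsub>N\<^esub> g (q (f y))" if xy: "x \<in> carrier P1" "y \<in> carrier P1" for x y
    proof (rule inj_onD[OF inj])
      have "i (g (q (f (x \<oplus>\<^bsub>P1\<^esub> y)))) = q (f (x \<oplus>\<^bsub>P1\<^esub> y))" by (rule g(2)) (use xy in simp)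
      also have "\<dots> = i (g (q (f x)) \<oplus>\<^bsub>N\<^esub> g (q (f y)))"
        using xy g f.closed by (simp add: i.add f.add q.add)
      finally show "i (g (q (f (x \<oplus>\<^bsub>P1\<^esub> y)))) = i (g (q (f x)) \<oplus>\<^bsub>N\<^esub> g (q (f y)))" .
    qed (use xy g(1)[of "x \<oplus>\<^bsub>P1\<^esub> y"] g(1) in simp_all)
    show "g (q (f (a \<odot>\<^bsub>P1\<^esub> x))) = a \<odot>\<^bsub>N\<^esub> g (q (f x))" if ax: "a \<in> carrier A" "x \<in> carrier P1" for a x
    proof (rule inj_onD[OF inj])
      have "i (g (q (f (a \<odot>\<^bsub>P1\<^esub> x)))) = q (f (a \<odot>\<^bsub>P1\<^esub> x))" by (rule g(2)) (rule LP1.smult_closed[OF ax])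
      also have "\<dots> = i (a \<odot>\<^bsub>N\<^esub> g (q (f x)))"
        using ax g f.closed by (simp add: i.smult f.smult q.smult)
      finally show "i (g (q (f (a \<odot>\<^bsub>P1\<^esub> x)))) = i (a \<odot>\<^bsub>N\<^esub> g (q (f x)))" .
      show "g (q (f (a \<odot>\<^bsub>P1\<^esub> x))) \<in> carrier N" by (rule g(1)[OF LP1.smult_closed[OF ax]])
      show "a \<odot>\<^bsub>N\<^esub> g (q (f x)) \<in> carrier N" by (rule LN.smult_closed[OF ax(1) g(1)[OF ax(2)]])
    qed
  qed (use g in \<open>auto simp: LP1.smult_closed\<close>)
  then obtain h where h: "h \<in> mod_hom A P0 N" "\<And>x. x \<in> carrier P1 ==> h (f x) = g (q (f x))"
    using fac by fastforce
  interpret h: module_hom A P0 N h using lm h by (intro module_homI)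
  define r where "r x = q x \<ominus>\<^bsub>E\<^esub> i (h x)" for x
  have rc: "r x \<in> carrier E" if "x \<in> carrier P0" for x using that q.closed h.closed i.closed by (simp add: r_def)
  have radd: "r (x \<oplus>\<^bsub>P0\<^esub> y) = r x \<oplus>\<^bsub>E\<^esub> r y" if "x \<in> carrier P0" "y \<in> carrier P0" for x y
    using that q.closed h.closed i.closed
    by (simp add: r_def q.add h.add i.add a_minus_def LE.M.minus_add LE.M.a_ac)
  have rsm: "r (a \<odot>\<^bsub>P0\<^esub> x) = a \<odot>\<^bsub>E\<^esub> r x" if "a \<in> carrier A" "x \<in> carrier P0" for a x
    using that q.closed h.closed i.closed
    by (simp add: r_def q.smult h.smult i.smult LE.smult_minus_distr)
  have rf: "r (f x) = \<zero>\<^bsub>E\<^esub>" if "x \<in> carrier P1" for x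
    using h(2)[OF that] g[OF that] q.closed[OF f.closed[OF that]] by (simp add: r_def LE.minus_eq_zero_iff)
  have \<pi>r: "\<pi> (r x) = p x" if "x \<in> carrier P0" for x
  proof -
    have "i (h x) \<in> hom_kernel E M \<pi>" using ker h.closed[OF that] by blast
    then show ?thesis using that q(2)[OF that] q.closed[OF that] p.closed[OF that]
      by (simp add: r_def \<pi>.diff hom_kernel_def) (simp add: a_minus_def)
  qed
  have req: "r x = r y" if xy: "x \<in> carrier P0" "y \<in> carrier P0" "p x = p y" for x y
  proof -
    have "x \<ominus>\<^bsub>P0\<^esub> y \<in> hom_kernel P0 M p"
      using xy by (simp add: hom_kernel_def p.diff p.closed LM.minus_eq_zero_iff)
    then obtain z where z: "z \<in> carrier P1" "x \<ominus>\<^bsub>P0\<^esub> y = f z" unfolding f(2)[symmetric] by blast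
    have "x = y \<oplus>\<^bsub>P0\<^esub> f z" unfolding z(2)[symmetric]
      using xy by (simp add: a_minus_def LP0.M.a_comm[of x] LP0.M.r_neg2)
    then show ?thesis using radd[OF xy(2) f.closed[OF z(1)]] rf[OF z(1)] rc[OF xy(2)] by simp
  qed
  define l where "l = inv_into (carrier P0) p"
  have l: "l m \<in> carrier P0" "p (l m) = m" if "m \<in> carrier M" for m
    using p(2) that by (auto simp: l_def inv_into_into f_inv_into_f)
  have "(\<lambda>m\<in>carrier M. r (l m)) \<in> mod_hom A M E"
  proof (rule mod_hom_restrictI)
    show "r (l m) \<in> carrier E" if "m \<in> carrier M" for m using rc l that by simp
    show "r (l (m \<oplus>\<^bsub>M\<^esub> n)) = r (l m) \<oplus>\<^bsub>E\<^esub> r (l n)" if "m \<in> carrier M" "n \<in> carrier M" for m n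
    proof -
      have "r (l (m \<oplus>\<^bsub>M\<^esub> n)) = r (l m \<oplus>\<^bsub>P0\<^esub> l n)" by (rule req) (use that l in \<open>auto simp: p.add\<close>)
      then show ?thesis using radd l that by simp
    qed
    show "r (l (a \<odot>\<^bsub>M\<^esub> m)) = a \<odot>\<^bsub>E\<^esub> r (l m)" if "a \<in> carrier A" "m \<in> carrier M" for a m
    proof -
      have "r (l (a \<odot>\<^bsub>M\<^esub> m)) = r (a \<odot>\<^bsub>P0\<^esub> l m)"
        by (rule req) (use that l in \<open>auto simp: p.smult LP0.smult_closed LM.smult_closed\<close>)
      then show ?thesis using rsm l that by simp
    qed
  qed (auto simp: LM.smult_closed)
  then show "\<exists>s\<in>mod_hom A M E. \<forall>x\<in>carrier M. \<pi> (s x) = x"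
    by (rule bexI[rotated]) (use \<pi>r l in simp)
qed

lemma Ext1_zero_iso:
  fixes A :: "('k::field, 'a) module" and M N :: "('k, 'a) fmod"
  assumes fg: "fg_module A M" "fg_module A N" and iso: "mod_iso A M N" and e: "Ext1_zero A N N"
  shows "Ext1_zero A M M"
  unfolding Ext1_zero_def
proof (intro allI impI)
  fix i E \<pi> assume se: "short_exact A M i E \<pi> M"
  note se = se[unfolded short_exact_def]
  have lm: "left_module A M" "left_module A N" "left_module A E" using fg se by (auto simp: fg_module_def)
  obtain h where h: "h \<in> mod_hom A M N" "bij_betw h (carrier M) (carrier N)" using iso by (auto simp: mod_iso_def)
  interpret h: module_hom A M N h using lm h by (intro module_homI)
  interpret i: module_hom A M E i using lm se by (intro module_homI) auto
  interpret \<pi>: module_hom A E M \<pi> using lm se by (intro module_homI) auto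
  note v = h.inverse[OF h(2)]
  define h' where "h' = restrict (inv_into (carrier M) h) (carrier N)"
  note v = v[folded h'_def]
  have h'c: "h' y \<in> carrier M" if "y \<in> carrier N" for y using mod_hom_closed[OF v(1) that] .
  have him: "h ` carrier M = carrier N" "h' ` carrier N = carrier M" using h(2) v(4) by (auto simp: bij_betw_def)
  have "short_exact A N (compose (carrier N) i h') E (compose (carrier E) h \<pi>) N"
    unfolding short_exact_def
  proof (intro conjI)
    show "compose (carrier N) i h' \<in> mod_hom A N E" by (rule mod_hom_compose[OF lm(2) v(1) i.hom])
    show "compose (carrier E) h \<pi> \<in> mod_hom A E N" by (rule mod_hom_compose[OF lm(3) \<pi>.hom h(1)])
    show "inj_on (compose (carrier N) i h') (carrier N)"
      using se v(4) h'c by (auto simp: inj_on_def compose_def bij_betw_def)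
    show "compose (carrier E) h \<pi> ` carrier E = carrier N"
      using se him(1) by (auto simp: compose_def image_image[symmetric])
    have "compose (carrier N) i h' ` carrier N = i ` carrier M"
      using him(2) by (auto simp: compose_def image_image[symmetric])
    also have "\<dots> = hom_kernel E M \<pi>" using se by simp
    also have "\<dots> = hom_kernel E N (compose (carrier E) h \<pi>)"
      using h(2) h.inj_iff h.zero \<pi>.closed by (auto simp: hom_kernel_def compose_def bij_betw_def)
    finally show "compose (carrier N) i h' ` carrier N = hom_kernel E N (compose (carrier E) h \<pi>)" .
  qed (use fg se in auto)
  then obtain s where s: "s \<in> mod_hom A N E" "\<And>x. x \<in> carrier N ==> compose (carrier E) h \<pi> (s x) = x"
    using e unfolding Ext1_zero_def by blast
  have "\<pi> (s (h x)) = x" if x: "x \<in> carrier M" for x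
  proof (rule inj_onD[OF bij_betw_imp_inj_on[OF h(2)]])
    have "s (h x) \<in> carrier E" using mod_hom_closed[OF s(1) h.closed[OF x]] .
    then show "h (\<pi> (s (h x))) = h x" "\<pi> (s (h x)) \<in> carrier M"
      using s(2)[OF h.closed[OF x]] \<pi>.closed by (auto simp: compose_def)
  qed (rule x)
  then show "\<exists>s\<in>mod_hom A M E. \<forall>x\<in>carrier M. \<pi> (s x) = x"
    using mod_hom_compose[OF lm(1) h(1) s(1)] by (intro bexI[of _ "compose (carrier M) s h"]) (auto simp: compose_def)
qed

text \<open>The condition for projective dimension at most one: the first syzygy is a sum of simple
  modules S_y at missed targets, and S_y is projective only if y is a sink.\<close>

definition zset :: "(nat \<times> nat) set => (nat \<times> nat set) set => bool" where
  "zset E S \<longleftrightarrow> (\<forall>(x, A)\<in>S. \<forall>y\<in>E `` {x} - A. E `` {y} = {})"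

text \<open>The middle term of an extension must have its carrier in \<open>nat => 'k\<close> as
  well, so its two halves share one function, on even and on odd arguments.\<close>

definition ev :: "(nat => 'k) => nat => 'k" where "ev f = (\<lambda>i. f (2 * i))"
definition od :: "(nat => 'k) => nat => 'k" where "od f = (\<lambda>i. f (2 * i + 1))"
definition jn :: "(nat => 'k) => (nat => 'k) => nat => 'k" where
  "jn a b = (\<lambda>k. if even k then a (k div 2) else b (k div 2))"

lemma ev_jn [simp]: "ev (jn a b) = a" and od_jn [simp]: "od (jn a b) = b" and jn_ev_od: "jn (ev f) (od f) = f"
  by (auto simp: ev_def od_def jn_def fun_eq_iff elim!: oddE)

lemma jn_inject: "jn a b = jn c d \<longleftrightarrow> a = c \<and> b = d"
  by (metis ev_jn od_jn)

section \<open>Projective dimension and self-extensions as conditions on pairs\<close>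

context radsq
begin

text \<open>A cover of \<open>P\<close> by a sum of modules P_x splits, so the question moves to
  such a sum. There no top coordinate at \<open>x\<close> is killed by the arrow to
  \<open>y\<close>, and only radical coordinates remain.\<close>

lemma projective_kernel:
  fixes P :: "('k, 'a) fmod"
  assumes P: "projective L P" and xy: "(x, y) \<in> E"
    and u: "u \<in> carrier P" "idem x \<odot>\<^bsub>P\<^esub> u = u" "arr x y \<odot>\<^bsub>P\<^esub> u = \<zero>\<^bsub>P\<^esub>"
  shows "\<exists>z\<in>carrier P. u = arr (inc x) x \<odot>\<^bsub>P\<^esub> z"
proof -
  have fg: "fg_module L P" using P by (simp add: projective_def)
  then have lm: "left_module L P" by (rule fg_moduleD)
  obtain J t q where J: "valid J t" "\<forall>j\<in>J. snd (t j) = E `` {fst (t j)}"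
    "q \<in> mod_hom L (Md J t) P" "q ` carrier (Md J t) = carrier P" using projective_cover_ex[OF fg] .
  obtain s where s: "s \<in> mod_hom L P (Md J t)" "\<And>x. x \<in> carrier P ==> q (s x) = x"
    using projectiveD[OF P fg_Md[OF J(1)] fg J(3,4) mod_hom_id[OF lm]] by (metis restrict_apply')
  interpret q: module_hom L "Md J t" P q by (rule module_homI[OF left_module_Md[OF J(1)] lm J(3)])
  interpret s: module_hom L P "Md J t" s by (rule module_homI[OF lm left_module_Md[OF J(1)] s(1)])
  have xV: "x \<in> V" using xy arcD by blast
  have "idem x \<odot>\<^bsub>Md J t\<^esub> s u = s u" "arr x y \<odot>\<^bsub>Md J t\<^esub> s u = \<zero>\<^bsub>Md J t\<^esub>"
    using u s.smult[of "idem x" u] s.smult[of "arr x y" u] s.zero by auto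
  then have "s u \<in> {f \<in> carrier (Md J t). idem x \<odot>\<^bsub>Md J t\<^esub> f = f \<and>
      (\<forall>z\<in>E `` {x} - (E `` {x} - {y}). arr x z \<odot>\<^bsub>Md J t\<^esub> f = \<zero>\<^bsub>Md J t\<^esub>)}"
    using s.closed[OF u(1)] by auto
  then have "s u \<in> Sp ((\<lambda>j. pe j x) ` {j \<in> J. fst (t j) = x \<and> snd (t j) \<subseteq> E `` {x} - {y} \<or> x \<in> snd (t j)})"
    unfolding Md_top_part[OF J(1) xV] .
  moreover have "{j \<in> J. fst (t j) = x \<and> snd (t j) \<subseteq> E `` {x} - {y} \<or> x \<in> snd (t j)} = {j \<in> J. x \<in> snd (t j)}"
    using J(2) xy by auto
  ultimately have "s u \<in> (\<lambda>f. arr (inc x) x \<odot>\<^bsub>Md J t\<^esub> f) ` carrier (Md J t)"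
    unfolding Md_rad_part[OF J(1)] by simp
  then obtain g where g: "s u = arr (inc x) x \<odot>\<^bsub>Md J t\<^esub> g" "g \<in> carrier (Md J t)" by (rule imageE)
  then have "u = arr (inc x) x \<odot>\<^bsub>P\<^esub> q g" using s(2)[OF u(1)] q.smult[of "arr (inc x) x" g] by simp
  then show ?thesis using q.closed[OF g(2)] by blast
qed

lemma gen_relations:
  assumes v: "valid J t" and j: "j \<in> J"
  shows "idem (fst (t j)) \<odot>\<^bsub>Md J t\<^esub> gen t j = gen t j"
    "y \<notin> snd (t j) ==> arr (fst (t j)) y \<odot>\<^bsub>Md J t\<^esub> gen t j = \<zero>\<^bsub>Md J t\<^esub>"
proof -
  have "fst (t j) \<in> V" using v j by (simp add: valid_def)
  then show "idem (fst (t j)) \<odot>\<^bsub>Md J t\<^esub> gen t j = gen t j"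
    using valid_neq[OF v j] by (intro pe_ext) (auto simp: Md_smult gen_def cf_idem)
  show "arr (fst (t j)) y \<odot>\<^bsub>Md J t\<^esub> gen t j = \<zero>\<^bsub>Md J t\<^esub>" if "y \<notin> snd (t j)"
    using that by (intro pe_ext) (auto simp: Md_smult gen_def cf_arr Md_zero)
qed

text \<open>If all missed targets are sinks, the covers P_y of the syzygy are simple and the minimal
  presentation is injective. Conversely, let a missed target \<open>y\<close> have an arrow to
  \<open>z\<close>. In a projective resolution of length one the generator of the summand then lifts
  to an element killed by the missed arrow, hence to one in the radical; but the generator is not in
  the radical.\<close>

lemma proj_dim_le_1_iff:
  fixes M :: "('k, 'a) fmod"
  assumes fg: "fg_module L M" and t: "has_type M m"
  shows "proj_dim_le_1 L M \<longleftrightarrow> zset E (set_mset m)"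
proof
  have M: "left_module L M" using fg by (rule fg_moduleD)
  obtain J t' where J: "valid J t'" "mtype J t' = m" "mod_iso L (Md J t') M" using t by (auto simp: has_type_def)
  have set: "set_mset m = t' ` J" using J(1,2) by (auto simp: mtype_def valid_def)
  obtain h where h: "h \<in> mod_hom L (Md J t') M" "bij_betw h (carrier (Md J t')) (carrier M)"
    using J(3) by (auto simp: mod_iso_def)
  interpret LMd: left_module L "Md J t'" by (rule left_module_Md[OF J(1)])
  interpret LM: left_module L M by (rule M)
  interpret h: module_hom L "Md J t'" M h by (rule module_homI[OF left_module_Md[OF J(1)] M h(1)])
  {
    assume "proj_dim_le_1 L M"
    then obtain P1 i P0 p where P: "projective L P1" "projective L P0" and se: "short_exact L P1 i P0 p M"
      by (auto simp: proj_dim_le_1_def)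
    note se = se[unfolded short_exact_def]
    have lm: "left_module L P1" "left_module L P0" using se by (auto simp: fg_module_def)
    interpret LP1: left_module L P1 by (rule lm)
    interpret LP0: left_module L P0 by (rule lm)
    interpret i: module_hom L P1 P0 i using lm se by (intro module_homI) auto
    interpret p: module_hom L P0 M p using lm M se by (intro module_homI) auto
    have inj: "inj_on i (carrier P1)" and ker: "i ` carrier P1 = hom_kernel P0 M p" and onto: "p ` carrier P0 = carrier M"
      using se by auto
    show "zset E (set_mset m)" unfolding zset_def set
    proof safe
      fix x A j y z assume jA: "(x, A) = t' j" "j \<in> J" and xy: "(x, y) \<in> E" "y \<notin> A" and yz: "(y, z) \<in> E"
      have fx: "fst (t' j) = x" "snd (t' j) = A" using jA(1)[symmetric] by auto
      note gr = gen_relations[OF J(1) jA(2), unfolded fx]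
      let ?\<tau> = "h (gen t' j)"
      have \<tau>: "?\<tau> \<in> carrier M" using h.closed gen_carrier[OF jA(2)] by blast
      have \<tau>1: "idem x \<odot>\<^bsub>M\<^esub> ?\<tau> = ?\<tau>" "arr x y \<odot>\<^bsub>M\<^esub> ?\<tau> = \<zero>\<^bsub>M\<^esub>"
        using gr(1) gr(2)[OF xy(2)] h.smult[OF _ gen_carrier[OF jA(2)]] h.zero by (metis idem(1), metis arr(1))
      obtain p' where p': "p' \<in> carrier P0" "p p' = ?\<tau>" using onto \<tau> by (metis imageE)
      let ?p0 = "idem x \<odot>\<^bsub>P0\<^esub> p'"
      have p0: "?p0 \<in> carrier P0" "p ?p0 = ?\<tau>" "idem x \<odot>\<^bsub>P0\<^esub> ?p0 = ?p0"
        using p' \<tau>1 by (auto simp: LP0.smult_closed p.smult LP0.smult_assoc[symmetric] mult_idem_idem)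
      have "arr x y \<odot>\<^bsub>P0\<^esub> ?p0 \<in> hom_kernel P0 M p"
        using p0(1,2) \<tau>1 by (simp add: hom_kernel_def p.smult LP0.smult_closed)
      then obtain u' where u': "u' \<in> carrier P1" "arr x y \<odot>\<^bsub>P0\<^esub> ?p0 = i u'" using ker by blast
      let ?u = "idem y \<odot>\<^bsub>P1\<^esub> u'"
      have u: "?u \<in> carrier P1" "i ?u = arr x y \<odot>\<^bsub>P0\<^esub> ?p0" "idem y \<odot>\<^bsub>P1\<^esub> ?u = ?u"
      proof -
        show "?u \<in> carrier P1" "idem y \<odot>\<^bsub>P1\<^esub> ?u = ?u"
          using u'(1) by (simp_all add: LP1.smult_closed LP1.smult_assoc[symmetric] mult_idem_idem)
        have "i ?u = idem y \<odot>\<^bsub>P0\<^esub> (arr x y \<odot>\<^bsub>P0\<^esub> ?p0)" using u' by (simp add: i.smult)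
        also have "\<dots> = (idem y \<otimes> arr x y) \<odot>\<^bsub>P0\<^esub> ?p0" using p0(1) by (simp only: LP0.smult_assoc idem arr)
        finally show "i ?u = arr x y \<odot>\<^bsub>P0\<^esub> ?p0" by (simp add: mult_idem_arr)
      qed
      \<comment> \<open>The product of two arrows is zero and \<open>i\<close> is injective, so the
        arrow to \<open>z\<close> kills \<open>?u\<close>. In the projective module
        \<open>P1\<close> this puts \<open>?u\<close> in the image of the arrow from
        \<open>x\<close>.\<close>
      have "i (arr y z \<odot>\<^bsub>P1\<^esub> ?u) = \<zero>\<^bsub>P0\<^esub>"
      proof -
        have "i (arr y z \<odot>\<^bsub>P1\<^esub> ?u) = arr y z \<odot>\<^bsub>P0\<^esub> (arr x y \<odot>\<^bsub>P0\<^esub> ?p0)"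
          using i.smult[OF arr u(1), of y z] u(2) by simp
        also have "\<dots> = (arr y z \<otimes> arr x y) \<odot>\<^bsub>P0\<^esub> ?p0" using p0(1) by (simp only: LP0.smult_assoc arr)
        finally show ?thesis using p0(1) by (simp add: mult_arr_arr LP0.smult_zero_left)
      qed
      then have "arr y z \<odot>\<^bsub>P1\<^esub> ?u = \<zero>\<^bsub>P1\<^esub>" using inj i.inj_iff LP1.smult_closed[OF arr u(1)] by blast
      then obtain z' where z': "z' \<in> carrier P1" "?u = arr (inc y) y \<odot>\<^bsub>P1\<^esub> z'"
        using projective_kernel[OF P(1) yz u(1,3)] by blast
      have incy: "inc y = x" using inc[OF xy(1)] .
      let ?z = "idem x \<odot>\<^bsub>P1\<^esub> z'"
      have zc: "?z \<in> carrier P1" "arr x y \<odot>\<^bsub>P1\<^esub> ?z = ?u"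
        using z' incy by (auto simp: LP1.smult_closed LP1.smult_assoc[symmetric] mult_arr_idem)
      \<comment> \<open>Correcting the lift by an element from \<open>P1\<close> does not change its
        image in \<open>M\<close>, and afterwards the arrow to \<open>y\<close> kills it.\<close>
      let ?d = "?p0 \<ominus>\<^bsub>P0\<^esub> i ?z"
      have dc: "?d \<in> carrier P0" using p0(1) i.closed[OF zc(1)] by simp
      have d1: "idem x \<odot>\<^bsub>P0\<^esub> ?d = ?d"
      proof -
        have "idem x \<odot>\<^bsub>P0\<^esub> i ?z = i ?z"
          using z'(1) i.smult[of "idem x" ?z] zc(1) by (simp add: LP1.smult_assoc[symmetric] mult_idem_idem)
        then show ?thesis using p0 i.closed[OF zc(1)] by (simp add: LP0.smult_minus_distr)
      qed
      have d2: "arr x y \<odot>\<^bsub>P0\<^esub> ?d = \<zero>\<^bsub>P0\<^esub>"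
      proof -
        have "arr x y \<odot>\<^bsub>P0\<^esub> i ?z = arr x y \<odot>\<^bsub>P0\<^esub> ?p0" using i.smult[OF arr zc(1), of x y] zc(2) u(2) by metis
        then show ?thesis using p0(1) i.closed[OF zc(1)]
          by (simp add: LP0.smult_minus_distr LP0.minus_eq_zero_iff LP0.smult_closed)
      qed
      obtain e where e: "e \<in> carrier P0" "?d = arr (inc x) x \<odot>\<^bsub>P0\<^esub> e"
        using projective_kernel[OF P(2) xy(1) dc d1 d2] by blast
      have "i ?z \<in> hom_kernel P0 M p" using ker zc(1) by blast
      then have "p ?d = ?\<tau>" using p0(1,2) i.closed[OF zc(1)] \<tau>
        by (simp add: p.diff hom_kernel_def) (simp add: a_minus_def)
      then have \<tau>e: "?\<tau> = arr (inc x) x \<odot>\<^bsub>M\<^esub> p e" using e p.smult[OF arr e(1)] by simp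
      obtain f where f: "f \<in> carrier (Md J t')" "p e = h f" using p.closed[OF e(1)] h(2) unfolding bij_betw_def by blast
      have "h (gen t' j) = h (arr (inc x) x \<odot>\<^bsub>Md J t'\<^esub> f)" using \<tau>e f h.smult[OF arr f(1)] by simp
      then have "gen t' j = arr (inc x) x \<odot>\<^bsub>Md J t'\<^esub> f"
        using inj_onD[OF bij_betw_imp_inj_on[OF h(2)]] gen_carrier[OF jA(2)] LMd.smult_closed[OF arr f(1)] by blast
      then have "gen t' j (pe j x) = (arr (inc x) x \<odot>\<^bsub>Md J t'\<^esub> f) (pe j x)" by simp
      then show "z \<in> {}" using fx by (simp add: gen_def Md_smult cf_arr)
    qed
  next
    assume Z: "zset E (set_mset m)"
    note mp = min_proj_presentation_iso[OF min_proj_presentation_Md[OF J(1)] left_module_Md[OF J(1)] M h,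
        unfolded min_proj_presentation_def]
    have sink: "E `` {y} = {}" if "pe j y \<in> J1 J t'" for j y
    proof -
      have "(fst (t' j), snd (t' j)) \<in> t' ` J" "y \<in> E `` {fst (t' j)} - snd (t' j)" using that by (auto simp: J1_iff)
      then show ?thesis using Z unfolding zset_def set by blast
    qed
    interpret f: module_hom L "Md (J1 J t') pt1" "Md J (pt0 t')" "pf J t'"
      using mp by (intro module_homI) (auto simp: projective_def fg_module_def)
    have "u = \<zero>\<^bsub>Md (J1 J t') pt1\<^esub>" if u: "u \<in> carrier (Md (J1 J t') pt1)" "pf J t' u = \<zero>\<^bsub>Md J (pt0 t')\<^esub>" for u
    proof (rule pe_ext)
      fix k w
      obtain j y where k: "k = pe j y" by (metis prod_decode_inverse surj_pair)
      show "u (pe k w) = \<zero>\<^bsub>Md (J1 J t') pt1\<^esub> (pe k w)"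
      proof (cases "u (pe k w) = 0")
        case False
        then have "pe j y \<in> J1 J t' \<and> (w = fst (pt1 (pe j y)) \<or> w \<in> snd (pt1 (pe j y)))"
          using u(1) unfolding Md_carrier k by blast
        then have kJ: "pe j y \<in> J1 J t'" "w = y" using sink[of j y] by (auto simp: pt1_def)
        then have "pf J t' u (pe j y) = u (pe (pe j y) y)" by (simp add: pf_pe[OF u(1)] J1_iff)
        then show ?thesis using u(2) kJ k by (simp add: Md_zero)
      qed (simp add: Md_zero)
    qed
    then have "inj_on (pf J t') (carrier (Md (J1 J t') pt1))" using f.inj_iff by blast
    then have "short_exact L (Md (J1 J t') pt1) (pf J t') (Md J (pt0 t')) (compose (carrier (Md J (pt0 t'))) h (pp J t')) M"
      unfolding short_exact_def using mp fg by (simp add: projective_def)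
    then show "proj_dim_le_1 L M" unfolding proj_dim_le_1_def using mp by blast
  }
qed

text \<open>The image of a generator of P_y lies over \<open>y\<close>. By rigidity it has
  coordinates only in radicals of summands with top at the source of the missed arrow, and there the
  arrow is undone by moving the coordinates to the tops.\<close>

lemma rigid_factor:
  assumes v: "valid J t" and rig: "rigid_set E (t ` J)"
    and \<psi>: "\<psi> \<in> mod_hom L (Md (J1 J t) pt1) (Md J t)"
  shows "\<exists>h\<in>mod_hom L (Md J (pt0 t)) (Md J t). \<forall>x\<in>carrier (Md (J1 J t) pt1). h (pf J t x) = \<psi> x"
proof -
  have v0: "valid J (pt0 t)" and v1: "valid (J1 J t) pt1" using prj_pt0[OF v] prj_pt1[OF v] by (auto simp: prj_def)
  note mp = min_proj_presentation_Md[OF v, unfolded min_proj_presentation_def]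
  interpret \<psi>: module_hom L "Md (J1 J t) pt1" "Md J t" \<psi>
    by (rule module_homI[OF left_module_Md[OF v1] left_module_Md[OF v] \<psi>])
  have xA: "fst (t j) \<notin> snd (t j)" "snd (t j) \<subseteq> E `` {fst (t j)}" "fst (t j) \<in> V" if "j \<in> J" for j
    using valid_neq[OF v that] v that by (auto simp: valid_def)
  \<comment> \<open>By rigidity the sum over targets missed by \<open>j\<close> has at most one term
    for each summand \<open>a\<close> with the same vertex. Therefore one element serves all missed
    arrows of \<open>j\<close> at once.\<close>
  define hh where "hh j = (\<lambda>i. case prod_decode i of (a, u) =>
      if a \<in> J \<and> u = fst (t a) \<and> u = fst (t j)
      then \<Sum>y\<in>snd (t a) - snd (t j). \<psi> (gen pt1 (pe j y)) (pe a y) else 0)" for j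
  have hh_pe: "hh j (pe a u) = (if a \<in> J \<and> u = fst (t a) \<and> u = fst (t j)
      then \<Sum>y\<in>snd (t a) - snd (t j). \<psi> (gen pt1 (pe j y)) (pe a y) else 0)" for j a u
    by (simp add: hh_def)
  have hhc: "hh j \<in> carrier (Md J t)" for j unfolding Md_carrier hh_pe by simp
  have rel: "relations (Md J t) J (pt0 t) hh" unfolding relations_def
  proof (intro ballI conjI hhc)
    fix j assume j: "j \<in> J"
    show "idem (fst (pt0 t j)) \<odot>\<^bsub>Md J t\<^esub> hh j = hh j"
    proof (rule pe_ext)
      fix a u
      show "(idem (fst (pt0 t j)) \<odot>\<^bsub>Md J t\<^esub> hh j) (pe a u) = hh j (pe a u)"
      proof (cases "hh j (pe a u) = 0 \<and> hh j (pe a (fst (t a))) = 0")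
        case True then show ?thesis by (auto simp: Md_smult)
      next
        case False
        then have "a \<in> J" by (auto simp: hh_pe split: if_splits)
        then show ?thesis using xA[OF \<open>a \<in> J\<close>] xA(3)[OF j] by (auto simp: Md_smult hh_pe cf_idem pt0_def)
      qed
    qed
  qed (simp add: pt0_def)
  note he = hext[OF left_module_Md[OF v] v0 rel]
  let ?h = "hext (Md J t) J (pt0 t) hh"
  interpret h: module_hom L "Md J (pt0 t)" "Md J t" ?h
    by (rule module_homI[OF left_module_Md[OF v0] left_module_Md[OF v] he(1)])
  have pf: "pf J t \<in> mod_hom L (Md (J1 J t) pt1) (Md J (pt0 t))" using mp by blast
  have "compose (carrier (Md (J1 J t) pt1)) ?h (pf J t) = \<psi>"
  proof (rule Md_hom_eqI[OF left_module_Md[OF v] v1 mod_hom_compose[OF left_module_Md[OF v1] pf he(1)] \<psi>])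
    fix i assume i: "i \<in> J1 J t"
    then obtain j y where k: "i = pe j y" "j \<in> J" "y \<in> E `` {fst (t j)} - snd (t j)" by (auto simp: J1_def)
    let ?m = "\<psi> (gen pt1 (pe j y))"
    have gc: "gen pt1 (pe j y) \<in> carrier (Md (J1 J t) pt1)" using gen_carrier i k(1) by blast
    have mc: "?m \<in> carrier (Md J t)" using \<psi>.closed[OF gc] .
    have "idem y \<odot>\<^bsub>Md J t\<^esub> ?m = ?m"
      using gen_relations(1)[OF v1 i] \<psi>.smult[OF idem gc, of y] k(1) by (simp add: pt1_def)
    then have my: "?m (pe a u) = (idem y \<odot>\<^bsub>Md J t\<^esub> ?m) (pe a u)" for a u by simp
    have mnz: "a \<in> J \<and> u = y \<and> y \<in> snd (t a)" if nz: "?m (pe a u) \<noteq> 0" for a u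
    proof -
      have a: "a \<in> J" "u = fst (t a) \<or> u \<in> snd (t a)" using mc nz unfolding Md_carrier by blast+
      have "u = y" using nz my[of a u] a xA(1)[OF a(1)] by (auto simp: Md_smult cf_idem split: if_splits)
      moreover have "fst (t a) \<noteq> y"
      proof
        assume "fst (t a) = y"
        then have "(y, snd (t a)) \<in> t ` J" using a(1) by (metis imageI prod.collapse)
        moreover have "(fst (t j), snd (t j)) \<in> t ` J" using k(2) by simp
        ultimately show False using rig k(3) unfolding rigid_set_def by blast
      qed
      ultimately show ?thesis using a by auto
    qed
    have "arr (fst (t j)) y \<odot>\<^bsub>Md J t\<^esub> hh j = ?m"
    proof (rule pe_ext)
      fix a u
      have E: "(fst (t j), y) \<in> E" using k(3) by simp
      show "(arr (fst (t j)) y \<odot>\<^bsub>Md J t\<^esub> hh j) (pe a u) = ?m (pe a u)"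
      proof (cases "a \<in> J \<and> u = y \<and> y \<in> snd (t a)")
        case True
        then have aJ: "a \<in> J" by blast
        have x: "fst (t a) = fst (t j)" using True xA(2)[OF aJ] E indeg by blast
        have "finite (snd (t a) - snd (t j))" using xA(2)[OF aJ] finite_out finite_subset by blast
        moreover have "card (snd (t a) - snd (t j)) \<le> 1"
        proof -
          have "(fst (t j), snd (t a)) \<in> t ` J" using aJ x by (metis imageI prod.collapse)
          moreover have "(fst (t j), snd (t j)) \<in> t ` J" using k(2) by simp
          ultimately show ?thesis using rig unfolding rigid_set_def by blast
        qed
        moreover have "y \<in> snd (t a) - snd (t j)" using True k(3) by blast
        ultimately have "snd (t a) - snd (t j) = {y}"
          using card_le_Suc0_iff_eq[of "snd (t a) - snd (t j)"] by auto
        then show ?thesis using True x E xA(1)[OF aJ] by (auto simp: Md_smult cf_arr hh_pe)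
      next
        case False
        then have "?m (pe a u) = 0" using mnz by blast
        moreover have "(arr (fst (t j)) y \<odot>\<^bsub>Md J t\<^esub> hh j) (pe a u) = 0"
          using False by (auto simp: Md_smult cf_arr hh_pe)
        ultimately show ?thesis by simp
      qed
    qed
    then have "?h (pf J t (gen pt1 i)) = ?m"
      using pf_gen[OF v, of j y] i k(1) h.smult[OF arr gen_carrier[OF k(2)], of "fst (t j)" y] he(2)[OF k(2)] by simp
    then show "compose (carrier (Md (J1 J t) pt1)) ?h (pf J t) (gen pt1 i) = \<psi> (gen pt1 i)"
      using gc k(1) by (simp add: compose_def)
  qed
  then show ?thesis using he(1) by (metis compose_eq)
qed

lemma Ext1_zero_Md:
  assumes v: "valid J t" and rig: "rigid_set E (t ` J)"
  shows "Ext1_zero L (Md J t) (Md J t)"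
proof -
  note mp = min_proj_presentation_Md[OF v, unfolded min_proj_presentation_def]
  show ?thesis
    by (rule Ext1_zeroI[of L "Md J (pt0 t)" "Md (J1 J t) pt1" "pp J t" _ "pf J t"])
      (use mp rigid_factor[OF v rig] in \<open>auto simp: projective_def fg_module_def\<close>)
qed

text \<open>
  An extension of \<open>Md J t\<close> by itself: the two copies are stored in the even and the odd
  coordinates, and the arrow to \<open>y\<close> maps the generator of the odd summand \<open>j\<close> to the element
  \<open>n\<close> of the even copy.
\<close>

definition Xt :: "nat set => shape => nat => nat => (nat => 'k) => ('k, 'a) fmod" where
  "Xt J t j y n = \<lparr>carrier = {f. ev f \<in> carrier (Md J t) \<and> od f \<in> carrier (Md J t)}, mult = undefined, one = undefined,
     zero = (\<lambda>i. 0), add = (\<lambda>f g i. f i + g i),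
     smult = (\<lambda>a f. jn (\<lambda>i. (a \<odot>\<^bsub>Md J t\<^esub> ev f) i + cf a (fst (t j), y) * od f (pe j (fst (t j))) * n i)
       (a \<odot>\<^bsub>Md J t\<^esub> od f))\<rparr>"

text \<open>A section of the extension \<open>Xt\<close> sends the generator of \<open>j\<close> to
  an element whose odd half is this generator. The missed arrows kill the generator, hence also its
  image, and the even half of the resulting equations gives the required element up to sign.\<close>

lemma Ext1_zero_lift:
  assumes v: "valid J t" and e: "Ext1_zero L (Md J t) (Md J t)"
    and j: "j \<in> J" and y: "y \<in> E `` {fst (t j)} - snd (t j)" "E `` {y} = {}"
    and n: "n \<in> carrier (Md J t)" "idem y \<odot>\<^bsub>Md J t\<^esub> n = n"
  shows "\<exists>e\<in>carrier (Md J t). arr (fst (t j)) y \<odot>\<^bsub>Md J t\<^esub> e = n \<and>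
    (\<forall>y'\<in>E `` {fst (t j)} - snd (t j). y' \<noteq> y \<longrightarrow> arr (fst (t j)) y' \<odot>\<^bsub>Md J t\<^esub> e = \<zero>\<^bsub>Md J t\<^esub>)"
proof -
  let ?x = "fst (t j)" and ?M = "Md J t" and ?X = "Xt J t j y n"
  interpret M: left_module L ?M by (rule left_module_Md[OF v])
  have xy: "(?x, y) \<in> E" "?x \<noteq> y" "y \<in> V" "?x \<in> V" using y arcD by blast+
  \<comment> \<open>As \<open>y\<close> is a sink, the algebra acts on \<open>n\<close> through the
    coefficient at the trivial path of \<open>y\<close> alone. Associativity of the action on
    \<open>?X\<close> rests on this.\<close>
  have an: "(a \<odot>\<^bsub>?M\<^esub> n) i = cf a (y, y) * n i" if a: "a \<in> carrier L" for a i
  proof -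
    have "a \<otimes> idem y = sc (cf a (y, y)) \<otimes> idem y"
    proof (rule cf_eqI)
      fix u w show "cf (a \<otimes> idem y) (u, w) = cf (sc (cf a (y, y)) \<otimes> idem y) (u, w)"
        using a cf_nonzero[OF a, of y w] y(2) xy(3) by (cases "cf a (y, w) = 0") (auto simp: cf_simps)
    qed (use a in auto)
    then have "a \<odot>\<^bsub>?M\<^esub> n = sc (cf a (y, y)) \<odot>\<^bsub>?M\<^esub> n"
      using a n by (metis M.smult_assoc idem(1) sc(1))
    then show ?thesis using Md_sc[OF v n(1)] by simp
  qed
  have Xcar: "f \<in> carrier ?X \<longleftrightarrow> ev f \<in> carrier ?M \<and> od f \<in> carrier ?M" for f by (simp add: Xt_def)
  have evadd: "ev (f \<oplus>\<^bsub>?X\<^esub> g) = ev f \<oplus>\<^bsub>?M\<^esub> ev g" "od (f \<oplus>\<^bsub>?X\<^esub> g) = od f \<oplus>\<^bsub>?M\<^esub> od g" for f g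
    by (auto simp: Xt_def ev_def od_def Md_add)
  have evsm: "ev (a \<odot>\<^bsub>?X\<^esub> f) = (\<lambda>i. (a \<odot>\<^bsub>?M\<^esub> ev f) i + cf a (?x, y) * od f (pe j ?x) * n i)"
    "od (a \<odot>\<^bsub>?X\<^esub> f) = a \<odot>\<^bsub>?M\<^esub> od f" for a f by (simp_all add: Xt_def)
  have ev0: "ev (\<lambda>i. 0) = \<zero>\<^bsub>?M\<^esub>" "od (\<lambda>i. 0) = \<zero>\<^bsub>?M\<^esub>" "\<zero>\<^bsub>?X\<^esub> = (\<lambda>i. 0)" by (auto simp: ev_def od_def Md_zero Xt_def)
  have XI: "f = g" if "ev f = ev g" "od f = od g" for f g :: "nat => 'k" using that by (metis jn_ev_od)
  have nc: "(\<lambda>i. c i + d * n i) \<in> carrier ?M" if "c \<in> carrier ?M" for c d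
    using M.M.a_closed[OF that M.smult_closed[OF sc n(1), of d]] by (simp add: Md_sc[OF v n(1)] Md_add)
  have abX: "abelian_group ?X"
  proof (rule abelian_groupI)
    show "f \<oplus>\<^bsub>?X\<^esub> g \<in> carrier ?X" if "f \<in> carrier ?X" "g \<in> carrier ?X" for f g
      using that by (simp add: Xcar evadd)
    show "\<exists>g\<in>carrier ?X. g \<oplus>\<^bsub>?X\<^esub> f = \<zero>\<^bsub>?X\<^esub>" if "f \<in> carrier ?X" for f
    proof (rule bexI)
      have "ev (\<lambda>i. - f i) = sc (-1) \<odot>\<^bsub>?M\<^esub> ev f" "od (\<lambda>i. - f i) = sc (-1) \<odot>\<^bsub>?M\<^esub> od f"
        using that by (auto simp: Xcar Md_sc[OF v] ev_def od_def)
      then show "(\<lambda>i. - f i) \<in> carrier ?X" using that by (simp add: Xcar M.smult_closed)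
      show "(\<lambda>i. - f i) \<oplus>\<^bsub>?X\<^esub> f = \<zero>\<^bsub>?X\<^esub>" by (simp add: Xt_def)
    qed
    show "\<zero>\<^bsub>?X\<^esub> \<in> carrier ?X" by (simp add: Xcar ev0)
  qed (auto simp: Xt_def add.assoc add.commute)
  have X: "left_module L ?X"
  proof (intro left_module.intro left_module_axioms.intro R.ring_axioms abX)
    show "a \<odot>\<^bsub>?X\<^esub> f \<in> carrier ?X" if "a \<in> carrier L" "f \<in> carrier ?X" for a f
      using that nc[OF M.smult_closed[OF that(1)], of "ev f" "cf a (?x, y) * od f (pe j ?x)"]
      by (simp add: Xcar evsm M.smult_closed)
    show "(a \<oplus> b) \<odot>\<^bsub>?X\<^esub> f = a \<odot>\<^bsub>?X\<^esub> f \<oplus>\<^bsub>?X\<^esub> b \<odot>\<^bsub>?X\<^esub> f" if "a \<in> carrier L" "b \<in> carrier L" "f \<in> carrier ?X" for a b f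
    proof (rule XI)
      show "ev ((a \<oplus> b) \<odot>\<^bsub>?X\<^esub> f) = ev (a \<odot>\<^bsub>?X\<^esub> f \<oplus>\<^bsub>?X\<^esub> b \<odot>\<^bsub>?X\<^esub> f)"
        using that unfolding evsm evadd by (simp add: Xcar M.smult_l_distr cf_add) (simp add: Md_add algebra_simps)
    qed (use that in \<open>simp add: evadd evsm Xcar M.smult_l_distr\<close>)
    show "a \<odot>\<^bsub>?X\<^esub> (f \<oplus>\<^bsub>?X\<^esub> g) = a \<odot>\<^bsub>?X\<^esub> f \<oplus>\<^bsub>?X\<^esub> a \<odot>\<^bsub>?X\<^esub> g" if "a \<in> carrier L" "f \<in> carrier ?X" "g \<in> carrier ?X" for a f g
    proof (rule XI)
      show "ev (a \<odot>\<^bsub>?X\<^esub> (f \<oplus>\<^bsub>?X\<^esub> g)) = ev (a \<odot>\<^bsub>?X\<^esub> f \<oplus>\<^bsub>?X\<^esub> a \<odot>\<^bsub>?X\<^esub> g)"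
        using that unfolding evsm evadd by (simp add: Xcar M.smult_r_distr) (simp add: Md_add algebra_simps)
    qed (use that in \<open>simp add: evadd evsm Xcar M.smult_r_distr\<close>)
    show "(a \<otimes> b) \<odot>\<^bsub>?X\<^esub> f = a \<odot>\<^bsub>?X\<^esub> (b \<odot>\<^bsub>?X\<^esub> f)" if ab: "a \<in> carrier L" "b \<in> carrier L" and f: "f \<in> carrier ?X" for a b f
    proof (rule XI)
      define d where "d = cf b (?x, y) * od f (pe j ?x)"
      have 1: "ev (b \<odot>\<^bsub>?X\<^esub> f) = b \<odot>\<^bsub>?M\<^esub> ev f \<oplus>\<^bsub>?M\<^esub> sc d \<odot>\<^bsub>?M\<^esub> n"
        unfolding evsm Md_sc[OF v n(1)] Md_add d_def by simp
      have "a \<odot>\<^bsub>?M\<^esub> ev (b \<odot>\<^bsub>?X\<^esub> f) = a \<odot>\<^bsub>?M\<^esub> (b \<odot>\<^bsub>?M\<^esub> ev f) \<oplus>\<^bsub>?M\<^esub> sc d \<odot>\<^bsub>?M\<^esub> (a \<odot>\<^bsub>?M\<^esub> n)"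
        unfolding 1 using ab f n(1)
        by (simp add: Xcar M.smult_r_distr M.smult_closed M.smult_assoc[symmetric] sc_commute)
      then have 2: "(a \<odot>\<^bsub>?M\<^esub> ev (b \<odot>\<^bsub>?X\<^esub> f)) i = ((a \<otimes> b) \<odot>\<^bsub>?M\<^esub> ev f) i + d * (cf a (y, y) * n i)" for i
        using ab f by (simp add: Xcar M.smult_assoc Md_add Md_sc[OF v M.smult_closed[OF ab(1) n(1)]] an)
      have 3: "od (b \<odot>\<^bsub>?X\<^esub> f) (pe j ?x) = cf b (?x, ?x) * od f (pe j ?x)" unfolding evsm by (simp add: Md_smult)
      show "ev ((a \<otimes> b) \<odot>\<^bsub>?X\<^esub> f) = ev (a \<odot>\<^bsub>?X\<^esub> (b \<odot>\<^bsub>?X\<^esub> f))"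
        unfolding evsm(1)[of "a \<otimes> b"] evsm(1)[of a] 2 3 using ab xy(2)
        by (simp add: cf_mult d_def algebra_simps)
    qed (use ab f in \<open>simp add: evsm Xcar M.smult_assoc\<close>)
    show "\<one> \<odot>\<^bsub>?X\<^esub> f = f" if "f \<in> carrier ?X" for f
      by (rule XI; use that xy(2) in \<open>auto simp: evsm Xcar M.smult_one cf_one\<close>)
  qed
  define i where "i = (\<lambda>f\<in>carrier ?M. jn f (\<lambda>k. 0))"
  define p where "p = (\<lambda>f\<in>carrier ?X. od f)"
  have "i \<in> mod_hom L ?M ?X" unfolding i_def
  proof (rule mod_hom_restrictI)
    show "jn f (\<lambda>k. 0) \<in> carrier ?X" if "f \<in> carrier ?M" for f using that M.M.zero_closed by (simp add: Xcar Md_zero)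
    show "jn (f \<oplus>\<^bsub>?M\<^esub> g) (\<lambda>k. 0) = jn f (\<lambda>k. 0) \<oplus>\<^bsub>?X\<^esub> jn g (\<lambda>k. 0)" for f g
      by (rule XI) (auto simp: evadd Md_add)
    show "jn (a \<odot>\<^bsub>?M\<^esub> f) (\<lambda>k. 0) = a \<odot>\<^bsub>?X\<^esub> jn f (\<lambda>k. 0)" if "a \<in> carrier L" for a f
      by (rule XI) (use M.smult_zero_right[OF that] in \<open>auto simp: evsm Md_zero\<close>)
  qed (auto simp: M.smult_closed)
  moreover have "p \<in> mod_hom L ?X ?M" unfolding p_def
  proof (rule mod_hom_restrictI)
    show "f \<oplus>\<^bsub>?X\<^esub> g \<in> carrier ?X" if "f \<in> carrier ?X" "g \<in> carrier ?X" for f g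
      using that by (simp add: Xcar evadd)
    show "a \<odot>\<^bsub>?X\<^esub> f \<in> carrier ?X" if "a \<in> carrier L" "f \<in> carrier ?X" for a f
      by (rule left_module.smult_closed[OF X that])
  qed (simp_all add: Xcar evadd evsm)
  moreover have "inj_on i (carrier ?M)" by (auto simp: i_def inj_on_def jn_inject)
  moreover have "p ` carrier ?X = carrier ?M"
  proof (intro equalityI subsetI)
    fix f assume f: "f \<in> carrier ?M"
    then have "jn f f \<in> carrier ?X" by (simp add: Xcar)
    then show "f \<in> p ` carrier ?X" by (force simp: p_def image_iff)
  qed (auto simp: p_def Xcar)
  moreover have "i ` carrier ?M = hom_kernel ?X ?M p"
  proof (intro equalityI subsetI)
    fix f assume "f \<in> hom_kernel ?X ?M p"
    then have f: "ev f \<in> carrier ?M" "od f = (\<lambda>k. 0)" by (auto simp: hom_kernel_def p_def Xcar Md_zero)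
    then have "f = i (ev f)" by - (rule XI; simp add: i_def)
    then show "f \<in> i ` carrier ?M" using f(1) by blast
  next
    fix f assume "f \<in> i ` carrier ?M"
    then show "f \<in> hom_kernel ?X ?M p" using M.M.zero_closed by (auto simp: i_def hom_kernel_def p_def Xcar Md_zero)
  qed
  ultimately have "short_exact L ?M i ?X p ?M"
    unfolding short_exact_def using fg_Md[OF v] fg_extension[OF fg_Md[OF v] fg_Md[OF v] X] by blast
  then obtain s where s: "s \<in> mod_hom L ?M ?X" "\<And>x. x \<in> carrier ?M ==> p (s x) = x"
    using e unfolding Ext1_zero_def by blast
  interpret s: module_hom L ?M ?X s by (rule module_homI[OF M.left_module_axioms X s(1)])
  note gc = gen_carrier[OF j, of t]
  let ?f = "s (gen t j)"
  have fX: "?f \<in> carrier ?X" using s.closed[OF gc] .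
  have odf: "od ?f = gen t j" using s(2)[OF gc] fX by (simp add: p_def)
  have evf: "ev ?f \<in> carrier ?M" using fX Xcar by blast
  have key: "(arr ?x y' \<odot>\<^bsub>?M\<^esub> ev ?f) i + (if y' = y then n i else 0) = 0" if y': "y' \<in> E `` {?x} - snd (t j)" for y' i
  proof -
    have "arr ?x y' \<odot>\<^bsub>?X\<^esub> ?f = \<zero>\<^bsub>?X\<^esub>"
      using gen_relations(2)[OF v j, of y'] y' s.smult[OF arr gc, of ?x y'] s.zero by simp
    then have "ev (arr ?x y' \<odot>\<^bsub>?X\<^esub> ?f) i = 0" unfolding ev0 by (simp add: ev_def)
    then show ?thesis unfolding evsm odf using y' y by (simp add: gen_def cf_arr split: if_splits)
  qed
  \<comment> \<open>The even half solves the equations with minus \<open>n\<close> in place of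
    \<open>n\<close>.\<close>
  define e' where "e' = sc (-1) \<odot>\<^bsub>?M\<^esub> ev ?f"
  have e'c: "e' \<in> carrier ?M" using evf by (simp add: e'_def M.smult_closed)
  have ae: "(arr ?x y' \<odot>\<^bsub>?M\<^esub> e') i = - (arr ?x y' \<odot>\<^bsub>?M\<^esub> ev ?f) i" for y' i
  proof -
    have "arr ?x y' \<odot>\<^bsub>?M\<^esub> e' = sc (-1) \<odot>\<^bsub>?M\<^esub> (arr ?x y' \<odot>\<^bsub>?M\<^esub> ev ?f)"
      using evf by (simp add: e'_def M.smult_assoc[symmetric] sc_commute)
    then show ?thesis using Md_sc[OF v M.smult_closed[OF arr evf]] by simp
  qed
  have "arr ?x y \<odot>\<^bsub>?M\<^esub> e' = n"
  proof
    fix i show "(arr ?x y \<odot>\<^bsub>?M\<^esub> e') i = n i" using key[OF y(1), of i] unfolding ae by (simp add: eq_neg_iff_add_eq_0 neg_eq_iff_add_eq_0)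
  qed
  moreover have "arr ?x y' \<odot>\<^bsub>?M\<^esub> e' = \<zero>\<^bsub>?M\<^esub>" if "y' \<in> E `` {?x} - snd (t j)" "y' \<noteq> y" for y'
  proof
    fix i show "(arr ?x y' \<odot>\<^bsub>?M\<^esub> e') i = \<zero>\<^bsub>?M\<^esub> i" using key[OF that(1), of i] that(2) unfolding ae by (simp add: Md_zero)
  qed
  ultimately show ?thesis using e'c by blast
qed

text \<open>Each violation of rigidity supplies an \<open>n\<close> without the preimage promised by
  \<open>Ext1_zero_lift\<close>. A generator is not in the image of an arrow; and two arrows from
  the same top carry the same coordinate, so that one result cannot vanish without the
  other.\<close>

lemma Ext1_zero_rigid:
  assumes v: "valid J t" and e: "Ext1_zero L (Md J t) (Md J t)" and Z: "zset E (t ` J)"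
  shows "rigid_set E (t ` J)"
  unfolding rigid_set_def
proof safe
  have sink: "E `` {y} = {}" if "j \<in> J" "y \<in> E `` {fst (t j)} - snd (t j)" for j y
  proof -
    have "(fst (t j), snd (t j)) \<in> t ` J" using that(1) by simp
    then show ?thesis using that(2) Z unfolding zset_def by blast
  qed
  {
    fix x A j y C i0
    assume jA: "(x, A) = t j" "j \<in> J" and y: "(x, y) \<in> E" "y \<notin> A" and i0: "(y, C) = t i0" "i0 \<in> J"
    have fx: "fst (t j) = x" "snd (t j) = A" "fst (t i0) = y" using jA(1)[symmetric] i0(1)[symmetric] by auto
    have y': "y \<in> E `` {fst (t j)} - snd (t j)" using y fx by simp
    obtain e where "arr x y \<odot>\<^bsub>Md J t\<^esub> e = gen t i0"
      using Ext1_zero_lift[OF v e jA(2) y' sink[OF jA(2) y'] gen_carrier[OF i0(2)]] gen_relations(1)[OF v i0(2)] fx by auto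
    then have "(arr x y \<odot>\<^bsub>Md J t\<^esub> e) (pe i0 y) = gen t i0 (pe i0 y)" by simp
    then show False using y(1) fx by (auto simp: Md_smult cf_arr gen_def)
  next
    fix x A j B i0
    assume jA: "(x, A) = t j" "j \<in> J" and i0: "(x, B) = t i0" "i0 \<in> J"
    have fx: "fst (t j) = x" "snd (t j) = A" "fst (t i0) = x" "snd (t i0) = B" using jA(1)[symmetric] i0(1)[symmetric] by auto
    show "card (B - A) \<le> 1"
    proof (rule ccontr)
      assume nc: "\<not> card (B - A) \<le> 1"
      then have "finite (B - A)" by (rule contrapos_np) simp
      then obtain y1 y2 where y: "y1 \<in> B - A" "y2 \<in> B - A" "y1 \<noteq> y2"
        using nc by (metis One_nat_def card_le_Suc0_iff_eq)
      have BE: "B \<subseteq> E `` {x}" "x \<notin> B" using v i0(2) fx valid_neq[OF v i0(2)] unfolding valid_def by (metis, metis)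
      then have y': "y1 \<in> E `` {fst (t j)} - snd (t j)" "y2 \<in> E `` {fst (t j)} - snd (t j)" using y fx by auto
      define n where "n = (\<lambda>i. if i = pe i0 y1 then 1 else 0 :: 'k)"
      have n: "n \<in> carrier (Md J t)" using i0(2) y fx by (auto simp: n_def Md_carrier)
      have y1V: "y1 \<in> V" using y' arcD by blast
      have idn: "idem y1 \<odot>\<^bsub>Md J t\<^esub> n = n"
        using y BE fx y1V by (intro pe_ext) (auto simp: Md_smult n_def cf_idem)
      obtain e where e: "arr x y1 \<odot>\<^bsub>Md J t\<^esub> e = n" "arr x y2 \<odot>\<^bsub>Md J t\<^esub> e = \<zero>\<^bsub>Md J t\<^esub>"
        using Ext1_zero_lift[OF v e jA(2) y'(1) sink[OF jA(2) y'(1)] n idn] y'(2) y(3) fx by auto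
      have E12: "(x, y1) \<in> E" "(x, y2) \<in> E" using y' fx by auto
      have "(arr x y1 \<odot>\<^bsub>Md J t\<^esub> e) (pe i0 y1) = e (pe i0 x)" using y BE fx E12 by (auto simp: Md_smult cf_arr)
      moreover have "(arr x y2 \<odot>\<^bsub>Md J t\<^esub> e) (pe i0 y2) = e (pe i0 x)" using y BE fx E12 by (auto simp: Md_smult cf_arr)
      ultimately show False using e by (simp add: n_def Md_zero)
    qed
  }
qed

lemma tilting_iff:
  fixes M :: "('k, 'a) fmod"
  assumes fg: "fg_module L M" and t: "has_type M m"
  shows "tilting L M \<longleftrightarrow> zset E (set_mset m) \<and> rigid_set E (set_mset m) \<and> card (set_mset m) = card V"
proof -
  have M: "left_module L M" using fg by (rule fg_moduleD)
  obtain J t' where J: "valid J t'" "mtype J t' = m" "mod_iso L (Md J t') M" using t by (auto simp: has_type_def)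
  have set: "set_mset m = t' ` J" using J(1,2) by (auto simp: mtype_def valid_def)
  note Jm = fg_Md[OF J(1)]
  have "Ext1_zero L M M \<longleftrightarrow> Ext1_zero L (Md J t') (Md J t')"
    using Ext1_zero_iso[OF Jm fg J(3)] Ext1_zero_iso[OF fg Jm mod_iso_sym[OF left_module_Md[OF J(1)] M J(3)]] by blast
  then have "zset E (set_mset m) ==> Ext1_zero L M M \<longleftrightarrow> rigid_set E (set_mset m)"
    using Ext1_zero_Md[OF J(1)] Ext1_zero_rigid[OF J(1)] unfolding set by blast
  then show ?thesis
    using proj_dim_le_1_iff[OF fg t] num_summands_has_type[OF fg t] num_summands_regular fg
    unfolding tilting_def by auto
qed

lemma tau_tilting_iff:
  fixes M :: "('k, 'a) fmod"
  assumes fg: "fg_module L M" and t: "has_type M m"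
  shows "tau_tilting L M \<longleftrightarrow> rigid_set E (set_mset m) \<and> card (set_mset m) = card V"
  using tau_rigid_iff[OF fg t] num_summands_has_type[OF fg t] num_summands_regular
  unfolding tau_tilting_def by auto

section \<open>Basic modules as sets of pairs\<close>

definition Ind :: "(nat \<times> nat set) set" where "Ind = {(x, A). x \<in> V \<and> A \<subseteq> E `` {x}}"

lemma finite_Ind: "finite Ind"
proof -
  have "Ind = Sigma V (\<lambda>x. Pow (E `` {x}))" by (auto simp: Ind_def)
  then show ?thesis using finV finite_out by simp
qed

lemma type_realize:
  assumes "S \<subseteq> Ind"
  obtains J t where "valid J t" "mtype J t = mset_set S"
proof -
  have "fst X \<in> V \<and> snd X \<subseteq> E `` {fst X}" if "X \<in> S" for X
  proof -
    have "X \<in> Ind" using assms that by blast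
    then show ?thesis by (simp add: Ind_def case_prod_beta)
  qed
  moreover have "finite S" using assms finite_Ind finite_subset by blast
  ultimately have "\<forall>X\<in>#mset_set S. fst X \<in> V \<and> snd X \<subseteq> E `` {fst X}" by simp
  then show thesis using mtype_realize that by blast
qed

text \<open>A type without repetition is a set, so classes of basic modules correspond to sets of
  pairs. \<open>Q_ex\<close> asks only for some module of the given type; for support tau-tilting
  modules the witnesses are inflations.\<close>

lemma card_basic_classes:
  fixes Q :: "('k, 'a) fmod => bool"
  assumes Q: "\<And>M. Q M ==> fg_module L M"
    and Q_imp: "\<And>M m. [|Q M; has_type M m; basic L M|] ==> \<Phi> (set_mset m)"
    and Q_ex: "\<And>S. [|S \<subseteq> Ind; \<Phi> S|] ==> \<exists>M. Q M \<and> has_type M (mset_set S)"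
  shows "card (iso_classes L {M. Q M \<and> basic L M}) = card {S. S \<subseteq> Ind \<and> \<Phi> S}"
proof -
  define cl where "cl M = (SOME m. has_type M m)" for M :: "('k, 'a) fmod"
  have cl: "has_type M (cl M)" if "fg_module L M" for M
    using someI_ex[OF has_type_ex[OF that]] by (simp add: cl_def)
  let ?C = "{M. Q M \<and> basic L M}"
  have "card (iso_classes L ?C) = card (cl ` ?C)"
  proof (rule card_iso_classes)
    fix M N assume "M \<in> ?C" "N \<in> ?C"
    then have "fg_module L M" "fg_module L N" using Q by auto
    then show "mod_iso L M N \<longleftrightarrow> cl M = cl N" using has_type_iso_iff[OF fg_moduleD fg_moduleD cl cl] by blast
  qed
  also have "cl ` ?C = mset_set ` {S. S \<subseteq> Ind \<and> \<Phi> S}"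
  proof (intro equalityI subsetI)
    fix m assume "m \<in> cl ` ?C"
    then obtain M where M: "Q M" "basic L M" "m = cl M" by blast
    note fg = Q[OF M(1)]
    have t: "has_type M m" using cl[OF fg] M(3) by simp
    have c: "count m X \<le> 1" for X using basic_iff[OF fg t] M(2) by blast
    have "m = mset_set (set_mset m)"
    proof (rule multiset_eqI)
      fix X show "count m X = count (mset_set (set_mset m)) X"
      proof (cases "X \<in># m")
        case True
        then have "0 < count m X" by simp
        then have "count m X = 1" using c[of X] by linarith
        then show ?thesis using True by (simp add: count_mset_set)
      qed (simp add: count_mset_set not_in_iff)
    qed
    moreover have "set_mset m \<subseteq> Ind" using has_type_valid[OF t] unfolding Ind_def by force
    ultimately show "m \<in> mset_set ` {S. S \<subseteq> Ind \<and> \<Phi> S}" using Q_imp[OF M(1) t M(2)] by blast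
  next
    fix m assume "m \<in> mset_set ` {S. S \<subseteq> Ind \<and> \<Phi> S}"
    then obtain S where S: "S \<subseteq> Ind" "\<Phi> S" "m = mset_set S" by blast
    have fS: "finite S" using S(1) finite_Ind finite_subset by blast
    obtain M where M: "Q M" "has_type M m" using Q_ex[OF S(1,2)] S(3) by blast
    note fg = Q[OF M(1)]
    have "basic L M" using basic_iff[OF fg M(2)] S(3) by (simp add: count_mset_set')
    moreover have "cl M = m" using has_type_unique[OF fg_moduleD[OF fg] cl[OF fg] M(2)] .
    ultimately show "m \<in> cl ` ?C" using M(1) by blast
  qed
  also have "card \<dots> = card {S. S \<subseteq> Ind \<and> \<Phi> S}"
  proof (rule card_image, rule inj_onI)
    fix S S' assume "S \<in> {S. S \<subseteq> Ind \<and> \<Phi> S}" "S' \<in> {S. S \<subseteq> Ind \<and> \<Phi> S}" "mset_set S = mset_set S'"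
    then show "S = S'" using finite_subset[OF _ finite_Ind] by (metis (no_types, lifting) finite_set_mset_mset_set mem_Collect_eq)
  qed
  finally show ?thesis .
qed

lemma card_basic_classes':
  fixes Q :: "('k, 'a) fmod => bool"
  assumes Q: "\<And>M. Q M ==> fg_module L M"
    and iff: "\<And>M m. [|fg_module L M; has_type M m|] ==> Q M \<longleftrightarrow> \<Phi> (set_mset m)"
  shows "card (iso_classes L {M. Q M \<and> basic L M}) = card {S. S \<subseteq> Ind \<and> \<Phi> S}"
proof (rule card_basic_classes)
  show "\<Phi> (set_mset m)" if "Q M" "has_type M m" for M m using iff[OF Q[OF that(1)] that(2)] that(1) by blast
  show "\<exists>M. Q M \<and> has_type M (mset_set S)" if S: "S \<subseteq> Ind" "\<Phi> S" for S
  proof -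
    have "finite S" using S(1) finite_Ind finite_subset by blast
    moreover obtain J t where J: "valid J t" "mtype J t = mset_set S" using type_realize[OF S(1)] .
    moreover have "has_type (Md J t) (mset_set S)" using has_type_Md[OF J(1)] J(2) by simp
    ultimately show ?thesis using iff[OF fg_Md[OF J(1)], of "mset_set S"] S(2) by auto
  qed
qed (rule Q)

lemma card_tilt: "card (tilt L) = card {S. S \<subseteq> Ind \<and> zset E S \<and> rigid_set E S \<and> card S = card V}"
  unfolding tilt_def
  by (rule card_basic_classes') (use tilting_iff in \<open>auto simp: tilting_def\<close>)

lemma card_tau_tilt: "card (tau_tilt L) = card {S. S \<subseteq> Ind \<and> rigid_set E S \<and> card S = card V}"
  unfolding tau_tilt_def
  by (rule card_basic_classes') (use tau_tilting_iff in \<open>auto simp: tau_tilting_def tau_rigid_def\<close>)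

end

section \<open>Quotients by idempotents\<close>

lemma quot_simps [simp]: "carrier (quot A I) = carrier (A Quot I)" "mult (quot A I) = mult (A Quot I)"
  "one (quot A I) = one (A Quot I)" "zero (quot A I) = zero (A Quot I)" "add (quot A I) = add (A Quot I)"
  by (simp_all add: quot_def)

lemma ring_quot:
  assumes "ideal I A" shows "ring (quot A I)"
proof -
  interpret Q: ring "A Quot I" by (rule ideal.quotient_is_ring[OF assms])
  have "abelian_group (quot A I)"
    by (rule abelian_groupI) (auto simp: Q.a_ac Q.add.l_inv_ex)
  moreover have "Group.monoid (quot A I)" by (rule monoidI) (auto simp: Q.m_assoc)
  ultimately show ?thesis by (rule ringI) (auto simp: Q.l_distr Q.r_distr)
qed

lemma (in ideal) coset_simps:
  assumes "a \<in> carrier R"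
  shows "carrier (R Quot I) = (\<lambda>a. I +> a) ` carrier R" "I +> a \<in> carrier (R Quot I)"
    "b \<in> I +> a ==> \<exists>i\<in>I. b = i \<oplus> a" "a \<in> I +> a"
proof -
  show 1: "carrier (R Quot I) = (\<lambda>a. I +> a) ` carrier R" by (auto simp: FactRing_def A_RCOSETS_def')
  show "I +> a \<in> carrier (R Quot I)" using assms 1 by blast
  show "\<exists>i\<in>I. b = i \<oplus> a" if "b \<in> I +> a" using that by (auto simp: a_r_coset_def')
  show "a \<in> I +> a" by (rule a_rcos_self[OF assms])
qed

lemma (in ideal) finsum_mem:
  assumes "finite A" "\<And>i. i \<in> A ==> h i \<in> I" shows "finsum R h A \<in> I"
  using assms
proof (induction A rule: finite_induct)
  case (insert i A)
  then have "h \<in> A \<rightarrow> carrier R" "h i \<in> carrier R" using a_Hcarr by auto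
  then show ?case using insert by simp
qed simp

text \<open>\<open>\<phi>\<close> has kernel \<open>I\<close> and so describes the quotient. It is
  applied to the path algebra modulo the square of its radical and again to the quotients by
  idempotents. The chosen representative does not matter, as \<open>\<phi>\<close> is constant on
  cosets.\<close>

lemma radsq_quot:
  fixes A :: "('k::field, 'a) module" and \<phi> :: "'a => nat \<times> nat => 'k"
  assumes quiver: "quiver V E" and ideal: "ideal I A"
    and smult_closed: "\<And>c a. a \<in> carrier A ==> c \<odot>\<^bsub>A\<^esub> a \<in> carrier A"
    and \<phi>_add: "\<And>a b w. [|a \<in> carrier A; b \<in> carrier A|] ==> \<phi> (a \<oplus>\<^bsub>A\<^esub> b) w = \<phi> a w + \<phi> b w"
    and \<phi>_mult: "\<And>a b x y. [|a \<in> carrier A; b \<in> carrier A|] ==> \<phi> (a \<otimes>\<^bsub>A\<^esub> b) (x, y) =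
      (if x = y then \<phi> a (x, x) * \<phi> b (x, x) else \<phi> a (y, y) * \<phi> b (x, y) + \<phi> a (x, y) * \<phi> b (x, x))"
    and \<phi>_one: "\<And>x y. \<phi> \<one>\<^bsub>A\<^esub> (x, y) = (if x = y \<and> x \<in> V then 1 else 0)"
    and \<phi>_smult: "\<And>c a w. a \<in> carrier A ==> \<phi> (c \<odot>\<^bsub>A\<^esub> a) w = c * \<phi> a w"
    and \<phi>_supp: "\<And>a x y. [|a \<in> carrier A; \<phi> a (x, y) \<noteq> 0|] ==> (x, y) \<in> E \<or> x = y \<and> x \<in> V"
    and \<phi>_onto: "\<And>f. \<forall>x y. f (x, y) \<noteq> 0 \<longrightarrow> (x, y) \<in> E \<or> x = y \<and> x \<in> V ==> \<exists>a\<in>carrier A. \<phi> a = f"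
    and kernel: "\<And>a. a \<in> carrier A ==> a \<in> I \<longleftrightarrow> (\<forall>w. \<phi> a w = 0)"
  shows "radsq V E (quot A I) (\<lambda>X. \<phi> (SOME a. a \<in> X))"
    "\<And>a. a \<in> carrier A ==> \<phi> (SOME b. b \<in> I +>\<^bsub>A\<^esub> a) = \<phi> a"
proof -
  interpret I: ideal I A by (rule ideal)
  let ?cf = "\<lambda>X. \<phi> (SOME a. a \<in> X)"
  have coset: "\<phi> b = \<phi> a \<and> b \<in> carrier A" if a: "a \<in> carrier A" and b: "b \<in> I +>\<^bsub>A\<^esub> a" for a b
  proof -
    obtain i where i: "i \<in> I" "b = i \<oplus>\<^bsub>A\<^esub> a" using I.coset_simps(3)[OF a b] by blast
    have "i \<in> carrier A" using i(1) by (rule I.a_Hcarr)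
    then show ?thesis using i a kernel[of i] by (auto simp: \<phi>_add)
  qed
  show cf: "\<phi> (SOME b. b \<in> I +>\<^bsub>A\<^esub> a) = \<phi> a" if "a \<in> carrier A" for a
  proof -
    have "(SOME b. b \<in> I +>\<^bsub>A\<^esub> a) \<in> I +>\<^bsub>A\<^esub> a" by (rule someI) (rule I.coset_simps(4)[OF that])
    then show ?thesis using coset[OF that] by blast
  qed
  have car: "carrier (quot A I) = (\<lambda>a. I +>\<^bsub>A\<^esub> a) ` carrier A"
    using I.coset_simps(1)[OF I.zero_closed] by simp
  have addc: "(I +>\<^bsub>A\<^esub> a) \<oplus>\<^bsub>quot A I\<^esub> (I +>\<^bsub>A\<^esub> b) = I +>\<^bsub>A\<^esub> (a \<oplus>\<^bsub>A\<^esub> b)" if "a \<in> carrier A" "b \<in> carrier A" for a b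
    using I.a_rcos_sum[OF that] by (simp add: FactRing_def)
  have multc: "(I +>\<^bsub>A\<^esub> a) \<otimes>\<^bsub>quot A I\<^esub> (I +>\<^bsub>A\<^esub> b) = I +>\<^bsub>A\<^esub> (a \<otimes>\<^bsub>A\<^esub> b)" if "a \<in> carrier A" "b \<in> carrier A" for a b
    using I.rcoset_mult_add[OF that] by (simp add: FactRing_def)
  have eqI: "I +>\<^bsub>A\<^esub> a = I +>\<^bsub>A\<^esub> b" if ab: "a \<in> carrier A" "b \<in> carrier A" "\<phi> a = \<phi> b" for a b
  proof -
    have "\<phi> (a \<ominus>\<^bsub>A\<^esub> b \<oplus>\<^bsub>A\<^esub> b) w = \<phi> (a \<ominus>\<^bsub>A\<^esub> b) w + \<phi> b w" for w using ab by (intro \<phi>_add) auto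
    moreover have "a \<ominus>\<^bsub>A\<^esub> b \<oplus>\<^bsub>A\<^esub> b = a" using ab by (simp add: a_minus_def I.a_assoc I.l_neg)
    ultimately have "\<phi> (a \<ominus>\<^bsub>A\<^esub> b) w = 0" for w using ab(3) by (metis add_cancel_left_left)
    then have "a \<ominus>\<^bsub>A\<^esub> b \<in> I" using kernel[of "a \<ominus>\<^bsub>A\<^esub> b"] ab by simp
    then have "a \<in> I +>\<^bsub>A\<^esub> b" using I.a_rcos_module[OF ab(2,1)] by (simp add: a_minus_def)
    then show ?thesis using I.a_repr_independence'[OF _ ab(2)] by simp
  qed
  have smc: "c \<odot>\<^bsub>quot A I\<^esub> (I +>\<^bsub>A\<^esub> a) = I +>\<^bsub>A\<^esub> (c \<odot>\<^bsub>A\<^esub> a)" if "a \<in> carrier A" for c a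
  proof -
    have "(\<Union>x\<in>I +>\<^bsub>A\<^esub> a. I +>\<^bsub>A\<^esub> (c \<odot>\<^bsub>A\<^esub> x)) = (\<Union>x\<in>I +>\<^bsub>A\<^esub> a. I +>\<^bsub>A\<^esub> (c \<odot>\<^bsub>A\<^esub> a))"
    proof (rule SUP_cong[OF refl])
      fix x assume "x \<in> I +>\<^bsub>A\<^esub> a"
      then have x: "\<phi> x = \<phi> a" "x \<in> carrier A" using coset[OF that] by auto
      show "I +>\<^bsub>A\<^esub> (c \<odot>\<^bsub>A\<^esub> x) = I +>\<^bsub>A\<^esub> (c \<odot>\<^bsub>A\<^esub> a)"
        by (rule eqI) (use x that smult_closed \<phi>_smult in auto)
    qed
    also have "\<dots> = I +>\<^bsub>A\<^esub> (c \<odot>\<^bsub>A\<^esub> a)" using I.coset_simps(4)[OF that] by blast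
    finally show ?thesis by (simp add: quot_def)
  qed
  interpret quiver V E by (rule quiver)
  interpret Q: ring "quot A I" by (rule ring_quot[OF ideal])
  show "radsq V E (quot A I) ?cf"
  proof unfold_locales
    show "bij_betw ?cf (carrier (quot A I)) {f. \<forall>x y. f (x, y) \<noteq> 0 \<longrightarrow> (x, y) \<in> E \<or> x = y \<and> x \<in> V}"
    proof (rule bij_betw_imageI)
      show "inj_on ?cf (carrier (quot A I))"
      proof
        fix X Y assume "X \<in> carrier (quot A I)" "Y \<in> carrier (quot A I)" and eq: "?cf X = ?cf Y"
        then obtain a b where "a \<in> carrier A" "X = I +>\<^bsub>A\<^esub> a" "b \<in> carrier A" "Y = I +>\<^bsub>A\<^esub> b" unfolding car by blast
        then show "X = Y" using eq cf eqI by metis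
      qed
      show "?cf ` carrier (quot A I) = {f. \<forall>x y. f (x, y) \<noteq> 0 \<longrightarrow> (x, y) \<in> E \<or> x = y \<and> x \<in> V}"
      proof (intro equalityI subsetI)
        fix f assume "f \<in> ?cf ` carrier (quot A I)"
        then obtain a where "a \<in> carrier A" "f = \<phi> a" unfolding car using cf by auto
        then show "f \<in> {f. \<forall>x y. f (x, y) \<noteq> 0 \<longrightarrow> (x, y) \<in> E \<or> x = y \<and> x \<in> V}" using \<phi>_supp by auto
      next
        fix f :: "nat \<times> nat => 'k" assume "f \<in> {f. \<forall>x y. f (x, y) \<noteq> 0 \<longrightarrow> (x, y) \<in> E \<or> x = y \<and> x \<in> V}"
        then obtain a where a: "a \<in> carrier A" "\<phi> a = f" using \<phi>_onto[of f] by auto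
        then have "f = ?cf (I +>\<^bsub>A\<^esub> a)" "I +>\<^bsub>A\<^esub> a \<in> carrier (quot A I)" using cf car by auto
        then show "f \<in> ?cf ` carrier (quot A I)" by blast
      qed
    qed
    show "?cf (X \<oplus>\<^bsub>quot A I\<^esub> Y) w = ?cf X w + ?cf Y w" if XY: "X \<in> carrier (quot A I)" "Y \<in> carrier (quot A I)" for X Y w
    proof -
      obtain a b where "a \<in> carrier A" "X = I +>\<^bsub>A\<^esub> a" "b \<in> carrier A" "Y = I +>\<^bsub>A\<^esub> b" using XY unfolding car by blast
      then show ?thesis by (simp only: addc cf I.a_closed \<phi>_add)
    qed
    show "?cf (X \<otimes>\<^bsub>quot A I\<^esub> Y) (x, y) = (if x = y then ?cf X (x, x) * ?cf Y (x, x)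
       else ?cf X (y, y) * ?cf Y (x, y) + ?cf X (x, y) * ?cf Y (x, x))"
      if XY: "X \<in> carrier (quot A I)" "Y \<in> carrier (quot A I)" for X Y x y
    proof -
      obtain a b where "a \<in> carrier A" "X = I +>\<^bsub>A\<^esub> a" "b \<in> carrier A" "Y = I +>\<^bsub>A\<^esub> b" using XY unfolding car by blast
      then show ?thesis by (simp only: multc cf I.m_closed \<phi>_mult)
    qed
    show "?cf \<one>\<^bsub>quot A I\<^esub> (x, y) = (if x = y \<and> x \<in> V then 1 else 0)" for x y
    proof -
      have "\<one>\<^bsub>quot A I\<^esub> = I +>\<^bsub>A\<^esub> \<one>\<^bsub>A\<^esub>" by (simp add: FactRing_def)
      then show ?thesis by (simp only: cf I.one_closed \<phi>_one)
    qed
    show "c \<odot>\<^bsub>quot A I\<^esub> X \<in> carrier (quot A I)" if X: "X \<in> carrier (quot A I)" for X c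
      using X smult_closed unfolding car by (auto simp: smc)
    show "?cf (c \<odot>\<^bsub>quot A I\<^esub> X) w = c * ?cf X w" if X: "X \<in> carrier (quot A I)" for X c w
    proof -
      obtain a where "a \<in> carrier A" "X = I +>\<^bsub>A\<^esub> a" using X unfolding car by blast
      then show ?thesis by (simp only: smc cf smult_closed \<phi>_smult)
    qed
  qed
qed

context radsq
begin

text \<open>The vertices that disappear from the quotient by the ideal of an idempotent
  \<open>e\<close>.\<close>

definition dead :: "'a => nat set" where "dead e = {x \<in> V. cf e (x, x) \<noteq> 0}"

text \<open>An idempotent may have coefficients on arrows, but it generates the same ideal as the
  sum \<open>?s\<close> of the trivial paths at its dead vertices.\<close>

lemma Idl_idempotent:
  assumes e: "e \<in> carrier L" "e \<otimes> e = e"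
  shows "Idl\<^bsub>L\<^esub> {e} = {a \<in> carrier L. \<forall>x\<in>V - dead e. \<forall>y\<in>V - dead e. cf a (x, y) = 0}" (is "_ = ?K")
proof
  have K: "ideal ?K L"
  proof (rule idealI[OF R.ring_axioms])
    show "subgroup ?K (add_monoid L)"
    proof (intro subgroup.intro)
      fix a assume a: "a \<in> ?K"
      have "cf a w + cf (\<ominus> a) w = 0" for w
        using a cf_add[of a "\<ominus> a" w] R.r_neg[of a] cf_zero by auto
      then have "cf (\<ominus> a) w = - cf a w" for w by (simp add: eq_neg_iff_add_eq_0 add.commute)
      then show "inv\<^bsub>add_monoid L\<^esub> a \<in> ?K" using a by (simp add: a_inv_def[symmetric])
    qed (auto simp: cf_add cf_zero)
  qed (auto simp: cf_mult)
  \<comment> \<open>For live \<open>x\<close> and \<open>y\<close> every term in the coefficient of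
    the square of \<open>e\<close> contains a diagonal coefficient that vanishes.\<close>
  have "cf e (x, y) = 0" if xy: "x \<in> V - dead e" "y \<in> V - dead e" for x y
  proof -
    have 0: "cf e (x, x) = 0" "cf e (y, y) = 0" using xy by (auto simp: dead_def)
    show ?thesis using cf_mult[OF e(1) e(1), of x y] e(2) 0 by (cases "x = y") auto
  qed
  then have "e \<in> ?K" using e by simp
  then show "Idl\<^bsub>L\<^esub> {e} \<subseteq> ?K" using R.genideal_minimal[OF K, of "{e}"] by blast
  interpret I: ideal "Idl\<^bsub>L\<^esub> {e}" L by (rule R.genideal_ideal) (use e in simp)
  have eI: "e \<in> Idl\<^bsub>L\<^esub> {e}" by (rule R.genideal_self') (rule e)
  have idI: "idem x \<in> Idl\<^bsub>L\<^esub> {e}" if x: "x \<in> dead e" for x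
  proof -
    have xV: "x \<in> V" "cf e (x, x) \<noteq> 0" using x by (auto simp: dead_def)
    \<comment> \<open>Multiplied by the trivial path on both sides, \<open>e\<close> retains only
      its diagonal coefficient at \<open>x\<close>, which is invertible.\<close>
    have "idem x = (sc (1 / cf e (x, x)) \<otimes> idem x) \<otimes> e \<otimes> idem x"
    proof (rule cf_eqI)
      fix u v show "cf (idem x) (u, v) = cf ((sc (1 / cf e (x, x)) \<otimes> idem x) \<otimes> e \<otimes> idem x) (u, v)"
        using e(1) xV by (auto simp: cf_simps)
    qed (use e in auto)
    moreover have "(sc (1 / cf e (x, x)) \<otimes> idem x) \<otimes> e \<otimes> idem x \<in> Idl\<^bsub>L\<^esub> {e}"
      by (intro I.I_r_closed I.I_l_closed eI) auto
    ultimately show ?thesis by simp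
  qed
  have fin: "finite (dead e)" using finV by (simp add: dead_def)
  let ?s = "finsum L idem (dead e)"
  have sI: "?s \<in> Idl\<^bsub>L\<^esub> {e}" using I.finsum_mem[OF fin idI] .
  have sc: "?s \<in> carrier L" by (rule I.a_Hcarr[OF sI])
  have cfs: "cf ?s (x, y) = (if x = y \<and> x \<in> dead e then 1 else 0)" for x y
  proof -
    have "cf ?s (x, y) = (\<Sum>i\<in>dead e. cf (idem i) (x, y))" by (rule cf_finsum[OF fin]) simp
    also have "\<dots> = (\<Sum>i\<in>dead e. if i = x then (if x = y then 1 else 0) else 0)"
      by (rule sum.cong) (auto simp: cf_idem dead_def)
    finally show ?thesis using fin by simp
  qed
  define n where "n = el (\<lambda>(x, y). if x = y \<and> x \<in> V - dead e then 1 else 0)"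
  have n: "n \<in> carrier L" "cf n (x, y) = (if x = y \<and> x \<in> V - dead e then 1 else 0)" for x y
    unfolding n_def by (subst el; auto split: if_splits)+
  show "?K \<subseteq> Idl\<^bsub>L\<^esub> {e}"
  proof
    fix a assume a: "a \<in> ?K"
    then have ac: "a \<in> carrier L" by simp
    \<comment> \<open>Coefficients with dead target are in the first term, those with live target
      and dead source in the second; the others are zero.\<close>
    have "a = ?s \<otimes> a \<oplus> (n \<otimes> a) \<otimes> ?s"
    proof (rule cf_eqI)
      fix x y
      show "cf a (x, y) = cf (?s \<otimes> a \<oplus> (n \<otimes> a) \<otimes> ?s) (x, y)"
      proof (cases "cf a (x, y) = 0")
        case True then show ?thesis using ac sc n by (auto simp: cf_add cf_mult cfs)
      next
        case False
        then have "x \<in> V" "y \<in> V" "x \<in> dead e \<or> y \<in> dead e" using cf_nonzero[OF ac False] arcD a by auto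
        then show ?thesis using ac sc n by (auto simp: cf_add cf_mult cfs)
      qed
    qed (use ac sc n in auto)
    moreover have "?s \<otimes> a \<oplus> (n \<otimes> a) \<otimes> ?s \<in> Idl\<^bsub>L\<^esub> {e}"
      using I.I_r_closed[OF sI ac] I.I_l_closed[OF sI, of "n \<otimes> a"] ac n by simp
    ultimately show "a \<in> Idl\<^bsub>L\<^esub> {e}" by simp
  qed
qed

section \<open>Full subquivers and inflated modules\<close>

definition subarcs :: "nat set => (nat \<times> nat) set" where "subarcs W = E \<inter> W \<times> W"

lemma quiver_sub: "W \<subseteq> V ==> quiver W (subarcs W)"
proof unfold_locales
  assume W: "W \<subseteq> V"
  show "finite W" using finV W finite_subset by blast
  show "card (subarcs W `` {x}) \<le> 2" for x
  proof -
    have "card (subarcs W `` {x}) \<le> card (E `` {x})" by (rule card_mono[OF finite_out]) (auto simp: subarcs_def)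
    then show ?thesis using outdeg[of x] by linarith
  qed
qed (auto simp: subarcs_def dest: arc_less indeg)

definition coset_cf :: "nat set => 'a set => nat \<times> nat => 'k" where
  "coset_cf W X = (\<lambda>(x, y). if x \<in> W \<and> y \<in> W then cf (SOME a. a \<in> X) (x, y) else 0)"

lemma quot_Idl:
  assumes e: "e \<in> carrier L" "e \<otimes> e = e" and W: "W = V - dead e"
  shows "radsq W (subarcs W) (quot L (Idl\<^bsub>L\<^esub> {e})) (coset_cf W)"
    "a \<in> carrier L ==> coset_cf W (Idl\<^bsub>L\<^esub> {e} +>\<^bsub>L\<^esub> a) (x, y) = (if x \<in> W \<and> y \<in> W then cf a (x, y) else 0)"
proof -
  define \<phi> where "\<phi> a = (\<lambda>(x, y). if x \<in> W \<and> y \<in> W then cf a (x, y) else 0)" for a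
  have c: "coset_cf W = (\<lambda>X. \<phi> (SOME a. a \<in> X))" by (rule ext) (simp add: coset_cf_def \<phi>_def)
  have WV: "W \<subseteq> V" using W by blast
  have id: "ideal (Idl\<^bsub>L\<^esub> {e}) L" by (rule R.genideal_ideal) (use e in simp)
  have onto: "\<exists>a\<in>carrier L. \<phi> a = f" if f: "\<forall>x y. f (x, y) \<noteq> 0 \<longrightarrow> (x, y) \<in> subarcs W \<or> x = y \<and> x \<in> W" for f
  proof -
    have "el f \<in> carrier L" "cf (el f) = f" using el[of f] f WV by (auto simp: subarcs_def)
    moreover have "\<phi> (el f) = f"
    proof
      fix w :: "nat \<times> nat"
      obtain x y where "w = (x, y)" by force
      then show "\<phi> (el f) w = f w" using calculation(2) f by (auto simp: \<phi>_def subarcs_def)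
    qed
    ultimately show ?thesis by blast
  qed
  have supp: "(x, y) \<in> subarcs W \<or> x = y \<and> x \<in> W" if "a \<in> carrier L" "\<phi> a (x, y) \<noteq> 0" for a x y
    using that cf_nonzero[OF that(1), of x y] by (auto simp: \<phi>_def subarcs_def split: if_splits)
  have ker: "a \<in> Idl\<^bsub>L\<^esub> {e} \<longleftrightarrow> (\<forall>w. \<phi> a w = 0)" if "a \<in> carrier L" for a
    unfolding Idl_idempotent[OF e] using that by (auto simp: \<phi>_def W)
  have 1: "\<phi> (a \<oplus> b) w = \<phi> a w + \<phi> b w" if "a \<in> carrier L" "b \<in> carrier L" for a b w
    using that by (cases w) (auto simp: \<phi>_def cf_add)
  have 2: "\<phi> (a \<otimes> b) (x, y) = (if x = y then \<phi> a (x, x) * \<phi> b (x, x) else \<phi> a (y, y) * \<phi> b (x, y) + \<phi> a (x, y) * \<phi> b (x, x))"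
    if "a \<in> carrier L" "b \<in> carrier L" for a b x y
    using that by (simp add: \<phi>_def cf_mult)
  have 3: "\<phi> \<one> (x, y) = (if x = y \<and> x \<in> W then 1 else 0)" for x y
    using WV by (auto simp: \<phi>_def cf_one)
  have 4: "\<phi> (c \<odot> a) w = c * \<phi> a w" if "a \<in> carrier L" for c a w
    using that by (cases w) (auto simp: \<phi>_def cf_smult)
  show "radsq W (subarcs W) (quot L (Idl\<^bsub>L\<^esub> {e})) (coset_cf W)"
    unfolding c by (rule radsq_quot(1)[OF quiver_sub[OF WV] id, where \<phi> = \<phi>]) (fact alg_closed 1 2 3 4 supp onto ker)+
  show "coset_cf W (Idl\<^bsub>L\<^esub> {e} +>\<^bsub>L\<^esub> a) (x, y) = (if x \<in> W \<and> y \<in> W then cf a (x, y) else 0)" if a: "a \<in> carrier L"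
  proof -
    have "\<phi> (SOME b. b \<in> Idl\<^bsub>L\<^esub> {e} +>\<^bsub>L\<^esub> a) = \<phi> a"
      by (rule radsq_quot(2)[OF quiver_sub[OF WV] id, where \<phi> = \<phi>]) (fact alg_closed 1 2 3 4 supp onto ker a)+
    then show ?thesis by (simp add: c \<phi>_def)
  qed
qed

lemma left_module_inflate:
  fixes N :: "('a set, 'm) module"
  assumes I: "ideal I L" and N: "left_module (quot L I) N"
  shows "left_module L (inflate L I N)"
proof -
  interpret I: ideal I L by (rule I)
  interpret N: left_module "quot L I" N by (rule N)
  have ab: "abelian_group (inflate L I N)"
    by (rule abelian_groupI) (auto simp: inflate_def N.M.a_ac N.M.add.l_inv_ex)
  have c: "I +>\<^bsub>L\<^esub> a \<in> carrier (quot L I)" if "a \<in> carrier L" for a using I.coset_simps(2)[OF that] by simp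
  have add: "I +>\<^bsub>L\<^esub> (a \<oplus> b) = (I +>\<^bsub>L\<^esub> a) \<oplus>\<^bsub>quot L I\<^esub> (I +>\<^bsub>L\<^esub> b)" if "a \<in> carrier L" "b \<in> carrier L" for a b
    using I.a_rcos_sum[OF that] by (simp add: FactRing_def)
  have mult: "I +>\<^bsub>L\<^esub> (a \<otimes> b) = (I +>\<^bsub>L\<^esub> a) \<otimes>\<^bsub>quot L I\<^esub> (I +>\<^bsub>L\<^esub> b)" if "a \<in> carrier L" "b \<in> carrier L" for a b
    using I.rcoset_mult_add[OF that] by (simp add: FactRing_def)
  have one: "I +>\<^bsub>L\<^esub> \<one> = \<one>\<^bsub>quot L I\<^esub>" by (simp add: FactRing_def)
  show ?thesis
    by (intro left_module.intro left_module_axioms.intro R.ring_axioms ab)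
      (auto simp: inflate_def add mult one N.smult_closed[OF c] N.smult_l_distr[OF c c] N.smult_r_distr[OF c]
        N.smult_assoc[OF c c] N.smult_one simp del: quot_simps)
qed

text \<open>The models over the quotient and over \<open>L\<close> have the same carrier and, after
  inflation, the same action, because the coefficients lost in the quotient belong to vertices
  outside \<open>W\<close>. So inflation keeps the type.\<close>

lemma stau_tilting_type:
  assumes e: "e \<in> carrier L" "e \<otimes> e = e" and W: "W = V - dead e"
    and v: "quiver.valid W (subarcs W) J t"
  shows "radsq W (subarcs W) (quot L (Idl\<^bsub>L\<^esub> {e})) (coset_cf W)" "valid J t"
    "mod_iso (quot L (Idl\<^bsub>L\<^esub> {e})) (radsq.Md (coset_cf W) J t) N ==> mod_iso L (Md J t) (inflate L (Idl\<^bsub>L\<^esub> {e}) N)"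
proof -
  let ?Q = "quot L (Idl\<^bsub>L\<^esub> {e})"
  note q = quot_Idl[OF e W]
  show r: "radsq W (subarcs W) ?Q (coset_cf W)" using q(1) .
  interpret Q: radsq W "subarcs W" ?Q "coset_cf W" by (rule r)
  show vV: "valid J t" using v W unfolding valid_def Q.valid_def by (auto simp: subarcs_def)
  have car: "carrier (Q.Md J t) = carrier (Md J t)" by (simp add: Md_def Q.Md_def idx_def Q.idx_def)
  have add: "add (Q.Md J t) = add (Md J t)" by (simp add: Md_def Q.Md_def)
  have sm: "a \<odot>\<^bsub>Md J t\<^esub> f = (Idl\<^bsub>L\<^esub> {e} +>\<^bsub>L\<^esub> a) \<odot>\<^bsub>Q.Md J t\<^esub> f" if a: "a \<in> carrier L" and f: "f \<in> carrier (Md J t)" for a f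
  proof (rule pe_ext)
    fix j w
    have cfq: "coset_cf W (Idl\<^bsub>L\<^esub> {e} +>\<^bsub>L\<^esub> a) (x, y) = (if x \<in> W \<and> y \<in> W then cf a (x, y) else 0)" for x y
      by (rule q(2)[OF a])
    show "(a \<odot>\<^bsub>Md J t\<^esub> f) (pe j w) = ((Idl\<^bsub>L\<^esub> {e} +>\<^bsub>L\<^esub> a) \<odot>\<^bsub>Q.Md J t\<^esub> f) (pe j w)"
    proof (cases "j \<in> J")
      case True
      have "fst (t j) \<in> W" "snd (t j) \<subseteq> W" using v True unfolding Q.valid_def by (auto simp: subarcs_def)
      then show ?thesis unfolding Md_smult Q.Md_smult cfq by auto
    next
      case False
      then have "f (pe j u) = 0" for u using f unfolding Md_carrier by blast
      then show ?thesis unfolding Md_smult Q.Md_smult by simp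
    qed
  qed
  have c: "Idl\<^bsub>L\<^esub> {e} +>\<^bsub>L\<^esub> a \<in> carrier ?Q" if "a \<in> carrier L" for a
    using ideal.coset_simps(2)[OF R.genideal_ideal that, of "{e}"] e by simp
  show "mod_iso L (Md J t) (inflate L (Idl\<^bsub>L\<^esub> {e}) N)" if iso: "mod_iso ?Q (Q.Md J t) N"
  proof -
    obtain h where h: "h \<in> mod_hom ?Q (Q.Md J t) N" "bij_betw h (carrier (Q.Md J t)) (carrier N)"
      using iso by (auto simp: mod_iso_def)
    have "h \<in> mod_hom L (Md J t) (inflate L (Idl\<^bsub>L\<^esub> {e}) N)"
      using h(1) c unfolding mod_hom_def car add by (auto simp: inflate_def sm simp del: quot_simps)
    moreover have "bij_betw h (carrier (Md J t)) (carrier (inflate L (Idl\<^bsub>L\<^esub> {e}) N))"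
      using h(2) by (simp add: car inflate_def)
    ultimately show ?thesis by (rule mod_isoI)
  qed
qed

definition sub_Ind :: "nat set => (nat \<times> nat set) set" where
  "sub_Ind W = {(x, A). x \<in> W \<and> A \<subseteq> subarcs W `` {x}}"

text \<open>The live vertices of idempotents form arbitrary subsets \<open>W\<close> of
  \<open>V\<close>. Rigidity refers to the full subquiver on \<open>W\<close>: an arrow to a deleted
  vertex does not count as missed.\<close>

lemma card_stau_tilt: "card (stau_tilt L) =
    card {S. S \<subseteq> Ind \<and> (\<exists>W\<subseteq>V. S \<subseteq> sub_Ind W \<and> rigid_set (subarcs W) S \<and> card S = card W)}"
  unfolding stau_tilt_def
proof (rule card_basic_classes)
  have ex: "\<exists>W\<subseteq>V. \<exists>m. fg_module L M \<and> has_type M m \<and> set_mset m \<subseteq> sub_Ind W \<and> rigid_set (subarcs W) (set_mset m) \<and>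
      card (set_mset m) = card W" if M: "support_tau_tilting L M" for M :: "('k, 'a) fmod"
  proof -
    obtain e N where e: "e \<in> carrier L" "e \<otimes> e = e" and N: "tau_tilting (quot L (Idl\<^bsub>L\<^esub> {e})) N"
      "M = inflate L (Idl\<^bsub>L\<^esub> {e}) N" using M by (auto simp: support_tau_tilting_def)
    let ?Q = "quot L (Idl\<^bsub>L\<^esub> {e})"
    define W where "W = V - dead e"
    have r: "radsq W (subarcs W) ?Q (coset_cf W)" by (rule quot_Idl(1)[OF e W_def])
    interpret Q: radsq W "subarcs W" ?Q "coset_cf W" by (rule r)
    have fgN: "fg_module ?Q N" using N(1) by (simp add: tau_tilting_def tau_rigid_def)
    obtain m where m: "Q.has_type N m" using Q.has_type_ex[OF fgN] by blast
    have rig: "rigid_set (subarcs W) (set_mset m)" "card (set_mset m) = card W"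
      using Q.tau_tilting_iff[OF fgN m] N(1) by auto
    obtain J t where J: "Q.valid J t" "Q.mtype J t = m" "mod_iso ?Q (Q.Md J t) N" using m by (auto simp: Q.has_type_def)
    note st = stau_tilting_type[OF e W_def J(1)]
    have iso: "mod_iso L (Md J t) M" unfolding N(2) by (rule st(3)[OF J(3)])
    have lm: "left_module L M" unfolding N(2)
      by (rule left_module_inflate[OF R.genideal_ideal fg_moduleD[OF fgN]]) (use e in simp)
    have fg: "fg_module L M" by (rule fg_module_iso[OF fg_Md[OF st(2)] lm iso])
    have "mtype J t = m" using J(2) by (simp add: mtype_def Q.mtype_def)
    then have "has_type M m" using st(2) iso unfolding has_type_def by blast
    moreover have "set_mset m \<subseteq> sub_Ind W" using Q.has_type_valid[OF m] unfolding sub_Ind_def by force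
    ultimately show ?thesis using fg rig by (intro exI[of _ W]) (auto simp: W_def)
  qed
  show "fg_module L M" if "support_tau_tilting L M" for M :: "('k, 'a) fmod" using ex[OF that] by blast
  show "\<exists>W\<subseteq>V. set_mset m \<subseteq> sub_Ind W \<and> rigid_set (subarcs W) (set_mset m) \<and> card (set_mset m) = card W"
    if "support_tau_tilting L M" "has_type M m" for M :: "('k, 'a) fmod" and m
    using ex[OF that(1)] has_type_unique[OF fg_moduleD _ that(2)] by metis
  show "\<exists>M. support_tau_tilting L M \<and> has_type M (mset_set S)"
    if S: "S \<subseteq> Ind" and ex: "\<exists>W\<subseteq>V. S \<subseteq> sub_Ind W \<and> rigid_set (subarcs W) S \<and> card S = card W" for S
  proof -
    obtain W where W: "W \<subseteq> V" "S \<subseteq> sub_Ind W" "rigid_set (subarcs W) S" "card S = card W" using ex by blast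
    define e where "e = el (\<lambda>(x, y). if x = y \<and> x \<in> V - W then 1 else 0)"
    have e: "e \<in> carrier L" "cf e (x, y) = (if x = y \<and> x \<in> V - W then 1 else 0)" for x y
      unfolding e_def by (subst el; auto split: if_splits)+
    have ee: "e \<otimes> e = e" by (rule cf_eqI) (use e in \<open>auto simp: cf_mult\<close>)
    have Wd: "W = V - dead e" using W(1) e by (auto simp: dead_def)
    let ?Q = "quot L (Idl\<^bsub>L\<^esub> {e})"
    have r: "radsq W (subarcs W) ?Q (coset_cf W)" by (rule quot_Idl(1)[OF e(1) ee Wd])
    interpret Q: radsq W "subarcs W" ?Q "coset_cf W" by (rule r)
    have "S \<subseteq> Q.Ind" using W(2) by (simp add: sub_Ind_def Q.Ind_def)
    then obtain J t where J: "Q.valid J t" "Q.mtype J t = mset_set S" using Q.type_realize by blast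
    note st = stau_tilting_type[OF e(1) ee Wd J(1)]
    have fin: "finite S" using S finite_Ind finite_subset by blast
    have "Q.has_type (Q.Md J t) (mset_set S)" using Q.has_type_Md[OF J(1)] J(2) by simp
    then have "tau_tilting ?Q (Q.Md J t)" using Q.tau_tilting_iff[OF Q.fg_Md[OF J(1)]] W fin by simp
    then have "support_tau_tilting L (inflate L (Idl\<^bsub>L\<^esub> {e}) (Q.Md J t))"
      using e(1) ee unfolding support_tau_tilting_def by blast
    moreover have "mod_iso L (Md J t) (inflate L (Idl\<^bsub>L\<^esub> {e}) (Q.Md J t))"
      by (rule st(3)[OF mod_iso_refl[OF Q.left_module_Md[OF J(1)]]])
    then have "has_type (inflate L (Idl\<^bsub>L\<^esub> {e}) (Q.Md J t)) (mset_set S)"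
      using st(2) J(2) unfolding has_type_def mtype_def Q.mtype_def by blast
    ultimately show ?thesis by blast
  qed
qed

end

section \<open>Path algebras\<close>

lemma (in ring) submodule_regular_iff: "submodule N R (regular_module R) \<longleftrightarrow> N \<subseteq> carrier R \<and> \<zero> \<in> N \<and>
    (\<forall>x\<in>N. \<forall>y\<in>N. x \<oplus> y \<in> N) \<and> (\<forall>a\<in>carrier R. \<forall>x\<in>N. a \<otimes> x \<in> N)"
  unfolding left_module.submodule_iff[OF left_module_regular] by (simp add: regular_module_def)

locale path_quiver = quiver +
  fixes A :: "('k::field, nat \<times> (nat \<times> nat) list \<times> nat => 'k) module" (structure)
  assumes A_def: "A = path_algebra \<lparr>verts = V, arcs = E, tail = fst, head = snd\<rparr>"
begin

definition P :: "(nat \<times> (nat \<times> nat) list \<times> nat) set" where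
  "P = paths \<lparr>verts = V, arcs = E, tail = fst, head = snd\<rparr>"

lemma P_Nil: "(u, [], v) \<in> P \<longleftrightarrow> u = v \<and> u \<in> V"
  by (auto simp: P_def paths_def pre_digraph.awalk_def pre_digraph.cas.simps)

lemma P_Cons: "(u, a # s, v) \<in> P \<longleftrightarrow> a \<in> E \<and> fst a = u \<and> (snd a, s, v) \<in> P"
  using arcs by (auto simp: P_def paths_def pre_digraph.awalk_def pre_digraph.cas.simps)

lemma P_append: "(u, r @ s, v) \<in> P \<longleftrightarrow> (\<exists>m. (u, r, m) \<in> P \<and> (m, s, v) \<in> P)"
proof (induction r arbitrary: u)
  case Nil
  have "u \<in> V" if "(u, s, v) \<in> P"
    using that arcs by (cases s) (auto simp: P_Nil P_Cons)
  then show ?case by (auto simp: P_Nil)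
qed (auto simp: P_Cons)

text \<open>Every arrow lowers the vertex number; this bounds the lengths of paths and makes their
  number finite.\<close>

lemma P_length: "(u, p, v) \<in> P ==> length p + v \<le> u \<and> u \<in> V \<and> v \<in> V \<and> set p \<subseteq> E"
proof (induction p arbitrary: u)
  case (Cons a s)
  then have "a = (u, snd a)" "a \<in> E" "(snd a, s, v) \<in> P" by (auto simp: P_Cons)
  then show ?case using Cons.IH[of "snd a"] arc_less[of u "snd a"] arcs by fastforce
qed (auto simp: P_Nil)

lemma finite_P: "finite P"
proof (rule finite_subset)
  have "finite E" using arcs finV by (metis finite_SigmaI finite_subset)
  then show "finite (V \<times> {p. set p \<subseteq> E \<and> length p \<le> Max V} \<times> V)"
    using finV by (intro finite_SigmaI finite_lists_length_le)
  show "P \<subseteq> V \<times> {p. set p \<subseteq> E \<and> length p \<le> Max V} \<times> V"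
  proof
    fix w assume w: "w \<in> P"
    obtain u p v where w': "w = (u, p, v)" by (metis surj_pair)
    then have *: "length p + v \<le> u \<and> u \<in> V \<and> v \<in> V \<and> set p \<subseteq> E" using P_length w by blast
    then have "u \<le> Max V" using finV by simp
    then show "w \<in> V \<times> {p. set p \<subseteq> E \<and> length p \<le> Max V} \<times> V" using * w' by auto
  qed
qed

definition T where "T u p v = {(r, s, m). p = r @ s \<and> (u, r, m) \<in> P \<and> (m, s, v) \<in> P}"

lemma T_iff: "(r, s, m) \<in> T u p v \<longleftrightarrow> p = r @ s \<and> (u, r, m) \<in> P \<and> (m, s, v) \<in> P"
  by (simp add: T_def)

lemma finite_T: "finite (T u p v)"
proof (rule finite_subset)
  show "T u p v \<subseteq> (\<lambda>((u, r, m), (m', s, v)). (r, s, m)) ` (P \<times> P)"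
  proof
    fix x assume x: "x \<in> T u p v"
    obtain r s m where "x = (r, s, m)" by (metis surj_pair)
    then show "x \<in> (\<lambda>((u, r, m), (m', s, v)). (r, s, m)) ` (P \<times> P)"
      using x by (intro image_eqI[of _ _ "((u, r, m), (m, s, v))"]) (auto simp: T_iff)
  qed
  show "finite ((\<lambda>((u, r, m), (m', s, v)). (r, s, m)) ` (P \<times> P))" using finite_P by simp
qed

lemma T_empty: "(u, p, v) \<notin> P ==> T u p v = {}"
  by (auto simp: T_iff P_append)

lemma car: "f \<in> carrier A \<longleftrightarrow> (\<forall>w. f w \<noteq> 0 \<longrightarrow> w \<in> P)"
proof -
  have "finite {w. f w \<noteq> 0}" if "{w. f w \<noteq> 0} \<subseteq> P" by (rule finite_subset[OF that finite_P])
  then show ?thesis by (auto simp: A_def path_algebra_def P_def[symmetric] simp del: split_paired_All)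
qed

lemma outside: "f \<in> carrier A ==> w \<notin> P ==> f w = 0"
  unfolding car by blast

lemma mult: "(f \<otimes> g) (u, p, v) = (\<Sum>(r, s, m)\<in>T u p v. f (m, s, v) * g (u, r, m))"
  by (simp add: A_def path_algebra_def T_def P_def)

lemma add [simp]: "(f \<oplus> g) w = f w + g w"
  by (simp add: A_def path_algebra_def)

lemma zero [simp]: "\<zero> w = 0"
  by (simp add: A_def path_algebra_def)

lemma smult [simp]: "(c \<odot> f) w = c * f w"
  by (simp add: A_def path_algebra_def)

lemma one: "\<one> (u, p, v) = (if u \<in> V \<and> p = [] \<and> v = u then 1 else 0)"
  by (simp add: A_def path_algebra_def)

lemma path_ext: "(\<And>u p v. f (u, p, v) = g (u, p, v)) ==> f = g"
  by (rule ext) (metis surj_pair)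

lemma one_car: "\<one> \<in> carrier A"
  unfolding car by (auto simp: one P_Nil split: if_splits)

lemma add_car: "[|f \<in> carrier A; g \<in> carrier A|] ==> f \<oplus> g \<in> carrier A"
  unfolding car by (metis add add_0)

lemma smult_car: "f \<in> carrier A ==> c \<odot> f \<in> carrier A"
  unfolding car by auto

lemma mult_outside: "(u, p, v) \<notin> P ==> (f \<otimes> g) (u, p, v) = 0"
  by (simp add: mult T_empty)

lemma mult_car: "f \<otimes> g \<in> carrier A"
  unfolding car using mult_outside by (metis surj_pair)

lemma mult_assoc: "(f \<otimes> g) \<otimes> h = f \<otimes> (g \<otimes> h)"
proof (rule path_ext)
  fix u p v
  \<comment> \<open>Both products are sums over the factorizations into three paths, indexed in two
    ways.\<close>
  let ?L = "Sigma (T u p v) (\<lambda>(r, s, m). T m s v)" and ?R = "Sigma (T u p v) (\<lambda>(r, s, m). T u r m)"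
  have "((f \<otimes> g) \<otimes> h) (u, p, v) =
      (\<Sum>x\<in>T u p v. \<Sum>y\<in>(case x of (r, s, m) => T m s v). case (x, y) of ((r, s, m), (s1, s2, m')) =>
        f (m', s2, v) * g (m, s1, m') * h (u, r, m))"
    by (simp add: mult sum_distrib_right split_def)
  also have "\<dots> = (\<Sum>((r, s, m), (s1, s2, m'))\<in>?L. f (m', s2, v) * g (m, s1, m') * h (u, r, m))"
    by (subst sum.Sigma) (auto simp: finite_T split_def)
  also have "\<dots> = (\<Sum>((r, s, m), (r1, r2, m'))\<in>?R. f (m, s, v) * g (m', r2, m) * h (u, r1, m'))"
    by (rule sum.reindex_bij_witness[of _ "\<lambda>((r, s, m), (r1, r2, m')). ((r1, r2 @ s, m'), (r2, s, m))"
          "\<lambda>((r, s, m), (s1, s2, m')). ((r @ s1, s2, m'), (r, s1, m))"])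
      (auto simp: T_iff P_append)
  also have "\<dots> = (\<Sum>x\<in>T u p v. \<Sum>y\<in>(case x of (r, s, m) => T u r m). case (x, y) of ((r, s, m), (r1, r2, m')) =>
        f (m, s, v) * g (m', r2, m) * h (u, r1, m'))"
    by (subst sum.Sigma) (auto simp: finite_T split_def)
  also have "\<dots> = (f \<otimes> (g \<otimes> h)) (u, p, v)"
    by (simp add: mult sum_distrib_left split_def mult.assoc)
  finally show "((f \<otimes> g) \<otimes> h) (u, p, v) = (f \<otimes> (g \<otimes> h)) (u, p, v)" .
qed

lemma mult_one: assumes f: "f \<in> carrier A" shows "f \<otimes> \<one> = f" "\<one> \<otimes> f = f"
proof -
  have "(f \<otimes> \<one>) (u, p, v) = f (u, p, v) \<and> (\<one> \<otimes> f) (u, p, v) = f (u, p, v)" for u p v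
  proof (cases "(u, p, v) \<in> P")
    case True
    have uv: "u \<in> V" "v \<in> V" using P_length[OF True] by auto
    have "(f \<otimes> \<one>) (u, p, v) = (\<Sum>x\<in>T u p v. if x = ([], p, u) then f (u, p, v) else 0)"
      unfolding mult by (rule sum.cong) (auto simp: one T_iff P_Nil split: if_splits)
    moreover have "([], p, u) \<in> T u p v" using True uv by (simp add: T_iff P_Nil)
    moreover have "(\<one> \<otimes> f) (u, p, v) = (\<Sum>x\<in>T u p v. if x = (p, [], v) then f (u, p, v) else 0)"
      unfolding mult by (rule sum.cong) (auto simp: one T_iff P_Nil split: if_splits)
    moreover have "(p, [], v) \<in> T u p v" using True uv by (simp add: T_iff P_Nil)
    ultimately show ?thesis by (simp add: finite_T)
  next
    case False then show ?thesis using f by (simp add: mult_outside outside)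
  qed
  then show "f \<otimes> \<one> = f" "\<one> \<otimes> f = f" by (auto intro: path_ext)
qed

lemma uminus_car: "f \<in> carrier A ==> (\<lambda>w. - f w) \<in> carrier A"
  by (simp add: car)

lemma ring_A: "ring A"
proof (rule ringI)
  show "abelian_group A"
  proof (rule abelian_groupI)
    show "\<exists>y\<in>carrier A. y \<oplus> x = \<zero>" if "x \<in> carrier A" for x
      by (rule bexI[OF _ uminus_car[OF that]]) (auto intro: path_ext)
    show "\<zero> \<in> carrier A" by (simp add: car)
  qed (auto intro!: path_ext add_car)
  show "Group.monoid A" by (rule monoidI) (auto simp: mult_car one_car mult_assoc mult_one)
  show "(x \<oplus> y) \<otimes> z = x \<otimes> z \<oplus> y \<otimes> z" for x y z
    by (rule path_ext) (simp add: mult split_def sum.distrib[symmetric] distrib_right)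
  show "z \<otimes> (x \<oplus> y) = z \<otimes> x \<oplus> z \<otimes> y" for x y z
    by (rule path_ext) (simp add: mult split_def sum.distrib[symmetric] distrib_left)
qed

sublocale PA: ring A by (rule ring_A)

text \<open>The filtration by path length. \<open>F 1\<close> turns out to be the radical and
  \<open>F 2\<close> its square.\<close>

definition F :: "nat => (nat \<times> (nat \<times> nat) list \<times> nat => 'k) set" where
  "F k = {f \<in> carrier A. \<forall>u p v. length p < k \<longrightarrow> f (u, p, v) = 0}"

lemma F_mult:
  assumes f: "f \<in> F i" and g: "g \<in> F j" shows "f \<otimes> g \<in> F (i + j)"
proof -
  have "(f \<otimes> g) (u, p, v) = 0" if p: "length p < i + j" for u p v
    unfolding mult
  proof (rule sum.neutral, clarify)
    fix r s m assume "(r, s, m) \<in> T u p v"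
    then have "length p = length r + length s" by (simp add: T_iff)
    then have "length s < i \<or> length r < j" using p by linarith
    then show "f (m, s, v) * g (u, r, m) = 0" using f g by (auto simp: F_def)
  qed
  then show ?thesis by (simp add: F_def mult_car)
qed

lemma F_0: "F 0 = carrier A" by (simp add: F_def)

lemma uminus_eq: "f \<in> carrier A ==> (\<ominus> f) w = - f w"
  using PA.r_neg[of f] by (metis add add_eq_0_iff zero)

lemma ideal_F: "ideal (F k) A"
proof (rule idealI[OF ring_A])
  show "subgroup (F k) (add_monoid A)"
  proof (intro subgroup.intro)
    fix f assume "f \<in> F k"
    then show "inv\<^bsub>add_monoid A\<^esub> f \<in> F k"
      by (auto simp: F_def a_inv_def[symmetric] uminus_eq)
  qed (auto simp: F_def)
next
  fix a x assume a: "a \<in> F k" and x: "x \<in> carrier A"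
  show "x \<otimes> a \<in> F k" using F_mult[of x 0 a k] a x by (simp add: F_0)
  show "a \<otimes> x \<in> F k" using F_mult[of a k x 0] a x by (simp add: F_0)
qed

lemma F_top: "F (Suc (Max V)) = {\<zero>}"
proof -
  have "f = \<zero>" if f: "f \<in> F (Suc (Max V))" for f
  proof (rule path_ext)
    fix u p v
    show "f (u, p, v) = \<zero> (u, p, v)"
    proof (cases "(u, p, v) \<in> P")
      case True
      then have "length p \<le> u" "u \<in> V" using P_length[OF True] by auto
      then have "length p < Suc (Max V)" using finV by (meson Max_ge le_imp_less_Suc le_trans)
      then show ?thesis using f by (simp add: F_def)
    qed (use f in \<open>auto simp: F_def car\<close>)
  qed
  moreover have "\<zero> \<in> F (Suc (Max V))" by (simp add: F_def)
  ultimately show ?thesis by blast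
qed

lemma F_1: "F 1 = {f \<in> carrier A. \<forall>u\<in>V. f (u, [], u) = 0}"
proof -
  have "f (u, [], v) = 0" if "f \<in> carrier A" "\<forall>u\<in>V. f (u, [], u) = 0" for f u v
    using outside[OF that(1), of "(u, [], v)"] that(2) by (cases "u = v \<and> u \<in> V") (auto simp: P_Nil)
  then show ?thesis by (auto simp: F_def)
qed

lemma mult_trivial: "u \<in> V ==> (f \<otimes> g) (u, [], u) = f (u, [], u) * g (u, [], u)"
proof -
  assume "u \<in> V"
  then have "T u [] u = {([], [], u)}" by (auto simp: T_def P_Nil)
  then show ?thesis by (simp add: mult)
qed

text \<open>
  Nakayama's argument: otherwise \<open>\<one>\<close> is a sum of elements of \<open>L\<close> and \<open>F 1\<close>, so that \<open>F (Suc k) \<subseteq> L\<close>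
  implies \<open>F k \<subseteq> L\<close>.
\<close>

lemma F_1_maximal:
  assumes L: "maximal_left_ideal A L" shows "F 1 \<subseteq> L"
proof (rule ccontr)
  assume nsub: "\<not> F 1 \<subseteq> L"
  have sub: "L \<subseteq> carrier A" "\<zero> \<in> L" "\<And>x y. x \<in> L ==> y \<in> L ==> x \<oplus> y \<in> L" "\<And>a x. a \<in> carrier A ==> x \<in> L ==> a \<otimes> x \<in> L"
    using L unfolding maximal_left_ideal_def PA.submodule_regular_iff by auto
  interpret I: ideal "F 1" A by (rule ideal_F)
  let ?S = "{l \<oplus> i |l i. l \<in> L \<and> i \<in> F 1}"
  have IC: "i \<in> carrier A" if "i \<in> F 1" for i using that I.a_Hcarr by blast
  have "submodule ?S A (regular_module A)"
    unfolding PA.submodule_regular_iff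
  proof (intro conjI ballI subsetI)
    show "x \<in> carrier A" if "x \<in> ?S" for x using that sub(1) IC by auto
    have "\<zero> = \<zero> \<oplus> \<zero>" by simp
    then show "\<zero> \<in> ?S" using sub(2) I.zero_closed by blast
    show "x \<oplus> y \<in> ?S" if xy: "x \<in> ?S" "y \<in> ?S" for x y
    proof -
      obtain l i l' i' where li: "x = l \<oplus> i" "l \<in> L" "i \<in> F 1" "y = l' \<oplus> i'" "l' \<in> L" "i' \<in> F 1" using xy by blast
      then have "x \<oplus> y = (l \<oplus> l') \<oplus> (i \<oplus> i')" using sub(1) IC by (auto simp: PA.a_ac subset_iff)
      moreover have "l \<oplus> l' \<in> L" "i \<oplus> i' \<in> F 1" using li sub(3) I.a_closed by auto
      ultimately show ?thesis by blast
    qed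
    show "a \<otimes> x \<in> ?S" if ax: "a \<in> carrier A" "x \<in> ?S" for a x
    proof -
      obtain l i where li: "x = l \<oplus> i" "l \<in> L" "i \<in> F 1" using ax(2) by blast
      then have "a \<otimes> x = a \<otimes> l \<oplus> a \<otimes> i" using sub(1) IC ax(1) by (auto simp: PA.r_distr subset_iff)
      then show ?thesis using sub(4)[OF ax(1) li(2)] I.I_l_closed[OF li(3) ax(1)] by blast
    qed
  qed
  moreover have "L \<subseteq> ?S"
  proof
    fix l assume l: "l \<in> L"
    then have "l = l \<oplus> \<zero>" using sub(1) by auto
    then show "l \<in> ?S" using l I.zero_closed by blast
  qed
  moreover have "?S \<noteq> L"
  proof
    assume eq: "?S = L"
    have "i \<in> ?S" if "i \<in> F 1" for i
    proof -
      have "i = \<zero> \<oplus> i" using IC[OF that] by simp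
      then show ?thesis using sub(2) that by blast
    qed
    then show False using eq nsub by blast
  qed
  ultimately have "?S = carrier A" using L unfolding maximal_left_ideal_def by blast
  then obtain l i where li: "\<one> = l \<oplus> i" "l \<in> L" "i \<in> F 1" using one_car by blast
  have lc: "l \<in> carrier A" using li(2) sub(1) by blast
  have step: "F k \<subseteq> L" if k: "F (Suc k) \<subseteq> L" for k
  proof
    fix f assume f: "f \<in> F k"
    then have fc: "f \<in> carrier A" using ideal.Icarr[OF ideal_F] by blast
    have "f \<otimes> (l \<oplus> i) = f \<otimes> l \<oplus> f \<otimes> i" by (rule PA.r_distr[OF lc IC[OF li(3)] fc])
    then have "f = f \<otimes> l \<oplus> f \<otimes> i" unfolding li(1)[symmetric] mult_one(1)[OF fc] .
    moreover have "f \<otimes> i \<in> L" using F_mult[OF f li(3)] k by (simp only: Suc_eq_plus1) blast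
    moreover have "f \<otimes> l \<in> L" by (rule sub(4)[OF fc li(2)])
    ultimately show "f \<in> L" using sub(3)[of "f \<otimes> l" "f \<otimes> i"] by (simp only:)
  qed
  have "F (Suc (Max V) - j) \<subseteq> L" for j
  proof (induction j)
    case 0 then show ?case using F_top sub(2) by simp
  next
    case (Suc j)
    show ?case
    proof (cases "j < Suc (Max V)")
      case True
      then have "Suc (Suc (Max V) - Suc j) = Suc (Max V) - j" by linarith
      then show ?thesis using step Suc by metis
    next
      case False then show ?thesis using Suc by simp
    qed
  qed
  from this[of "Suc (Max V)"] have "carrier A \<subseteq> L" by (simp add: F_0)
  then show False using L sub(1) unfolding maximal_left_ideal_def by blast
qed

text \<open>The coefficient at the trivial path of \<open>u\<close> is a ring homomorphism onto the
  field, by \<open>mult_trivial\<close>, and the set is its kernel.\<close>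

lemma maximal_vertex:
  assumes u: "u \<in> V" shows "maximal_left_ideal A {f \<in> carrier A. f (u, [], u) = 0}" (is "maximal_left_ideal A ?L")
  unfolding maximal_left_ideal_def
proof (intro conjI allI impI)
  show "submodule ?L A (regular_module A)"
    unfolding PA.submodule_regular_iff using u by (auto simp: mult_car mult_trivial)
  show "?L \<noteq> carrier A" using one_car u one[of u "[]" u] zero_neq_one by (metis (mono_tags, lifting) mem_Collect_eq)
  fix L' assume "submodule L' A (regular_module A) \<and> ?L \<subseteq> L'"
  then have sub: "L' \<subseteq> carrier A" "\<And>x y. x \<in> L' ==> y \<in> L' ==> x \<oplus> y \<in> L'" "\<And>a x. a \<in> carrier A ==> x \<in> L' ==> a \<otimes> x \<in> L'"
    and L: "?L \<subseteq> L'"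
    unfolding PA.submodule_regular_iff by auto
  show "L' = ?L \<or> L' = carrier A"
  proof (rule disjCI)
    assume "L' \<noteq> carrier A"
    show "L' = ?L"
    proof (rule ccontr)
      assume "L' \<noteq> ?L"
      then obtain g where g: "g \<in> L'" "g (u, [], u) \<noteq> 0" using L sub(1) by blast
      have "f \<in> L'" if f: "f \<in> carrier A" for f
      proof -
        \<comment> \<open>\<open>?h\<close> lies in \<open>L'\<close> and has the same coefficient
          as \<open>f\<close> at the trivial path, so the difference lies in the smaller
          ideal.\<close>
        let ?h = "((f (u, [], u) / g (u, [], u)) \<odot> \<one>) \<otimes> g"
        have h: "?h \<in> L'" using g(1) one_car smult_car sub(3) by blast
        then have hc: "?h \<in> carrier A" using sub(1) by blast
        have "?h (u, [], u) = f (u, [], u)" using g(2) u by (simp add: mult_trivial one)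
        then have "f \<ominus> ?h \<in> ?L" using f hc by (simp add: a_minus_def uminus_eq)
        moreover have "f = (f \<ominus> ?h) \<oplus> ?h" using f hc by (simp add: a_minus_def PA.a_assoc PA.l_neg)
        ultimately show "f \<in> L'" using L sub(2) h by (metis (no_types, lifting) subsetD)
      qed
      then show False using \<open>L' \<noteq> carrier A\<close> sub(1) by blast
    qed
  qed
qed

lemma jacobson_A: "jacobson_radical A = F 1"
proof
  show "F 1 \<subseteq> jacobson_radical A"
    using F_1_maximal by (auto simp: jacobson_radical_def F_def)
  show "jacobson_radical A \<subseteq> F 1"
  proof
    fix f assume f: "f \<in> jacobson_radical A"
    have "f \<in> {f \<in> carrier A. f (u, [], u) = 0}" if "u \<in> V" for u
      using f maximal_vertex[OF that] unfolding jacobson_radical_def by blast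
    then show "f \<in> F 1" using f unfolding F_1 by (auto simp: jacobson_radical_def)
  qed
qed

definition del where "del c w = (\<lambda>w'. if w' = w then c else 0)"

lemma del_car: "w \<in> P ==> del c w \<in> carrier A"
  by (simp add: del_def car)

lemma del_mult:
  assumes r: "(u, r, m) \<in> P" and s: "(m, s, v) \<in> P"
  shows "del c (m, s, v) \<otimes> del 1 (u, r, m) = del c (u, r @ s, v)"
proof (rule path_ext)
  fix u' p v'
  have "(del c (m, s, v) \<otimes> del 1 (u, r, m)) (u', p, v') =
      (\<Sum>x\<in>T u' p v'. if x = (r, s, m) then (if u' = u \<and> v' = v then c else 0) else 0)"
    unfolding mult by (rule sum.cong) (auto simp: del_def split: if_splits)
  also have "\<dots> = (if (r, s, m) \<in> T u' p v' then (if u' = u \<and> v' = v then c else 0) else 0)"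
    by (simp add: finite_T)
  also have "\<dots> = del c (u, r @ s, v) (u', p, v')"
    using r s by (auto simp: del_def T_iff)
  finally show "(del c (m, s, v) \<otimes> del 1 (u, r, m)) (u', p, v') = del c (u, r @ s, v) (u', p, v')" .
qed

text \<open>A path of length at least two is an arrow followed by a path of positive length.
  Elements of \<open>F 2\<close> are treated by splitting off one path at a time.\<close>

lemma ideal_prod_F: "F 1 \<cdot> F 1 = F 2"
proof
  show "F 1 \<cdot> F 1 \<subseteq> F 2"
  proof
    fix x assume "x \<in> F 1 \<cdot> F 1"
    then show "x \<in> F 2"
    proof induction
      case (prod i j) then show ?case using F_mult[of i 1 j 1] by (simp add: numeral_2_eq_2)
    next
      case (sum s1 s2)
      then show ?case using additive_subgroup.a_closed[OF ideal.axioms(1)[OF ideal_F]] by blast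
    qed
  qed
  have "f \<in> F 1 \<cdot> F 1" if "finite S" "f \<in> F 2" "{w. f w \<noteq> 0} \<subseteq> S" for S f
    using that
  proof (induction S arbitrary: f rule: finite_induct)
    case empty
    then have "f = \<zero> \<otimes> \<zero>" by (auto intro: path_ext)
    moreover have "\<zero> \<in> F 1" by (simp add: F_def)
    ultimately show ?case using ideal_prod.prod by metis
  next
    case (insert w S)
    show ?case
    proof (cases "f w = 0")
      case True
      then have "{w. f w \<noteq> 0} \<subseteq> S" using insert.prems(2) by auto
      then show ?thesis using insert by blast
    next
      case False
      obtain u p v where w: "w = (u, p, v)" by (metis surj_pair)
      have fc: "f \<in> carrier A" using insert.prems by (simp add: F_def)
      have wP: "(u, p, v) \<in> P" using False fc w by (auto simp: car)
      have "\<not> length p < 2" using False insert.prems w by (auto simp: F_def)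
      then obtain a s where p: "p = a # s" "s \<noteq> []" by (cases p) auto
      obtain m where m: "(u, [a], m) \<in> P" "(m, s, v) \<in> P" using wP P_append[of u "[a]" s v] p by auto
      have "del (f w) (m, s, v) \<in> F 1" "del 1 (u, [a], m) \<in> F 1"
        using p(2) del_car[OF m(1)] del_car[OF m(2)] by (auto simp: F_def del_def)
      then have 1: "del (f w) (m, s, v) \<otimes> del 1 (u, [a], m) \<in> F 1 \<cdot> F 1" by (rule ideal_prod.prod)
      have "f(w := 0) \<in> F 2" using insert.prems by (auto simp: F_def car)
      moreover have "{w'. (f(w := 0)) w' \<noteq> 0} \<subseteq> S" using insert.prems(2) by auto
      ultimately have 2: "f(w := 0) \<in> F 1 \<cdot> F 1" by (rule insert.IH)
      have "f = del (f w) (m, s, v) \<otimes> del 1 (u, [a], m) \<oplus> f(w := 0)"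
        unfolding del_mult[OF m] using w p by (auto intro!: path_ext simp: del_def)
      then show ?thesis using ideal_prod.sum[OF 1 2] by metis
    qed
  qed
  moreover have "finite {w. f w \<noteq> 0}" if "f \<in> F 2" for f
    using finite_subset[OF _ finite_P, of "{w. f w \<noteq> 0}"] that outside[of f] by (force simp: F_def)
  ultimately show "F 2 \<subseteq> F 1 \<cdot> F 1" by blast
qed

text \<open>There are no loops, so the pair \<open>(x, x)\<close> is free to stand for the trivial
  path.\<close>

definition \<phi> :: "(nat \<times> (nat \<times> nat) list \<times> nat => 'k) => nat \<times> nat => 'k" where
  "\<phi> f = (\<lambda>(x, y). if x = y then f (x, [], x) else f (x, [(x, y)], y))"

lemma \<phi>_mult:
  assumes f: "f \<in> carrier A" and g: "g \<in> carrier A"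
  shows "\<phi> (f \<otimes> g) (x, y) = (if x = y then \<phi> f (x, x) * \<phi> g (x, x) else \<phi> f (y, y) * \<phi> g (x, y) + \<phi> f (x, y) * \<phi> g (x, x))"
proof -
  consider "x = y" "x \<in> V" | "x = y" "x \<notin> V" | "x \<noteq> y" "(x, y) \<in> E" | "x \<noteq> y" "(x, y) \<notin> E" by blast
  then show ?thesis
  proof cases
    case 1 then show ?thesis by (simp add: \<phi>_def mult_trivial)
  next
    case 2
    then have "(x, [], x) \<notin> P" by (simp add: P_Nil)
    then show ?thesis using 2 outside[OF f] outside[OF g] outside[OF mult_car[of f g]] by (simp add: \<phi>_def)
  next
    case 3
    then have "x \<in> V" "y \<in> V" using arcD by auto
    then have "T x [(x, y)] y = {([], [(x, y)], x), ([(x, y)], [], y)}"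
      using 3 by (auto simp: T_def P_Nil P_Cons append_eq_Cons_conv Cons_eq_append_conv)
    then show ?thesis using 3 by (simp add: \<phi>_def mult)
  next
    case 4
    then have "(x, [(x, y)], y) \<notin> P" by (simp add: P_Cons)
    then have "f (x, [(x, y)], y) = 0" "g (x, [(x, y)], y) = 0" "(f \<otimes> g) (x, [(x, y)], y) = 0"
      using outside[OF f] outside[OF g] outside[OF mult_car[of f g]] by auto
    then show ?thesis using 4 by (simp add: \<phi>_def)
  qed
qed

lemma radsq_path_algebra: "radsq V E (mod_rad_square A) (\<lambda>X. \<phi> (SOME f. f \<in> X))"
proof -
  have J: "mod_rad_square A = quot A (F 2)"
    unfolding mod_rad_square_def jacobson_A ideal_prod_F ..
  show ?thesis
    unfolding J
  proof (rule radsq_quot(1)[OF quiver_axioms ideal_F smult_car, where \<phi> = \<phi>])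
    show "\<phi> (f \<oplus> g) w = \<phi> f w + \<phi> g w" for f g w by (cases w) (simp add: \<phi>_def)
    show "\<phi> \<one> (x, y) = (if x = y \<and> x \<in> V then 1 else 0)" for x y by (simp add: \<phi>_def one)
    show "\<phi> (c \<odot> f) w = c * \<phi> f w" for c f w by (cases w) (simp add: \<phi>_def)
    show "(x, y) \<in> E \<or> x = y \<and> x \<in> V" if "f \<in> carrier A" "\<phi> f (x, y) \<noteq> 0" for f x y
      using that(2) outside[OF that(1), of "(x, [], x)"] outside[OF that(1), of "(x, [(x, y)], y)"]
      by (auto simp: \<phi>_def P_Nil P_Cons split: if_splits)
    show "\<exists>f\<in>carrier A. \<phi> f = h" if h: "\<forall>x y. h (x, y) \<noteq> 0 \<longrightarrow> (x, y) \<in> E \<or> x = y \<and> x \<in> V" for h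
    proof -
      let ?f = "\<lambda>(u, p, v). if u = v \<and> p = [] \<or> u \<noteq> v \<and> p = [(u, v)] then h (u, v) else 0"
      have "w \<in> P" if w: "?f w \<noteq> 0" for w
      proof -
        obtain u p v where "w = (u, p, v)" by (metis surj_pair)
        then show ?thesis using w h[rule_format, of u v] arcD[of u v]
          by (auto simp: P_Nil P_Cons split: if_splits)
      qed
      then have "?f \<in> carrier A" unfolding car by blast
      moreover have "\<phi> ?f = h" by (auto simp: \<phi>_def)
      ultimately show ?thesis by blast
    qed
    show "f \<in> F 2 \<longleftrightarrow> (\<forall>w. \<phi> f w = 0)" if f: "f \<in> carrier A" for f
    proof
      assume "f \<in> F 2" then show "\<forall>w. \<phi> f w = 0" by (auto simp: \<phi>_def F_def)
    next
      assume 0: "\<forall>w. \<phi> f w = 0"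
      have "f (u, p, v) = 0" if p: "length p < 2" for u p v
      proof (rule ccontr)
        assume nz: "f (u, p, v) \<noteq> 0"
        then have uP: "(u, p, v) \<in> P" using f by (auto simp: car)
        show False
        proof (cases p)
          case Nil then show False using uP nz 0[rule_format, of "(u, v)"] by (auto simp: P_Nil \<phi>_def)
        next
          case (Cons a s)
          then have "s = []" using p by simp
          then have "p = [(u, v)]" "(u, v) \<in> E" using uP Cons by (auto simp: P_Cons P_Nil)
          then show False using nz 0[rule_format, of "(u, v)"] arcD[of u v] by (auto simp: \<phi>_def)
        qed
      qed
      then show "f \<in> F 2" using f by (simp add: F_def)
    qed
  qed (assumption, rule \<phi>_mult)
qed

end

section \<open>Maximal rigid sets\<close>

definition missed :: "nat set => nat set set => nat set" where
  "missed U F = {y \<in> U. \<exists>A\<in>F. y \<notin> A}"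

text \<open>The possible sets of all \<open>A\<close> with \<open>(x, A)\<close> in a maximal rigid
  set, where \<open>x\<close> is the largest vertex and \<open>U\<close> its set of targets. Such an
  \<open>F\<close> takes \<open>x\<close> and the missed targets out of the quiver, so it has to
  supply as many pairs as vertices are lost; by \<open>card_fan_le\<close> it cannot supply
  more.\<close>

definition fans :: "nat set => nat set set set" where
  "fans U = {F. F \<subseteq> Pow U \<and> F \<noteq> {} \<and> (\<forall>A\<in>F. \<forall>B\<in>F. card (B - A) \<le> 1) \<and> card F = Suc (card (missed U F))}"

lemma le_2_cases:
  fixes U :: "nat set"
  assumes "finite U" "card U \<le> 2"
  obtains "U = {}" | a where "U = {a}" | a b where "a \<noteq> b" "U = {a, b}"
proof -
  consider "card U = 0" | "card U = 1" | "card U = 2" using assms(2) by linarith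
  then show thesis
  proof cases
    case 1 then show ?thesis using that(1) assms(1) by simp
  next
    case 2 then show ?thesis using that(2) card_1_singletonE by blast
  next
    case 3 then show ?thesis using that(3) card_2_iff by metis
  qed
qed

lemma card_pair_diff:
  fixes a b :: nat
  assumes "a \<noteq> b"
  shows "card {a, b} = 2" "{a, b} - {a} = {b}" "{a, b} - {b} = {a}" "{a} - {b} = {a}" "{b} - {a} = {b}"
  using assms by auto

text \<open>Of the sixteen families of subsets of a pair, the four that contain both the empty set
  and the whole pair violate the bound on differences.\<close>

lemma fan_subset_pair:
  fixes a b :: nat
  assumes ab: "a \<noteq> b" and F: "F \<subseteq> Pow {a, b}" and 1: "\<forall>A\<in>F. \<forall>B\<in>F. card (B - A) \<le> 1"
  shows "F = {} \<or> F = {{a, b}} \<or> F = {{a}} \<or> F = {{b}} \<or> F = {{}} \<or> F = {{a, b}, {a}} \<or> F = {{a, b}, {b}} \<or>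
    F = {{a}, {b}} \<or> F = {{}, {a}} \<or> F = {{}, {b}} \<or> F = {{a, b}, {a}, {b}} \<or> F = {{}, {a}, {b}}"
proof -
  have n: "\<not> ({} \<in> F \<and> {a, b} \<in> F)" using 1 ab by force
  have "F \<in> Pow (Pow {a, b})" using F by simp
  then show ?thesis using n by (simp add: Pow_insert) (elim disjE; simp add: insert_commute)
qed

lemma missed_pair:
  fixes a b :: nat
  assumes "a \<noteq> b"
  shows "missed {a, b} {{a, b}} = {}" "missed {a, b} {{a}} = {b}" "missed {a, b} {{b}} = {a}" "missed {a, b} {{}} = {a, b}"
    "missed {a, b} {{a, b}, {a}} = {b}" "missed {a, b} {{a, b}, {b}} = {a}" "missed {a, b} {{a}, {b}} = {a, b}"
    "missed {a, b} {{}, {a}} = {a, b}" "missed {a, b} {{}, {b}} = {a, b}" "missed {a, b} {{a, b}, {a}, {b}} = {a, b}"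
    "missed {a, b} {{}, {a}, {b}} = {a, b}"
  using assms by (auto simp: missed_def)

lemma set_pair_neq:
  fixes a b :: nat
  assumes "a \<noteq> b"
  shows "{a, b} \<noteq> {a}" "{a, b} \<noteq> {b}" "{a} \<noteq> {b}"
  using assms by auto

text \<open>A check of all families on at most two targets. The bound on differences matters for a
  pair: its full power set has four members but misses only two targets.\<close>

lemma card_fan_le:
  assumes U: "finite U" "card U \<le> 2" and F: "F \<subseteq> Pow U" "\<forall>A\<in>F. \<forall>B\<in>F. card (B - A) \<le> 1"
  shows "card F \<le> Suc (card (missed U F))"
  using U
proof (cases rule: le_2_cases)
  case 1
  then have "F = {} \<or> F = {{}}" using F(1) by auto
  then show ?thesis by auto
next
  case (2 a)
  then have "F \<in> Pow (Pow {a})" using F(1) by simp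
  then have "F = {} \<or> F = {{}} \<or> F = {{a}} \<or> F = {{}, {a}}" by (simp add: Pow_insert insert_commute)
  then show ?thesis using 2 by (auto simp: missed_def)
next
  case (3 a b)
  then show ?thesis
    using fan_subset_pair[OF 3(1) F(1)[unfolded 3(2)] F(2)] set_pair_neq[OF 3(1)] 3(1)
    unfolding 3(2) by (elim disjE) (simp_all add: missed_pair[OF 3(1)])
qed

lemma fans_empty: "fans {} = {{{}}}"
  by (auto simp: fans_def missed_def)

lemma fans_single: "fans {a} = {{{a}}, {{}, {a}}}"
proof
  show "fans {a} \<subseteq> {{{a}}, {{}, {a}}}"
  proof
    fix F assume F: "F \<in> fans {a}"
    then have "F \<in> Pow (Pow {a})" "F \<noteq> {}" by (simp_all add: fans_def)
    then have "F = {{}} \<or> F = {{a}} \<or> F = {{}, {a}}" by (simp add: Pow_insert insert_commute)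
    then show "F \<in> {{{a}}, {{}, {a}}}" using F by (auto simp: fans_def missed_def)
  qed
  have "{y. y = a} = {a}" by auto
  then show "{{{a}}, {{}, {a}}} \<subseteq> fans {a}" by (auto simp: fans_def missed_def)
qed

text \<open>The targets missed are, in this order: none, \<open>b\<close>, \<open>a\<close>, both,
  both. At the branching vertex 3 these families give the five tilting modules of type D.\<close>

lemma fans_pair:
  assumes ab: "a \<noteq> b"
  shows "fans {a, b} = {{{a, b}}, {{a, b}, {a}}, {{a, b}, {b}}, {{a, b}, {a}, {b}}, {{}, {a}, {b}}}"
proof
  note neq = set_pair_neq[OF ab]
  show "fans {a, b} \<subseteq> {{{a, b}}, {{a, b}, {a}}, {{a, b}, {b}}, {{a, b}, {a}, {b}}, {{}, {a}, {b}}}"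
  proof
    fix F assume F: "F \<in> fans {a, b}"
    then have F': "F \<subseteq> Pow {a, b}" "\<forall>A\<in>F. \<forall>B\<in>F. card (B - A) \<le> 1" "F \<noteq> {}" "card F = Suc (card (missed {a, b} F))"
      by (auto simp: fans_def)
    show "F \<in> {{{a, b}}, {{a, b}, {a}}, {{a, b}, {b}}, {{a, b}, {a}, {b}}, {{}, {a}, {b}}}"
      using fan_subset_pair[OF ab F'(1,2)] F'(3,4) neq ab
      by (elim disjE) (simp_all add: missed_pair[OF ab])
  qed
  show "{{{a, b}}, {{a, b}, {a}}, {{a, b}, {b}}, {{a, b}, {a}, {b}}, {{}, {a}, {b}}} \<subseteq> fans {a, b}"
    using neq ab by (simp add: fans_def missed_pair[OF ab] card_pair_diff[OF ab])
qed

lemma sum_Pow_insert: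
  fixes f :: "'a set => 'b::comm_monoid_add"
  assumes "finite A" "x \<notin> A"
  shows "sum f (Pow (insert x A)) = sum f (Pow A) + (\<Sum>U\<in>Pow A. f (insert x U))"
proof -
  have "inj_on (insert x) (Pow A)" using assms(2) by (auto simp: inj_on_def)
  then have "sum f (insert x ` Pow A) = (\<Sum>U\<in>Pow A. f (insert x U))" by (simp add: sum.reindex)
  moreover have "sum f (Pow A \<union> insert x ` Pow A) = sum f (Pow A) + sum f (insert x ` Pow A)"
    using assms by (intro sum.union_disjoint) auto
  ultimately show ?thesis by (simp add: Pow_insert)
qed

section \<open>Rigid sets over full subquivers and their recursion\<close>

context quiver
begin

text \<open>\<open>Z\<close> limits the targets that may be missed: \<open>UNIV\<close> for
  tau-tilting modules, the sinks of the whole quiver for tilting modules. It stays fixed while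
  \<open>W\<close> shrinks, although new sinks can appear in the smaller quiver.\<close>

definition rigid_on :: "nat set => nat set => (nat \<times> nat set) set => bool" where
  "rigid_on Z W S \<longleftrightarrow> (\<forall>x A. (x, A) \<in> S \<longrightarrow> x \<in> W \<and> A \<subseteq> E `` {x} \<inter> W \<and> E `` {x} \<inter> W - A \<subseteq> Z \<and>
     (\<forall>y\<in>E `` {x} \<inter> W - A. \<forall>C. (y, C) \<notin> S) \<and> (\<forall>B. (x, B) \<in> S \<longrightarrow> card (B - A) \<le> 1))"

definition maximal_rigid :: "nat set => nat set => (nat \<times> nat set) set set" where
  "maximal_rigid Z W = {S. rigid_on Z W S \<and> card S = card W}"

definition num :: "nat set => nat set => nat" where
  "num Z W = card (maximal_rigid Z W)"

definition num_support :: "nat set => nat" where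
  "num_support W = (\<Sum>U\<in>Pow W. num UNIV U)"

lemma rigid_onD:
  assumes "rigid_on Z W S" "(x, A) \<in> S"
  shows "x \<in> W" "A \<subseteq> E `` {x} \<inter> W" "E `` {x} \<inter> W - A \<subseteq> Z" "y \<in> E `` {x} \<inter> W - A ==> (y, C) \<notin> S"
    "(x, B) \<in> S ==> card (B - A) \<le> 1"
  using assms unfolding rigid_on_def by blast+

lemma rigid_onI:
  assumes "\<And>x A. (x, A) \<in> S ==> x \<in> W" "\<And>x A. (x, A) \<in> S ==> A \<subseteq> E `` {x} \<inter> W"
    "\<And>x A. (x, A) \<in> S ==> E `` {x} \<inter> W - A \<subseteq> Z"
    "\<And>x A y C. [|(x, A) \<in> S; y \<in> E `` {x} \<inter> W - A|] ==> (y, C) \<notin> S"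
    "\<And>x A B. [|(x, A) \<in> S; (x, B) \<in> S|] ==> card (B - A) \<le> 1"
  shows "rigid_on Z W S"
  unfolding rigid_on_def by (intro allI impI conjI ballI; rule assms; assumption)

lemma rigid_on_finite:
  assumes "W \<subseteq> V" shows "finite {S. rigid_on Z W S}" "rigid_on Z W S ==> finite S"
proof -
  have W: "finite W" using finite_subset[OF assms finV] .
  have sub: "S \<subseteq> W \<times> Pow W" if r: "rigid_on Z W S" for S
  proof (rule subrelI)
    fix x A assume "(x, A) \<in> S"
    from rigid_onD(1,2)[OF r this] show "(x, A) \<in> W \<times> Pow W" by simp
  qed
  show "finite S" if "rigid_on Z W S" using sub[OF that] W finite_subset by blast
  show "finite {S. rigid_on Z W S}"
    by (rule finite_subset[of _ "Pow (W \<times> Pow W)"]) (use sub W in auto)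
qed

text \<open>No arrow ends in the largest vertex \<open>x\<close>, and a target of \<open>x\<close>
  has no second arrow into it. So the vertices that remain keep all their targets.\<close>

lemma out_restrict:
  assumes x: "\<forall>w\<in>W. w \<le> x" and z: "z \<in> W" "z \<noteq> x" and D: "D \<subseteq> E `` {x}"
  shows "E `` {z} \<inter> (W - {x} - D) = E `` {z} \<inter> W"
proof -
  have "y \<noteq> x \<and> y \<notin> D" if "(z, y) \<in> E" for y
    using arc_less[OF that] x z D indeg[OF that, of x] by fastforce
  then show ?thesis by auto
qed

text \<open>No pair of \<open>S\<close> sits at a missed target of \<open>x\<close>, and by
  \<open>out_restrict\<close> the conditions on the remaining pairs read the same in the smaller
  quiver.\<close>

lemma rigid_on_split:
  assumes x: "x \<in> W" "\<forall>w\<in>W. w \<le> x" and S: "rigid_on Z W S"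
  defines "F \<equiv> {A. (x, A) \<in> S}" and "U \<equiv> E `` {x} \<inter> W"
  shows "F \<subseteq> Pow U" "\<forall>A\<in>F. \<forall>B\<in>F. card (B - A) \<le> 1" "missed U F \<subseteq> Z"
    "rigid_on Z (W - {x} - missed U F) (S - {x} \<times> F)" "S = (S - {x} \<times> F) \<union> {x} \<times> F"
proof -
  show "F \<subseteq> Pow U" unfolding F_def U_def using rigid_onD(2)[OF S] by blast
  show "\<forall>A\<in>F. \<forall>B\<in>F. card (B - A) \<le> 1" unfolding F_def using rigid_onD(5)[OF S] by blast
  show "missed U F \<subseteq> Z" unfolding F_def U_def missed_def using rigid_onD(3)[OF S] by blast
  show "S = (S - {x} \<times> F) \<union> {x} \<times> F" by (auto simp: F_def)
  show "rigid_on Z (W - {x} - missed U F) (S - {x} \<times> F)"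
  proof -
    have r: "z \<in> W - {x} - missed U F" "E `` {z} \<inter> (W - {x} - missed U F) = E `` {z} \<inter> W" "(z, A) \<in> S"
      if zA: "(z, A) \<in> S - {x} \<times> F" for z A
    proof -
      have zS: "(z, A) \<in> S" "z \<noteq> x" using zA by (auto simp: F_def)
      note zW = rigid_onD(1)[OF S zS(1)]
      have "z \<notin> missed U F"
      proof
        assume "z \<in> missed U F"
        then obtain B where "(x, B) \<in> S" "z \<in> E `` {x} \<inter> W - B" by (auto simp: missed_def F_def U_def)
        then show False using rigid_onD(4)[OF S] zS(1) by blast
      qed
      then show "z \<in> W - {x} - missed U F" using zW zS(2) by blast
      show "E `` {z} \<inter> (W - {x} - missed U F) = E `` {z} \<inter> W"
        by (rule out_restrict[OF x(2) zW zS(2)]) (auto simp: missed_def U_def)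
      show "(z, A) \<in> S" by (rule zS(1))
    qed
    show ?thesis
    proof (rule rigid_onI)
      fix z A assume zA: "(z, A) \<in> S - {x} \<times> F"
      note d = rigid_onD[OF S r(3)[OF zA]]
      show "z \<in> W - {x} - missed U F" by (rule r(1)[OF zA])
      show "A \<subseteq> E `` {z} \<inter> (W - {x} - missed U F)" "E `` {z} \<inter> (W - {x} - missed U F) - A \<subseteq> Z"
        unfolding r(2)[OF zA] by (fact d(2), fact d(3))
      show "(y, C) \<notin> S - {x} \<times> F" if "y \<in> E `` {z} \<inter> (W - {x} - missed U F) - A" for y C
        using d(4) that unfolding r(2)[OF zA] by blast
      show "card (B - A) \<le> 1" if "(z, B) \<in> S - {x} \<times> F" for B using d(5) that by blast
    qed
  qed
qed

text \<open>The pairs of \<open>S\<close> avoid the targets missed by \<open>F\<close>, no arrow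
  leads back to \<open>x\<close>, and \<open>out_restrict\<close> transfers all other conditions to
  \<open>W\<close>.\<close>

lemma rigid_on_join:
  assumes x: "x \<in> W" "\<forall>w\<in>W. w \<le> x" and U: "U = E `` {x} \<inter> W"
    and F: "F \<subseteq> Pow U" "\<forall>A\<in>F. \<forall>B\<in>F. card (B - A) \<le> 1" "missed U F \<subseteq> Z"
    and S: "rigid_on Z (W - {x} - missed U F) S"
  shows "rigid_on Z W (S \<union> {x} \<times> F)"
proof (rule rigid_onI)
  have top: "z \<in> W \<and> z \<noteq> x \<and> z \<notin> missed U F" if "(z, A) \<in> S" for z A using rigid_onD(1)[OF S that] by blast
  have out: "E `` {z} \<inter> (W - {x} - missed U F) = E `` {z} \<inter> W" if "(z, A) \<in> S" for z A
    by (rule out_restrict[OF x(2)]) (use top[OF that] in \<open>auto simp: missed_def U\<close>)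
  have m: "U - A \<subseteq> missed U F" if "A \<in> F" for A using that by (auto simp: missed_def)
  have split: "(z, A) \<in> S \<and> z \<noteq> x \<or> z = x \<and> A \<in> F" if "(z, A) \<in> S \<union> {x} \<times> F" for z A using that top by blast
  fix z A assume zA: "(z, A) \<in> S \<union> {x} \<times> F"
  show "z \<in> W" using split[OF zA] top x(1) by blast
  show "A \<subseteq> E `` {z} \<inter> W" using split[OF zA] rigid_onD(2)[OF S] out F(1) U by blast
  show "E `` {z} \<inter> W - A \<subseteq> Z" using split[OF zA] rigid_onD(3)[OF S] out F(3) m U by blast
  show "(y, C) \<notin> S \<union> {x} \<times> F" if y: "y \<in> E `` {z} \<inter> W - A" for y C
  proof -
    have "z \<le> x" using split[OF zA] top x by blast
    then have "y \<noteq> x" using arc_less[of z y] y by auto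
    moreover have "(y, C) \<notin> S"
    proof (cases "z = x")
      case True
      then have "y \<in> missed U F" using split[OF zA] top m y U by blast
      then show ?thesis using top by blast
    next
      case False
      then have "(z, A) \<in> S" using split[OF zA] by blast
      then show ?thesis using rigid_onD(4)[OF S] y out by blast
    qed
    ultimately show ?thesis by blast
  qed
  show "card (B - A) \<le> 1" if zB: "(z, B) \<in> S \<union> {x} \<times> F" for B
    using split[OF zA] split[OF zB] rigid_onD(5)[OF S] F(2) by blast
qed

text \<open>The pairs at the largest vertex number at most one more than the targets that they miss,
  and exactly that vertex and those targets are removed.\<close>

lemma card_rigid_on_le:
  assumes "W \<subseteq> V" "rigid_on Z W S" shows "card S \<le> card W"
  using assms
proof (induction "card W" arbitrary: W S rule: less_induct)
  case less
  have W: "finite W" using finite_subset[OF less.prems(1) finV] .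
  show ?case
  proof (cases "W = {}")
    case True then have "S = {}" using less.prems(2) by (auto simp: rigid_on_def)
    then show ?thesis by simp
  next
    case False
    define x where "x = Max W"
    have x: "x \<in> W" "\<forall>w\<in>W. w \<le> x" using W False by (auto simp: x_def)
    define F where "F = {A. (x, A) \<in> S}"
    define U where "U = E `` {x} \<inter> W"
    note sp = rigid_on_split[OF x less.prems(2), folded F_def U_def]
    have U: "finite U" "card U \<le> 2" using card_mono[OF finite_out, of U x] finite_out[of x] outdeg[of x] by (auto simp: U_def)
    have m: "missed U F \<subseteq> W - {x}" by (auto simp: missed_def U_def)
    have cW: "card (W - {x} - missed U F) = card W - 1 - card (missed U F)" "card (missed U F) \<le> card W - 1"
      using card_Diff_subset[OF finite_subset[OF m] m] card_mono[OF _ m] W x(1) by simp_all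
    have c0: "card W \<noteq> 0" using W False by simp
    have "card (S - {x} \<times> F) \<le> card (W - {x} - missed U F)"
      by (rule less.hyps[OF _ _ sp(4)]) (use cW c0 less.prems(1) in auto)
    moreover have "card S \<le> card (S - {x} \<times> F) + card ({x} \<times> F)"
      using card_Un_le[of "S - {x} \<times> F" "{x} \<times> F"] sp(5) by simp
    moreover have "card ({x} \<times> F) = card F" by (simp add: card_cartesian_product)
    ultimately show ?thesis using card_fan_le[OF U sp(1,2)] cW c0 by linarith
  qed
qed

text \<open>For a set of maximal size the bounds at the largest vertex and on the rest must both be
  attained; conversely \<open>rigid_on_join\<close> puts the pieces together. \<open>F\<close> can
  be recovered as the family of shapes at \<open>x\<close>, so nothing is counted twice.\<close>

lemma num_step:
  assumes W: "W \<subseteq> V" and x: "x \<in> W" "\<forall>w\<in>W. w \<le> x" and U: "U = E `` {x} \<inter> W"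
  shows "num Z W = (\<Sum>F\<in>{F \<in> fans U. missed U F \<subseteq> Z}. num Z (W - {x} - missed U F))"
proof -
  let ?G = "{F \<in> fans U. missed U F \<subseteq> Z}"
  have fW: "finite W" using finite_subset[OF W finV] .
  have fU: "finite U" "card U \<le> 2" using card_mono[OF finite_out, of U x] finite_out[of x] outdeg[of x] by (auto simp: U)
  have fG: "finite ?G" by (rule finite_subset[of _ "Pow (Pow U)"]) (use fU in \<open>auto simp: fans_def\<close>)
  have cW: "card W = Suc (card (missed U F) + card (W - {x} - missed U F))" for F
  proof -
    have m: "missed U F \<subseteq> W - {x}" by (auto simp: missed_def U)
    have "card (W - {x}) = card (missed U F) + card (W - {x} - missed U F)"
      using card_Un_disjoint[of "missed U F" "W - {x} - missed U F"] m fW finite_subset[OF m]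
      by (simp add: Un_absorb1)
    then show ?thesis using card.remove[OF fW x(1)] by simp
  qed
  have sub: "W - {x} - missed U F \<subseteq> V" for F using W by blast
  have top: "(x, A) \<notin> S" if "S \<in> maximal_rigid Z (W - {x} - missed U F)" for S F A
    using that unfolding maximal_rigid_def rigid_on_def by blast
  have eq: "maximal_rigid Z W = (\<Union>F\<in>?G. (\<lambda>S. S \<union> {x} \<times> F) ` maximal_rigid Z (W - {x} - missed U F))"
  proof (intro equalityI subsetI)
    fix S assume "S \<in> maximal_rigid Z W"
    then have S: "rigid_on Z W S" "card S = card W" by (auto simp: maximal_rigid_def)
    define F where "F = {A. (x, A) \<in> S}"
    note sp = rigid_on_split[OF x S(1), folded F_def U]
    have le: "card (S - {x} \<times> F) \<le> card (W - {x} - missed U F)" by (rule card_rigid_on_le[OF sub sp(4)])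
    have "finite S" using rigid_on_finite(2)[OF W S(1)] .
    then have "card S = card (S - {x} \<times> F) + card ({x} \<times> F)"
      using card_Un_disjoint[of "S - {x} \<times> F" "{x} \<times> F"] sp(5) finite_subset[of "{x} \<times> F" S] by auto
    moreover have "card ({x} \<times> F) = card F" by (simp add: card_cartesian_product)
    ultimately have c: "card F = Suc (card (missed U F))" "card (S - {x} \<times> F) = card (W - {x} - missed U F)"
      using card_fan_le[OF fU sp(1,2)] le cW[of F] S(2) by linarith+
    then have "F \<in> ?G" using sp by (auto simp: fans_def)
    moreover have "S - {x} \<times> F \<in> maximal_rigid Z (W - {x} - missed U F)" using sp(4) c(2) by (simp add: maximal_rigid_def)
    ultimately show "S \<in> (\<Union>F\<in>?G. (\<lambda>S. S \<union> {x} \<times> F) ` maximal_rigid Z (W - {x} - missed U F))" using sp(5) by blast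
  next
    fix S assume "S \<in> (\<Union>F\<in>?G. (\<lambda>S. S \<union> {x} \<times> F) ` maximal_rigid Z (W - {x} - missed U F))"
    then obtain F S' where FS: "F \<in> ?G" "S' \<in> maximal_rigid Z (W - {x} - missed U F)" "S = S' \<union> {x} \<times> F" by blast
    have F: "F \<subseteq> Pow U" "\<forall>A\<in>F. \<forall>B\<in>F. card (B - A) \<le> 1" "missed U F \<subseteq> Z" "card F = Suc (card (missed U F))"
      using FS(1) by (auto simp: fans_def)
    have S': "rigid_on Z (W - {x} - missed U F) S'" "card S' = card (W - {x} - missed U F)"
      using FS(2) by (auto simp: maximal_rigid_def)
    have "rigid_on Z W S" unfolding FS(3) by (rule rigid_on_join[OF x U F(1-3) S'(1)])
    moreover have "card S = card S' + card ({x} \<times> F)"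
      unfolding FS(3) using top[OF FS(2)] rigid_on_finite(2)[OF sub S'(1)] finite_subset[OF F(1)] fU(1)
      by (intro card_Un_disjoint) auto
    ultimately show "S \<in> maximal_rigid Z W" using F(4) S'(2) cW[of F] by (simp add: maximal_rigid_def card_cartesian_product)
  qed
  have rec: "{A. (x, A) \<in> S} = F" if "S \<in> (\<lambda>S. S \<union> {x} \<times> F) ` maximal_rigid Z (W - {x} - missed U F)" for S F
    using that top by auto
  have "num Z W = (\<Sum>F\<in>?G. card ((\<lambda>S. S \<union> {x} \<times> F) ` maximal_rigid Z (W - {x} - missed U F)))"
    unfolding num_def eq
  proof (rule card_UN_disjoint[OF fG])
    show "\<forall>F\<in>?G. finite ((\<lambda>S. S \<union> {x} \<times> F) ` maximal_rigid Z (W - {x} - missed U F))"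
      using rigid_on_finite(1)[OF sub] by (auto simp: maximal_rigid_def)
    show "\<forall>F\<in>?G. \<forall>F'\<in>?G. F \<noteq> F' \<longrightarrow> (\<lambda>S. S \<union> {x} \<times> F) ` maximal_rigid Z (W - {x} - missed U F) \<inter>
        (\<lambda>S. S \<union> {x} \<times> F') ` maximal_rigid Z (W - {x} - missed U F') = {}"
      using rec by blast
  qed
  also have "\<dots> = (\<Sum>F\<in>?G. num Z (W - {x} - missed U F))"
    unfolding num_def
  proof (rule sum.cong[OF refl], rule card_image, rule inj_onI)
    fix F S S' assume S: "S \<in> maximal_rigid Z (W - {x} - missed U F)" "S' \<in> maximal_rigid Z (W - {x} - missed U F)"
      and eq: "S \<union> {x} \<times> F = S' \<union> {x} \<times> F"
    have "S - {x} \<times> UNIV = S" "S' - {x} \<times> UNIV = S'" using top[OF S(1)] top[OF S(2)] by auto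
    moreover have "S - {x} \<times> UNIV = S' - {x} \<times> UNIV" using eq by blast
    ultimately show "S = S'" by metis
  qed
  finally show ?thesis .
qed

lemma num_empty: "num Z {} = 1"
proof -
  have "maximal_rigid Z {} = {{}}" by (auto simp: maximal_rigid_def rigid_on_def)
  then show ?thesis by (simp add: num_def)
qed

text \<open>Without targets the only family at \<open>x\<close> consists of the simple projective
  module.\<close>

lemma num_isolated:
  assumes "insert x W \<subseteq> V" "\<forall>w\<in>W. w < x" "E `` {x} \<inter> W = {}"
  shows "num Z (insert x W) = num Z W"
proof -
  have U: "{} = E `` {x} \<inter> insert x W" using assms(3) by auto
  have "{F \<in> {{{}}}. missed {} F \<subseteq> Z} = {{{}}}" by (auto simp: missed_def)
  moreover have "insert x W - {x} = W" using assms(2) by auto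
  ultimately show ?thesis
    using num_step[OF assms(1) _ _ U, of Z] assms(2) by (auto simp: fans_empty missed_def intro: less_imp_le)
qed

text \<open>At \<open>x\<close> there is either P_x alone or P_x together with the simple module
  S_x; the second choice misses \<open>y\<close> and so removes it.\<close>

lemma num_single:
  assumes "insert x (insert y W) \<subseteq> V" "\<forall>w\<in>insert y W. w < x" "E `` {x} \<inter> insert y W = {y}" "y \<notin> W"
  shows "num Z (insert x (insert y W)) = num Z (insert y W) + (if y \<in> Z then num Z W else 0)"
proof -
  have U: "{y} = E `` {x} \<inter> insert x (insert y W)" using assms(3) by auto
  have m: "missed {y} {{y}} = {}" "missed {y} {{}, {y}} = {y}" by (auto simp: missed_def)
  have d: "insert x (insert y W) - {x} = insert y W" "insert y W - {y} = W" using assms(2,4) by auto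
  have G: "{F \<in> fans {y}. missed {y} F \<subseteq> Z} = (if y \<in> Z then {{{y}}, {{}, {y}}} else {{{y}}})"
    unfolding fans_single using m by auto
  have "num Z (insert x (insert y W)) =
      (\<Sum>F\<in>{F \<in> fans {y}. missed {y} F \<subseteq> Z}. num Z (insert x (insert y W) - {x} - missed {y} F))"
    by (rule num_step[OF assms(1) _ _ U]) (use assms(2) in \<open>auto intro: less_imp_le\<close>)
  then show ?thesis unfolding G d(1) using m d(2) by auto
qed

text \<open>The five families of \<open>fans_pair\<close> leave the vertex sets {a, b}, {a}, {b} and
  twice the empty set.\<close>

lemma num_pair:
  assumes "{x, a, b} \<subseteq> V" "a < x" "b < x" "E `` {x} = {a, b}" "a \<noteq> b" "a \<in> Z" "b \<in> Z"
  shows "num Z {x, a, b} = num Z {a, b} + num Z {a} + num Z {b} + 2"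
proof -
  have U: "{a, b} = E `` {x} \<inter> {x, a, b}" using assms(4) by auto
  have d: "{x, a, b} - {x} = {a, b}" using assms(2,3) by auto
  have G: "{F \<in> fans {a, b}. missed {a, b} F \<subseteq> Z} = fans {a, b}" using assms(6,7) by (auto simp: missed_def)
  have "num Z {x, a, b} = (\<Sum>F\<in>{F \<in> fans {a, b}. missed {a, b} F \<subseteq> Z}. num Z ({x, a, b} - {x} - missed {a, b} F))"
    by (rule num_step[OF assms(1) _ _ U]) (use assms(2,3) in auto)
  also have "\<dots> = (\<Sum>F\<in>fans {a, b}. num Z ({a, b} - missed {a, b} F))" unfolding G d ..
  also have "\<dots> = num Z {a, b} + num Z {a} + num Z {b} + 2"
  proof -
    \<comment> \<open>The five families are told apart by their members, so the sum over them has
      five terms.\<close>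
    define g where "g F = ({} \<in> F, {a} \<in> F, {b} \<in> F, {a, b} \<in> F)" for F
    have g: "g F \<noteq> g F' ==> F \<noteq> F'" for F F' by blast
    have n: "{{a, b}} \<noteq> {{a, b}, {a}}" "{{a, b}} \<noteq> {{a, b}, {b}}" "{{a, b}} \<noteq> {{a, b}, {a}, {b}}" "{{a, b}} \<noteq> {{}, {a}, {b}}"
      "{{a, b}, {a}} \<noteq> {{a, b}, {b}}" "{{a, b}, {a}} \<noteq> {{a, b}, {a}, {b}}" "{{a, b}, {a}} \<noteq> {{}, {a}, {b}}"
      "{{a, b}, {b}} \<noteq> {{a, b}, {a}, {b}}" "{{a, b}, {b}} \<noteq> {{}, {a}, {b}}" "{{a, b}, {a}, {b}} \<noteq> {{}, {a}, {b}}"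
      by (rule g; use assms(5) in \<open>simp add: g_def\<close>)+
    show ?thesis
      unfolding fans_pair[OF assms(5)]
      using n by (simp add: missed_pair[OF assms(5)] card_pair_diff[OF assms(5)] num_empty)
  qed
  finally show ?thesis .
qed

lemma num_support_empty: "num_support {} = 1"
  by (simp add: num_support_def num_empty)

lemma num_support_isolated:
  assumes W: "insert x W \<subseteq> V" "\<forall>w\<in>W. w < x" "E `` {x} \<inter> W = {}"
  shows "num_support (insert x W) = 2 * num_support W"
proof -
  have f: "finite W" "x \<notin> W" using finite_subset[OF W(1) finV] W(2) by auto
  have "num UNIV (insert x U) = num UNIV U" if "U \<in> Pow W" for U
    by (rule num_isolated) (use that W in auto)
  then show ?thesis unfolding num_support_def sum_Pow_insert[OF f] by simp
qed

text \<open>Subsets are sorted by whether they contain \<open>x\<close> and \<open>y\<close>. With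
  \<open>x\<close> but without \<open>y\<close>, the vertex \<open>x\<close> is isolated; with both,
  \<open>num_single\<close> applies. The subsets with \<open>x\<close> thus contribute
  \<open>num_support (insert y W) + num_support W\<close>.\<close>

lemma num_support_single:
  assumes W: "insert x (insert y W) \<subseteq> V" "\<forall>w\<in>insert y W. w < x" "E `` {x} \<inter> insert y W = {y}" "y \<notin> W"
  shows "num_support (insert x (insert y W)) = 2 * num_support (insert y W) + num_support W"
proof -
  have f: "finite (insert y W)" "x \<notin> insert y W" "finite W" using finite_subset[OF W(1) finV] W(2) by auto
  have 1: "num UNIV (insert x U) = num UNIV U" if "U \<in> Pow W" for U
    by (rule num_isolated) (use that W in auto)
  have 2: "num UNIV (insert x (insert y U)) = num UNIV (insert y U) + num UNIV U" if U: "U \<in> Pow W" for U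
    using num_single[of x y U UNIV] U W by auto
  have "(\<Sum>U\<in>Pow (insert y W). num UNIV (insert x U)) = num_support (insert y W) + num_support W"
    unfolding num_support_def sum_Pow_insert[OF f(3) W(4)] by (simp add: 1 2 sum.distrib)
  then show ?thesis unfolding num_support_def sum_Pow_insert[OF f(1,2)] by simp
qed

text \<open>\<open>S\<close> stays rigid over its own support, which therefore has at least
  \<open>card S = card W\<close> vertices. So \<open>W\<close> is determined by \<open>S\<close>,
  and summing over all \<open>W\<close> counts every support tau-tilting module once.\<close>

lemma rigid_on_support:
  assumes W: "W \<subseteq> V" and S: "S \<in> maximal_rigid Z W"
  shows "(\<Union>(x, A)\<in>S. insert x A) = W" (is "?U = W")
proof -
  have r: "rigid_on Z W S" "card S = card W" using S by (auto simp: maximal_rigid_def)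
  have sub: "?U \<subseteq> W" using rigid_onD(1,2)[OF r(1)] by blast
  have "rigid_on Z ?U S"
  proof (rule rigid_onI)
    fix x A assume xA: "(x, A) \<in> S"
    then have "insert x A \<subseteq> ?U" by blast
    note d = this rigid_onD[OF r(1) xA]
    show "x \<in> ?U" "A \<subseteq> E `` {x} \<inter> ?U" using d(1,3) by blast+
    show "E `` {x} \<inter> ?U - A \<subseteq> Z" using d(4) sub by blast
    show "(y, C) \<notin> S" if "y \<in> E `` {x} \<inter> ?U - A" for y C using d(5)[of y C] that sub by blast
    show "card (B - A) \<le> 1" if "(x, B) \<in> S" for B using d(6) that .
  qed
  then have "card S \<le> card ?U" using card_rigid_on_le sub W by (meson order_trans)
  then show ?thesis using card_subset_eq[OF finite_subset[OF W finV] sub] card_mono[OF finite_subset[OF W finV] sub] r(2) by linarith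
qed

end

section \<open>From modules to the counting numbers\<close>

context radsq
begin

text \<open>Links the condition on modules, stated in the arrows of the subquiver, to
  \<open>rigid_on\<close>, which keeps the arrows of the whole quiver and intersects with
  \<open>W\<close>; the second form suits the recursion.\<close>

lemma maximal_rigid_iff:
  assumes W: "W \<subseteq> V"
  shows "S \<in> maximal_rigid Z W \<longleftrightarrow> S \<subseteq> Ind \<and> S \<subseteq> sub_Ind W \<and> rigid_set (subarcs W) S \<and> card S = card W \<and>
    (\<forall>(x, A)\<in>S. E `` {x} \<inter> W - A \<subseteq> Z)"
proof
  have out: "subarcs W `` {x} = E `` {x} \<inter> W" if "x \<in> W" for x using that by (auto simp: subarcs_def)
  {
    assume "S \<in> maximal_rigid Z W"
    then have S: "rigid_on Z W S" "card S = card W" by (auto simp: maximal_rigid_def)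
    have Ind: "S \<subseteq> Ind" using rigid_onD(1,2)[OF S(1)] W unfolding Ind_def by blast
    have sub: "S \<subseteq> sub_Ind W" using rigid_onD(1,2)[OF S(1)] out unfolding sub_Ind_def by blast
    have "rigid_set (subarcs W) S"
      unfolding rigid_set_def
    proof (intro ballI, clarify, intro conjI ballI allI impI)
      fix x A assume xA: "(x, A) \<in> S"
      note d = rigid_onD[OF S(1) xA]
      show "(y, C) \<notin> S" if "y \<in> subarcs W `` {x} - A" for y C using d(4) that unfolding out[OF d(1)] .
      show "card (B - A) \<le> 1" if "(x, B) \<in> S" for B using d(5)[OF that] .
    qed
    then show "S \<subseteq> Ind \<and> S \<subseteq> sub_Ind W \<and> rigid_set (subarcs W) S \<and> card S = card W \<and> (\<forall>(x, A)\<in>S. E `` {x} \<inter> W - A \<subseteq> Z)"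
      using Ind sub S(2) rigid_onD(3)[OF S(1)] by blast
  }
  assume a: "S \<subseteq> Ind \<and> S \<subseteq> sub_Ind W \<and> rigid_set (subarcs W) S \<and> card S = card W \<and> (\<forall>(x, A)\<in>S. E `` {x} \<inter> W - A \<subseteq> Z)"
  have "rigid_on Z W S"
  proof (rule rigid_onI)
    fix x A assume xA: "(x, A) \<in> S"
    then have x: "x \<in> W" "A \<subseteq> subarcs W `` {x}" using a by (auto simp: sub_Ind_def)
    have r: "(\<forall>y\<in>subarcs W `` {x} - A. \<forall>C. (y, C) \<notin> S) \<and> (\<forall>B. (x, B) \<in> S \<longrightarrow> card (B - A) \<le> 1)"
      using a xA unfolding rigid_set_def by blast
    show "x \<in> W" by (rule x(1))
    show "A \<subseteq> E `` {x} \<inter> W" using x(2) unfolding out[OF x(1)] .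
    show "E `` {x} \<inter> W - A \<subseteq> Z" using a xA by blast
    show "(y, C) \<notin> S" if "y \<in> E `` {x} \<inter> W - A" for y C using r that unfolding out[OF x(1)] by blast
    show "card (B - A) \<le> 1" if "(x, B) \<in> S" for B using r that by blast
  qed
  then show "S \<in> maximal_rigid Z W" using a by (simp add: maximal_rigid_def)
qed

lemma sub_V: "sub_Ind V = Ind" "subarcs V = E" "E `` {x} \<inter> V = E `` {x}"
  using arcs by (auto simp: sub_Ind_def subarcs_def Ind_def)

lemma card_tilt_num: "card (tilt L) = num {y. E `` {y} = {}} V"
proof -
  have "zset E S \<longleftrightarrow> (\<forall>(x, A)\<in>S. E `` {x} - A \<subseteq> {y. E `` {y} = {}})" for S unfolding zset_def by blast
  then have "S \<in> maximal_rigid {y. E `` {y} = {}} V \<longleftrightarrow> S \<subseteq> Ind \<and> zset E S \<and> rigid_set E S \<and> card S = card V" for S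
    using maximal_rigid_iff[OF order_refl, of S "{y. E `` {y} = {}}"] unfolding sub_V by blast
  then have "{S. S \<subseteq> Ind \<and> zset E S \<and> rigid_set E S \<and> card S = card V} = maximal_rigid {y. E `` {y} = {}} V" by blast
  then show ?thesis unfolding card_tilt num_def by simp
qed

lemma card_tau_tilt_num: "card (tau_tilt L) = num UNIV V"
proof -
  have "{S. S \<subseteq> Ind \<and> rigid_set E S \<and> card S = card V} = maximal_rigid UNIV V"
    using maximal_rigid_iff[of V] by (auto simp: sub_V)
  then show ?thesis unfolding card_tau_tilt num_def by simp
qed

lemma card_stau_tilt_num: "card (stau_tilt L) = num_support V"
proof -
  have eq: "S \<subseteq> Ind \<and> S \<subseteq> sub_Ind W \<and> rigid_set (subarcs W) S \<and> card S = card W \<longleftrightarrow> S \<in> maximal_rigid UNIV W" if "W \<subseteq> V" for S W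
    using maximal_rigid_iff[OF that, of S UNIV] by auto
  have "{S. S \<subseteq> Ind \<and> (\<exists>W\<subseteq>V. S \<subseteq> sub_Ind W \<and> rigid_set (subarcs W) S \<and> card S = card W)} = (\<Union>W\<in>Pow V. maximal_rigid UNIV W)"
    using eq by blast
  moreover have "card (\<Union>W\<in>Pow V. maximal_rigid UNIV W) = (\<Sum>W\<in>Pow V. card (maximal_rigid UNIV W))"
  proof (rule card_UN_disjoint)
    show "\<forall>W\<in>Pow V. finite (maximal_rigid UNIV W)" using rigid_on_finite(1) by (auto simp: maximal_rigid_def)
    show "\<forall>W\<in>Pow V. \<forall>W'\<in>Pow V. W \<noteq> W' \<longrightarrow> maximal_rigid UNIV W \<inter> maximal_rigid UNIV W' = {}"
    proof (intro ballI impI)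
      fix W W' assume W: "W \<in> Pow V" "W' \<in> Pow V" "W \<noteq> W'"
      have False if "S \<in> maximal_rigid UNIV W" "S \<in> maximal_rigid UNIV W'" for S
        using rigid_on_support[of W S UNIV] rigid_on_support[of W' S UNIV] that W by simp
      then show "maximal_rigid UNIV W \<inter> maximal_rigid UNIV W' = {}" by blast
    qed
  qed (use finV in simp)
  ultimately show ?thesis unfolding card_stau_tilt num_support_def num_def by simp
qed

end

section \<open>The linear quivers\<close>

definition A_arcs :: "nat => (nat \<times> nat) set" where
  "A_arcs n = {(i + 1, i) |i. 1 \<le> i \<and> i < n}"

definition D_arcs :: "nat => (nat \<times> nat) set" where
  "D_arcs n = {(i + 1, i) |i. 3 \<le> i \<and> i < n} \<union> {(3, 1), (3, 2)}"

lemma A_arcs_out: "A_arcs n `` {x} = (if 2 \<le> x \<and> x \<le> n then {x - 1} else {})"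
  by (auto simp: A_arcs_def image_iff)

lemma D_arcs_out: "D_arcs n `` {x} = (if x = 3 then {1, 2} else if 4 \<le> x \<and> x \<le> n then {x - 1} else {})"
  by (auto simp: D_arcs_def)

lemma quiver_A: "quiver {1..n} (A_arcs n)"
proof
  show "card (A_arcs n `` {x}) \<le> 2" for x by (simp add: A_arcs_out)
qed (auto simp: A_arcs_def)

lemma quiver_D:
  assumes "3 \<le> n" shows "quiver {1..n} (D_arcs n)"
proof
  show "card (D_arcs n `` {x}) \<le> 2" for x by (simp add: D_arcs_out)
qed (use assms in \<open>auto simp: D_arcs_def\<close>)

lemma radsq_A: "\<exists>cf. radsq {1..n} (A_arcs n) (A_radsq n :: 'k::field radsq_algebra) cf"
proof -
  interpret quiver "{1..n}" "A_arcs n" by (rule quiver_A)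
  interpret path_quiver "{1..n}" "A_arcs n" "path_algebra (A_quiver n) :: ('k, _) module"
    by unfold_locales (simp add: A_quiver_def A_arcs_def)
  show ?thesis using radsq_path_algebra unfolding A_radsq_def by blast
qed

lemma radsq_D:
  assumes "3 \<le> n" shows "\<exists>cf. radsq {1..n} (D_arcs n) (D_radsq n :: 'k::field radsq_algebra) cf"
proof -
  interpret quiver "{1..n}" "D_arcs n" by (rule quiver_D[OF assms])
  interpret path_quiver "{1..n}" "D_arcs n" "path_algebra (D_quiver n) :: ('k, _) module"
    by unfold_locales (simp add: D_quiver_def D_arcs_def)
  show ?thesis using radsq_path_algebra unfolding D_radsq_def by blast
qed

text \<open>\<open>p\<close> and \<open>q\<close> are roots of the characteristic polynomial, while
  \<open>c\<close> and \<open>d\<close> fit the first two values. The bound \<open>n\<close>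
  reflects that the recursions are available only for intervals inside the vertex set.\<close>

lemma linear_recurrence:
  fixes f :: "nat => real"
  assumes "p * p = a * p + b" "q * q = a * q + b" "f 0 = c + d" "1 \<le> n ==> f 1 = c * p + d * q"
    "\<And>m. Suc (Suc m) \<le> n ==> f (Suc (Suc m)) = a * f (Suc m) + b * f m"
  shows "m \<le> n ==> f m = c * p ^ m + d * q ^ m"
proof (induction m rule: induct_nat_012)
  case (ge2 m)
  have "f (Suc (Suc m)) = c * p ^ m * (a * p + b) + d * q ^ m * (a * q + b)"
    using ge2 assms(5)[of m] by (simp add: algebra_simps)
  then show ?case unfolding assms(1,2)[symmetric] by (simp add: mult.assoc)
qed (use assms(3,4) in auto)

lemma golden:
  fixes p q :: real
  defines "p \<equiv> (1 + sqrt 5) / 2" and "q \<equiv> (1 - sqrt 5) / 2"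
  shows "p * p = 1 * p + 1" "q * q = 1 * q + 1" "sqrt 5 * sqrt 5 = (5::real)"
    "p ^ m = (1 + sqrt 5) ^ m / 2 ^ m" "q ^ m = (1 - sqrt 5) ^ m / 2 ^ m"
  unfolding p_def q_def by (simp_all add: field_simps power_divide)

lemma silver:
  fixes p q :: real
  defines "p \<equiv> 1 + sqrt 2" and "q \<equiv> 1 - sqrt 2"
  shows "p * p = 2 * p + 1" "q * q = 2 * q + 1" "sqrt 2 * sqrt 2 = (2::real)"
  unfolding p_def q_def by (simp_all add: field_simps)

lemma interval_Suc: "{1..Suc m} = insert (Suc m) {1..m}"
  by auto

context quiver
begin

lemma num_chain:
  assumes "{1..Suc (Suc m)} \<subseteq> V" "E `` {Suc (Suc m)} = {Suc m}"
  shows "num Z {1..Suc (Suc m)} = num Z {1..Suc m} + (if Suc m \<in> Z then num Z {1..m} else 0)"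
    "num_support {1..Suc (Suc m)} = 2 * num_support {1..Suc m} + num_support {1..m}"
  using num_single[of "Suc (Suc m)" "Suc m" "{1..m}" Z] num_support_single[of "Suc (Suc m)" "Suc m" "{1..m}"] assms
  unfolding interval_Suc by auto

end

lemma A_numbers:
  fixes n :: nat
  defines "N \<equiv> quiver.num (A_arcs n)" and "G \<equiv> quiver.num_support (A_arcs n)"
  shows "m \<le> n ==> real (N UNIV {1..m}) = ((1 + sqrt 5) ^ (m + 1) - (1 - sqrt 5) ^ (m + 1)) / (sqrt 5 * 2 ^ (m + 1))"
    "m \<le> n ==> real (G {1..m}) = ((1 + sqrt 2) ^ (m + 1) - (1 - sqrt 2) ^ (m + 1)) / (2 * sqrt 2)"
    "2 \<le> m ==> m \<le> n ==> N {y. A_arcs n `` {y} = {}} {1..m} = 2"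
proof -
  interpret quiver "{1..n}" "A_arcs n" by (rule quiver_A)
  have base0: "N Z {1..0} = 1" "G {1..0} = 1" for Z by (simp_all add: N_def G_def num_empty num_support_empty)
  have base1: "N Z {1..Suc 0} = 1" "G {1..Suc 0} = 2" if "1 \<le> n" for Z
    using num_isolated[of 1 "{}" Z] num_support_isolated[of 1 "{}"] that
    by (simp_all add: N_def G_def num_empty num_support_empty)
  have chain: "N Z {1..Suc (Suc m)} = N Z {1..Suc m} + (if Suc m \<in> Z then N Z {1..m} else 0)"
    "G {1..Suc (Suc m)} = 2 * G {1..Suc m} + G {1..m}" if "Suc (Suc m) \<le> n" for Z m
    using num_chain(1)[of m Z] num_chain(2)[of m] that by (simp_all add: N_def G_def A_arcs_out)
  show "real (N UNIV {1..m}) = ((1 + sqrt 5) ^ (m + 1) - (1 - sqrt 5) ^ (m + 1)) / (sqrt 5 * 2 ^ (m + 1))" if "m \<le> n"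
  proof -
    define u v where "u = 1 + sqrt (5::real)" and "v = 1 - sqrt (5::real)"
    \<comment> \<open>Initial values 1 and 1: the Fibonacci numbers, with index shifted by
      one.\<close>
    have "real (N UNIV {1..m}) = (1 + sqrt 5) / (sqrt 5 * 2) * ((1 + sqrt 5) / 2) ^ m +
        - ((1 - sqrt 5) / (sqrt 5 * 2)) * ((1 - sqrt 5) / 2) ^ m"
    proof (rule linear_recurrence[OF golden(1,2) _ _ _ that])
      show "real (N UNIV {1..Suc (Suc m)}) = 1 * real (N UNIV {1..Suc m}) + 1 * real (N UNIV {1..m})" if "Suc (Suc m) \<le> n" for m
        using chain(1)[OF that, of UNIV] by simp
    qed (use base0(1)[of UNIV] base1(1)[of UNIV] golden(3) in \<open>simp_all add: field_simps\<close>)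
    then show ?thesis unfolding u_def[symmetric] v_def[symmetric] by (simp add: power_divide add_divide_distrib diff_divide_distrib ac_simps)
  qed
  show "real (G {1..m}) = ((1 + sqrt 2) ^ (m + 1) - (1 - sqrt 2) ^ (m + 1)) / (2 * sqrt 2)" if "m \<le> n"
  proof -
    define u v where "u = 1 + sqrt (2::real)" and "v = 1 - sqrt (2::real)"
    \<comment> \<open>Initial values 1 and 2: the Pell numbers, with index shifted by one.\<close>
    have "real (G {1..m}) = (1 + sqrt 2) / (2 * sqrt 2) * (1 + sqrt 2) ^ m +
        - ((1 - sqrt 2) / (2 * sqrt 2)) * (1 - sqrt 2) ^ m"
    proof (rule linear_recurrence[OF silver(1,2) _ _ _ that])
      show "real (G {1..Suc (Suc m)}) = 2 * real (G {1..Suc m}) + 1 * real (G {1..m})" if "Suc (Suc m) \<le> n" for m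
        using chain(2)[OF that] by simp
    qed (use base0(2) base1(2) silver(3) in \<open>simp_all add: field_simps\<close>)
    then show ?thesis unfolding u_def[symmetric] v_def[symmetric] by (simp add: add_divide_distrib diff_divide_distrib ac_simps)
  qed
  \<comment> \<open>Among the targets only 1 is a sink, so the second term of the recursion is
    present only in the passage from one vertex to two.\<close>
  show "N {y. A_arcs n `` {y} = {}} {1..m} = 2" if "2 \<le> m" "m \<le> n"
    using that
  proof (induction m rule: dec_induct)
    case base then show ?case using chain(1)[of 0] base1(1) base0(1) by (simp add: A_arcs_out numeral_2_eq_2)
  next
    case (step m)
    then obtain l where l: "m = Suc l" "1 \<le> l" by (cases m) auto
    then show ?case using chain(1)[of l] step by (simp add: A_arcs_out)
  qed
qed

text \<open>The chain recursion sets in at vertex 4. Hence the sequences start with the intervals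
  {1, 2} and {1, 2, 3}, which explains the shift by two; their first values are 1, 5 for tau-tilting
  and 4, 14 for support tau-tilting modules.\<close>

lemma D_numbers:
  fixes n :: nat
  assumes n: "3 \<le> n"
  defines "N \<equiv> quiver.num (D_arcs n)" and "G \<equiv> quiver.num_support (D_arcs n)"
  shows "m + 2 \<le> n ==> real (N UNIV {1..m + 2}) =
      ((2 * sqrt 5 - 1) * (1 + sqrt 5) ^ (m + 1) + (2 * sqrt 5 + 1) * (1 - sqrt 5) ^ (m + 1)) / (sqrt 5 * 2 ^ (m + 1))"
    "m + 2 \<le> n ==> real (G {1..m + 2}) =
      ((3 * sqrt 2 - 1) * (1 + sqrt 2) ^ (m + 1) + (3 * sqrt 2 + 1) * (1 - sqrt 2) ^ (m + 1)) / sqrt 2"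
    "3 \<le> m ==> m \<le> n ==> N {y. D_arcs n `` {y} = {}} {1..m} = 5"
proof -
  interpret quiver "{1..n}" "D_arcs n" by (rule quiver_D[OF n])
  have i: "{1..Suc (Suc 0)} = {2, 1}" "{1..Suc (Suc (Suc 0))} = {3, 1, 2}" by auto
  have single: "N Z {1} = 1" "N Z {2} = 1" for Z
    using num_isolated[of 1 "{}" Z] num_isolated[of 2 "{}" Z] n by (simp_all add: N_def num_empty)
  have two: "N Z {1..Suc (Suc 0)} = 1" for Z
    unfolding i using num_isolated[of 2 "{1}" Z] n single(1)[of Z] by (simp add: N_def D_arcs_out)
  have three: "N Z {1..Suc (Suc (Suc 0))} = 5" if "1 \<in> Z" "2 \<in> Z" for Z
    using num_pair[of 3 1 2 Z] that n single[of Z] two[of Z] unfolding i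
    by (simp add: N_def D_arcs_out insert_commute)
  have Gtwo: "G {1..Suc (Suc 0)} = 4"
    unfolding i using num_support_isolated[of 2 "{1}"] num_support_isolated[of 1 "{}"] n
    by (simp add: G_def D_arcs_out num_support_empty)
  have Gthree: "G {1..Suc (Suc (Suc 0))} = 14"
  proof -
    have P: "Pow {1, 2::nat} = {{}, {1}, {2}, {1, 2}}" by auto
    have "N UNIV {3} = 1" using num_isolated[of 3 "{}" UNIV] n by (simp add: N_def num_empty)
    moreover have "N UNIV {3, 1} = 2"
      using num_single[of 3 1 "{}" UNIV] n single(1)[of UNIV] by (simp add: N_def D_arcs_out num_empty)
    moreover have "N UNIV {3, 2} = 2"
      using num_single[of 3 2 "{}" UNIV] n single(2)[of UNIV] by (simp add: N_def D_arcs_out num_empty)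
    moreover have "N UNIV {3, 1, 2} = 5" using three[of UNIV] unfolding i by simp
    \<comment> \<open>The sum 1 + 2 + 2 + 5 over the supports that contain 3.\<close>
    ultimately have "(\<Sum>U\<in>Pow {1, 2}. N UNIV (insert 3 U)) = 10" unfolding P by (simp add: doubleton_eq_iff)
    moreover have "G {3, 1, 2} = G {1, 2} + (\<Sum>U\<in>Pow {1, 2}. N UNIV (insert 3 U))"
      unfolding G_def N_def num_support_def by (rule sum_Pow_insert) auto
    ultimately show ?thesis using Gtwo unfolding i by (simp add: insert_commute)
  qed
  have chain: "N Z {1..Suc (Suc m)} = N Z {1..Suc m} + (if Suc m \<in> Z then N Z {1..m} else 0)"
    "G {1..Suc (Suc m)} = 2 * G {1..Suc m} + G {1..m}" if "2 \<le> m" "Suc (Suc m) \<le> n" for Z m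
    using num_chain(1)[of m Z] num_chain(2)[of m] that by (simp_all add: N_def G_def D_arcs_out)
  show "real (N UNIV {1..m + 2}) =
      ((2 * sqrt 5 - 1) * (1 + sqrt 5) ^ (m + 1) + (2 * sqrt 5 + 1) * (1 - sqrt 5) ^ (m + 1)) / (sqrt 5 * 2 ^ (m + 1))"
    if "m + 2 \<le> n"
  proof -
    define u v where "u = 1 + sqrt (5::real)" and "v = 1 - sqrt (5::real)"
    have "real (N UNIV {1..m + 2}) = (2 * sqrt 5 - 1) * (1 + sqrt 5) / (sqrt 5 * 2) * ((1 + sqrt 5) / 2) ^ m +
        (2 * sqrt 5 + 1) * (1 - sqrt 5) / (sqrt 5 * 2) * ((1 - sqrt 5) / 2) ^ m"
    proof (rule linear_recurrence[OF golden(1,2), of _ _ _ "n - 2"])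
      show "real (N UNIV {1..Suc (Suc m) + 2}) = 1 * real (N UNIV {1..Suc m + 2}) + 1 * real (N UNIV {1..m + 2})"
        if "Suc (Suc m) \<le> n - 2" for m
        using chain(1)[of "m + 2" UNIV] that by simp
    qed (use that two[of UNIV] three[of UNIV] golden(3) in \<open>simp_all add: field_simps\<close>)
    then show ?thesis unfolding u_def[symmetric] v_def[symmetric] by (simp add: power_divide add_divide_distrib ac_simps)
  qed
  show "real (G {1..m + 2}) =
      ((3 * sqrt 2 - 1) * (1 + sqrt 2) ^ (m + 1) + (3 * sqrt 2 + 1) * (1 - sqrt 2) ^ (m + 1)) / sqrt 2"
    if "m + 2 \<le> n"
  proof -
    have "real (G {1..m + 2}) = (3 * sqrt 2 - 1) * (1 + sqrt 2) / sqrt 2 * (1 + sqrt 2) ^ m +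
        (3 * sqrt 2 + 1) * (1 - sqrt 2) / sqrt 2 * (1 - sqrt 2) ^ m"
    proof (rule linear_recurrence[OF silver(1,2), of _ _ _ "n - 2"])
      show "real (G {1..Suc (Suc m) + 2}) = 2 * real (G {1..Suc m + 2}) + 1 * real (G {1..m + 2})"
        if "Suc (Suc m) \<le> n - 2" for m
        using chain(2)[of "m + 2"] that by simp
    qed (use that Gtwo Gthree silver(3) in \<open>simp_all add: field_simps\<close>)
    then show ?thesis by (simp add: add_divide_distrib)
  qed
  \<comment> \<open>Both targets of 3 are sinks, so all five families are allowed there. From vertex
    4 on the only target is not a sink and the number does not change.\<close>
  show "N {y. D_arcs n `` {y} = {}} {1..m} = 5" if "3 \<le> m" "m \<le> n"
    using that
  proof (induction m rule: dec_induct)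
    case base then show ?case using three[of "{y. D_arcs n `` {y} = {}}"] by (simp add: D_arcs_out numeral_3_eq_3)
  next
    case (step m)
    then obtain l where l: "m = Suc l" "2 \<le> l" by (cases m) auto
    then show ?case using chain(1)[of l] step by (simp add: D_arcs_out)
  qed
qed

theorem corollary2p13:
  shows
    "(\<forall>n\<ge>2. card (tilt (A_radsq n :: 'k::alg_closed_field radsq_algebra)) = 2) \<and>
     (\<forall>n\<ge>1. real (card (tau_tilt (A_radsq n :: 'k radsq_algebra))) =
        ((1 + sqrt 5) ^ (n + 1) - (1 - sqrt 5) ^ (n + 1)) / (sqrt 5 * 2 ^ (n + 1))) \<and>
     (\<forall>n\<ge>1. real (card (stau_tilt (A_radsq n :: 'k radsq_algebra))) =
        ((1 + sqrt 2) ^ (n + 1) - (1 - sqrt 2) ^ (n + 1)) / (2 * sqrt 2)) \<and>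
     (\<forall>n\<ge>4. card (tilt (D_radsq n :: 'k radsq_algebra)) = 5) \<and>
     (\<forall>n\<ge>4. real (card (tau_tilt (D_radsq n :: 'k radsq_algebra))) =
        ((2 * sqrt 5 - 1) * (1 + sqrt 5) ^ (n - 1) + (2 * sqrt 5 + 1) * (1 - sqrt 5) ^ (n - 1))
          / (sqrt 5 * 2 ^ (n - 1))) \<and>
     (\<forall>n\<ge>4. real (card (stau_tilt (D_radsq n :: 'k radsq_algebra))) =
        ((3 * sqrt 2 - 1) * (1 + sqrt 2) ^ (n - 1) + (3 * sqrt 2 + 1) * (1 - sqrt 2) ^ (n - 1))
          / sqrt 2)"
proof -
  have A: "card (tilt (A_radsq n :: 'k radsq_algebra)) = quiver.num (A_arcs n) {y. A_arcs n `` {y} = {}} {1..n}"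
    "card (tau_tilt (A_radsq n :: 'k radsq_algebra)) = quiver.num (A_arcs n) UNIV {1..n}"
    "card (stau_tilt (A_radsq n :: 'k radsq_algebra)) = quiver.num_support (A_arcs n) {1..n}" for n
  proof -
    obtain cf where "radsq {1..n} (A_arcs n) (A_radsq n :: 'k radsq_algebra) cf" using radsq_A by blast
    then interpret radsq "{1..n}" "A_arcs n" "A_radsq n :: 'k radsq_algebra" cf .
    show "card (tilt (A_radsq n :: 'k radsq_algebra)) = num {y. A_arcs n `` {y} = {}} {1..n}"
      "card (tau_tilt (A_radsq n :: 'k radsq_algebra)) = num UNIV {1..n}"
      "card (stau_tilt (A_radsq n :: 'k radsq_algebra)) = num_support {1..n}"
      by (fact card_tilt_num card_tau_tilt_num card_stau_tilt_num)+
  qed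
  have D: "card (tilt (D_radsq n :: 'k radsq_algebra)) = quiver.num (D_arcs n) {y. D_arcs n `` {y} = {}} {1..n}"
    "card (tau_tilt (D_radsq n :: 'k radsq_algebra)) = quiver.num (D_arcs n) UNIV {1..n}"
    "card (stau_tilt (D_radsq n :: 'k radsq_algebra)) = quiver.num_support (D_arcs n) {1..n}" if n: "3 \<le> n" for n
  proof -
    obtain cf where "radsq {1..n} (D_arcs n) (D_radsq n :: 'k radsq_algebra) cf" using radsq_D[OF n] by blast
    then interpret radsq "{1..n}" "D_arcs n" "D_radsq n :: 'k radsq_algebra" cf .
    show "card (tilt (D_radsq n :: 'k radsq_algebra)) = num {y. D_arcs n `` {y} = {}} {1..n}"
      "card (tau_tilt (D_radsq n :: 'k radsq_algebra)) = num UNIV {1..n}"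
      "card (stau_tilt (D_radsq n :: 'k radsq_algebra)) = num_support {1..n}"
      by (fact card_tilt_num card_tau_tilt_num card_stau_tilt_num)+
  qed
  show ?thesis
  proof (intro conjI allI impI)
    fix n :: nat
    show "card (tilt (A_radsq n :: 'k radsq_algebra)) = 2" if "2 \<le> n"
      unfolding A(1) by (rule A_numbers(3)[OF that order_refl])
    show "real (card (tau_tilt (A_radsq n :: 'k radsq_algebra))) =
        ((1 + sqrt 5) ^ (n + 1) - (1 - sqrt 5) ^ (n + 1)) / (sqrt 5 * 2 ^ (n + 1))"
      unfolding A(2) by (rule A_numbers(1)[OF order_refl])
    show "real (card (stau_tilt (A_radsq n :: 'k radsq_algebra))) =
        ((1 + sqrt 2) ^ (n + 1) - (1 - sqrt 2) ^ (n + 1)) / (2 * sqrt 2)"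
      unfolding A(3) by (rule A_numbers(2)[OF order_refl])
  next
    fix n :: nat assume n: "4 \<le> n"
    \<comment> \<open>The shift by two in \<open>D_numbers\<close> turns its exponent
      \<open>m + 1\<close> into \<open>n - 1\<close>.\<close>
    then have n3: "3 \<le> n" and le: "(n - 2) + 2 \<le> n" and eq: "(n - 2) + 2 = n" "(n - 2) + 1 = n - 1" by auto
    show "card (tilt (D_radsq n :: 'k radsq_algebra)) = 5"
      unfolding D(1)[OF n3] by (rule D_numbers(3)[OF n3 n3 order_refl])
    show "real (card (tau_tilt (D_radsq n :: 'k radsq_algebra))) =
        ((2 * sqrt 5 - 1) * (1 + sqrt 5) ^ (n - 1) + (2 * sqrt 5 + 1) * (1 - sqrt 5) ^ (n - 1))
          / (sqrt 5 * 2 ^ (n - 1))"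
      using D_numbers(1)[OF n3 le] unfolding D(2)[OF n3] eq .
    show "real (card (stau_tilt (D_radsq n :: 'k radsq_algebra))) =
        ((3 * sqrt 2 - 1) * (1 + sqrt 2) ^ (n - 1) + (3 * sqrt 2 + 1) * (1 - sqrt 2) ^ (n - 1))
          / sqrt 2"
      using D_numbers(2)[OF n3 le] unfolding D(3)[OF n3] eq .
  qed
qed

end
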